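(* Let $k$ be a regular unitarily invariant CNP kernel on $\mathbb{B}_d$. Let $\mathcal E$ be a Hilbert space and $\mathcal M\subseteq H_k\otimes\mathcal E$ be a closed subspace invariant under $M_{z_i}\otimes I_{\mathcal E}$ on $H_k\otimes\mathcal E$ for all $i=1,\dots,d$. Then $$\mathcal M=(H_k\otimes\mathcal E_1)\oplus(I_{H_k}\otimes\tau)\,\theta_{\mathbf T}(H_k\otimes\mathcal D_{\tilde{\mathbf T}}),$$ where $\mathcal E_1$ is a closed subspace of $\mathcal E$ such that $H_k\otimes\mathcal E_1$ is the largest reducing subspace (for $\mathbf M_{\bm z}\otimes I_{\mathcal E}$) contained in $\mathcal M$, $\theta_{\mathbf T}$ is the characteristic function of the pure $1/k$-contraction $$\mathbf T=\Big(P_{\mathcal M^\perp}(M_{z_1}\otimes I_{\mathcal E})|_{\mathcal M^\perp},\dots,P_{\mathcal M^\perp}(M_{z_d}\otimes I_{\mathcal E})|_{\mathcal M^\perp}\Big),$$ and $\tau:\overline{\mathrm{Ran}}\,\Delta_{\mathbf T}\to\mathcal E\ominus\mathcal E_1$ is a unitary.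
   Context: $\mathbb{B}_d$ is the open Euclidean unit ball of $\mathbb{C}^d$. A regular unitarily invariant CNP kernel on $\mathbb{B}_d$ is a reproducing kernel $k(\bm z,\bm w)=\sum_{n=0}^\infty a_n\langle\bm z,\bm w\rangle^n$ on $\mathbb{B}_d$ with $a_0=1$, $a_n>0$ for all $n$, $\lim_{n\to\infty}a_n/a_{n+1}=1$, such that there are real numbers $b_n\ge 0$ ($n\ge1$) with $1-\frac{1}{k(\bm z,\bm w)}=\sum_{n=1}^\infty b_n\langle\bm z,\bm w\rangle^n$ for $\bm z,\bm w\in\mathbb{B}_d$ (equivalently $k$ is an irreducible complete Nevanlinna–Pick kernel). $H_k$ is the reproducing kernel Hilbert space of $k$, and $\mathbf M_{\bm z}=(M_{z_1},\dots,M_{z_d})$ is the tuple of multiplications by the coordinate functions on $H_k$. For $\alpha\in\mathbb{Z}_+^d$ put $a_\alpha=a_{|\alpha|}\frac{|\alpha|!}{\alpha!}$, and for $\alpha\ne0$ put $b_\alpha=b_{|\alpha|}\frac{|\alpha|!}{\alpha!}$. A commuting tuple $\mathbf T=(T_1,\dots,T_d)$ of bounded operators on a Hilbert space $\mathcal H$ is a $1/k$-contraction if $\sum_{\alpha\in\mathbb{Z}_+^d\setminus\{0\}}b_\alpha\mathbf T^\alpha(\mathbf T^\alpha)^*$ converges strongly to a contraction; then $\Delta_{\mathbf T}=\big(I-\sum_{\alpha\neq0}b_\alpha\mathbf T^\alpha(\mathbf T^\alpha)^*\big)^{1/2}$. It is pure if $\sum_{\alpha\in\mathbb{Z}_+^d}a_\alpha\mathbf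 T^\alpha\Delta_{\mathbf T}^2(\mathbf T^\alpha)^*=I$ (strong convergence). The compression of $\mathbf M_{\bm z}\otimes I_{\mathcal E}$ to a co-invariant subspace is a pure $1/k$-contraction. Characteristic function: let $\tilde{\mathcal H}=\bigoplus_{\alpha\in\mathbb{Z}_+^d\setminus\{0\}}\mathcal H$. Let $\tilde{\mathbf T}:\tilde{\mathcal H}\to\mathcal H$, $(h_\alpha)\mapsto\sum_{\alpha\ne0}b_\alpha^{1/2}\mathbf T^\alpha h_\alpha$, and for $\bm z\in\mathbb{B}_d$ let $\mathbf Z:\tilde{\mathcal H}\to\mathcal H$, $(h_\alpha)\mapsto\sum_{\alpha\neq0}b_\alpha^{1/2}\bm z^\alpha h_\alpha$. Put $D_{\tilde{\mathbf T}}=(I-\tilde{\mathbf T}^*\tilde{\mathbf T})^{1/2}$ and $\mathcal D_{\tilde{\mathbf T}}=\overline{\mathrm{Ran}}\,D_{\tilde{\mathbf T}}$. Then $\theta_{\mathbf T}:\mathbb{B}_d\to\mathcal B(\mathcal D_{\tilde{\mathbf T}},\overline{\mathrm{Ran}}\,\Delta_{\mathbf T})$ is $\theta_{\mathbf T}(\bm z)=\big(-\tilde{\mathbf T}+\Delta_{\mathbf T}(I_{\mathcal H}-\mathbf Z\tilde{\mathbf T}^* )^{-1}\mathbf Z D_{\tilde{\mathbf T}}\big)|_{\mathcal D_{\tilde{\mathbf T}}}$. It is a contractive multiplier, and $\theta_{\mathbf T}(H_k\otimes\mathcal D_{\tilde{\mathbf T}})$ denotes the range of its multiplication operator $M_{\theta_{\mathbf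 T}}:H_k\otimes\mathcal D_{\tilde{\mathbf T}}\to H_k\otimes\overline{\mathrm{Ran}}\,\Delta_{\mathbf T}$. *)

theory Defs
  imports "HOL-Analysis.Analysis" "HOL-Library.Function_Algebras"
begin

section \<open>Complex vector spaces\<close>

class complex_vector = ab_group_add +
  fixes scaleC :: "complex \<Rightarrow> 'a \<Rightarrow> 'a"  (infixr \<open>*\<^sub>C\<close> 75)
  assumes scaleC_add_right: "c *\<^sub>C (x + y) = c *\<^sub>C x + c *\<^sub>C y"
    and scaleC_add_left: "(c + c') *\<^sub>C x = c *\<^sub>C x + c' *\<^sub>C x"
    and scaleC_scaleC: "c *\<^sub>C (c' *\<^sub>C x) = (c * c') *\<^sub>C x"
    and scaleC_one: "1 *\<^sub>C x = x"

interpretation complex_vector: vector_space "scaleC :: complex \<Rightarrow> 'a \<Rightarrow> 'a::complex_vector"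
  by unfold_locales (simp_all add: scaleC_add_right scaleC_add_left scaleC_scaleC scaleC_one)

abbreviation csubspace :: "'a::complex_vector set \<Rightarrow> bool"
  where "csubspace \<equiv> complex_vector.subspace"

abbreviation cspan :: "'a::complex_vector set \<Rightarrow> 'a set"
  where "cspan \<equiv> complex_vector.span"

instantiation complex :: complex_vector
begin
definition scaleC_complex :: "complex \<Rightarrow> complex \<Rightarrow> complex"
  where "scaleC_complex c x = c * x"
instance by intro_classes (simp_all add: scaleC_complex_def algebra_simps)
end

instantiation "fun" :: (type, complex_vector) complex_vector
begin
definition scaleC_fun :: "complex \<Rightarrow> ('a \<Rightarrow> 'b) \<Rightarrow> 'a \<Rightarrow> 'b"
  where "scaleC_fun c f = (\<lambda>x. c *\<^sub>C f x)"
instance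
  by intro_classes
    (auto simp: scaleC_fun_def scaleC_add_right scaleC_add_left scaleC_scaleC scaleC_one)
end


section \<open>Hilbert spaces\<close>

text \<open>
  A Hilbert space is a complex subspace of an ambient type together with an inner product on it,
  linear in the first argument.  The inner product, and all operators below, are only meaningful
  on the carrier; their values elsewhere are irrelevant.
\<close>

record 'a hilbert =
  carrier :: "'a set"
  cip :: "'a \<Rightarrow> 'a \<Rightarrow> complex"

definition hnorm :: "'a hilbert \<Rightarrow> 'a \<Rightarrow> real"
  where "hnorm H x = sqrt (Re (cip H x x))"

text \<open>The case distinction is needed because \<^locale>\<open>Metric_space\<close> asks for nonnegativity and
  symmetry on the whole type.\<close>

definition hdist :: "('a::complex_vector) hilbert \<Rightarrow> 'a \<Rightarrow> 'a \<Rightarrow> real"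
  where "hdist H x y = (if x \<in> carrier H \<and> y \<in> carrier H then hnorm H (x - y) else 0)"

definition htop :: "('a::complex_vector) hilbert \<Rightarrow> 'a topology"
  where "htop H = Metric_space.mtopology (carrier H) (hdist H)"

locale hilbert_space =
  fixes H :: "('a::complex_vector) hilbert"
  assumes subspace: "csubspace (carrier H)"
    and cip_add: "\<lbrakk>x \<in> carrier H; y \<in> carrier H; u \<in> carrier H\<rbrakk>
          \<Longrightarrow> cip H (x + y) u = cip H x u + cip H y u"
    and cip_scale: "\<lbrakk>x \<in> carrier H; u \<in> carrier H\<rbrakk> \<Longrightarrow> cip H (c *\<^sub>C x) u = c * cip H x u"
    and cip_commute: "\<lbrakk>x \<in> carrier H; y \<in> carrier H\<rbrakk> \<Longrightarrow> cip H x y = cnj (cip H y x)"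
    and cip_nonneg: "x \<in> carrier H \<Longrightarrow> 0 \<le> Re (cip H x x)"
    and cip_eq_0: "\<lbrakk>x \<in> carrier H; cip H x x = 0\<rbrakk> \<Longrightarrow> x = 0"
    and complete: "Metric_space.mcomplete (carrier H) (hdist H)"

definition closed_subspace :: "('a::complex_vector) hilbert \<Rightarrow> 'a set \<Rightarrow> bool"
  where "closed_subspace H S \<longleftrightarrow> csubspace S \<and> S \<subseteq> carrier H \<and> closedin (htop H) S"

definition sub_hilbert :: "'a hilbert \<Rightarrow> 'a set \<Rightarrow> 'a hilbert"
  where "sub_hilbert H S = H\<lparr>carrier := S\<rparr>"

definition orth_compl :: "'a hilbert \<Rightarrow> 'a set \<Rightarrow> 'a set"
  where "orth_compl H S = {x \<in> carrier H. \<forall>s\<in>S. cip H x s = 0}"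

definition orth_proj :: "('a::complex_vector) hilbert \<Rightarrow> 'a set \<Rightarrow> 'a \<Rightarrow> 'a"
  where "orth_proj H S x = (THE y. y \<in> S \<and> (\<forall>s\<in>S. cip H (x - y) s = 0))"

definition orth_sum :: "('a::complex_vector) hilbert \<Rightarrow> 'a set \<Rightarrow> 'a set \<Rightarrow> 'a set \<Rightarrow> bool"
  where "orth_sum H M A B \<longleftrightarrow>
    (\<forall>x\<in>A. \<forall>y\<in>B. cip H x y = 0) \<and> M = {x + y | x y. x \<in> A \<and> y \<in> B}"

text \<open>Unconditional convergence (along the net of finite subsets) in the norm of \<open>H\<close>.\<close>

definition has_hsum :: "('a::complex_vector) hilbert \<Rightarrow> ('i \<Rightarrow> 'a) \<Rightarrow> 'i set \<Rightarrow> 'a \<Rightarrow> bool"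
  where "has_hsum H f A s \<longleftrightarrow> limitin (htop H) (sum f) s (finite_subsets_at_top A)"

definition hsum :: "('a::complex_vector) hilbert \<Rightarrow> ('i \<Rightarrow> 'a) \<Rightarrow> 'i set \<Rightarrow> 'a"
  where "hsum H f A = (THE s. has_hsum H f A s)"

definition direct_sum :: "'i set \<Rightarrow> ('a::complex_vector) hilbert \<Rightarrow> ('i \<Rightarrow> 'a) hilbert"
  where "direct_sum A H =
    \<lparr>carrier = {h. (\<forall>i\<in>A. h i \<in> carrier H) \<and> (\<forall>i. i \<notin> A \<longrightarrow> h i = 0) \<and>
                   (\<lambda>i. (hnorm H (h i))\<^sup>2) summable_on A},
     cip = (\<lambda>g h. \<Sum>\<^sub>\<infinity>i\<in>A. cip H (g i) (h i))\<rparr>"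


section \<open>Operators\<close>

definition bounded_op ::
  "('a::complex_vector) hilbert \<Rightarrow> ('b::complex_vector) hilbert \<Rightarrow> ('a \<Rightarrow> 'b) \<Rightarrow> bool"
  where "bounded_op H K T \<longleftrightarrow>
    (\<forall>x\<in>carrier H. T x \<in> carrier K) \<and>
    (\<forall>x\<in>carrier H. \<forall>y\<in>carrier H. T (x + y) = T x + T y) \<and>
    (\<forall>c. \<forall>x\<in>carrier H. T (c *\<^sub>C x) = c *\<^sub>C T x) \<and>
    (\<exists>B. \<forall>x\<in>carrier H. hnorm K (T x) \<le> B * hnorm H x)"

definition contraction_op ::
  "('a::complex_vector) hilbert \<Rightarrow> ('b::complex_vector) hilbert \<Rightarrow> ('a \<Rightarrow> 'b) \<Rightarrow> bool"
  where "contraction_op H K T \<longleftrightarrow>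
    bounded_op H K T \<and> (\<forall>x\<in>carrier H. hnorm K (T x) \<le> hnorm H x)"

definition unitary_op ::
  "('a::complex_vector) hilbert \<Rightarrow> ('b::complex_vector) hilbert \<Rightarrow> ('a \<Rightarrow> 'b) \<Rightarrow> bool"
  where "unitary_op H K U \<longleftrightarrow> bounded_op H K U \<and> U ` carrier H = carrier K \<and>
    (\<forall>x\<in>carrier H. \<forall>y\<in>carrier H. cip K (U x) (U y) = cip H x y)"

definition adj :: "'a hilbert \<Rightarrow> 'b hilbert \<Rightarrow> ('a \<Rightarrow> 'b) \<Rightarrow> 'b \<Rightarrow> 'a"
  where "adj H K T y = (THE x. x \<in> carrier H \<and> (\<forall>h\<in>carrier H. cip K (T h) y = cip H h x))"

definition positive_op :: "('a::complex_vector) hilbert \<Rightarrow> ('a \<Rightarrow> 'a) \<Rightarrow> bool"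
  where "positive_op H A \<longleftrightarrow> bounded_op H H A \<and>
    (\<forall>x\<in>carrier H. Im (cip H (A x) x) = 0 \<and> 0 \<le> Re (cip H (A x) x))"

text \<open>The positive square root; it is unique on the carrier.\<close>

definition op_sqrt :: "('a::complex_vector) hilbert \<Rightarrow> ('a \<Rightarrow> 'a) \<Rightarrow> 'a \<Rightarrow> 'a"
  where "op_sqrt H A = (SOME S. positive_op H S \<and> (\<forall>x\<in>carrier H. S (S x) = A x))"

definition closed_range :: "'a hilbert \<Rightarrow> ('b::complex_vector) hilbert \<Rightarrow> ('a \<Rightarrow> 'b) \<Rightarrow> 'b hilbert"
  where "closed_range H K T = sub_hilbert K (htop K closure_of (T ` carrier H))"

definition reducing :: "('a::complex_vector) hilbert \<Rightarrow> ('d \<Rightarrow> 'a \<Rightarrow> 'a) \<Rightarrow> 'a set \<Rightarrow> bool"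
  where "reducing H T S \<longleftrightarrow> closed_subspace H S \<and>
    (\<forall>i. \<forall>x\<in>S. T i x \<in> S \<and> adj H H (T i) x \<in> S)"


section \<open>Reproducing kernel Hilbert spaces and tensor products\<close>

text \<open>Functions on \<open>X\<close> are represented by functions on the whole type that vanish off \<open>X\<close>.\<close>

definition is_rkhs :: "'x set \<Rightarrow> ('x \<Rightarrow> 'x \<Rightarrow> complex) \<Rightarrow> ('x \<Rightarrow> complex) hilbert \<Rightarrow> bool"
  where "is_rkhs X k H \<longleftrightarrow> hilbert_space H \<and>
    (\<forall>f\<in>carrier H. \<forall>x. x \<notin> X \<longrightarrow> f x = 0) \<and>
    (\<forall>w\<in>X. (\<lambda>z. if z \<in> X then k z w else 0) \<in> carrier H \<and>
       (\<forall>f\<in>carrier H. cip H f (\<lambda>z. if z \<in> X then k z w else 0) = f w))"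

text \<open>By Moore--Aronszajn the carrier and the inner product on it are determined by the kernel.\<close>

definition rkhs :: "'x set \<Rightarrow> ('x \<Rightarrow> 'x \<Rightarrow> complex) \<Rightarrow> ('x \<Rightarrow> complex) hilbert"
  where "rkhs X k = (SOME H. is_rkhs X k H)"

definition elem_tensor :: "('x \<Rightarrow> complex) \<Rightarrow> 'e \<Rightarrow> 'x \<Rightarrow> 'e::complex_vector"  (infixr \<open>\<otimes>\<^sub>e\<close> 78)
  where "f \<otimes>\<^sub>e e = (\<lambda>x. f x *\<^sub>C e)"

text \<open>
  The Hilbert space tensor product of a reproducing kernel Hilbert space \<open>H\<close> with \<open>E\<close>, realised
  as usual as a space of \<open>E\<close>-valued functions through \<open>(f \<otimes> e)(x) = f(x) e\<close>.  The first two
  conditions after completeness (values in \<open>E\<close>, continuous point evaluations) fix this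
  realisation; the remaining ones are the defining properties of the Hilbert space tensor product.
  Together they determine the carrier and the inner product on it.
\<close>

definition is_tensor ::
  "('x \<Rightarrow> complex) hilbert \<Rightarrow> ('e::complex_vector) hilbert \<Rightarrow> ('x \<Rightarrow> 'e) hilbert \<Rightarrow> bool"
  where "is_tensor H E K \<longleftrightarrow> hilbert_space K \<and>
    (\<forall>F\<in>carrier K. \<forall>x. F x \<in> carrier E) \<and>
    (\<forall>x. \<exists>B. \<forall>F\<in>carrier K. hnorm E (F x) \<le> B * hnorm K F) \<and>
    (\<forall>f\<in>carrier H. \<forall>e\<in>carrier E. f \<otimes>\<^sub>e e \<in> carrier K) \<and>
    (\<forall>f\<in>carrier H. \<forall>g\<in>carrier H. \<forall>e\<in>carrier E. \<forall>e'\<in>carrier E.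
       cip K (f \<otimes>\<^sub>e e) (g \<otimes>\<^sub>e e') = cip H f g * cip E e e') \<and>
    htop K closure_of (cspan {f \<otimes>\<^sub>e e | f e. f \<in> carrier H \<and> e \<in> carrier E}) = carrier K"

definition tensor ::
  "('x \<Rightarrow> complex) hilbert \<Rightarrow> ('e::complex_vector) hilbert \<Rightarrow> ('x \<Rightarrow> 'e) hilbert"  (infixr \<open>\<otimes>\<^sub>H\<close> 78)
  where "H \<otimes>\<^sub>H E = (SOME K. is_tensor H E K)"

text \<open>\<open>tensor_op H E H' E' A B\<close> is the operator \<open>A \<otimes> B\<close> from \<open>H \<otimes> E\<close> to \<open>H' \<otimes> E'\<close>.\<close>

definition tensor_op ::
  "('x \<Rightarrow> complex) hilbert \<Rightarrow> ('e::complex_vector) hilbert \<Rightarrow>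
   ('y \<Rightarrow> complex) hilbert \<Rightarrow> ('f::complex_vector) hilbert \<Rightarrow>
   (('x \<Rightarrow> complex) \<Rightarrow> 'y \<Rightarrow> complex) \<Rightarrow> ('e \<Rightarrow> 'f) \<Rightarrow> ('x \<Rightarrow> 'e) \<Rightarrow> 'y \<Rightarrow> 'f"
  where "tensor_op H E H' E' A B =
    (SOME R. bounded_op (H \<otimes>\<^sub>H E) (H' \<otimes>\<^sub>H E') R \<and>
       (\<forall>f\<in>carrier H. \<forall>e\<in>carrier E. R (f \<otimes>\<^sub>e e) = A f \<otimes>\<^sub>e B e))"

text \<open>Multiplication by an operator-valued function \<open>\<theta>\<close> on \<open>X\<close>.\<close>

definition mult_op :: "'x set \<Rightarrow> ('x \<Rightarrow> 'e \<Rightarrow> 'f) \<Rightarrow> ('x \<Rightarrow> 'e) \<Rightarrow> 'x \<Rightarrow> 'f::complex_vector"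
  where "mult_op X \<theta> f = (\<lambda>x. if x \<in> X then \<theta> x (f x) else 0)"

definition contractive_multiplier ::
  "'x set \<Rightarrow> ('x \<Rightarrow> complex) hilbert \<Rightarrow> ('e::complex_vector) hilbert \<Rightarrow> ('f::complex_vector) hilbert \<Rightarrow>
   ('x \<Rightarrow> 'e \<Rightarrow> 'f) \<Rightarrow> bool"
  where "contractive_multiplier X H E F \<theta> \<longleftrightarrow>
    (\<forall>x\<in>X. bounded_op E F (\<theta> x)) \<and> contraction_op (H \<otimes>\<^sub>H E) (H \<otimes>\<^sub>H F) (mult_op X \<theta>)"


section \<open>Multi-indices\<close>

definition msize :: "('d::finite \<Rightarrow> nat) \<Rightarrow> nat"
  where "msize \<alpha> = (\<Sum>i\<in>UNIV. \<alpha> i)"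

text \<open>\<open>c\<^sub>\<alpha> = c\<^bsub>|\<alpha>|\<^esub> |\<alpha>|! / \<alpha>!\<close>\<close>

definition mweight :: "(nat \<Rightarrow> real) \<Rightarrow> ('d::finite \<Rightarrow> nat) \<Rightarrow> real"
  where "mweight c \<alpha> = c (msize \<alpha>) * fact (msize \<alpha>) / (\<Prod>i\<in>UNIV. fact (\<alpha> i))"

definition mpow :: "complex ^ 'd \<Rightarrow> ('d::finite \<Rightarrow> nat) \<Rightarrow> complex"
  where "mpow z \<alpha> = (\<Prod>i\<in>UNIV. (z $ i) ^ \<alpha> i)"

text \<open>\<open>T\<^sup>\<alpha>\<close>, the factors being composed in some unspecified order of the indices; for the commuting
  tuples to which it is applied the order does not matter.\<close>

definition tuple_pow :: "('d::finite \<Rightarrow> 'a \<Rightarrow> 'a) \<Rightarrow> ('d \<Rightarrow> nat) \<Rightarrow> 'a \<Rightarrow> 'a"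
  where "tuple_pow T \<alpha> =
    foldr (\<lambda>i S. (T i ^^ \<alpha> i) \<circ> S) (SOME is. distinct is \<and> set is = UNIV) id"


section \<open>Regular unitarily invariant CNP kernels\<close>

abbreviation Bd :: "(complex ^ 'd::finite) set"
  where "Bd \<equiv> ball 0 1"

definition cdot :: "complex ^ 'd::finite \<Rightarrow> complex ^ 'd \<Rightarrow> complex"
  where "cdot z w = (\<Sum>i\<in>UNIV. z $ i * cnj (w $ i))"

text \<open>The value \<open>b 0\<close> is irrelevant throughout.\<close>

definition regular_cnp_kernel ::
  "(nat \<Rightarrow> real) \<Rightarrow> (nat \<Rightarrow> real) \<Rightarrow> (complex ^ 'd::finite \<Rightarrow> complex ^ 'd \<Rightarrow> complex) \<Rightarrow> bool"
  where "regular_cnp_kernel a b k \<longleftrightarrow>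
    a 0 = 1 \<and> (\<forall>n. 0 < a n) \<and> (\<lambda>n. a n / a (Suc n)) \<longlonglongrightarrow> 1 \<and>
    (\<forall>n\<ge>1. 0 \<le> b n) \<and>
    (\<forall>z\<in>Bd. \<forall>w\<in>Bd. (\<lambda>n. of_real (a n) * cdot z w ^ n) sums k z w) \<and>
    (\<forall>z\<in>Bd. \<forall>w\<in>Bd. k z w \<noteq> 0 \<and>
       (\<lambda>n. of_real (b (Suc n)) * cdot z w ^ Suc n) sums (1 - 1 / k z w))"

abbreviation Hk :: "(complex ^ 'd::finite \<Rightarrow> complex ^ 'd \<Rightarrow> complex) \<Rightarrow> (complex ^ 'd \<Rightarrow> complex) hilbert"
  where "Hk k \<equiv> rkhs Bd k"

definition mult_coord :: "'d \<Rightarrow> (complex ^ 'd::finite \<Rightarrow> complex) \<Rightarrow> complex ^ 'd \<Rightarrow> complex"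
  where "mult_coord i f = (\<lambda>z. z $ i * f z)"

text \<open>The tuple \<open>M\<^sub>z \<otimes> I\<^sub>E\<close> on \<open>H\<^sub>k \<otimes> E\<close>.\<close>

definition Mz_tensor_I ::
  "(complex ^ 'd::finite \<Rightarrow> complex ^ 'd \<Rightarrow> complex) \<Rightarrow> ('e::complex_vector) hilbert \<Rightarrow>
   'd \<Rightarrow> (complex ^ 'd \<Rightarrow> 'e) \<Rightarrow> complex ^ 'd \<Rightarrow> 'e"
  where "Mz_tensor_I k E i = tensor_op (Hk k) E (Hk k) E (mult_coord i) (\<lambda>e. e)"


section \<open>\<open>1/k\<close>-contractions and their characteristic functions\<close>

definition commuting_tuple :: "('a::complex_vector) hilbert \<Rightarrow> ('d \<Rightarrow> 'a \<Rightarrow> 'a) \<Rightarrow> bool"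
  where "commuting_tuple H T \<longleftrightarrow> (\<forall>i. bounded_op H H (T i)) \<and>
    (\<forall>i j. \<forall>x\<in>carrier H. T i (T j x) = T j (T i x))"

text \<open>In \<open>b_term\<close> and \<open>b_sum\<close>: the operators \<open>b\<^sub>\<alpha> T\<^sup>\<alpha> (T\<^sup>\<alpha>)\<^sup>*\<close> and their strong sum over \<open>\<alpha> \<noteq> 0\<close>.\<close>

definition b_term ::
  "(nat \<Rightarrow> real) \<Rightarrow> ('a::complex_vector) hilbert \<Rightarrow> ('d::finite \<Rightarrow> 'a \<Rightarrow> 'a) \<Rightarrow> ('d \<Rightarrow> nat) \<Rightarrow> 'a \<Rightarrow> 'a"
  where "b_term b H T \<alpha> h =
    of_real (mweight b \<alpha>) *\<^sub>C tuple_pow T \<alpha> (adj H H (tuple_pow T \<alpha>) h)"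

definition b_sum ::
  "(nat \<Rightarrow> real) \<Rightarrow> ('a::complex_vector) hilbert \<Rightarrow> ('d::finite \<Rightarrow> 'a \<Rightarrow> 'a) \<Rightarrow> 'a \<Rightarrow> 'a"
  where "b_sum b H T h = hsum H (\<lambda>\<alpha>. b_term b H T \<alpha> h) (- {0})"

definition k_contraction ::
  "(nat \<Rightarrow> real) \<Rightarrow> ('a::complex_vector) hilbert \<Rightarrow> ('d::finite \<Rightarrow> 'a \<Rightarrow> 'a) \<Rightarrow> bool"
  where "k_contraction b H T \<longleftrightarrow> commuting_tuple H T \<and>
    (\<forall>h\<in>carrier H. has_hsum H (\<lambda>\<alpha>. b_term b H T \<alpha> h) (- {0}) (b_sum b H T h)) \<and>
    contraction_op H H (b_sum b H T)"

definition defect ::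
  "(nat \<Rightarrow> real) \<Rightarrow> ('a::complex_vector) hilbert \<Rightarrow> ('d::finite \<Rightarrow> 'a \<Rightarrow> 'a) \<Rightarrow> 'a \<Rightarrow> 'a"
  where "defect b H T = op_sqrt H (\<lambda>h. h - b_sum b H T h)"

definition pure_k_contraction ::
  "(nat \<Rightarrow> real) \<Rightarrow> (nat \<Rightarrow> real) \<Rightarrow> ('a::complex_vector) hilbert \<Rightarrow> ('d::finite \<Rightarrow> 'a \<Rightarrow> 'a) \<Rightarrow> bool"
  where "pure_k_contraction a b H T \<longleftrightarrow> k_contraction b H T \<and>
    (\<forall>h\<in>carrier H. has_hsum H (\<lambda>\<alpha>. of_real (mweight a \<alpha>) *\<^sub>C
        tuple_pow T \<alpha> (defect b H T (defect b H T (adj H H (tuple_pow T \<alpha>) h)))) UNIV h)"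

definition tilde_space :: "('a::complex_vector) hilbert \<Rightarrow> (('d::finite \<Rightarrow> nat) \<Rightarrow> 'a) hilbert"
  where "tilde_space H = direct_sum (- {0}) H"

definition tilde_op ::
  "(nat \<Rightarrow> real) \<Rightarrow> ('a::complex_vector) hilbert \<Rightarrow> ('d::finite \<Rightarrow> 'a \<Rightarrow> 'a) \<Rightarrow> (('d \<Rightarrow> nat) \<Rightarrow> 'a) \<Rightarrow> 'a"
  where "tilde_op b H T h =
    hsum H (\<lambda>\<alpha>. of_real (sqrt (mweight b \<alpha>)) *\<^sub>C tuple_pow T \<alpha> (h \<alpha>)) (- {0})"

definition Z_op ::
  "(nat \<Rightarrow> real) \<Rightarrow> ('a::complex_vector) hilbert \<Rightarrow> complex ^ 'd::finite \<Rightarrow> (('d \<Rightarrow> nat) \<Rightarrow> 'a) \<Rightarrow> 'a"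
  where "Z_op b H z h =
    hsum H (\<lambda>\<alpha>. (of_real (sqrt (mweight b \<alpha>)) * mpow z \<alpha>) *\<^sub>C h \<alpha>) (- {0})"

definition tilde_adj ::
  "(nat \<Rightarrow> real) \<Rightarrow> ('a::complex_vector) hilbert \<Rightarrow> ('d::finite \<Rightarrow> 'a \<Rightarrow> 'a) \<Rightarrow> 'a \<Rightarrow> ('d \<Rightarrow> nat) \<Rightarrow> 'a"
  where "tilde_adj b H T = adj (tilde_space H) H (tilde_op b H T)"

definition tilde_defect ::
  "(nat \<Rightarrow> real) \<Rightarrow> ('a::complex_vector) hilbert \<Rightarrow> ('d::finite \<Rightarrow> 'a \<Rightarrow> 'a) \<Rightarrow>
   (('d \<Rightarrow> nat) \<Rightarrow> 'a) \<Rightarrow> ('d \<Rightarrow> nat) \<Rightarrow> 'a"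
  where "tilde_defect b H T =
    op_sqrt (tilde_space H) (\<lambda>x. x - tilde_adj b H T (tilde_op b H T x))"

definition defect_space ::
  "(nat \<Rightarrow> real) \<Rightarrow> ('a::complex_vector) hilbert \<Rightarrow> ('d::finite \<Rightarrow> 'a \<Rightarrow> 'a) \<Rightarrow> 'a hilbert"
  where "defect_space b H T = closed_range H H (defect b H T)"

definition tilde_defect_space ::
  "(nat \<Rightarrow> real) \<Rightarrow> ('a::complex_vector) hilbert \<Rightarrow> ('d::finite \<Rightarrow> 'a \<Rightarrow> 'a) \<Rightarrow> (('d \<Rightarrow> nat) \<Rightarrow> 'a) hilbert"
  where "tilde_defect_space b H T =
    closed_range (tilde_space H) (tilde_space H) (tilde_defect b H T)"

definition char_fun ::
  "(nat \<Rightarrow> real) \<Rightarrow> ('a::complex_vector) hilbert \<Rightarrow> ('d::finite \<Rightarrow> 'a \<Rightarrow> 'a) \<Rightarrow>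
   complex ^ 'd \<Rightarrow> (('d \<Rightarrow> nat) \<Rightarrow> 'a) \<Rightarrow> 'a"
  where "char_fun b H T z x =
    - tilde_op b H T x +
    defect b H T
      (inv_into (carrier H) (\<lambda>h. h - Z_op b H z (tilde_adj b H T h))
        (Z_op b H z (tilde_defect b H T x)))"

end

theory Submission
  imports Defs
begin

text \<open>
  Let \<open>N = M\<^sup>\<bottom>\<close> and let \<open>W\<close> be the column \<open>F \<mapsto> (sqrt b\<^sub>\<alpha> (M\<^sub>z\<^sup>\<alpha>)\<^sup>* F)\<^sub>\<alpha>\<close>.  Since \<open>(1 - 1/k) k = k - 1\<close>, testing on
  kernel functions gives \<open>\<langle>W F, W G\<rangle> = \<langle>F, G\<rangle> - \<langle>F(0), G(0)\<rangle>\<close>.  Hence \<open>\<Delta>\<close> satisfies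
  \<open>\<parallel>\<Delta> h\<parallel> = \<parallel>h(0)\<parallel>\<close> on \<open>N\<close>, and \<open>\<Delta> h \<mapsto> h(0)\<close> extends to a unitary \<open>\<tau>\<close> onto
  \<open>E\<^sub>2\<close>, the closure of \<open>{h(0) | h \<in> N}\<close>; put \<open>E\<^sub>1 = E \<ominus> E\<^sub>2\<close>.  If \<open>h = (I - Z W) g\<close> then \<open>h(z) = g(0)\<close>, so
  functions in \<open>N\<close> take all their values in \<open>E\<^sub>2\<close>, that is, \<open>H\<^sub>k \<otimes> E\<^sub>1 \<subseteq> M\<close>; the same identity on a reducing
  subspace of \<open>M\<close> shows that \<open>H\<^sub>k \<otimes> E\<^sub>1\<close> is the largest one.

  The vectors \<open>v(w,e) = D Z(w)\<^sup>* P\<^sub>N (k\<^sub>w e) - W \<tau>\<^sup>* e\<close>, which are \<open>(\<tau> \<theta>(w))\<^sup>* e\<close>, satisfy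
  \<open>k(z,w) \<langle>v(w,e), v(z,f)\<rangle> = \<langle>(I - P\<^sub>N) k\<^sub>w e, k\<^sub>z f\<rangle>\<close> because of the intertwining \<open>D W = W \<Delta>\<close>.  Therefore
  \<open>k\<^sub>w e \<mapsto> k\<^sub>w \<otimes> v(w,e)\<close> extends to a partial isometry on \<open>H\<^sub>k \<otimes> E\<^sub>2\<close> with initial space
  \<open>M \<ominus> (H\<^sub>k \<otimes> E\<^sub>1)\<close>, and its adjoint is \<open>(I \<otimes> \<tau>) M\<^sub>\<theta>\<close>, whose range is thus that space.
\<close>

text \<open>\<open>rkhs\<close>, \<open>tensor\<close>, \<open>tensor_op\<close> and
  \<open>op_sqrt\<close> are choices, so a witness must be built before anything can be said about
  them. For the function spaces it comes from the feature maps e -> (sqrt a_\<alpha>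
  conj(w^\<alpha>) e)_\<alpha>. The chosen tensor product is not literally the witness, so the
  reproducing property is derived again from \<open>is_tensor\<close>. Operators prescribed on a
  total family (J, W, \<tau>, R) all come from \<open>gram_extension\<close>: one Gram computation
  gives existence, boundedness and the norm identity. Strong operator sums are read off as adjoints
  of column operators, which settles their convergence. The intertwining D W = W \<Delta> needs
  roots that are functions of the operators. The root is built as a weak power series, which passes
  through intertwiners term by term; uniqueness of positive roots carries this over to the chosen
  \<open>op_sqrt\<close>. Boundedness of M_z is not part of the definitions. It is where regularity
  enters: the ratios a_n / a_(n+1) bound a weighted backward shift that models the adjoint.\<close>

lemma tendsto_zero_sandwich:
  fixes f g :: "'a \<Rightarrow> real"
  assumes "(g \<longlongrightarrow> 0) F" "\<And>x. 0 \<le> f x" "\<And>x. f x \<le> g x"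
  shows "(f \<longlongrightarrow> 0) F"
  by (rule tendsto_sandwich[of "\<lambda>_. 0" f F g]) (use assms in \<open>auto intro: always_eventually\<close>)

section \<open>Hilbert space geometry\<close>

text \<open>Completeness is split off because the norm calculus is already required to prove
  completeness of subspaces, direct sums and transported spaces. Adjoints need completeness on the
  domain side only.\<close>

locale pre_hilbert =
  fixes H :: "('a::complex_vector) hilbert"
  assumes csub: "csubspace (carrier H)"
    and cip_add_left: "\<lbrakk>x \<in> carrier H; y \<in> carrier H; u \<in> carrier H\<rbrakk>
          \<Longrightarrow> cip H (x + y) u = cip H x u + cip H y u"
    and cip_scale_left: "\<lbrakk>x \<in> carrier H; u \<in> carrier H\<rbrakk> \<Longrightarrow> cip H (c *\<^sub>C x) u = c * cip H x u"
    and cip_swap: "\<lbrakk>x \<in> carrier H; y \<in> carrier H\<rbrakk> \<Longrightarrow> cip H x y = cnj (cip H y x)"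
    and cip_self_nonneg: "x \<in> carrier H \<Longrightarrow> 0 \<le> Re (cip H x x)"
    and cip_self_0D: "\<lbrakk>x \<in> carrier H; cip H x x = 0\<rbrakk> \<Longrightarrow> x = 0"
begin

abbreviation "C \<equiv> carrier H"
abbreviation "ip \<equiv> cip H"
abbreviation "nrm \<equiv> hnorm H"

lemma zero_c [simp, intro]: "0 \<in> C"
  and add_c [simp, intro]: "x \<in> C \<Longrightarrow> y \<in> C \<Longrightarrow> x + y \<in> C"
  and scale_c [simp, intro]: "x \<in> C \<Longrightarrow> c *\<^sub>C x \<in> C"
  and uminus_c [simp, intro]: "x \<in> C \<Longrightarrow> - x \<in> C"
  and diff_c [simp, intro]: "x \<in> C \<Longrightarrow> y \<in> C \<Longrightarrow> x - y \<in> C"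
  using csub complex_vector.subspace_neg[OF csub] complex_vector.subspace_diff[OF csub]
  unfolding complex_vector.subspace_def by blast+

lemma sum_c [intro]: "(\<And>i. i \<in> A \<Longrightarrow> f i \<in> C) \<Longrightarrow> sum f A \<in> C"
  using csub complex_vector.subspace_sum by blast

lemma cip_uminus_left [simp]: "x \<in> C \<Longrightarrow> u \<in> C \<Longrightarrow> ip (- x) u = - ip x u"
  using cip_scale_left[of x u "-1"] by simp

lemma cip_zero_left [simp]: "u \<in> C \<Longrightarrow> ip 0 u = 0"
  using cip_scale_left[of 0 u 0] by simp

lemma cip_diff_left: "x \<in> C \<Longrightarrow> y \<in> C \<Longrightarrow> u \<in> C \<Longrightarrow> ip (x - y) u = ip x u - ip y u"
  using cip_add_left[of x "-y" u] by simp

lemma cip_add_right: "x \<in> C \<Longrightarrow> y \<in> C \<Longrightarrow> u \<in> C \<Longrightarrow> ip u (x + y) = ip u x + ip u y"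
  using cip_add_left[of x y u] cip_swap by (metis add_c complex_cnj_add)

lemma cip_scale_right: "x \<in> C \<Longrightarrow> u \<in> C \<Longrightarrow> ip u (c *\<^sub>C x) = cnj c * ip u x"
  using cip_scale_left[of x u c] cip_swap by (metis complex_cnj_mult scale_c)

lemma cip_uminus_right [simp]: "x \<in> C \<Longrightarrow> u \<in> C \<Longrightarrow> ip u (- x) = - ip u x"
  using cip_scale_right[of x u "-1"] by simp

lemma cip_zero_right [simp]: "u \<in> C \<Longrightarrow> ip u 0 = 0"
  using cip_scale_right[of 0 u 0] by simp

lemma cip_diff_right: "x \<in> C \<Longrightarrow> y \<in> C \<Longrightarrow> u \<in> C \<Longrightarrow> ip u (x - y) = ip u x - ip u y"
  using cip_add_right[of x "-y" u] by simp

lemmas cip_bilinear = cip_add_left cip_add_right cip_diff_left cip_diff_right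
  cip_scale_left cip_scale_right

lemma nrm_nonneg [simp]: "x \<in> C \<Longrightarrow> 0 \<le> nrm x"
  by (simp add: hnorm_def cip_self_nonneg)

lemma nrm_sq: "x \<in> C \<Longrightarrow> (nrm x)\<^sup>2 = Re (ip x x)"
  by (simp add: hnorm_def cip_self_nonneg)

lemma cip_self: "x \<in> C \<Longrightarrow> ip x x = of_real ((nrm x)\<^sup>2)"
  using arg_cong[OF cip_swap[of x x], of Im] nrm_sq[of x] by (simp add: complex_eq_iff)

lemma nrm_zero [simp]: "nrm 0 = 0"
  by (simp add: hnorm_def)

lemma nrm_eq_0 [simp]: "x \<in> C \<Longrightarrow> nrm x = 0 \<longleftrightarrow> x = 0"
  using cip_self[of x] cip_self_0D[of x] by auto

lemma nrm_scale: "x \<in> C \<Longrightarrow> nrm (c *\<^sub>C x) = cmod c * nrm x"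
proof -
  assume x: "x \<in> C"
  have "(nrm (c *\<^sub>C x))\<^sup>2 = Re (c * cnj c * ip x x)"
    using x by (simp add: nrm_sq cip_scale_left cip_scale_right mult.assoc mult.left_commute)
  also have "\<dots> = (cmod c * nrm x)\<^sup>2"
    unfolding complex_norm_square[symmetric] cip_self[OF x] of_real_mult[symmetric] Re_complex_of_real
    by (simp add: power_mult_distrib)
  finally show ?thesis
    using x by (simp add: power2_eq_iff_nonneg)
qed

lemma nrm_uminus [simp]: "x \<in> C \<Longrightarrow> nrm (- x) = nrm x"
  by (simp add: hnorm_def)

lemma nrm_minus_commute: "x \<in> C \<Longrightarrow> y \<in> C \<Longrightarrow> nrm (x - y) = nrm (y - x)"
  using nrm_uminus[of "x - y"] by simp

lemma nrm_add_sq: "x \<in> C \<Longrightarrow> y \<in> C \<Longrightarrow> (nrm (x + y))\<^sup>2 = (nrm x)\<^sup>2 + (nrm y)\<^sup>2 + 2 * Re (ip x y)"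
  using cip_swap[of y x] by (simp add: nrm_sq cip_bilinear)

lemma nrm_diff_sq: "x \<in> C \<Longrightarrow> y \<in> C \<Longrightarrow> (nrm (x - y))\<^sup>2 = (nrm x)\<^sup>2 + (nrm y)\<^sup>2 - 2 * Re (ip x y)"
  using cip_swap[of y x] by (simp add: nrm_sq cip_bilinear)

lemma cauchy_schwarz:
  assumes x: "x \<in> C" and y: "y \<in> C"
  shows "cmod (ip x y) \<le> nrm x * nrm y"
proof (cases "y = 0")
  case True then show ?thesis using x by simp
next
  case False
  \<comment> \<open>The vector \<open>c *\<^sub>C y\<close> is the projection of x onto the line
    through y.\<close>
  define c where "c = ip x y / of_real ((nrm y)\<^sup>2)"
  have ny: "nrm y > 0" using False y nrm_nonneg[of y] nrm_eq_0[of y] by linarith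
  have cm: "cmod c = cmod (ip x y) / (nrm y)\<^sup>2" by (simp add: c_def norm_divide norm_power)
  have "Re (ip x (c *\<^sub>C y)) = Re (cnj c * ip x y)" using x y by (simp add: cip_scale_right)
  also have "cnj c * ip x y = of_real ((cmod (ip x y))\<^sup>2 / (nrm y)\<^sup>2)"
    by (simp add: c_def complex_norm_square[symmetric] mult.commute)
  finally have "Re (ip x (c *\<^sub>C y)) = (cmod (ip x y))\<^sup>2 / (nrm y)\<^sup>2" by (simp only: Re_complex_of_real)
  moreover have "(nrm (c *\<^sub>C y))\<^sup>2 = (cmod (ip x y))\<^sup>2 / (nrm y)\<^sup>2"
    using ny y by (simp add: nrm_scale cm power_mult_distrib power_divide field_simps power2_eq_square)
  moreover have "0 \<le> (nrm (x - c *\<^sub>C y))\<^sup>2" by simp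
  ultimately have "(cmod (ip x y))\<^sup>2 / (nrm y)\<^sup>2 \<le> (nrm x)\<^sup>2"
    using x y by (simp add: nrm_diff_sq)
  then have "(cmod (ip x y))\<^sup>2 \<le> (nrm x * nrm y)\<^sup>2"
    using ny by (simp add: field_simps power_mult_distrib)
  then show ?thesis by (rule power2_le_imp_le) (use x y in simp)
qed

lemma Re_cip_le: "x \<in> C \<Longrightarrow> y \<in> C \<Longrightarrow> Re (ip x y) \<le> nrm x * nrm y"
  by (rule order_trans[OF complex_Re_le_cmod cauchy_schwarz])

lemma nrm_triangle: "x \<in> C \<Longrightarrow> y \<in> C \<Longrightarrow> nrm (x + y) \<le> nrm x + nrm y"
proof -
  assume xy: "x \<in> C" "y \<in> C"
  then have "(nrm (x + y))\<^sup>2 \<le> (nrm x + nrm y)\<^sup>2"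
    using Re_cip_le[OF xy] by (simp add: nrm_add_sq power2_sum)
  then show ?thesis by (rule power2_le_imp_le) (use xy in simp)
qed

lemma nrm_triangle_diff: "x \<in> C \<Longrightarrow> y \<in> C \<Longrightarrow> nrm (x - y) \<le> nrm x + nrm y"
  using nrm_triangle[of x "-y"] by simp

lemma nrm_triangle3: "x \<in> C \<Longrightarrow> y \<in> C \<Longrightarrow> z \<in> C \<Longrightarrow> nrm (x - z) \<le> nrm (x - y) + nrm (y - z)"
  using nrm_triangle[of "x - y" "y - z"] by simp

lemma nrm_abs_diff: "x \<in> C \<Longrightarrow> y \<in> C \<Longrightarrow> \<bar>nrm x - nrm y\<bar> \<le> nrm (x - y)"
  using nrm_triangle[of "x - y" y] nrm_triangle[of "y - x" x] nrm_minus_commute[of x y] by auto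

lemma parallelogram:
  "x \<in> C \<Longrightarrow> y \<in> C \<Longrightarrow> (nrm (x + y))\<^sup>2 + (nrm (x - y))\<^sup>2 = 2 * (nrm x)\<^sup>2 + 2 * (nrm y)\<^sup>2"
  by (simp add: nrm_add_sq nrm_diff_sq)

lemma eq_if_cip_eq:
  assumes "x \<in> C" "y \<in> C" "\<And>u. u \<in> C \<Longrightarrow> ip x u = ip y u"
  shows "x = y"
proof -
  have "ip (x - y) (x - y) = 0" using assms by (simp add: cip_diff_left)
  then show ?thesis using assms cip_self_0D[of "x - y"] by simp
qed

lemma eq_if_cip_eq':
  assumes "x \<in> C" "y \<in> C" "\<And>u. u \<in> C \<Longrightarrow> ip u x = ip u y"
  shows "x = y"
  using assms by (intro eq_if_cip_eq) (metis cip_swap)+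

lemma metric: "Metric_space C (hdist H)"
proof
  show "0 \<le> hdist H x y" for x y by (simp add: hdist_def)
  show "hdist H x y = hdist H y x" for x y by (simp add: hdist_def nrm_minus_commute)
  show "hdist H x y = 0 \<longleftrightarrow> x = y" if "x \<in> C" "y \<in> C" for x y
    using that by (simp add: hdist_def)
  show "hdist H x z \<le> hdist H x y + hdist H y z" if "x \<in> C" "y \<in> C" "z \<in> C" for x y z
    using that by (simp add: hdist_def nrm_triangle3)
qed

sublocale met: Metric_space C "hdist H"
  by (rule metric)

text \<open>\<open>hdist\<close> is 0 as soon as one point lies off the carrier, so distance and
  norm of the difference agree only along values in the carrier.\<close>

lemma limitin_htop:
  assumes "eventually (\<lambda>n. f n \<in> C) F"
  shows "limitin (htop H) f l F \<longleftrightarrow> l \<in> C \<and> ((\<lambda>n. nrm (f n - l)) \<longlongrightarrow> 0) F"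
proof (cases "l \<in> C")
  case True
  have "((\<lambda>n. hdist H (f n) l) \<longlongrightarrow> 0) F \<longleftrightarrow> ((\<lambda>n. nrm (f n - l)) \<longlongrightarrow> 0) F"
    by (rule filterlim_cong[OF refl refl])
       (use assms in \<open>auto elim!: eventually_mono simp: hdist_def True\<close>)
  then show ?thesis
    using assms True by (simp add: htop_def met.limitin_metric_dist_null)
qed (simp add: htop_def met.limitin_metric)

lemma closedin_htop:
  assumes "S \<subseteq> C"
  shows "closedin (htop H) S \<longleftrightarrow>
    (\<forall>s l. (\<forall>n::nat. s n \<in> S) \<and> l \<in> C \<and> (\<lambda>n. nrm (s n - l)) \<longlonglongrightarrow> 0 \<longrightarrow> l \<in> S)"
proof -
  have "range s \<subseteq> S \<and> limitin (htop H) s l sequentially \<longleftrightarrow>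
     (\<forall>n. s n \<in> S) \<and> l \<in> C \<and> (\<lambda>n. nrm (s n - l)) \<longlonglongrightarrow> 0" for s :: "nat \<Rightarrow> 'a" and l
    using limitin_htop[of s sequentially l] assms by (auto simp: image_subset_iff subset_iff)
  then show ?thesis
    using assms met.metric_closedin_iff_sequentially_closed[of S] by (auto simp: htop_def)
qed

lemma in_closure_htop:
  assumes "S \<subseteq> C"
  shows "x \<in> htop H closure_of S \<longleftrightarrow>
    x \<in> C \<and> (\<exists>s. (\<forall>n::nat. s n \<in> S) \<and> (\<lambda>n. nrm (s n - x)) \<longlonglongrightarrow> 0)"
proof safe
  assume "x \<in> htop H closure_of S"
  then have x: "x \<in> C" and d: "\<And>r. r > 0 \<Longrightarrow> \<exists>y\<in>S. nrm (y - x) < r"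
    using assms nrm_minus_commute[of x]
    by (auto simp: htop_def met.metric_closure_of hdist_def subset_iff) metis+
  then show "x \<in> C" by blast
  have "\<exists>y\<in>S. nrm (y - x) < inverse (real (Suc n))" for n
    by (rule d) simp
  then obtain s where s: "\<And>n. s n \<in> S" "\<And>n. nrm (s n - x) < inverse (real (Suc n))" by metis
  moreover have "(\<lambda>n. nrm (s n - x)) \<longlonglongrightarrow> 0"
  proof (rule tendsto_zero_sandwich[OF LIMSEQ_inverse_real_of_nat])
    fix n show "0 \<le> nrm (s n - x)" using s(1) x assms by (simp add: subset_iff)
    show "nrm (s n - x) \<le> inverse (real (Suc n))" using s(2)[of n] by simp
  qed
  ultimately show "\<exists>s. (\<forall>n. s n \<in> S) \<and> (\<lambda>n. nrm (s n - x)) \<longlonglongrightarrow> 0" by blast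
next
  fix s :: "nat \<Rightarrow> 'a"
  assume x: "x \<in> C" and s: "\<forall>n. s n \<in> S" "(\<lambda>n. nrm (s n - x)) \<longlonglongrightarrow> 0"
  have "\<exists>y\<in>S. nrm (x - y) < r" if r: "r > 0" for r
  proof -
    from s(2) r have "\<forall>\<^sub>F n in sequentially. nrm (s n - x) < r" by (rule order_tendstoD)
    then obtain n where "nrm (s n - x) < r" by (auto simp: eventually_sequentially)
    then show ?thesis using s(1) x assms nrm_minus_commute[of x "s n"] by (metis subset_iff)
  qed
  then show "x \<in> htop H closure_of S"
    using x assms by (auto simp: htop_def met.metric_closure_of hdist_def subset_iff)
qed

lemma lim_unique:
  assumes "F \<noteq> bot" "eventually (\<lambda>n. f n \<in> C) F" "l \<in> C" "l' \<in> C"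
    "((\<lambda>n. nrm (f n - l)) \<longlongrightarrow> 0) F" "((\<lambda>n. nrm (f n - l')) \<longlongrightarrow> 0) F"
  shows "l = l'"
  using assms limitin_htop[OF assms(2)] met.limitin_metric_unique[of f l F l']
  by (simp add: htop_def)

lemma cip_tendsto:
  assumes "eventually (\<lambda>n. f n \<in> C) F" "eventually (\<lambda>n. g n \<in> C) F" "l \<in> C" "m \<in> C"
    and f: "((\<lambda>n. nrm (f n - l)) \<longlongrightarrow> 0) F" and g: "((\<lambda>n. nrm (g n - m)) \<longlongrightarrow> 0) F"
  shows "((\<lambda>n. ip (f n) (g n)) \<longlongrightarrow> ip l m) F"
proof -
  let ?r = "\<lambda>n. nrm (f n - l) * nrm (g n - m) + nrm (f n - l) * nrm m + nrm l * nrm (g n - m)"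
  have r: "(?r \<longlongrightarrow> 0) F"
    by (rule tendsto_eq_intros f g refl | simp)+
  have "eventually (\<lambda>n. cmod (ip (f n) (g n) - ip l m) \<le> ?r n) F"
    using assms(1,2)
  proof eventually_elim
    case (elim n)
    have "ip (f n) (g n) - ip l m = ip (f n - l) (g n - m) + ip (f n - l) m + ip l (g n - m)"
      using elim assms by (simp add: cip_bilinear)
    then show ?case
      using cauchy_schwarz[of "f n - l" "g n - m"] cauchy_schwarz[of "f n - l" m]
        cauchy_schwarz[of l "g n - m"] elim assms
      by (smt (verit) norm_triangle_ineq diff_c)
  qed
  then have "((\<lambda>n. ip (f n) (g n) - ip l m) \<longlongrightarrow> 0) F"
    using r by (rule Lim_null_comparison)
  then show ?thesis by (simp add: LIM_zero_iff)
qed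

lemma cip_tendsto_left:
  assumes "eventually (\<lambda>n. f n \<in> C) F" "l \<in> C" "m \<in> C" "((\<lambda>n. nrm (f n - l)) \<longlongrightarrow> 0) F"
  shows "((\<lambda>n. ip (f n) m) \<longlongrightarrow> ip l m) F"
  using cip_tendsto[OF assms(1) _ assms(2,3,4), of "\<lambda>_. m"] assms by simp

lemma nrm_tendsto:
  assumes "eventually (\<lambda>n. f n \<in> C) F" "l \<in> C" "((\<lambda>n. nrm (f n - l)) \<longlongrightarrow> 0) F"
  shows "((\<lambda>n. nrm (f n)) \<longlongrightarrow> nrm l) F"
proof -
  have "((\<lambda>n. nrm (f n) - nrm l) \<longlongrightarrow> 0) F"
    by (rule Lim_null_comparison[OF _ assms(3)])
       (use assms(1) in \<open>eventually_elim, simp add: nrm_abs_diff assms(2)\<close>)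
  then show ?thesis by (simp add: LIM_zero_iff)
qed

lemma has_hsum_iff:
  assumes "\<And>i. i \<in> A \<Longrightarrow> f i \<in> C"
  shows "has_hsum H f A s \<longleftrightarrow>
    s \<in> C \<and> ((\<lambda>F. nrm (sum f F - s)) \<longlongrightarrow> 0) (finite_subsets_at_top A)"
  unfolding has_hsum_def
  by (rule limitin_htop) (auto simp: eventually_finite_subsets_at_top intro!: exI[of _ "{}"] sum_c assms)

lemma hsum_eq:
  assumes "has_hsum H f A s"
  shows "hsum H f A = s"
  unfolding hsum_def
proof (rule the_equality)
  show "t = s" if "has_hsum H f A t" for t
    using that assms met.limitin_metric_unique unfolding has_hsum_def htop_def
    by (metis finite_subsets_at_top_neq_bot)
qed (rule assms)

text \<open>Division by the norm. It serves projections, adjoints and weakly defined operators,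
  where the inner product of x with itself can be rewritten as one with the argument of the
  operator.\<close>

lemma nrm_le_if_cip_le:
  assumes x: "x \<in> C" and B: "cmod (ip x x) \<le> B * nrm x" "0 \<le> B"
  shows "nrm x \<le> B"
proof (cases "nrm x = 0")
  case False
  then have "nrm x * nrm x \<le> B * nrm x" using B x by (simp add: cip_self power2_eq_square norm_mult)
  then show ?thesis using False x nrm_nonneg[OF x] by (simp add: mult_le_cancel_right)
qed (use B in simp)

lemma mcomplete_iff:
  "Metric_space.mcomplete C (hdist H) \<longleftrightarrow>
   (\<forall>s::nat \<Rightarrow> 'a. (\<forall>n. s n \<in> C) \<and> (\<forall>e>0. \<exists>N. \<forall>m\<ge>N. \<forall>n\<ge>N. nrm (s m - s n) < e) \<longrightarrow>
      (\<exists>l\<in>C. (\<lambda>n. nrm (s n - l)) \<longlonglongrightarrow> 0))"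
proof -
  have "met.MCauchy s \<longleftrightarrow> (\<forall>n. s n \<in> C) \<and> (\<forall>e>0. \<exists>N. \<forall>m\<ge>N. \<forall>n\<ge>N. nrm (s m - s n) < e)" for s :: "nat \<Rightarrow> 'a"
  proof (cases "\<forall>n. s n \<in> C")
    case True
    have "(\<forall>n n'. N \<le> n \<longrightarrow> N \<le> n' \<longrightarrow> P n n') = (\<forall>m\<ge>N. \<forall>n\<ge>N. P m n)"
      for N :: nat and P :: "nat \<Rightarrow> nat \<Rightarrow> bool" by auto
    then show ?thesis using True by (simp add: met.MCauchy_def hdist_def image_subset_iff)
  qed (auto simp: met.MCauchy_def)
  moreover have "limitin met.mtopology s l sequentially \<longleftrightarrow> l \<in> C \<and> (\<lambda>n. nrm (s n - l)) \<longlonglongrightarrow> 0"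
    if "\<forall>n. s n \<in> C" for s :: "nat \<Rightarrow> 'a" and l
    using limitin_htop[of s sequentially l] that by (simp add: htop_def)
  ultimately have "(met.MCauchy s \<longrightarrow> (\<exists>l. limitin met.mtopology s l sequentially)) \<longleftrightarrow>
     ((\<forall>n. s n \<in> C) \<and> (\<forall>e>0. \<exists>N. \<forall>m\<ge>N. \<forall>n\<ge>N. nrm (s m - s n) < e) \<longrightarrow>
      (\<exists>l\<in>C. (\<lambda>n. nrm (s n - l)) \<longlonglongrightarrow> 0))" for s :: "nat \<Rightarrow> 'a"
    by (cases "\<forall>n. s n \<in> C") (simp_all add: Bex_def)
  then show ?thesis
    unfolding met.mcomplete_def by (simp only:)
qed

lemma hilbert_spaceI:
  assumes "\<And>s::nat \<Rightarrow> 'a. (\<And>n. s n \<in> C) \<Longrightarrow> (\<And>e. e > 0 \<Longrightarrow> \<exists>N. \<forall>m\<ge>N. \<forall>n\<ge>N. nrm (s m - s n) < e) \<Longrightarrow>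
      \<exists>l\<in>C. (\<lambda>n. nrm (s n - l)) \<longlonglongrightarrow> 0"
  shows "hilbert_space H"
proof unfold_locales
  show "met.mcomplete" unfolding mcomplete_iff using assms by blast
qed (use csub in \<open>auto simp: cip_add_left cip_scale_left cip_self_nonneg cip_self_0D intro: cip_swap\<close>)

end

sublocale hilbert_space \<subseteq> pre_hilbert
  by unfold_locales
    (use subspace in \<open>auto simp: cip_add cip_scale cip_nonneg cip_eq_0 intro: cip_commute\<close>)

section \<open>Closed subspaces, orthogonal projections and the Riesz representation theorem\<close>

lemma closed_subspace_iff:
  assumes "pre_hilbert H"
  shows "closed_subspace H S \<longleftrightarrow> csubspace S \<and> S \<subseteq> carrier H \<and>
    (\<forall>s l. (\<forall>n::nat. s n \<in> S) \<and> l \<in> carrier H \<and> (\<lambda>n. hnorm H (s n - l)) \<longlonglongrightarrow> 0 \<longrightarrow> l \<in> S)"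
  using pre_hilbert.closedin_htop[OF assms, of S] unfolding closed_subspace_def by blast

lemma sub_hilbert_simps [simp]:
  "carrier (sub_hilbert H S) = S" "cip (sub_hilbert H S) = cip H" "hnorm (sub_hilbert H S) = hnorm H"
  by (auto simp: sub_hilbert_def hnorm_def fun_eq_iff)

context hilbert_space
begin

lemma complete_seq:
  assumes "\<And>n. s n \<in> C" "\<And>e. e > 0 \<Longrightarrow> \<exists>N. \<forall>m\<ge>N. \<forall>n\<ge>N. nrm (s m - s n) < e"
  shows "\<exists>l\<in>C. (\<lambda>n::nat. nrm (s n - l)) \<longlonglongrightarrow> 0"
  using complete assms unfolding mcomplete_iff by blast

lemma closed_subspaceD:
  assumes "closed_subspace H S"
  shows "csubspace S" "S \<subseteq> C"
    "\<And>s l. (\<And>n::nat. s n \<in> S) \<Longrightarrow> l \<in> C \<Longrightarrow> (\<lambda>n. nrm (s n - l)) \<longlonglongrightarrow> 0 \<Longrightarrow> l \<in> S"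
  using assms closed_subspace_iff[OF pre_hilbert_axioms] by blast+

lemma sub_hilbert_space:
  assumes "closed_subspace H S"
  shows "hilbert_space (sub_hilbert H S)"
proof -
  note S = closed_subspaceD[OF assms]
  interpret sub: pre_hilbert "sub_hilbert H S"
    by unfold_locales
      (use S(1,2) in \<open>auto simp: cip_add_left cip_scale_left cip_self_nonneg cip_self_0D subset_iff intro: cip_swap\<close>)
  show ?thesis
  proof (rule sub.hilbert_spaceI)
    fix s :: "nat \<Rightarrow> 'a"
    assume s: "\<And>n. s n \<in> sub.C" and c: "\<And>e. e > 0 \<Longrightarrow> \<exists>N. \<forall>m\<ge>N. \<forall>n\<ge>N. sub.nrm (s m - s n) < e"
    then obtain l where "l \<in> C" "(\<lambda>n. nrm (s n - l)) \<longlonglongrightarrow> 0"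
      using complete_seq[of s] S(2) by (auto simp: subset_iff)
    then show "\<exists>l\<in>sub.C. (\<lambda>n. sub.nrm (s n - l)) \<longlonglongrightarrow> 0"
      using S(3)[of s l] s by auto
  qed
qed

lemma proj_exists:
  assumes S: "closed_subspace H S" and x: "x \<in> C"
  shows "\<exists>y\<in>S. \<forall>s\<in>S. ip (x - y) s = 0"
proof -
  note S' = closed_subspaceD[OF S]
  have SC: "\<And>y. y \<in> S \<Longrightarrow> y \<in> C" using S'(2) by blast
  have S0: "0 \<in> S" using S'(1) complex_vector.subspace_0 by blast
  define d where "d = (INF y\<in>S. (nrm (x - y))\<^sup>2)"
  have bdd: "bdd_below ((\<lambda>y. (nrm (x - y))\<^sup>2) ` S)" by (rule bdd_belowI[of _ 0]) auto
  have d_le: "d \<le> (nrm (x - y))\<^sup>2" if "y \<in> S" for y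
    unfolding d_def by (rule cINF_lower[OF bdd that])
  have "\<exists>y\<in>S. (nrm (x - y))\<^sup>2 < d + inverse (real (Suc n))" for n
    using cINF_less_iff[OF _ bdd, of "d + inverse (real (Suc n))"] S0 unfolding d_def by auto
  then obtain y where y: "\<And>n. y n \<in> S" and yd: "\<And>n. (nrm (x - y n))\<^sup>2 < d + inverse (real (Suc n))" by metis
  \<comment> \<open>The midpoint of \<open>y m\<close> and \<open>y n\<close> lies in S, so its
    squared distance from x is at least d. The parallelogram law for \<open>x - y m\<close> and
    \<open>x - y n\<close> then forces the two approximants together.\<close>
  have key: "(nrm (y m - y n))\<^sup>2 \<le> 2 * inverse (real (Suc m)) + 2 * inverse (real (Suc n))" for m n
  proof -
    have "(1/2) *\<^sub>C (y m + y n) \<in> S"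
      using y S'(1) by (simp add: complex_vector.subspace_add complex_vector.subspace_scale)
    from d_le[OF this] have "4 * d \<le> (2 * nrm (x - (1/2) *\<^sub>C (y m + y n)))\<^sup>2"
      by (simp add: power_mult_distrib)
    also have "2 * nrm (x - (1/2) *\<^sub>C (y m + y n)) = nrm (2 *\<^sub>C (x - (1/2) *\<^sub>C (y m + y n)))"
      using x y SC by (subst nrm_scale) auto
    also have "2 *\<^sub>C (x - (1/2) *\<^sub>C (y m + y n)) = (x - y m) + (x - y n)"
      using scaleC_add_left[of 1 1 x]
      by (simp add: complex_vector.scale_right_diff_distrib scaleC_scaleC scaleC_one)
    finally have "4 * d \<le> (nrm ((x - y m) + (x - y n)))\<^sup>2" .
    moreover have "(nrm ((x - y m) + (x - y n)))\<^sup>2 + (nrm ((x - y m) - (x - y n)))\<^sup>2 =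
       2 * (nrm (x - y m))\<^sup>2 + 2 * (nrm (x - y n))\<^sup>2"
      using x y SC by (intro parallelogram) auto
    moreover have "(nrm ((x - y m) - (x - y n)))\<^sup>2 = (nrm (y m - y n))\<^sup>2"
      using y SC nrm_minus_commute[of "y n" "y m"] by simp
    ultimately show ?thesis using yd[of m] yd[of n] by linarith
  qed
  have "\<exists>N. \<forall>m\<ge>N. \<forall>n\<ge>N. nrm (y m - y n) < e" if e: "e > 0" for e
  proof -
    have "(\<lambda>n. 4 * inverse (real (Suc n))) \<longlonglongrightarrow> 4 * 0"
      by (intro tendsto_mult_left LIMSEQ_inverse_real_of_nat)
    then have "\<forall>\<^sub>F n in sequentially. 4 * inverse (real (Suc n)) < e\<^sup>2"
      by (rule order_tendstoD) (use e in simp)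
    then obtain N where N: "4 * inverse (real (Suc N)) < e\<^sup>2" by (auto simp: eventually_sequentially)
    have "nrm (y m - y n) < e" if "m \<ge> N" "n \<ge> N" for m n
    proof -
      have "inverse (real (Suc m)) \<le> inverse (real (Suc N))" "inverse (real (Suc n)) \<le> inverse (real (Suc N))"
        using that by (auto intro!: le_imp_inverse_le)
      then have "(nrm (y m - y n))\<^sup>2 < e\<^sup>2" using key[of m n] N by linarith
      then show ?thesis using e by (simp add: power_less_imp_less_base)
    qed
    then show ?thesis by blast
  qed
  then obtain l where l: "l \<in> C" "(\<lambda>n. nrm (y n - l)) \<longlonglongrightarrow> 0"
    using complete_seq[of y] y SC by blast
  then have lS: "l \<in> S" using S'(3)[of y l] y by blast
  have nl: "(nrm (x - l))\<^sup>2 \<le> d"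
  proof -
    have "(\<lambda>n. nrm (x - y n)) \<longlonglongrightarrow> nrm (x - l)"
      by (rule nrm_tendsto) (use x y SC l in \<open>auto simp: nrm_minus_commute\<close>)
    then have "(\<lambda>n. (nrm (x - y n))\<^sup>2) \<longlonglongrightarrow> (nrm (x - l))\<^sup>2" by (rule tendsto_power)
    moreover have "(\<lambda>n. d + inverse (real (Suc n))) \<longlonglongrightarrow> d + 0"
      by (intro tendsto_add tendsto_const LIMSEQ_inverse_real_of_nat)
    ultimately show ?thesis using yd
      by (intro LIMSEQ_le[of _ "(nrm (x - l))\<^sup>2" _ "d"]) (auto simp: less_imp_le)
  qed
  have "ip (x - l) s = 0" if s: "s \<in> S" for s
  proof (cases "s = 0")
    case False
    have sC: "s \<in> C" using s SC by blast
    have ns: "nrm s > 0" using False sC nrm_nonneg[of s] nrm_eq_0[of s] by linarith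
    \<comment> \<open>Moving l by the projection of \<open>x - l\<close> onto the line of s cannot
      reduce the distance. With this c, minimality reads 2 t \<le> t for the square t of |c| times
      the norm of s.\<close>
    define c where "c = ip (x - l) s / of_real ((nrm s)\<^sup>2)"
    have "l + c *\<^sub>C s \<in> S"
      using s lS S'(1) by (simp add: complex_vector.subspace_add complex_vector.subspace_scale)
    from d_le[OF this] nl have "(nrm (x - l))\<^sup>2 \<le> (nrm ((x - l) - c *\<^sub>C s))\<^sup>2" by (simp add: diff_diff_eq)
    also have "\<dots> = (nrm (x - l))\<^sup>2 + (nrm (c *\<^sub>C s))\<^sup>2 - 2 * Re (ip (x - l) (c *\<^sub>C s))"
      using x l sC by (intro nrm_diff_sq) auto
    finally have *: "2 * Re (ip (x - l) (c *\<^sub>C s)) \<le> (nrm (c *\<^sub>C s))\<^sup>2" by simp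
    have e: "ip (x - l) s = c * of_real ((nrm s)\<^sup>2)" using ns by (simp add: c_def)
    have "ip (x - l) (c *\<^sub>C s) = of_real ((cmod c * nrm s)\<^sup>2)"
      using x l sC e complex_norm_square[of c] by (simp add: cip_scale_right power_mult_distrib mult_ac)
    then have "2 * (cmod c * nrm s)\<^sup>2 \<le> (cmod c * nrm s)\<^sup>2" using * sC by (simp add: nrm_scale)
    then have "cmod c * nrm s = 0" by auto
    then show ?thesis using ns e by auto
  qed (use x l in simp)
  then show ?thesis using lS by blast
qed

lemma proj_unique:
  assumes S: "closed_subspace H S" and x: "x \<in> C" and y: "y \<in> S" "\<And>s. s \<in> S \<Longrightarrow> ip (x - y) s = 0"
    and z: "z \<in> S" "\<And>s. s \<in> S \<Longrightarrow> ip (x - z) s = 0"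
  shows "y = z"
proof -
  note S' = closed_subspaceD[OF S]
  have yz: "y \<in> C" "z \<in> C" "y - z \<in> S" using y(1) z(1) S'(1,2) complex_vector.subspace_diff by blast+
  have "ip (y - z) (y - z) = ip (x - z) (y - z) - ip (x - y) (y - z)"
    using x yz by (simp add: cip_diff_left)
  also have "\<dots> = 0" using y(2) z(2) yz(3) by simp
  finally show ?thesis using cip_self_0D[of "y - z"] yz by simp
qed

lemma proj:
  assumes "closed_subspace H S" "x \<in> C"
  shows "orth_proj H S x \<in> S" "\<And>s. s \<in> S \<Longrightarrow> ip (x - orth_proj H S x) s = 0"
proof -
  have "\<exists>!y. y \<in> S \<and> (\<forall>s\<in>S. ip (x - y) s = 0)"
    using proj_exists[OF assms] proj_unique[OF assms] by blast
  from theI'[OF this] show "orth_proj H S x \<in> S" "\<And>s. s \<in> S \<Longrightarrow> ip (x - orth_proj H S x) s = 0"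
    unfolding orth_proj_def by blast+
qed

lemma proj_eqI:
  assumes "closed_subspace H S" "x \<in> C" "y \<in> S" "\<And>s. s \<in> S \<Longrightarrow> ip (x - y) s = 0"
  shows "orth_proj H S x = y"
  using proj_unique[OF assms(1,2) _ _ assms(3,4)] proj[OF assms(1,2)] by blast

lemma proj_c: "closed_subspace H S \<Longrightarrow> x \<in> C \<Longrightarrow> orth_proj H S x \<in> C"
  using proj(1) closed_subspaceD(2) by blast

lemma cip_proj:
  assumes "closed_subspace H S" "x \<in> C" "s \<in> S"
  shows "ip (orth_proj H S x) s = ip x s" "ip s (orth_proj H S x) = ip s x"
proof -
  have s: "s \<in> C" using assms closed_subspaceD(2) by blast
  show *: "ip (orth_proj H S x) s = ip x s"
    using proj(2)[OF assms] proj_c[OF assms(1,2)] assms(2) s by (simp add: cip_diff_left)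
  show "ip s (orth_proj H S x) = ip s x"
    using * cip_swap s assms(2) proj_c[OF assms(1,2)] by metis
qed

lemma proj_ident: "closed_subspace H S \<Longrightarrow> x \<in> S \<Longrightarrow> orth_proj H S x = x"
  using closed_subspaceD(2) by (intro proj_eqI) (auto simp: subset_iff)

lemma cip_proj_proj:
  assumes "closed_subspace H S" "x \<in> C" "y \<in> C"
  shows "ip (orth_proj H S x) (orth_proj H S y) = ip (orth_proj H S x) y"
  using cip_proj(2)[OF assms(1,3) proj(1)[OF assms(1,2)]] .

lemma bounded_proj:
  assumes S: "closed_subspace H S"
  shows "bounded_op H (sub_hilbert H S) (orth_proj H S)"
    and "\<And>x. x \<in> C \<Longrightarrow> nrm (orth_proj H S x) \<le> nrm x"
proof -
  note S' = closed_subspaceD[OF S]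
  show le: "nrm (orth_proj H S x) \<le> nrm x" if x: "x \<in> C" for x
  proof (rule nrm_le_if_cip_le)
    have "ip (orth_proj H S x) (orth_proj H S x) = ip x (orth_proj H S x)"
      using cip_proj(1)[OF S x proj(1)[OF S x]] .
    then show "cmod (ip (orth_proj H S x) (orth_proj H S x)) \<le> nrm x * nrm (orth_proj H S x)"
      using cauchy_schwarz[OF x proj_c[OF S x]] by simp
  qed (use x proj_c[OF S] in auto)
  show "bounded_op H (sub_hilbert H S) (orth_proj H S)"
    unfolding bounded_op_def
  proof (intro conjI ballI allI)
    show "orth_proj H S x \<in> carrier (sub_hilbert H S)" if "x \<in> C" for x
      using proj(1)[OF S that] by simp
    show "orth_proj H S (x + y) = orth_proj H S x + orth_proj H S y" if "x \<in> C" "y \<in> C" for x y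
    proof (rule proj_eqI[OF S])
      show "orth_proj H S x + orth_proj H S y \<in> S"
        using complex_vector.subspace_add[OF S'(1)] proj(1)[OF S] that by blast
      fix s assume "s \<in> S"
      then show "ip (x + y - (orth_proj H S x + orth_proj H S y)) s = 0"
        using that S'(2) proj_c[OF S] by (simp add: cip_diff_left cip_add_left cip_proj(1)[OF S] subset_iff)
    qed (use that in simp)
    show "orth_proj H S (c *\<^sub>C x) = c *\<^sub>C orth_proj H S x" if "x \<in> C" for x c
    proof (rule proj_eqI[OF S])
      show "c *\<^sub>C orth_proj H S x \<in> S"
        using complex_vector.subspace_scale[OF S'(1)] proj(1)[OF S that] by blast
      fix s assume "s \<in> S"
      then show "ip (c *\<^sub>C x - c *\<^sub>C orth_proj H S x) s = 0"
        using that S'(2) proj_c[OF S that]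
        by (simp add: cip_diff_left cip_scale_left cip_proj(1)[OF S] subset_iff)
    qed (use that in simp)
    show "\<exists>B. \<forall>x\<in>C. hnorm (sub_hilbert H S) (orth_proj H S x) \<le> B * nrm x"
      using le by (intro exI[of _ 1]) auto
  qed
qed

lemma orth_compl_closed:
  assumes "S \<subseteq> C"
  shows "closed_subspace H (orth_compl H S)"
  unfolding closed_subspace_iff[OF pre_hilbert_axioms]
proof (intro conjI allI impI)
  show "csubspace (orth_compl H S)"
    using assms unfolding complex_vector.subspace_def
    by (auto simp: orth_compl_def cip_add_left cip_scale_left subset_iff)
  show "orth_compl H S \<subseteq> C" by (auto simp: orth_compl_def)
  fix s :: "nat \<Rightarrow> 'a" and l
  assume *: "(\<forall>n. s n \<in> orth_compl H S) \<and> l \<in> C \<and> (\<lambda>n. nrm (s n - l)) \<longlonglongrightarrow> 0"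
  have "ip l t = 0" if t: "t \<in> S" for t
  proof -
    have "(\<lambda>n. ip (s n) t) \<longlonglongrightarrow> ip l t"
      by (rule cip_tendsto_left) (use * t assms in \<open>auto simp: orth_compl_def\<close>)
    moreover have "ip (s n) t = 0" for n using * t by (auto simp: orth_compl_def)
    ultimately show ?thesis by (simp add: LIMSEQ_const_iff)
  qed
  then show "l \<in> orth_compl H S" using * by (auto simp: orth_compl_def)
qed

text \<open>For x in the double complement, x minus its projection onto S is orthogonal to x and to
  the projection, hence to itself.\<close>

lemma orth_compl_orth_compl:
  assumes S: "closed_subspace H S"
  shows "orth_compl H (orth_compl H S) = S"
proof
  note S' = closed_subspaceD[OF S]
  show "S \<subseteq> orth_compl H (orth_compl H S)"
    using S'(2) by (auto simp: orth_compl_def subset_iff) (metis cip_swap complex_cnj_zero)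
  show "orth_compl H (orth_compl H S) \<subseteq> S"
  proof
    fix x assume x: "x \<in> orth_compl H (orth_compl H S)"
    then have xC: "x \<in> C" by (simp add: orth_compl_def)
    let ?p = "orth_proj H S x"
    have d: "x - ?p \<in> orth_compl H S"
      using proj[OF S xC] xC proj_c[OF S xC] by (auto simp: orth_compl_def)
    then have "ip x (x - ?p) = 0" using x by (simp add: orth_compl_def)
    moreover have "ip ?p (x - ?p) = 0"
      using proj(2)[OF S xC proj(1)[OF S xC]] cip_swap[of ?p "x - ?p"] xC proj_c[OF S xC] by simp
    ultimately have "ip (x - ?p) (x - ?p) = 0"
      using xC proj_c[OF S xC] cip_diff_left[of x ?p "x - ?p"] by simp
    then have "x - ?p = 0" using xC proj_c[OF S xC] by (intro cip_self_0D) auto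
    then show "x \<in> S" using proj(1)[OF S xC] by simp
  qed
qed

text \<open>The form in which density is used below: a domain or a range is everything once it is
  closed and only 0 is orthogonal to it.\<close>

lemma closed_subspace_eq_if_total:
  assumes S: "closed_subspace H S" and "\<And>x. x \<in> C \<Longrightarrow> (\<And>s. s \<in> S \<Longrightarrow> ip x s = 0) \<Longrightarrow> x = 0"
  shows "S = C"
proof -
  have "orth_compl H S = {0}" using assms(2) closed_subspaceD(2)[OF S] by (auto simp: orth_compl_def)
  then show ?thesis using orth_compl_orth_compl[OF S] by (auto simp: orth_compl_def)
qed

lemma closed_subspace_closure:
  assumes S: "csubspace S" "S \<subseteq> C"
  shows "closed_subspace H (htop H closure_of S)" "S \<subseteq> htop H closure_of S"
proof -
  show "S \<subseteq> htop H closure_of S"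
    using S(2) by (intro closure_of_subset) (simp add: htop_def)
  have "csubspace (htop H closure_of S)"
  proof (rule complex_vector.subspaceI)
    show "0 \<in> htop H closure_of S"
      using S complex_vector.subspace_0 \<open>S \<subseteq> htop H closure_of S\<close> by blast
    fix x y assume "x \<in> htop H closure_of S" "y \<in> htop H closure_of S"
    then obtain s t where x: "x \<in> C" "\<And>n::nat. s n \<in> S" "(\<lambda>n. nrm (s n - x)) \<longlonglongrightarrow> 0"
      and y: "y \<in> C" "\<And>n::nat. t n \<in> S" "(\<lambda>n. nrm (t n - y)) \<longlonglongrightarrow> 0"
      unfolding in_closure_htop[OF S(2)] by auto
    have "(\<lambda>n. nrm ((s n + t n) - (x + y))) \<longlonglongrightarrow> 0"
    proof (rule tendsto_zero_sandwich)
      show "(\<lambda>n. nrm (s n - x) + nrm (t n - y)) \<longlonglongrightarrow> 0" using x y by (intro tendsto_add_zero)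
      fix n show "0 \<le> nrm ((s n + t n) - (x + y))" using x y S(2) by (intro nrm_nonneg) (simp add: subset_iff)
      have "(s n + t n) - (x + y) = (s n - x) + (t n - y)" by simp
      also have "nrm ((s n - x) + (t n - y)) \<le> nrm (s n - x) + nrm (t n - y)"
        using x y S(2) by (intro nrm_triangle) (simp_all add: subset_iff)
      finally show "nrm ((s n + t n) - (x + y)) \<le> nrm (s n - x) + nrm (t n - y)" .
    qed
    moreover have "\<And>n. s n + t n \<in> S" using x y S(1) complex_vector.subspace_add by blast
    ultimately show "x + y \<in> htop H closure_of S"
      unfolding in_closure_htop[OF S(2)] using x(1) y(1) by (intro conjI exI[of _ "\<lambda>n. s n + t n"]) auto
  next
    fix c x assume "x \<in> htop H closure_of S"
    then obtain s where x: "x \<in> C" "\<And>n::nat. s n \<in> S" "(\<lambda>n. nrm (s n - x)) \<longlonglongrightarrow> 0"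
      unfolding in_closure_htop[OF S(2)] by auto
    have "nrm (c *\<^sub>C s n - c *\<^sub>C x) = cmod c * nrm (s n - x)" for n
      using x S(2) nrm_scale[of "s n - x" c]
      by (simp add: complex_vector.scale_right_diff_distrib subset_iff)
    then have "(\<lambda>n. nrm (c *\<^sub>C s n - c *\<^sub>C x)) \<longlonglongrightarrow> 0" using x by (simp add: tendsto_mult_right_zero)
    moreover have "\<And>n. c *\<^sub>C s n \<in> S" using x S(1) complex_vector.subspace_scale by blast
    ultimately show "c *\<^sub>C x \<in> htop H closure_of S"
      unfolding in_closure_htop[OF S(2)] using x(1) by (intro conjI exI[of _ "\<lambda>n. c *\<^sub>C s n"]) auto
  qed
  then show "closed_subspace H (htop H closure_of S)"
    unfolding closed_subspace_def using closure_of_subset_topspace[of "htop H" S]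
    by (simp add: htop_def)
qed

text \<open>A vector u orthogonal to the kernel with \<phi> u nonzero represents \<phi> up to a
  scalar, because x - (\<phi> x / \<phi> u) u always lies in the kernel. The scalar is conjugated
  since the second argument of the inner product is conjugate linear.\<close>

lemma riesz:
  assumes add: "\<And>x y. x \<in> C \<Longrightarrow> y \<in> C \<Longrightarrow> \<phi> (x + y) = \<phi> x + \<phi> y"
    and scale: "\<And>c x. x \<in> C \<Longrightarrow> \<phi> (c *\<^sub>C x) = c * \<phi> x"
    and bound: "\<And>x. x \<in> C \<Longrightarrow> cmod (\<phi> x) \<le> B * nrm x"
  shows "\<exists>y\<in>C. \<forall>x\<in>C. \<phi> x = ip x y"
proof (cases "\<forall>x\<in>C. \<phi> x = 0")
  case True then show ?thesis by (intro bexI[of _ 0]) auto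
next
  case False
  then obtain x0 where x0: "x0 \<in> C" "\<phi> x0 \<noteq> 0" by blast
  have diff: "\<phi> (x - y) = \<phi> x - \<phi> y" if "x \<in> C" "y \<in> C" for x y
    using add[of x "(-1) *\<^sub>C y"] scale[of y "-1"] that by simp
  define S where "S = {x\<in>C. \<phi> x = 0}"
  have S: "closed_subspace H S"
    unfolding closed_subspace_iff[OF pre_hilbert_axioms]
  proof (intro conjI allI impI)
    have "\<phi> 0 = 0" using scale[of 0 0] by simp
    then show "csubspace S" unfolding complex_vector.subspace_def S_def by (auto simp: add scale)
    show "S \<subseteq> C" by (auto simp: S_def)
    fix s :: "nat \<Rightarrow> 'a" and l
    assume *: "(\<forall>n. s n \<in> S) \<and> l \<in> C \<and> (\<lambda>n. nrm (s n - l)) \<longlonglongrightarrow> 0"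
    then have "(\<lambda>n. B * nrm (s n - l)) \<longlonglongrightarrow> B * 0" by (intro tendsto_mult_left) simp
    moreover have "cmod (\<phi> l) \<le> B * nrm (s n - l)" for n
      using bound[of "s n - l"] diff[of "s n" l] * by (auto simp: S_def)
    ultimately have "cmod (\<phi> l) \<le> B * 0" by (intro LIMSEQ_le_const) auto
    then show "l \<in> S" using * by (simp add: S_def)
  qed
  define u where "u = x0 - orth_proj H S x0"
  have pC: "orth_proj H S x0 \<in> S" "orth_proj H S x0 \<in> C" using proj(1)[OF S x0(1)] proj_c[OF S x0(1)] by auto
  have u: "u \<in> C" "\<phi> u \<noteq> 0" using x0 pC diff by (auto simp: u_def S_def)
  then have "u \<noteq> 0" using scale[of 0 0] by auto
  then have nu: "nrm u \<noteq> 0" using u by simp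
  define y where "y = (cnj (\<phi> u) / of_real ((nrm u)\<^sup>2)) *\<^sub>C u"
  show ?thesis
  proof (intro bexI[of _ y] ballI)
    show "y \<in> C" using u by (simp add: y_def)
    fix x assume x: "x \<in> C"
    let ?c = "\<phi> x / \<phi> u"
    have "x - ?c *\<^sub>C u \<in> S" using x u diff scale by (simp add: S_def)
    then have "ip u (x - ?c *\<^sub>C u) = 0" using proj(2)[OF S x0(1)] by (simp add: u_def)
    then have "ip (x - ?c *\<^sub>C u) u = 0" using cip_swap[of "x - ?c *\<^sub>C u" u] u x by simp
    then have "ip x u = ?c * of_real ((nrm u)\<^sup>2)" using x u by (simp add: cip_bilinear cip_self)
    then show "\<phi> x = ip x y" using x u nu by (simp add: y_def cip_scale_right)
  qed
qed

end

section \<open>Bounded operators and adjoints\<close>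

lemma bounded_opD:
  assumes "bounded_op H K T"
  shows "\<And>x. x \<in> carrier H \<Longrightarrow> T x \<in> carrier K"
    "\<And>x y. x \<in> carrier H \<Longrightarrow> y \<in> carrier H \<Longrightarrow> T (x + y) = T x + T y"
    "\<And>c x. x \<in> carrier H \<Longrightarrow> T (c *\<^sub>C x) = c *\<^sub>C T x"
  using assms by (auto simp: bounded_op_def)

lemma bounded_op_diff:
  assumes "bounded_op H K T" "pre_hilbert H" "x \<in> carrier H" "y \<in> carrier H"
  shows "T (x - y) = T x - T y"
proof -
  interpret pre_hilbert H by fact
  show ?thesis
    using bounded_opD(2)[OF assms(1), of x "(-1) *\<^sub>C y"] bounded_opD(3)[OF assms(1), of y "-1"] assms(3,4)
    by simp
qed

lemma bounded_op_0: "bounded_op H K T \<Longrightarrow> pre_hilbert H \<Longrightarrow> T 0 = 0"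
  using bounded_op_diff[of H K T 0 0] pre_hilbert.zero_c by fastforce

lemma bounded_op_sum:
  assumes "bounded_op H K T" "pre_hilbert H" "\<And>i. i \<in> A \<Longrightarrow> f i \<in> carrier H"
  shows "T (sum f A) = (\<Sum>i\<in>A. T (f i))"
proof -
  interpret pre_hilbert H by fact
  show ?thesis using assms(3)
    by (induction A rule: infinite_finite_induct)
      (auto simp: bounded_op_0[OF assms(1,2)] bounded_opD(2)[OF assms(1)] sum_c)
qed

lemma bounded_op_bound:
  assumes "bounded_op H K T" "pre_hilbert H"
  obtains B where "B \<ge> 0" "\<And>x. x \<in> carrier H \<Longrightarrow> hnorm K (T x) \<le> B * hnorm H x"
proof -
  obtain B where B: "\<And>x. x \<in> carrier H \<Longrightarrow> hnorm K (T x) \<le> B * hnorm H x"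
    using assms(1) unfolding bounded_op_def by blast
  have "hnorm K (T x) \<le> max B 0 * hnorm H x" if "x \<in> carrier H" for x
    using B[OF that] mult_right_mono[of B "max B 0" "hnorm H x"] pre_hilbert.nrm_nonneg[OF assms(2) that]
    by simp
  then show thesis using that[of "max B 0"] by auto
qed

lemma bounded_op_tendsto:
  assumes T: "bounded_op H K T" and H: "pre_hilbert H" and K: "pre_hilbert K"
    and f: "eventually (\<lambda>n. f n \<in> carrier H) F" "l \<in> carrier H" "((\<lambda>n. hnorm H (f n - l)) \<longlongrightarrow> 0) F"
  shows "((\<lambda>n. hnorm K (T (f n) - T l)) \<longlongrightarrow> 0) F"
proof -
  interpret H: pre_hilbert H by fact
  interpret K: pre_hilbert K by fact
  obtain B where B: "B \<ge> 0" "\<And>x. x \<in> carrier H \<Longrightarrow> hnorm K (T x) \<le> B * hnorm H x"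
    using bounded_op_bound[OF T H] by blast
  show ?thesis
  proof (rule Lim_null_comparison)
    show "((\<lambda>n. B * hnorm H (f n - l)) \<longlongrightarrow> 0) F" using tendsto_mult_left[OF f(3), of B] by simp
    show "\<forall>\<^sub>F n in F. norm (hnorm K (T (f n) - T l)) \<le> B * hnorm H (f n - l)"
      using f(1)
    proof eventually_elim
      case (elim n)
      then show ?case
        using B(2)[of "f n - l"] f(2) bounded_op_diff[OF T H, of "f n" l] bounded_opD(1)[OF T]
        by (simp add: K.nrm_nonneg)
    qed
  qed
qed

lemma bounded_op_comp:
  assumes "bounded_op H K T" "bounded_op K L S" "pre_hilbert K"
  shows "bounded_op H L (\<lambda>x. S (T x))"
proof -
  obtain B where B: "B \<ge> 0" "\<And>x. x \<in> carrier K \<Longrightarrow> hnorm L (S x) \<le> B * hnorm K x"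
    using bounded_op_bound[OF assms(2,3)] by blast
  obtain B' where B': "\<And>x. x \<in> carrier H \<Longrightarrow> hnorm K (T x) \<le> B' * hnorm H x"
    using assms(1) unfolding bounded_op_def by blast
  have "hnorm L (S (T x)) \<le> (B * B') * hnorm H x" if "x \<in> carrier H" for x
    using B(2)[of "T x"] mult_left_mono[OF B'[OF that] B(1)] bounded_opD(1)[OF assms(1) that] by (simp add: mult.assoc)
  then show ?thesis
    using assms(1,2) unfolding bounded_op_def by (auto 0 3 intro: exI[of _ "B * B'"])
qed

lemma adj_exists:
  assumes H: "hilbert_space H" and K: "pre_hilbert K" and T: "bounded_op H K T" and y: "y \<in> carrier K"
  shows "\<exists>!x. x \<in> carrier H \<and> (\<forall>h\<in>carrier H. cip K (T h) y = cip H h x)"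
proof -
  interpret H: hilbert_space H by fact
  interpret K: pre_hilbert K by fact
  note T' = bounded_opD[OF T]
  obtain B where B: "B \<ge> 0" "\<And>x. x \<in> H.C \<Longrightarrow> hnorm K (T x) \<le> B * hnorm H x"
    using bounded_op_bound[OF T H.pre_hilbert_axioms] by blast
  have "\<exists>x\<in>H.C. \<forall>h\<in>H.C. cip K (T h) y = cip H h x"
  proof (rule H.riesz[where B = "B * hnorm K y"])
    fix x assume x: "x \<in> H.C"
    have "cmod (cip K (T x) y) \<le> hnorm K (T x) * hnorm K y"
      using x y T' by (intro K.cauchy_schwarz) auto
    also have "\<dots> \<le> (B * hnorm H x) * hnorm K y"
      using B x y by (intro mult_right_mono) auto
    finally show "cmod (cip K (T x) y) \<le> B * hnorm K y * hnorm H x" by (simp add: mult_ac)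
  qed (use y T' in \<open>auto simp: K.cip_add_left K.cip_scale_left\<close>)
  moreover have "x = x'" if "x \<in> H.C" "x' \<in> H.C" "\<forall>h\<in>H.C. cip K (T h) y = cip H h x"
    "\<forall>h\<in>H.C. cip K (T h) y = cip H h x'" for x x'
    using that by (intro H.eq_if_cip_eq') auto
  ultimately show ?thesis by blast
qed

lemma adj:
  assumes "hilbert_space H" "pre_hilbert K" "bounded_op H K T" "y \<in> carrier K"
  shows "adj H K T y \<in> carrier H" "\<And>h. h \<in> carrier H \<Longrightarrow> cip K (T h) y = cip H h (adj H K T y)"
  using theI'[OF adj_exists[OF assms]] unfolding adj_def by auto

lemma adj_left:
  assumes "hilbert_space H" "pre_hilbert K" "bounded_op H K T" "y \<in> carrier K" "h \<in> carrier H"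
  shows "cip H (adj H K T y) h = cip K y (T h)"
  using adj(1)[OF assms(1-4)] adj(2)[OF assms(1-4) assms(5)] assms(4,5) bounded_opD(1)[OF assms(3)]
    hilbert_space.cip_commute[OF assms(1)] pre_hilbert.cip_swap[OF assms(2)]
  by metis

lemma adj_eqI:
  assumes "hilbert_space H" "pre_hilbert K" "bounded_op H K T" "y \<in> carrier K"
    "x \<in> carrier H" "\<And>h. h \<in> carrier H \<Longrightarrow> cip K (T h) y = cip H h x"
  shows "adj H K T y = x"
  using the1_equality[OF adj_exists[OF assms(1-4)]] assms(5,6) unfolding adj_def by auto

lemma bounded_op_adj:
  assumes H: "hilbert_space H" and K: "pre_hilbert K" and T: "bounded_op H K T"
  shows "bounded_op K H (adj H K T)"
proof -
  interpret H: hilbert_space H by fact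
  interpret K: pre_hilbert K by fact
  note T' = bounded_opD[OF T] and A = adj[OF H K T]
  obtain B where B: "B \<ge> 0" "\<And>x. x \<in> H.C \<Longrightarrow> hnorm K (T x) \<le> B * hnorm H x"
    using bounded_op_bound[OF T H.pre_hilbert_axioms] by blast
  show ?thesis unfolding bounded_op_def
  proof (intro conjI ballI allI)
    show "adj H K T (x + y) = adj H K T x + adj H K T y" if "x \<in> K.C" "y \<in> K.C" for x y
      by (rule adj_eqI[OF H K T]) (use that A T' in \<open>auto simp: H.cip_add_right K.cip_add_right\<close>)
    show "adj H K T (c *\<^sub>C x) = c *\<^sub>C adj H K T x" if "x \<in> K.C" for x c
      by (rule adj_eqI[OF H K T]) (use that A T' in \<open>auto simp: H.cip_scale_right K.cip_scale_right\<close>)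
    have "hnorm H (adj H K T x) \<le> B * hnorm K x" if x: "x \<in> K.C" for x
    proof (rule H.nrm_le_if_cip_le)
      have "cip H (adj H K T x) (adj H K T x) = cip K (T (adj H K T x)) x" using A x by simp
      also have "cmod \<dots> \<le> hnorm K (T (adj H K T x)) * hnorm K x"
        using x A T' by (intro K.cauchy_schwarz) auto
      also have "\<dots> \<le> B * hnorm H (adj H K T x) * hnorm K x"
        using x A B by (intro mult_right_mono) auto
      finally show "cmod (cip H (adj H K T x) (adj H K T x)) \<le> B * hnorm K x * hnorm H (adj H K T x)"
        by (simp add: mult_ac)
    qed (use A x B in auto)
    then show "\<exists>B. \<forall>x\<in>K.C. hnorm H (adj H K T x) \<le> B * hnorm K x" by blast
  qed (use A in auto)
qed

lemma pre_hilbert_of_hilbert: "hilbert_space H \<Longrightarrow> pre_hilbert H"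
proof -
  assume "hilbert_space H"
  then interpret hilbert_space H .
  show ?thesis by (rule pre_hilbert_axioms)
qed

text \<open>Applied to any y, the two adjoints differ by a vector orthogonal to every
  \<open>u i\<close>, which totality makes 0. No approximation by linear combinations is
  involved.\<close>

lemma bounded_op_eq_on_total:
  assumes H: "hilbert_space H" and K: "pre_hilbert K" and T: "bounded_op H K T" and S: "bounded_op H K S"
    and u: "\<And>i. i \<in> I \<Longrightarrow> u i \<in> carrier H"
    and total: "\<And>x. x \<in> carrier H \<Longrightarrow> (\<And>i. i \<in> I \<Longrightarrow> cip H x (u i) = 0) \<Longrightarrow> x = 0"
    and eq: "\<And>i. i \<in> I \<Longrightarrow> T (u i) = S (u i)" and x: "x \<in> carrier H"
  shows "T x = S x"
proof -
  interpret H: hilbert_space H by fact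
  interpret K: pre_hilbert K by fact
  note Ta = adj[OF H K T] adj_left[OF H K T] and Sa = adj[OF H K S] adj_left[OF H K S]
  show ?thesis
  proof (rule K.eq_if_cip_eq)
    fix y assume y: "y \<in> K.C"
    have "adj H K T y - adj H K S y = 0"
    proof (rule total)
      show "adj H K T y - adj H K S y \<in> H.C" using Ta(1) Sa(1) y by simp
      fix i assume i: "i \<in> I"
      have "cip H (adj H K T y) (u i) = cip H (adj H K S y) (u i)"
        using Ta(3)[OF y u[OF i]] Sa(3)[OF y u[OF i]] eq[OF i] by simp
      then show "cip H (adj H K T y - adj H K S y) (u i) = 0"
        using Ta(1)[OF y] Sa(1)[OF y] u[OF i] by (simp add: H.cip_diff_left)
    qed
    then show "cip K (T x) y = cip K (S x) y"
      using Ta(2)[OF y x] Sa(2)[OF y x] by simp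
  qed (use x bounded_opD(1)[OF T] bounded_opD(1)[OF S] in auto)
qed

lemma bounded_op_has_hsum:
  assumes H: "pre_hilbert H" and K: "pre_hilbert K" and T: "bounded_op H K T"
    and f: "\<And>i. i \<in> A \<Longrightarrow> f i \<in> carrier H" and s: "has_hsum H f A s"
  shows "has_hsum K (\<lambda>i. T (f i)) A (T s)"
proof -
  interpret H: pre_hilbert H by fact
  interpret K: pre_hilbert K by fact
  have s': "s \<in> H.C" "((\<lambda>F. H.nrm (sum f F - s)) \<longlongrightarrow> 0) (finite_subsets_at_top A)"
    using s H.has_hsum_iff[of A f s] f by auto
  have ev: "eventually (\<lambda>F. F \<subseteq> A) (finite_subsets_at_top A)"
    by (auto simp: eventually_finite_subsets_at_top intro!: exI[of _ "{}"])
  have "((\<lambda>F. K.nrm (T (sum f F) - T s)) \<longlongrightarrow> 0) (finite_subsets_at_top A)"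
    by (rule bounded_op_tendsto[OF T H K _ s'])
      (use ev in \<open>auto elim!: eventually_mono intro!: H.sum_c f\<close>)
  then have "((\<lambda>F. K.nrm ((\<Sum>i\<in>F. T (f i)) - T s)) \<longlongrightarrow> 0) (finite_subsets_at_top A)"
    by (rule tendsto_cong[THEN iffD1, rotated])
      (use ev in \<open>eventually_elim, subst bounded_op_sum[OF T H], auto intro: f\<close>)
  then show ?thesis
    using bounded_opD(1)[OF T] f s'(1) by (subst K.has_hsum_iff) auto
qed

lemma has_hsum_cong:
  assumes "\<And>i. i \<in> A \<Longrightarrow> f i = g i"
  shows "has_hsum H f A s \<longleftrightarrow> has_hsum H g A s"
proof -
  have "\<forall>\<^sub>F F in finite_subsets_at_top A. F \<subseteq> A"
    by (auto simp: eventually_finite_subsets_at_top intro!: exI[of _ "{}"])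
  then have *: "\<forall>\<^sub>F F in finite_subsets_at_top A. sum f F = sum g F"
    by eventually_elim (rule sum.cong[OF refl], use assms in blast)
  then have **: "\<forall>\<^sub>F F in finite_subsets_at_top A. sum g F = sum f F"
    by eventually_elim simp
  show ?thesis
    unfolding has_hsum_def
    using limitin_transform_eventually[OF *, of "htop H" s] limitin_transform_eventually[OF **, of "htop H" s]
    by iprover
qed

section \<open>Direct sums\<close>

lemma direct_sum_simps:
  "carrier (direct_sum A H) = {h. (\<forall>i\<in>A. h i \<in> carrier H) \<and> (\<forall>i. i \<notin> A \<longrightarrow> h i = 0) \<and>
                   (\<lambda>i. (hnorm H (h i))\<^sup>2) summable_on A}"
  "cip (direct_sum A H) g h = (\<Sum>\<^sub>\<infinity>i\<in>A. cip H (g i) (h i))"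
  by (simp_all add: direct_sum_def)

context pre_hilbert
begin

lemma ds_add_summable:
  assumes "x \<in> carrier (direct_sum A H)" "y \<in> carrier (direct_sum A H)"
  shows "(\<lambda>i. (nrm (x i + y i))\<^sup>2) summable_on A"
proof (rule summable_on_comparison_test)
  show "(\<lambda>i. 2 * (nrm (x i))\<^sup>2 + 2 * (nrm (y i))\<^sup>2) summable_on A"
    using assms by (intro summable_on_add summable_on_cmult_right) (auto simp: direct_sum_simps)
  show "(nrm (x i + y i))\<^sup>2 \<le> 2 * (nrm (x i))\<^sup>2 + 2 * (nrm (y i))\<^sup>2" if "i \<in> A" for i
    using parallelogram[of "x i" "y i"] assms that by (simp add: direct_sum_simps) (smt (verit) zero_le_power2)
qed auto

lemma ds_csubspace: "csubspace (carrier (direct_sum A H))"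
proof (rule complex_vector.subspaceI)
  show "0 \<in> carrier (direct_sum A H)" by (simp add: direct_sum_simps)
  fix x y assume *: "x \<in> carrier (direct_sum A H)" "y \<in> carrier (direct_sum A H)"
  then show "x + y \<in> carrier (direct_sum A H)"
    using ds_add_summable[OF *] by (simp add: direct_sum_simps)
next
  fix c x assume x: "x \<in> carrier (direct_sum A H)"
  have "(\<lambda>i. (cmod c)\<^sup>2 * (nrm (x i))\<^sup>2) summable_on A"
    using x by (intro summable_on_cmult_right) (simp add: direct_sum_simps)
  then have "(\<lambda>i. (nrm (c *\<^sub>C x i))\<^sup>2) summable_on A"
    by (rule summable_on_cong[THEN iffD1, rotated])
      (use x in \<open>auto simp: nrm_scale power_mult_distrib direct_sum_simps\<close>)
  then show "c *\<^sub>C x \<in> carrier (direct_sum A H)"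
    using x by (simp add: direct_sum_simps scaleC_fun_def)
qed

lemma ds_cip_summable:
  assumes "x \<in> carrier (direct_sum A H)" "y \<in> carrier (direct_sum A H)"
  shows "(\<lambda>i. ip (x i) (y i)) summable_on A" "(\<lambda>i. cmod (ip (x i) (y i))) summable_on A"
proof -
  show "(\<lambda>i. cmod (ip (x i) (y i))) summable_on A"
  proof (rule summable_on_comparison_test)
    show "(\<lambda>i. (nrm (x i))\<^sup>2 + (nrm (y i))\<^sup>2) summable_on A"
      using assms by (intro summable_on_add) (auto simp: direct_sum_simps)
    fix i assume i: "i \<in> A"
    then have xy: "x i \<in> C" "y i \<in> C" using assms by (auto simp: direct_sum_simps)
    have "2 * (nrm (x i) * nrm (y i)) \<le> (nrm (x i))\<^sup>2 + (nrm (y i))\<^sup>2"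
      using sum_squares_bound[of "nrm (x i)" "nrm (y i)"] by simp
    moreover have "0 \<le> nrm (x i) * nrm (y i)" using xy by simp
    ultimately show "norm (ip (x i) (y i)) \<le> (nrm (x i))\<^sup>2 + (nrm (y i))\<^sup>2"
      using cauchy_schwarz[OF xy] by linarith
  qed simp
  then show "(\<lambda>i. ip (x i) (y i)) summable_on A"
    by (rule Infinite_Sum.abs_summable_summable)
qed

lemma ds_cip_self:
  assumes "x \<in> carrier (direct_sum A H)"
  shows "cip (direct_sum A H) x x = of_real (\<Sum>\<^sub>\<infinity>i\<in>A. (nrm (x i))\<^sup>2)"
proof -
  have "cip (direct_sum A H) x x = (\<Sum>\<^sub>\<infinity>i\<in>A. of_real ((nrm (x i))\<^sup>2))"
    unfolding direct_sum_simps(2)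
    by (rule infsum_cong) (use assms in \<open>auto simp: direct_sum_simps cip_self\<close>)
  also have "\<dots> = of_real (\<Sum>\<^sub>\<infinity>i\<in>A. (nrm (x i))\<^sup>2)"
    using assms by (intro infsumI has_sum_of_real has_sum_infsum) (simp add: direct_sum_simps)
  finally show ?thesis .
qed

lemma ds_pre_hilbert: "pre_hilbert (direct_sum A H)"
proof
  let ?D = "direct_sum A H"
  show "csubspace (carrier ?D)" by (rule ds_csubspace)
  fix x y u :: "'b \<Rightarrow> 'a" and c
  assume x: "x \<in> carrier ?D"
  show "cip ?D (c *\<^sub>C x) u = c * cip ?D x u" if u: "u \<in> carrier ?D"
  proof -
    have "cip ?D (c *\<^sub>C x) u = (\<Sum>\<^sub>\<infinity>i\<in>A. c * ip (x i) (u i))"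
      unfolding direct_sum_simps(2)
      by (rule infsum_cong) (use x u in \<open>auto simp: direct_sum_simps cip_scale_left scaleC_fun_def\<close>)
    also have "\<dots> = c * cip ?D x u"
      unfolding direct_sum_simps(2) by (rule infsum_cmult_right) (use ds_cip_summable(1)[OF x u] in simp)
    finally show ?thesis .
  qed
  show "0 \<le> Re (cip ?D x x)" unfolding ds_cip_self[OF x] by (simp add: infsum_nonneg)
  show "x = 0" if "cip ?D x x = 0"
  proof
    fix i
    have s: "(\<lambda>i. (nrm (x i))\<^sup>2) summable_on A" using x by (simp add: direct_sum_simps)
    have "(\<Sum>\<^sub>\<infinity>i\<in>A. (nrm (x i))\<^sup>2) = 0" using that unfolding ds_cip_self[OF x] by simp
    then have "(nrm (x i))\<^sup>2 = 0" if "i \<in> A"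
      using nonneg_infsum_le_0D[OF _ s _ that] by simp
    then show "x i = 0 i" using x by (cases "i \<in> A") (auto simp: direct_sum_simps)
  qed
  assume y: "y \<in> carrier ?D"
  show "cip ?D x y = cnj (cip ?D y x)"
    unfolding direct_sum_simps(2) infsum_cnj[symmetric]
    by (rule infsum_cong) (use x y in \<open>auto simp: direct_sum_simps intro: cip_swap\<close>)
  assume u: "u \<in> carrier ?D"
  have "cip ?D (x + y) u = (\<Sum>\<^sub>\<infinity>i\<in>A. ip (x i) (u i) + ip (y i) (u i))"
    unfolding direct_sum_simps(2)
    by (rule infsum_cong) (use x y u in \<open>auto simp: direct_sum_simps cip_add_left\<close>)
  also have "\<dots> = cip ?D x u + cip ?D y u"
    unfolding direct_sum_simps(2) using ds_cip_summable(1)[OF x u] ds_cip_summable(1)[OF y u]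
    by (rule infsum_add)
  finally show "cip ?D (x + y) u = cip ?D x u + cip ?D y u" .
qed

lemma ds_nrm_sq:
  "x \<in> carrier (direct_sum A H) \<Longrightarrow> (hnorm (direct_sum A H) x)\<^sup>2 = (\<Sum>\<^sub>\<infinity>i\<in>A. (nrm (x i))\<^sup>2)"
  using pre_hilbert.nrm_sq[OF ds_pre_hilbert, of x A] ds_cip_self[of x A] by simp

lemma ds_finite_le:
  assumes x: "x \<in> carrier (direct_sum A H)" and F: "finite F" "F \<subseteq> A"
  shows "(\<Sum>i\<in>F. (nrm (x i))\<^sup>2) \<le> (hnorm (direct_sum A H) x)\<^sup>2"
  unfolding ds_nrm_sq[OF x]
  by (rule finite_sum_le_infsum) (use x F in \<open>auto simp: direct_sum_simps\<close>)

lemma ds_coord_le: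
  assumes x: "x \<in> carrier (direct_sum A H)" and i: "i \<in> A"
  shows "nrm (x i) \<le> hnorm (direct_sum A H) x"
proof -
  interpret D: pre_hilbert "direct_sum A H" by (rule ds_pre_hilbert)
  show ?thesis
    using ds_finite_le[OF x, of "{i}"] i x by (intro power2_le_imp_le[OF _ D.nrm_nonneg]) auto
qed

lemma ds_memI:
  assumes "\<And>i. i \<in> A \<Longrightarrow> x i \<in> C" "\<And>i. i \<notin> A \<Longrightarrow> x i = 0"
    and B: "\<And>F. finite F \<Longrightarrow> F \<subseteq> A \<Longrightarrow> (\<Sum>i\<in>F. (nrm (x i))\<^sup>2) \<le> B\<^sup>2" "0 \<le> B"
  shows "x \<in> carrier (direct_sum A H)" "hnorm (direct_sum A H) x \<le> B"
proof -
  have "(\<lambda>i. (nrm (x i))\<^sup>2) summable_on A"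
    by (rule nonneg_bdd_above_summable_on) (use B in \<open>auto intro!: bdd_aboveI[of _ "B\<^sup>2"]\<close>)
  then show x: "x \<in> carrier (direct_sum A H)" using assms by (simp add: direct_sum_simps)
  have "(hnorm (direct_sum A H) x)\<^sup>2 \<le> B\<^sup>2"
    unfolding ds_nrm_sq[OF x]
    by (rule infsum_le_finite_sums) (use x B in \<open>auto simp: direct_sum_simps\<close>)
  then show "hnorm (direct_sum A H) x \<le> B" using B(2) by (rule power2_le_imp_le)
qed

lemma ds_single:
  assumes i: "i \<in> A" and h: "h \<in> C"
  shows "(\<lambda>j. if j = i then h else 0) \<in> carrier (direct_sum A H)"
    "x \<in> carrier (direct_sum A H) \<Longrightarrow> cip (direct_sum A H) x (\<lambda>j. if j = i then h else 0) = ip (x i) h"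
proof -
  let ?s = "\<lambda>j. if j = i then h else 0"
  have "(\<Sum>j\<in>F. (nrm (?s j))\<^sup>2) \<le> (nrm h)\<^sup>2" if "finite F" for F
    using that by (simp add: if_distrib[of nrm] if_distrib[of "\<lambda>x. x\<^sup>2"] sum.delta cong: if_cong)
  then show "?s \<in> carrier (direct_sum A H)" by (intro ds_memI(1)[where B="nrm h"]) (use i h in auto)
  assume x: "x \<in> carrier (direct_sum A H)"
  have "cip (direct_sum A H) x ?s = (\<Sum>\<^sub>\<infinity>j\<in>{i}. ip (x j) (?s j))"
    unfolding direct_sum_simps(2)
    by (rule infsum_cong_neutral) (use i x in \<open>auto simp: direct_sum_simps\<close>)
  then show "cip (direct_sum A H) x ?s = ip (x i) h" by simp
qed

text \<open>An operator applied to this expansion becomes a series over the coordinates;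
  \<open>adj_direct_sum_has_hsum\<close> rests on it. The squared error of a partial sum is the tail
  of the series of squared norms.\<close>

lemma ds_has_hsum_single:
  assumes x: "x \<in> carrier (direct_sum A H)"
  shows "has_hsum (direct_sum A H) (\<lambda>i j. if j = i then x i else 0) A x"
proof -
  interpret D: pre_hilbert "direct_sum A H" by (rule ds_pre_hilbert)
  have xs: "\<And>i. i \<in> A \<Longrightarrow> x i \<in> C" "(\<lambda>i. (nrm (x i))\<^sup>2) summable_on A" "\<And>i. i \<notin> A \<Longrightarrow> x i = 0"
    using x by (auto simp: direct_sum_simps)
  have s: "(\<lambda>j. if j = i then x i else 0) \<in> D.C" if "i \<in> A" for i
    using ds_single(1)[OF that xs(1)[OF that]] .
  have sum_eq: "(\<Sum>i\<in>F. (\<lambda>j. if j = i then x i else 0)) = (\<lambda>j. if j \<in> F then x j else 0)" if "finite F" for F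
    using that by (induction F) (auto simp: fun_eq_iff)
  have nrm_eq: "(D.nrm ((\<Sum>i\<in>F. (\<lambda>j. if j = i then x i else 0)) - x))\<^sup>2
      = (\<Sum>\<^sub>\<infinity>i\<in>A. (nrm (x i))\<^sup>2) - (\<Sum>i\<in>F. (nrm (x i))\<^sup>2)" if F: "finite F" "F \<subseteq> A" for F
  proof -
    let ?t = "\<Sum>i\<in>F. (\<lambda>j. if j = i then x i else 0)"
    have t: "?t - x \<in> D.C" using F by (intro D.diff_c D.sum_c x s) blast
    have "(D.nrm (?t - x))\<^sup>2 = (\<Sum>\<^sub>\<infinity>i\<in>A. (nrm ((?t - x) i))\<^sup>2)" by (rule ds_nrm_sq[OF t])
    also have "\<dots> = (\<Sum>\<^sub>\<infinity>i\<in>A - F. (nrm (x i))\<^sup>2)"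
      unfolding sum_eq[OF F(1)] by (rule infsum_cong_neutral) (use F xs in auto)
    also have "\<dots> = (\<Sum>\<^sub>\<infinity>i\<in>A. (nrm (x i))\<^sup>2) - (\<Sum>\<^sub>\<infinity>i\<in>F. (nrm (x i))\<^sup>2)"
      by (rule infsum_Diff) (use xs F in auto)
    finally show ?thesis using F by simp
  qed
  have ev: "eventually (\<lambda>F. finite F \<and> F \<subseteq> A) (finite_subsets_at_top A)"
    by (auto simp: eventually_finite_subsets_at_top intro!: exI[of _ "{}"])
  have "(sum (\<lambda>i. (nrm (x i))\<^sup>2) \<longlongrightarrow> (\<Sum>\<^sub>\<infinity>i\<in>A. (nrm (x i))\<^sup>2)) (finite_subsets_at_top A)"
    using has_sum_infsum[OF xs(2)] by (simp add: has_sum_def)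
  from tendsto_diff[OF tendsto_const[of "\<Sum>\<^sub>\<infinity>i\<in>A. (nrm (x i))\<^sup>2"] this]
  have "((\<lambda>F. sqrt ((\<Sum>\<^sub>\<infinity>i\<in>A. (nrm (x i))\<^sup>2) - (\<Sum>i\<in>F. (nrm (x i))\<^sup>2))) \<longlongrightarrow> sqrt 0) (finite_subsets_at_top A)"
    by (intro tendsto_real_sqrt) simp
  then have "((\<lambda>F. D.nrm ((\<Sum>i\<in>F. (\<lambda>j. if j = i then x i else 0)) - x)) \<longlongrightarrow> 0) (finite_subsets_at_top A)"
    unfolding real_sqrt_zero
  proof (rule tendsto_cong[THEN iffD1, rotated])
    show "\<forall>\<^sub>F F in finite_subsets_at_top A. sqrt ((\<Sum>\<^sub>\<infinity>i\<in>A. (nrm (x i))\<^sup>2) - (\<Sum>i\<in>F. (nrm (x i))\<^sup>2))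
       = D.nrm ((\<Sum>i\<in>F. (\<lambda>j. if j = i then x i else 0)) - x)"
      using ev
    proof eventually_elim
      case (elim F)
      then have "(\<Sum>i\<in>F. (\<lambda>j. if j = i then x i else 0)) - x \<in> D.C"
        by (intro D.diff_c D.sum_c x s) blast
      then show ?case
        using elim by (intro real_sqrt_unique nrm_eq D.nrm_nonneg) auto
    qed
  qed
  with x show ?thesis by (intro D.has_hsum_iff[THEN iffD2] conjI s)
qed

end

lemma (in hilbert_space) ds_hilbert: "hilbert_space (direct_sum A H)"
proof -
  interpret D: pre_hilbert "direct_sum A H" by (rule ds_pre_hilbert)
  show ?thesis
  proof (rule D.hilbert_spaceI)
    fix s :: "nat \<Rightarrow> _" assume s: "\<And>n. s n \<in> D.C"
      and cau: "\<And>e. e > 0 \<Longrightarrow> \<exists>N. \<forall>m\<ge>N. \<forall>n\<ge>N. D.nrm (s m - s n) < e"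
    have sC: "s n i \<in> C" if "i \<in> A" for n i using s[of n] that by (simp add: direct_sum_simps)
    have sd: "s m - s n \<in> D.C" for m n using s by simp
    have "\<exists>l\<in>C. (\<lambda>n. nrm (s n i - l)) \<longlonglongrightarrow> 0" if i: "i \<in> A" for i
    proof (rule complete_seq)
      fix e :: real assume "e > 0"
      then obtain N where N: "\<forall>m\<ge>N. \<forall>n\<ge>N. D.nrm (s m - s n) < e" using cau by blast
      have "nrm (s m i - s n i) < e" if "m \<ge> N" "n \<ge> N" for m n
        using ds_coord_le[OF sd i, of m n] N that by (auto intro: le_less_trans)
      then show "\<exists>N. \<forall>m\<ge>N. \<forall>n\<ge>N. nrm (s m i - s n i) < e" by blast
    qed (use sC i in auto)
    then obtain l0 where l0: "\<And>i. i \<in> A \<Longrightarrow> l0 i \<in> C" "\<And>i. i \<in> A \<Longrightarrow> (\<lambda>n. nrm (s n i - l0 i)) \<longlonglongrightarrow> 0"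
      by metis
    define l where "l = (\<lambda>i. if i \<in> A then l0 i else 0)"
    \<comment> \<open>The Cauchy bound is passed to the limit on finite index sets, where
      coordinatewise convergence suffices, and \<open>ds_memI\<close> reassembles it. The limit
      makes the inequality nonstrict.\<close>
    have close: "s m - l \<in> D.C \<and> D.nrm (s m - l) \<le> e"
      if e: "e > 0" and N: "\<forall>m\<ge>N. \<forall>n\<ge>N. D.nrm (s m - s n) < e" and m: "m \<ge> N" for e N m
    proof -
      have fin: "(\<Sum>i\<in>F. (nrm ((s m - l) i))\<^sup>2) \<le> e\<^sup>2" if F: "finite F" "F \<subseteq> A" for F
      proof (rule LIMSEQ_le_const2)
        have "(\<lambda>n. nrm (s m i - s n i)) \<longlonglongrightarrow> nrm (s m i - l i)" if i: "i \<in> F" for i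
        proof (rule nrm_tendsto)
          have iA: "i \<in> A" using F i by blast
          have "nrm (s m i - s n i - (s m i - l i)) = nrm (s n i - l0 i)" for n
            using iA sC[OF iA] l0(1)[OF iA] nrm_minus_commute[of "s n i" "l0 i"] by (simp add: l_def)
          then show "(\<lambda>n. nrm (s m i - s n i - (s m i - l i))) \<longlonglongrightarrow> 0" using l0(2)[OF iA] by simp
          show "s m i - l i \<in> C" using iA sC[OF iA] l0(1)[OF iA] by (simp add: l_def)
          show "\<forall>\<^sub>F n in sequentially. s m i - s n i \<in> C" using sC[OF iA] by simp
        qed
        then show "(\<lambda>n. \<Sum>i\<in>F. (nrm (s m i - s n i))\<^sup>2) \<longlonglongrightarrow> (\<Sum>i\<in>F. (nrm ((s m - l) i))\<^sup>2)"
          by (auto intro!: tendsto_sum tendsto_power)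
        have "(\<Sum>i\<in>F. (nrm (s m i - s n i))\<^sup>2) \<le> e\<^sup>2" if n: "n \<ge> N" for n
        proof -
          have "(\<Sum>i\<in>F. (nrm ((s m - s n) i))\<^sup>2) \<le> (D.nrm (s m - s n))\<^sup>2" by (rule ds_finite_le[OF sd F])
          also have "\<dots> \<le> e\<^sup>2" using N m n D.nrm_nonneg[OF sd, of m n] by (intro power_mono) (auto intro: less_imp_le)
          finally show ?thesis by simp
        qed
        then show "\<exists>N. \<forall>n\<ge>N. (\<Sum>i\<in>F. (nrm (s m i - s n i))\<^sup>2) \<le> e\<^sup>2" by blast
      qed
      have 1: "(s m - l) i \<in> C" if "i \<in> A" for i using sC[OF that] l0(1)[OF that] that by (simp add: l_def)
      have 2: "(s m - l) i = 0" if "i \<notin> A" for i using s[of m] that by (simp add: l_def direct_sum_simps)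
      show ?thesis using ds_memI[of A "s m - l" e, OF 1 2 fin] e by simp
    qed
    obtain N0 where N0: "\<forall>m\<ge>N0. \<forall>n\<ge>N0. D.nrm (s m - s n) < 1" using cau[of 1] by auto
    \<comment> \<open>The limit l carries no bound of its own; it lies in the direct sum as the
      difference of \<open>s N0\<close> and a vector already known to be there.\<close>
    have "s N0 - l \<in> D.C" using close[OF _ N0] by simp
    then have l: "l \<in> D.C" using D.diff_c[OF s[of N0], of "s N0 - l"] by simp
    have "(\<lambda>n. D.nrm (s n - l)) \<longlonglongrightarrow> 0"
    proof (rule LIMSEQ_I)
      fix r :: real assume r: "r > 0"
      then obtain N where N: "\<forall>m\<ge>N. \<forall>n\<ge>N. D.nrm (s m - s n) < r/2" using cau[of "r/2"] by auto
      have "norm (D.nrm (s n - l) - 0) < r" if "n \<ge> N" for n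
        using close[OF _ N that] r D.nrm_nonneg[of "s n - l"] by auto
      then show "\<exists>no. \<forall>n\<ge>no. norm (D.nrm (s n - l) - 0) < r" by blast
    qed
    then show "\<exists>l\<in>D.C. (\<lambda>n. D.nrm (s n - l)) \<longlonglongrightarrow> 0" using l by blast
  qed
qed

lemma bounded_op_coord:
  assumes H: "pre_hilbert H" and V: "bounded_op K (direct_sum A H) V" and i: "i \<in> A"
  shows "bounded_op K H (\<lambda>f. V f i)"
proof -
  obtain B where B: "\<And>x. x \<in> carrier K \<Longrightarrow> hnorm (direct_sum A H) (V x) \<le> B * hnorm K x"
    using V unfolding bounded_op_def by blast
  have "hnorm H (V x i) \<le> B * hnorm K x" if "x \<in> carrier K" for x
    using pre_hilbert.ds_coord_le[OF H bounded_opD(1)[OF V that] i] B[OF that] by linarith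
  moreover have "V x i \<in> carrier H" if "x \<in> carrier K" for x
    using bounded_opD(1)[OF V that] i by (simp add: direct_sum_simps)
  ultimately show ?thesis
    using bounded_opD(2,3)[OF V] unfolding bounded_op_def
    by (auto simp: scaleC_fun_def)
qed

text \<open>Source of the convergence of the strong sums below: the series for the row operators,
  for \<open>Z_op\<close>, for the b-sum and for purity are all adjoints of columns, expanded along
  coordinates.\<close>

lemma adj_direct_sum_has_hsum:
  assumes K: "hilbert_space K" and H: "pre_hilbert H" and V: "bounded_op K (direct_sum A H) V"
    and x: "x \<in> carrier (direct_sum A H)"
  shows "has_hsum K (\<lambda>i. adj K H (\<lambda>f. V f i) (x i)) A (adj K (direct_sum A H) V x)"
proof -
  interpret H: pre_hilbert H by fact
  interpret K: hilbert_space K by fact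
  interpret D: pre_hilbert "direct_sum A H" by (rule H.ds_pre_hilbert)
  have xi: "\<And>i. i \<in> A \<Longrightarrow> x i \<in> H.C" using x by (simp add: direct_sum_simps)
  have s: "(\<lambda>j. if j = i then x i else 0) \<in> D.C" if "i \<in> A" for i
    using H.ds_single(1)[OF that xi[OF that]] .
  have eq: "adj K (direct_sum A H) V (\<lambda>j. if j = i then x i else 0) = adj K H (\<lambda>f. V f i) (x i)"
    if i: "i \<in> A" for i
  proof (rule adj_eqI[OF K D.pre_hilbert_axioms V s[OF i]])
    note c = adj[OF K H bounded_op_coord[OF H V i] xi[OF i]]
    show "adj K H (\<lambda>f. V f i) (x i) \<in> K.C" by (rule c)
    fix h assume h: "h \<in> K.C"
    show "cip (direct_sum A H) (V h) (\<lambda>j. if j = i then x i else 0) = cip K h (adj K H (\<lambda>f. V f i) (x i))"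
      using H.ds_single(2)[OF i xi[OF i] bounded_opD(1)[OF V h]] c(2)[OF h] by simp
  qed
  have "has_hsum K (\<lambda>i. adj K (direct_sum A H) V (\<lambda>j. if j = i then x i else 0)) A (adj K (direct_sum A H) V x)"
    by (rule bounded_op_has_hsum[OF D.pre_hilbert_axioms K.pre_hilbert_axioms
          bounded_op_adj[OF K D.pre_hilbert_axioms V] s H.ds_has_hsum_single[OF x]])
  then show ?thesis by (subst (asm) has_hsum_cong[OF eq])
qed

lemma (in pre_hilbert) ds_weights:
  assumes p: "p \<in> C" and w: "(\<lambda>i. (cmod (w i))\<^sup>2) summable_on A"
  shows "(\<lambda>i. if i \<in> A then w i *\<^sub>C p else 0) \<in> carrier (direct_sum A H)"
proof -
  have "(\<lambda>i. (cmod (w i))\<^sup>2 * (nrm p)\<^sup>2) summable_on A" using w by (rule summable_on_cmult_left)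
  then have "(\<lambda>i. (nrm (if i \<in> A then w i *\<^sub>C p else 0))\<^sup>2) summable_on A"
    by (rule summable_on_cong[THEN iffD1, rotated]) (use p in \<open>simp add: nrm_scale power_mult_distrib\<close>)
  then show ?thesis using p by (simp add: direct_sum_simps)
qed

lemma (in pre_hilbert) ds_weights_cip:
  assumes p: "p \<in> C" "q \<in> C" and s: "((\<lambda>i. w i * cnj (v i)) has_sum s) A"
  shows "cip (direct_sum A H) (\<lambda>i. if i \<in> A then w i *\<^sub>C p else 0) (\<lambda>i. if i \<in> A then v i *\<^sub>C q else 0)
    = s * ip p q"
proof -
  have "cip (direct_sum A H) (\<lambda>i. if i \<in> A then w i *\<^sub>C p else 0) (\<lambda>i. if i \<in> A then v i *\<^sub>C q else 0)
    = (\<Sum>\<^sub>\<infinity>i\<in>A. w i * cnj (v i) * ip p q)"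
    unfolding direct_sum_simps(2)
    by (rule infsum_cong) (use p in \<open>simp add: cip_scale_left cip_scale_right\<close>)
  also have "\<dots> = s * ip p q" using has_sum_cmult_left[OF s, of "ip p q"] by (rule infsumI)
  finally show ?thesis .
qed

section \<open>Extension by Gram matrices\<close>

text \<open>The graph of U is described by inner products instead of linear combinations: a pair (x,
  y) is \<open>good\<close> if y pairs with the target as U x has to. Such pairs form a closed
  linear relation whose domain contains every \<open>u i\<close>, hence is the whole carrier.
  Isometries are the case where T is the identity.\<close>

lemma gram_extension:
  assumes H: "hilbert_space H" and K: "hilbert_space K" and T: "bounded_op H H T"
    and u: "\<And>i. i \<in> I \<Longrightarrow> u i \<in> carrier H" and v: "\<And>i. i \<in> I \<Longrightarrow> v i \<in> carrier K"
    and total: "\<And>x. x \<in> carrier H \<Longrightarrow> (\<And>i. i \<in> I \<Longrightarrow> cip H x (u i) = 0) \<Longrightarrow> x = 0"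
    and gram: "\<And>i j. i \<in> I \<Longrightarrow> j \<in> I \<Longrightarrow> cip K (v i) (v j) = cip H (T (u i)) (u j)"
  shows "\<exists>U. bounded_op H K U \<and> (\<forall>i\<in>I. U (u i) = v i) \<and>
    (\<forall>x\<in>carrier H. \<forall>y\<in>carrier H. cip K (U x) (U y) = cip H (T x) y)"
proof -
  interpret H: hilbert_space H by fact
  interpret K: hilbert_space K by fact
  note T' = bounded_opD[OF T]
  obtain B where B: "B \<ge> 0" "\<And>x. x \<in> H.C \<Longrightarrow> H.nrm (T x) \<le> B * H.nrm x"
    using bounded_op_bound[OF T H.pre_hilbert_axioms] by blast
  \<comment> \<open>These are the inner products with all \<open>v j\<close> that an image of x must
    have. They do not determine y if the \<open>v j\<close> fail to be total in K.\<close>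
  define R where "R = (\<lambda>x y. x \<in> H.C \<and> y \<in> K.C \<and> (\<forall>j\<in>I. cip K y (v j) = cip H (T x) (u j)))"
  \<comment> \<open>This removes the ambiguity: a y' orthogonal to all \<open>v j\<close> is
    R-related to 0, so a good y is orthogonal to it and lies in the closed span of the
    \<open>v j\<close>.\<close>
  define good where "good = (\<lambda>x y. R x y \<and> (\<forall>x' y'. R x' y' \<longrightarrow> cip K y' y = cip H (T x') x))"
  have goodC: "x \<in> H.C" "y \<in> K.C" if "good x y" for x y using that by (auto simp: good_def R_def)
  have good_cip: "cip K y' y = cip H (T x') x" if "good x y" "good x' y'" for x y x' y'
    using that by (auto simp: good_def)
  have good_u: "good (u i) (v i)" if i: "i \<in> I" for i
    using i u v gram by (auto simp: good_def R_def)
  have good_R: "cip K y' y = cip H (T x') x" if "good x y" "R x' y'" for x y x' y'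
    using that by (auto simp: good_def)
  have RC: "x \<in> H.C" "y \<in> K.C" if "R x y" for x y using that by (auto simp: R_def)
  have good_add: "good (x + x') (y + y')" if g: "good x y" "good x' y'" for x y x' y'
    unfolding good_def
  proof (intro conjI allI impI)
    show "R (x + x') (y + y')"
      using g T' u v by (simp add: good_def R_def H.cip_add_left K.cip_add_left)
    show "cip K y'' (y + y') = cip H (T x'') (x + x')" if r: "R x'' y''" for x'' y''
      using good_R[OF g(1) r] good_R[OF g(2) r] goodC[OF g(1)] goodC[OF g(2)] RC[OF r] T'
      by (simp add: H.cip_add_right K.cip_add_right)
  qed
  have good_scale: "good (c *\<^sub>C x) (c *\<^sub>C y)" if g: "good x y" for x y c
    unfolding good_def
  proof (intro conjI allI impI)
    show "R (c *\<^sub>C x) (c *\<^sub>C y)"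
      using g T' u v by (simp add: good_def R_def H.cip_scale_left K.cip_scale_left)
    show "cip K y'' (c *\<^sub>C y) = cip H (T x'') (c *\<^sub>C x)" if r: "R x'' y''" for x'' y''
      using good_R[OF g r] goodC[OF g] RC[OF r] T'
      by (simp add: H.cip_scale_right K.cip_scale_right)
  qed
  have good_diff: "good (x - x') (y - y')" if "good x y" "good x' y'" for x y x' y'
    using good_add[OF that(1) good_scale[OF that(2), of "-1"]] by simp
  \<comment> \<open>A good pair paired with itself computes the norm of y. From this come uniqueness
    of y, the Cauchy property of images and the bound sqrt B of the extension.\<close>
  have good_nrm: "(K.nrm y)\<^sup>2 \<le> B * (H.nrm x)\<^sup>2" if g: "good x y" for x y
  proof -
    note xy = goodC[OF g]
    have "(K.nrm y)\<^sup>2 = Re (cip H (T x) x)" unfolding K.nrm_sq[OF xy(2)] good_cip[OF g g] ..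
    also have "\<dots> \<le> H.nrm (T x) * H.nrm x" using xy T' by (intro H.Re_cip_le) auto
    also have "\<dots> \<le> B * H.nrm x * H.nrm x" using xy B by (intro mult_right_mono) auto
    finally show ?thesis by (simp add: power2_eq_square)
  qed
  have good_le: "K.nrm y \<le> sqrt B * H.nrm x" if g: "good x y" for x y
  proof (rule power2_le_imp_le)
    show "(K.nrm y)\<^sup>2 \<le> (sqrt B * H.nrm x)\<^sup>2" using good_nrm[OF g] B(1) by (simp add: power_mult_distrib)
    show "0 \<le> sqrt B * H.nrm x" using goodC[OF g] B(1) by simp
  qed
  have good_unique: "y = y'" if "good x y" "good x y'" for x y y'
  proof -
    have "K.nrm (y - y') \<le> 0" using good_le[OF good_diff[OF that]] by simp
    moreover have yC: "y - y' \<in> K.C" by (rule K.diff_c[OF goodC(2)[OF that(1)] goodC(2)[OF that(2)]])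
    ultimately have "K.nrm (y - y') = 0" using K.nrm_nonneg[OF yC] by linarith
    then show ?thesis using yC by simp
  qed
  define S where "S = {x. \<exists>y. good x y}"
  have "closed_subspace H S"
    unfolding closed_subspace_iff[OF H.pre_hilbert_axioms]
  proof (intro conjI allI impI)
    show "S \<subseteq> H.C" using goodC by (auto simp: S_def)
    have "T 0 = 0" by (rule bounded_op_0[OF T H.pre_hilbert_axioms])
    then have "good 0 0" using T' u v unfolding good_def R_def by simp
    then show "csubspace S"
      unfolding S_def by (intro complex_vector.subspaceI; simp; metis good_add good_scale)
    fix s :: "nat \<Rightarrow> _" and l
    assume *: "(\<forall>n. s n \<in> S) \<and> l \<in> H.C \<and> (\<lambda>n. H.nrm (s n - l)) \<longlonglongrightarrow> 0"
    then have "\<forall>n. \<exists>y. good (s n) y" by (simp add: S_def)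
    then obtain t where t: "\<And>n. good (s n) (t n)" by metis
    have sC: "s n \<in> H.C" and tC: "t n \<in> K.C" for n using goodC[OF t[of n]] by auto
    have "\<exists>m\<in>K.C. (\<lambda>n. K.nrm (t n - m)) \<longlonglongrightarrow> 0"
    proof (rule K.complete_seq)
      fix e :: real assume e: "e > 0"
      have "(\<lambda>n. sqrt B * H.nrm (s n - l)) \<longlonglongrightarrow> sqrt B * 0" using * by (intro tendsto_mult_left) simp
      then have "\<forall>\<^sub>F n in sequentially. sqrt B * H.nrm (s n - l) < e/2"
        by (rule order_tendstoD) (use e in simp)
      then obtain N where N: "\<And>n. n \<ge> N \<Longrightarrow> sqrt B * H.nrm (s n - l) < e/2"
        unfolding eventually_sequentially by blast
      have "K.nrm (t m - t n) < e" if mn: "m \<ge> N" "n \<ge> N" for m n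
      proof -
        have "K.nrm (t m - t n) \<le> sqrt B * H.nrm (s m - s n)" by (rule good_le[OF good_diff[OF t t]])
        also have "\<dots> \<le> sqrt B * (H.nrm (s m - l) + H.nrm (s n - l))"
          using H.nrm_triangle3[of "s m" l "s n"] H.nrm_minus_commute[of l "s n"] sC * B(1)
          by (intro mult_left_mono) auto
        also have "\<dots> < e" using N[OF mn(1)] N[OF mn(2)] by (simp add: distrib_left)
        finally show ?thesis .
      qed
      then show "\<exists>N. \<forall>m\<ge>N. \<forall>n\<ge>N. K.nrm (t m - t n) < e" by blast
    qed (rule tC)
    then obtain m where m: "m \<in> K.C" "(\<lambda>n. K.nrm (t n - m)) \<longlonglongrightarrow> 0" by blast
    have l: "l \<in> H.C" "(\<lambda>n. H.nrm (s n - l)) \<longlonglongrightarrow> 0" using * by auto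
    have Tl: "(\<lambda>n. H.nrm (T (s n) - T l)) \<longlonglongrightarrow> 0"
      by (rule bounded_op_tendsto[OF T H.pre_hilbert_axioms H.pre_hilbert_axioms _ l]) (simp add: sC)
    have "R l m"
      unfolding R_def
    proof (intro conjI ballI)
      fix j assume j: "j \<in> I"
      have "(\<lambda>n. cip K (t n) (v j)) \<longlonglongrightarrow> cip K m (v j)"
        by (rule K.cip_tendsto_left) (simp_all add: tC m v j)
      moreover have "(\<lambda>n. cip H (T (s n)) (u j)) \<longlonglongrightarrow> cip H (T l) (u j)"
        by (rule H.cip_tendsto_left) (simp_all add: sC l T' u j Tl)
      moreover have "cip K (t n) (v j) = cip H (T (s n)) (u j)" for n
        using t[of n] j by (simp add: good_def R_def)
      ultimately show "cip K m (v j) = cip H (T l) (u j)" using LIMSEQ_unique by fastforce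
    qed (use l m in auto)
    moreover have "cip K y' m = cip H (T x') l" if r: "R x' y'" for x' y'
    proof -
      have xy: "x' \<in> H.C" "y' \<in> K.C" using r by (auto simp: R_def)
      have "(\<lambda>n. cip K y' (t n)) \<longlonglongrightarrow> cip K y' m"
        by (rule K.cip_tendsto) (simp_all add: tC m xy)
      moreover have "(\<lambda>n. cip H (T x') (s n)) \<longlonglongrightarrow> cip H (T x') l"
        by (rule H.cip_tendsto) (simp_all add: sC l T' xy)
      moreover have "cip K y' (t n) = cip H (T x') (s n)" for n
        using t[of n] r by (simp add: good_def)
      ultimately show ?thesis using LIMSEQ_unique by fastforce
    qed
    ultimately have "good l m" by (simp add: good_def)
    then show "l \<in> S" by (auto simp: S_def)
  qed
  then have "S = H.C"
    by (rule H.closed_subspace_eq_if_total) (rule total, use good_u in \<open>auto simp: S_def\<close>)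
  then have ex: "\<exists>!y. good x y" if "x \<in> H.C" for x
  proof -
    have "x \<in> S" using that \<open>S = H.C\<close> by simp
    then obtain y where "good x y" by (auto simp: S_def)
    then show ?thesis using good_unique by (intro ex1I[of _ y])
  qed
  define U where "U = (\<lambda>x. THE y. good x y)"
  have U: "good x (U x)" if "x \<in> H.C" for x unfolding U_def by (rule theI'[OF ex[OF that]])
  have U_eq: "U x = y" if "good x y" for x y
    by (rule good_unique[OF U[OF goodC(1)[OF that]] that])
  show ?thesis
  proof (intro exI[of _ U] conjI ballI)
    show "bounded_op H K U"
      unfolding bounded_op_def
    proof (intro conjI ballI allI)
      show "U x \<in> K.C" if "x \<in> H.C" for x using goodC(2)[OF U[OF that]] .
      show "U (x + y) = U x + U y" if "x \<in> H.C" "y \<in> H.C" for x y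
        by (rule U_eq[OF good_add[OF U[OF that(1)] U[OF that(2)]]])
      show "U (c *\<^sub>C x) = c *\<^sub>C U x" if "x \<in> H.C" for x c
        by (rule U_eq[OF good_scale[OF U[OF that]]])
      show "\<exists>B. \<forall>x\<in>H.C. K.nrm (U x) \<le> B * H.nrm x"
        by (intro exI[of _ "sqrt B"] ballI good_le U)
    qed
    show "U (u i) = v i" if "i \<in> I" for i by (rule U_eq[OF good_u[OF that]])
    show "cip K (U x) (U y) = cip H (T x) y" if "x \<in> H.C" "y \<in> H.C" for x y
      by (rule good_cip[OF U[OF that(2)] U[OF that(1)]])
  qed
qed

lemma bounded_op_id: "bounded_op H H (\<lambda>x. x)"
  unfolding bounded_op_def by (auto intro: exI[of _ 1])

text \<open>In place of a Neumann series: the lower bound 1 - c gives injectivity and closed range,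
  and a vector x orthogonal to the range satisfies |x|^2 = Re <x, V x> \<le> c |x|^2, so it
  vanishes.\<close>

lemma bounded_op_inverse_exists:
  assumes H: "hilbert_space H" and V: "bounded_op H H V" and c: "c < 1"
    and bound: "\<And>x. x \<in> carrier H \<Longrightarrow> hnorm H (V x) \<le> c * hnorm H x"
  shows "bij_betw (\<lambda>x. x - V x) (carrier H) (carrier H)"
proof -
  interpret H: hilbert_space H by fact
  note V' = bounded_opD[OF V]
  let ?A = "\<lambda>x. x - V x"
  have VC: "V x \<in> H.C" if "x \<in> H.C" for x by (rule V'(1)[OF that])
  have A_diff: "?A (x - y) = ?A x - ?A y" if "x \<in> H.C" "y \<in> H.C" for x y
    using bounded_op_diff[OF V H.pre_hilbert_axioms that] by simp
  have lower: "(1 - c) * H.nrm x \<le> H.nrm (?A x)" if x: "x \<in> H.C" for x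
  proof -
    have "H.nrm x \<le> H.nrm (?A x) + H.nrm (V x)"
      using H.nrm_triangle[of "x - V x" "V x"] x VC[OF x] by simp
    then show ?thesis using bound[OF x] by (simp add: left_diff_distrib)
  qed
  have inj: "inj_on ?A H.C"
  proof (rule inj_onI)
    fix x y assume xy: "x \<in> H.C" "y \<in> H.C" and e: "?A x = ?A y"
    have "(1 - c) * H.nrm (x - y) \<le> 0"
      using lower[OF H.diff_c[OF xy]] A_diff[OF xy] e by simp
    then have "H.nrm (x - y) \<le> 0" using c by (simp add: mult_le_0_iff)
    then have "H.nrm (x - y) = 0" using H.nrm_nonneg[OF H.diff_c[OF xy]] by linarith
    then show "x = y" using xy by simp
  qed
  have sub: "?A ` H.C \<subseteq> H.C" using VC by auto
  have "closed_subspace H (?A ` H.C)"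
    unfolding closed_subspace_iff[OF H.pre_hilbert_axioms]
  proof (intro conjI allI impI)
    show "csubspace (?A ` H.C)"
    proof (rule complex_vector.subspaceI)
      show "0 \<in> ?A ` H.C" using bounded_op_0[OF V H.pre_hilbert_axioms] by (intro image_eqI[of _ _ 0]) auto
      fix x y assume "x \<in> ?A ` H.C" "y \<in> ?A ` H.C"
      then obtain x' y' where "x' \<in> H.C" "x = ?A x'" "y' \<in> H.C" "y = ?A y'" by blast
      then show "x + y \<in> ?A ` H.C" using V'(2)[of x' y'] by (intro image_eqI[of _ _ "x' + y'"]) auto
    next
      fix d x assume "x \<in> ?A ` H.C"
      then obtain x' where "x' \<in> H.C" "x = ?A x'" by blast
      then show "d *\<^sub>C x \<in> ?A ` H.C" using V'(3)[of x' d]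
        by (intro image_eqI[of _ _ "d *\<^sub>C x'"]) (auto simp: complex_vector.scale_right_diff_distrib)
    qed
    show "?A ` H.C \<subseteq> H.C" by (rule sub)
    fix s :: "nat \<Rightarrow> _" and l
    assume *: "(\<forall>n. s n \<in> ?A ` H.C) \<and> l \<in> H.C \<and> (\<lambda>n. H.nrm (s n - l)) \<longlonglongrightarrow> 0"
    then have "\<forall>n. \<exists>t. t \<in> H.C \<and> s n = ?A t" by blast
    then obtain t where t: "\<And>n. t n \<in> H.C" "\<And>n. s n = ?A (t n)" by metis
    have sC: "s n \<in> H.C" for n using t VC by simp
    have "\<exists>m\<in>H.C. (\<lambda>n. H.nrm (t n - m)) \<longlonglongrightarrow> 0"
    proof (rule H.complete_seq)
      fix e :: real assume e: "e > 0"
      from * have "(\<lambda>n. H.nrm (s n - l)) \<longlonglongrightarrow> 0" by blast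
      then have "\<forall>\<^sub>F n in sequentially. H.nrm (s n - l) < e * (1 - c) / 2"
        by (rule order_tendstoD) (use e c in simp)
      then obtain N where N: "\<And>n. n \<ge> N \<Longrightarrow> H.nrm (s n - l) < e * (1 - c) / 2"
        unfolding eventually_sequentially by blast
      have "H.nrm (t m - t n) < e" if mn: "m \<ge> N" "n \<ge> N" for m n
      proof -
        have "(1 - c) * H.nrm (t m - t n) \<le> H.nrm (s m - s n)"
          using lower[OF H.diff_c[OF t(1) t(1)]] A_diff[OF t(1) t(1)] t(2) by simp
        also have "\<dots> \<le> H.nrm (s m - l) + H.nrm (s n - l)"
          using H.nrm_triangle3[of "s m" l "s n"] H.nrm_minus_commute[of l "s n"] sC * by simp
        also have "\<dots> < (1 - c) * e" using N[OF mn(1)] N[OF mn(2)] by (simp add: mult.commute)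
        finally show ?thesis using c by simp
      qed
      then show "\<exists>N. \<forall>m\<ge>N. \<forall>n\<ge>N. H.nrm (t m - t n) < e" by blast
    qed (rule t)
    then obtain m where m: "m \<in> H.C" "(\<lambda>n. H.nrm (t n - m)) \<longlonglongrightarrow> 0" by blast
    have Vm: "(\<lambda>n. H.nrm (V (t n) - V m)) \<longlonglongrightarrow> 0"
      by (rule bounded_op_tendsto[OF V H.pre_hilbert_axioms H.pre_hilbert_axioms _ m]) (simp add: t)
    have "(\<lambda>n. H.nrm (s n - ?A m)) \<longlonglongrightarrow> 0"
    proof (rule tendsto_zero_sandwich)
      show "(\<lambda>n. H.nrm (t n - m) + H.nrm (V (t n) - V m)) \<longlonglongrightarrow> 0"
        using m Vm by (intro tendsto_add_zero)
      fix n
      show "0 \<le> H.nrm (s n - ?A m)" using sC m VC by simp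
      have "s n - ?A m = (t n - m) - (V (t n) - V m)" using t(2)[of n] by simp
      also have "H.nrm \<dots> \<le> H.nrm (t n - m) + H.nrm (V (t n) - V m)"
        using t m VC by (intro H.nrm_triangle_diff) auto
      finally show "H.nrm (s n - ?A m) \<le> H.nrm (t n - m) + H.nrm (V (t n) - V m)" .
    qed
    then have "l = ?A m"
      using H.lim_unique[of sequentially s l "?A m"] sC * m VC by simp
    then show "l \<in> ?A ` H.C" using m by blast
  qed
  then have "?A ` H.C = H.C"
  proof (rule H.closed_subspace_eq_if_total)
    fix x assume x: "x \<in> H.C" and o: "\<And>s. s \<in> ?A ` H.C \<Longrightarrow> cip H x s = 0"
    have "cip H x (?A x) = 0" using o x by blast
    then have "cip H x x = cip H x (V x)" using x VC by (simp add: H.cip_diff_right)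
    then have "(H.nrm x)\<^sup>2 = Re (cip H x (V x))" using H.nrm_sq[OF x] by simp
    also have "\<dots> \<le> H.nrm x * H.nrm (V x)" using x VC by (intro H.Re_cip_le) auto
    also have "\<dots> \<le> H.nrm x * (c * H.nrm x)" using x bound[OF x] by (intro mult_left_mono) auto
    finally have "(1 - c) * (H.nrm x)\<^sup>2 \<le> 0" by (simp add: power2_eq_square algebra_simps)
    then have "H.nrm x = 0" using c by (simp add: mult_le_0_iff)
    then show "x = 0" using x by simp
  qed
  then show ?thesis using inj by (simp add: bij_betw_def)
qed

section \<open>Positive square roots\<close>

text \<open>\<open>sqc\<close> lists the Taylor coefficients of \<open>y(x) = 1 - sqrt (1 - x)\<close>; the recursion is
  \<open>y = (x + y\<^sup>2) / 2\<close>.\<close>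

fun sqc :: "nat \<Rightarrow> real" where
  "sqc 0 = 0"
| "sqc (Suc 0) = 1/2"
| "sqc (Suc (Suc n)) = (\<Sum>i\<le>n. sqc (Suc i) * sqc (Suc n - i)) / 2"

lemma sqc_nonneg: "0 \<le> sqc n"
  by (induction n rule: sqc.induct) (auto intro!: sum_nonneg mult_nonneg_nonneg)

text \<open>Coefficients of y^2 = 2 y - x; the exception at n = 1 is the term x. The index shift
  only drops the two products that contain \<open>sqc 0 = 0\<close>.\<close>

lemma sqc_conv: "(\<Sum>i\<le>n. sqc i * sqc (n - i)) = 2 * sqc n - (if n = 1 then 1 else 0)"
proof (cases n rule: sqc.cases)
  case (3 m)
  have "(\<Sum>i\<le>Suc (Suc m). sqc i * sqc (Suc (Suc m) - i)) = (\<Sum>i\<le>Suc m. sqc (Suc i) * sqc (Suc m - i))"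
    by (subst sum.atMost_Suc_shift) simp
  also have "\<dots> = (\<Sum>i\<le>m. sqc (Suc i) * sqc (Suc m - i))" by simp
  finally show ?thesis using 3 by simp
qed auto

declare sqc.simps(2,3) [simp del]

text \<open>The partial sums satisfy 2 s_(N+1) \<le> 1 + s_N^2, so the bound 1 propagates.\<close>

lemma sqc_sum_le: "(\<Sum>n\<le>N. sqc n) \<le> 1"
proof (induction N)
  case (Suc N)
  let ?f = "\<lambda>(i, j). sqc i * sqc j"
  have "2 * (\<Sum>n\<le>Suc N. sqc n) = (\<Sum>n\<le>Suc N. (if n = 1 then 1 else 0)) + (\<Sum>n\<le>Suc N. \<Sum>i\<le>n. sqc i * sqc (n - i))"
    unfolding sqc_conv sum_subtractf sum_distrib_left[symmetric] by simp
  also have "(\<Sum>n\<le>Suc N. (if n = 1 then 1 else 0)) = (1::real)" by simp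
  also have "(\<Sum>n\<le>Suc N. \<Sum>i\<le>n. sqc i * sqc (n - i)) = sum ?f {(i, j). i + j \<le> Suc N}"
    by (rule sum.triangle_reindex_eq[symmetric])
  \<comment> \<open>Once both indices are nonzero, each is at most N, which is what lets the
    induction hypothesis apply to both factors.\<close>
  also have "\<dots> = sum ?f {(i, j). i + j \<le> Suc N \<and> i \<noteq> 0 \<and> j \<noteq> 0}"
  proof (rule sum.mono_neutral_right)
    show "finite {(i, j). i + j \<le> Suc N}"
      by (rule finite_subset[of _ "{..Suc N} \<times> {..Suc N}"]) auto
  qed (auto intro!: Nat.gr0I)
  also have "\<dots> \<le> sum ?f ({..N} \<times> {..N})"
    by (rule sum_mono2) (auto simp: sqc_nonneg)
  also have "\<dots> = (\<Sum>n\<le>N. sqc n) * (\<Sum>n\<le>N. sqc n)"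
    by (simp only: sum_product sum.cartesian_product)
  also have "\<dots> \<le> 1 * 1"
    using Suc by (intro mult_mono) (auto intro: sum_nonneg sqc_nonneg)
  finally show ?case by simp
qed simp

lemma sqc_summable: "sqc summable_on UNIV" "infsum sqc UNIV \<le> 1"
proof -
  have fin: "sum sqc F \<le> 1" if F: "finite F" for F
  proof -
    obtain N where "F \<subseteq> {..N}" using finite_nat_iff_bounded_le[THEN iffD1, OF F] by blast
    then have "sum sqc F \<le> sum sqc {..N}" by (intro sum_mono2) (auto simp: sqc_nonneg)
    then show ?thesis using sqc_sum_le[of N] by linarith
  qed
  show s: "sqc summable_on UNIV"
    by (rule nonneg_bdd_above_summable_on) (auto simp: sqc_nonneg intro!: bdd_aboveI[of _ 1] fin)
  show "infsum sqc UNIV \<le> 1" by (rule infsum_le_finite_sums[OF s]) (rule fin)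
qed

text \<open>The numerical content of Y Y = 2 Y - B: with t n = <v, B^n x> the double series is <v, Y
  (Y x)>. Absolute convergence allows summation along the diagonals m + n = N, where
  \<open>sqc_conv\<close> evaluates the inner sums.\<close>

lemma sqc_double_sum:
  fixes t :: "nat \<Rightarrow> complex"
  assumes t: "\<And>n. cmod (t n) \<le> K"
  shows "(\<Sum>\<^sub>\<infinity>n. of_real (sqc n) * (\<Sum>\<^sub>\<infinity>m. of_real (sqc m) * t (m + n))) =
    2 * (\<Sum>\<^sub>\<infinity>n. of_real (sqc n) * t n) - t 1"
proof -
  define f where "f = (\<lambda>(n, m). complex_of_real (sqc n) * (of_real (sqc m) * t (m + n)))"
  have K: "K \<ge> 0" using t[of 0] norm_ge_zero order_trans by blast
  have sq: "(\<lambda>(n, m). sqc n * (sqc m * K)) summable_on UNIV \<times> UNIV"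
  proof (rule summable_on_SigmaI)
    fix n :: nat
    have "((\<lambda>m. sqc m) has_sum infsum sqc UNIV) UNIV" using has_sum_infsum[OF sqc_summable(1)] .
    then have "((\<lambda>m. sqc m * K) has_sum (infsum sqc UNIV * K)) UNIV" by (rule has_sum_cmult_left)
    then show "((\<lambda>m. case (n, m) of (n, m) \<Rightarrow> sqc n * (sqc m * K)) has_sum (sqc n * (infsum sqc UNIV * K))) UNIV"
      using has_sum_cmult_right by fastforce
    show "(\<lambda>n. sqc n * (infsum sqc UNIV * K)) summable_on UNIV"
      by (rule summable_on_cmult_left[OF sqc_summable(1)])
  qed (auto simp: sqc_nonneg K)
  have "(\<lambda>x. norm (f x)) summable_on UNIV \<times> UNIV"
  proof (rule summable_on_comparison_test[OF sq])
    fix x :: "nat \<times> nat"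
    show "norm (f x) \<le> (case x of (n, m) \<Rightarrow> sqc n * (sqc m * K))"
      by (cases x) (auto simp: f_def norm_mult sqc_nonneg intro!: mult_left_mono t)
  qed simp
  then have fs: "f summable_on UNIV \<times> UNIV" by (rule Infinite_Sum.abs_summable_summable)
  have tn: "(\<lambda>n. of_real (sqc n) * t n) summable_on UNIV"
  proof (rule Infinite_Sum.abs_summable_summable, rule summable_on_comparison_test)
    show "(\<lambda>n. sqc n * K) summable_on UNIV" by (rule summable_on_cmult_left[OF sqc_summable(1)])
    show "norm (complex_of_real (sqc n) * t n) \<le> sqc n * K" for n
      using t[of n] by (simp add: norm_mult sqc_nonneg mult_left_mono)
  qed simp
  have "(\<Sum>\<^sub>\<infinity>n. of_real (sqc n) * (\<Sum>\<^sub>\<infinity>m. of_real (sqc m) * t (m + n))) = (\<Sum>\<^sub>\<infinity>n. \<Sum>\<^sub>\<infinity>m. f (n, m))"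
    unfolding f_def by (simp add: infsum_cmult_right')
  also have "\<dots> = infsum f (UNIV \<times> UNIV)"
    using infsum_Sigma'_banach[of "\<lambda>n m. f (n, m)" UNIV "\<lambda>_. UNIV"] fs by simp
  also have "\<dots> = infsum (\<lambda>x. f ((\<lambda>(N, i). (i, N - i)) x)) (Sigma UNIV (\<lambda>N. {..N}))"
  proof (rule infsum_reindex_bij_betw[symmetric])
    show "bij_betw (\<lambda>(N, i). (i, N - i)) (Sigma UNIV (\<lambda>N. {..N})) (UNIV \<times> (UNIV :: nat set))"
      by (rule bij_betwI[where g = "\<lambda>(n, m). (n + m, n)"]) auto
  qed
  also have "\<dots> = infsum (\<lambda>(N, i). of_real (sqc i * sqc (N - i)) * t N) (Sigma UNIV (\<lambda>N. {..N}))"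
    by (rule infsum_cong) (auto simp: f_def)
  also have "\<dots> = (\<Sum>\<^sub>\<infinity>N. \<Sum>\<^sub>\<infinity>i\<in>{..N}. of_real (sqc i * sqc (N - i)) * t N)"
  proof (rule infsum_Sigma'_banach[symmetric])
    have "(\<lambda>x. f ((\<lambda>(N, i). (i, N - i)) x)) summable_on (Sigma UNIV (\<lambda>N. {..N}))"
      by (subst summable_on_reindex_bij_betw[of _ _ "UNIV \<times> UNIV" f])
        (use fs in \<open>auto intro: bij_betwI[where g = "\<lambda>(n, m). (n + m, n)"]\<close>)
    then show "(\<lambda>(N, i). of_real (sqc i * sqc (N - i)) * t N) summable_on Sigma UNIV (\<lambda>N. {..N})"
      by (rule summable_on_cong[THEN iffD1, rotated]) (auto simp: f_def)
  qed
  also have "\<dots> = (\<Sum>\<^sub>\<infinity>N. 2 * (of_real (sqc N) * t N) - (if N = 1 then t N else 0))"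
  proof (rule infsum_cong)
    fix N :: nat
    have "(\<Sum>\<^sub>\<infinity>i\<in>{..N}. of_real (sqc i * sqc (N - i)) * t N) = of_real (\<Sum>i\<le>N. sqc i * sqc (N - i)) * t N"
      by (simp add: sum_distrib_right)
    also have "\<dots> = 2 * (of_real (sqc N) * t N) - (if N = 1 then t N else 0)"
      unfolding sqc_conv by (simp add: algebra_simps)
    finally show "(\<Sum>\<^sub>\<infinity>i\<in>{..N}. of_real (sqc i * sqc (N - i)) * t N) = 2 * (of_real (sqc N) * t N) - (if N = 1 then t N else 0)" .
  qed
  also have "\<dots> = 2 * (\<Sum>\<^sub>\<infinity>n. of_real (sqc n) * t n) - t 1"
  proof (rule infsumI)
    have "((\<lambda>N. if N = 1 then t N else 0) has_sum t 1) UNIV"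
      using has_sum_finite_neutralI[of "{1::nat}" UNIV "\<lambda>N. if N = 1 then t N else 0" "t 1"] by simp
    then have "((\<lambda>N. - (if N = 1 then t N else 0)) has_sum - t 1) UNIV"
      by (rule has_sum_uminusI)
    from has_sum_add[OF has_sum_cmult_right[OF has_sum_infsum[OF tn], of 2] this]
    show "((\<lambda>N. 2 * (of_real (sqc N) * t N) - (if N = 1 then t N else 0)) has_sum
      2 * (\<Sum>\<^sub>\<infinity>n. of_real (sqc n) * t n) - t 1) UNIV" by simp
  qed
  finally show ?thesis .
qed

definition contraction_sa :: "('a::complex_vector) hilbert \<Rightarrow> ('a \<Rightarrow> 'a) \<Rightarrow> bool"
  where "contraction_sa H B \<longleftrightarrow> contraction_op H H B \<and>
    (\<forall>x\<in>carrier H. \<forall>y\<in>carrier H. cip H (B x) y = cip H x (B y))"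

text \<open>The operator \<open>I - sqrt (I - B)\<close>, given weakly by its power series in \<open>B\<close>, so that only series of
  numbers have to be summed.\<close>

definition sq_series :: "('a::complex_vector) hilbert \<Rightarrow> ('a \<Rightarrow> 'a) \<Rightarrow> 'a \<Rightarrow> 'a"
  where "sq_series H B x = (SOME y. y \<in> carrier H \<and>
    (\<forall>v\<in>carrier H. (\<Sum>\<^sub>\<infinity>n. of_real (sqc n) * cip H v ((B ^^ n) x)) = cip H v y))"

context hilbert_space
begin

context
  fixes B assumes B: "contraction_sa H B"
begin

lemma sa_bounded: "bounded_op H H B"
  and sa_le: "x \<in> C \<Longrightarrow> nrm (B x) \<le> nrm x"
  and sa_cip: "x \<in> C \<Longrightarrow> y \<in> C \<Longrightarrow> ip (B x) y = ip x (B y)"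
  using B by (auto simp: contraction_sa_def contraction_op_def)

lemma sa_pow_c: "x \<in> C \<Longrightarrow> (B ^^ n) x \<in> C"
  by (induction n) (auto simp: bounded_opD(1)[OF sa_bounded])

lemma sa_pow_le: "x \<in> C \<Longrightarrow> nrm ((B ^^ n) x) \<le> nrm x"
  by (induction n) (auto intro: order_trans[OF sa_le[OF sa_pow_c]])

lemma sa_pow_cip: "x \<in> C \<Longrightarrow> y \<in> C \<Longrightarrow> ip ((B ^^ n) x) y = ip x ((B ^^ n) y)"
proof (induction n arbitrary: y)
  case (Suc n)
  then have "ip ((B ^^ Suc n) x) y = ip ((B ^^ n) x) (B y)" using sa_cip[OF sa_pow_c[OF Suc(2)] Suc(3)] by simp
  also have "\<dots> = ip x ((B ^^ n) (B y))" using Suc bounded_opD(1)[OF sa_bounded] by simp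
  finally show ?case by (simp add: funpow_swap1)
qed simp

lemma sa_term_le: "v \<in> C \<Longrightarrow> x \<in> C \<Longrightarrow> cmod (ip v ((B ^^ n) x)) \<le> nrm v * nrm x"
  by (rule order_trans[OF cauchy_schwarz]) (auto simp: sa_pow_c intro!: mult_left_mono sa_pow_le)

lemma sa_summable:
  assumes "v \<in> C" "x \<in> C"
  shows "(\<lambda>n. of_real (sqc n) * ip v ((B ^^ n) x)) summable_on UNIV"
    "cmod (\<Sum>\<^sub>\<infinity>n. of_real (sqc n) * ip v ((B ^^ n) x)) \<le> nrm x * nrm v"
proof -
  have s: "(\<lambda>n. sqc n * (nrm v * nrm x)) summable_on UNIV"
    by (rule summable_on_cmult_left[OF sqc_summable(1)])
  have le: "norm (of_real (sqc n) * ip v ((B ^^ n) x)) \<le> sqc n * (nrm v * nrm x)" for n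
    using sa_term_le[OF assms] by (simp add: norm_mult sqc_nonneg mult_left_mono)
  have a: "(\<lambda>n. norm (of_real (sqc n) * ip v ((B ^^ n) x))) summable_on UNIV"
    by (rule summable_on_comparison_test[OF s]) (use le in auto)
  then show "(\<lambda>n. of_real (sqc n) * ip v ((B ^^ n) x)) summable_on UNIV"
    by (rule Infinite_Sum.abs_summable_summable)
  have "cmod (\<Sum>\<^sub>\<infinity>n. of_real (sqc n) * ip v ((B ^^ n) x)) \<le> (\<Sum>\<^sub>\<infinity>n. norm (of_real (sqc n) * ip v ((B ^^ n) x)))"
    using a by (rule norm_infsum_bound)
  also have "\<dots> \<le> (\<Sum>\<^sub>\<infinity>n. sqc n * (nrm v * nrm x))" using a s le by (rule infsum_mono)
  also have "\<dots> = infsum sqc UNIV * (nrm v * nrm x)" using sqc_summable(1) by (intro infsum_cmult_left) simp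
  also have "\<dots> \<le> 1 * (nrm v * nrm x)" using sqc_summable(2) assms by (intro mult_right_mono) auto
  finally show "cmod (\<Sum>\<^sub>\<infinity>n. of_real (sqc n) * ip v ((B ^^ n) x)) \<le> nrm x * nrm v" by (simp add: mult.commute)
qed

lemma sq_series:
  assumes x: "x \<in> C"
  shows "sq_series H B x \<in> C"
    "\<And>v. v \<in> C \<Longrightarrow> ip v (sq_series H B x) = (\<Sum>\<^sub>\<infinity>n. of_real (sqc n) * ip v ((B ^^ n) x))"
proof -
  have "\<exists>y\<in>C. \<forall>v\<in>C. (\<Sum>\<^sub>\<infinity>n. of_real (sqc n) * ip v ((B ^^ n) x)) = ip v y"
  proof (rule riesz[where B = "nrm x"])
    fix v w assume vw: "v \<in> C" "w \<in> C"
    show "(\<Sum>\<^sub>\<infinity>n. of_real (sqc n) * ip (v + w) ((B ^^ n) x)) =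
      (\<Sum>\<^sub>\<infinity>n. of_real (sqc n) * ip v ((B ^^ n) x)) + (\<Sum>\<^sub>\<infinity>n. of_real (sqc n) * ip w ((B ^^ n) x))"
      using vw x sa_pow_c[OF x] infsum_add[OF sa_summable(1)[OF vw(1) x] sa_summable(1)[OF vw(2) x]]
      by (simp add: cip_add_left distrib_left)
  next
    fix c v assume v: "v \<in> C"
    have "(\<Sum>\<^sub>\<infinity>n. of_real (sqc n) * ip (c *\<^sub>C v) ((B ^^ n) x)) = (\<Sum>\<^sub>\<infinity>n. c * (of_real (sqc n) * ip v ((B ^^ n) x)))"
      using v sa_pow_c[OF x] by (simp add: cip_scale_left mult.left_commute)
    also have "\<dots> = c * (\<Sum>\<^sub>\<infinity>n. of_real (sqc n) * ip v ((B ^^ n) x))"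
      by (rule infsum_cmult_right')
    finally show "(\<Sum>\<^sub>\<infinity>n. of_real (sqc n) * ip (c *\<^sub>C v) ((B ^^ n) x)) = c * (\<Sum>\<^sub>\<infinity>n. of_real (sqc n) * ip v ((B ^^ n) x))" .
  qed (rule sa_summable(2)[OF _ x])
  then have "\<exists>y. y \<in> C \<and> (\<forall>v\<in>C. (\<Sum>\<^sub>\<infinity>n. of_real (sqc n) * ip v ((B ^^ n) x)) = ip v y)" by blast
  from someI_ex[OF this] show "sq_series H B x \<in> C"
    "\<And>v. v \<in> C \<Longrightarrow> ip v (sq_series H B x) = (\<Sum>\<^sub>\<infinity>n. of_real (sqc n) * ip v ((B ^^ n) x))"
    unfolding sq_series_def by auto
qed

lemma sq_series_sa:
  assumes "x \<in> C" "y \<in> C"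
  shows "ip (sq_series H B x) y = ip x (sq_series H B y)"
proof -
  have "ip (sq_series H B x) y = cnj (\<Sum>\<^sub>\<infinity>n. of_real (sqc n) * ip y ((B ^^ n) x))"
    using sq_series[OF assms(1)] assms cip_swap[of "sq_series H B x" y] by simp
  also have "\<dots> = (\<Sum>\<^sub>\<infinity>n. of_real (sqc n) * ip x ((B ^^ n) y))"
    unfolding infsum_cnj[symmetric]
    by (rule infsum_cong)
      (simp add: assms sa_pow_c cip_swap[OF assms(2) sa_pow_c[OF assms(1)]] sa_pow_cip)
  finally show ?thesis using sq_series(2)[OF assms(2,1)] by simp
qed

text \<open>Linearity follows from self-adjointness: moved across the inner product, the operator
  acts on the test vector and leaves the argument free.\<close>

lemma bounded_sq_series: "bounded_op H H (sq_series H B)" "x \<in> C \<Longrightarrow> nrm (sq_series H B x) \<le> nrm x"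
proof -
  show le: "nrm (sq_series H B x) \<le> nrm x" if x: "x \<in> C" for x
    using sq_series[OF x] sa_summable(2)[OF sq_series(1)[OF x] x] x
    by (intro nrm_le_if_cip_le) auto
  show "bounded_op H H (sq_series H B)"
    unfolding bounded_op_def
  proof (intro conjI ballI allI)
    fix x assume x: "x \<in> C"
    show "sq_series H B x \<in> C" by (rule sq_series[OF x])
    show "sq_series H B (c *\<^sub>C x) = c *\<^sub>C sq_series H B x" for c
    proof (rule eq_if_cip_eq)
      fix u assume u: "u \<in> C"
      show "ip (sq_series H B (c *\<^sub>C x)) u = ip (c *\<^sub>C sq_series H B x) u"
        using x u sq_series(1) by (simp add: sq_series_sa cip_scale_left)
    qed (use x sq_series(1) in auto)
    fix y assume y: "y \<in> C"
    show "sq_series H B (x + y) = sq_series H B x + sq_series H B y"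
    proof (rule eq_if_cip_eq)
      fix u assume u: "u \<in> C"
      show "ip (sq_series H B (x + y)) u = ip (sq_series H B x + sq_series H B y) u"
        using x y u sq_series(1) by (simp add: sq_series_sa cip_add_left)
    qed (use x y sq_series(1) in auto)
  next
    show "\<exists>B'. \<forall>x\<in>C. nrm (sq_series H B x) \<le> B' * nrm x" using le by (intro exI[of _ 1]) auto
  qed
qed

lemma sq_series_square:
  assumes x: "x \<in> C"
  shows "sq_series H B (sq_series H B x) = 2 *\<^sub>C sq_series H B x - B x"
proof (rule eq_if_cip_eq')
  note S = sq_series
  have BC: "B x \<in> C" using bounded_opD(1)[OF sa_bounded x] .
  show "sq_series H B (sq_series H B x) \<in> C" "2 *\<^sub>C sq_series H B x - B x \<in> C"
    using x S(1) BC by auto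
  fix v assume v: "v \<in> C"
  have "ip v (sq_series H B (sq_series H B x)) = (\<Sum>\<^sub>\<infinity>n. of_real (sqc n) * ip v ((B ^^ n) (sq_series H B x)))"
    using S x v by simp
  also have "\<dots> = (\<Sum>\<^sub>\<infinity>n. of_real (sqc n) * (\<Sum>\<^sub>\<infinity>m. of_real (sqc m) * ip v ((B ^^ (m + n)) x)))"
  proof (rule infsum_cong)
    fix n :: nat
    have "ip v ((B ^^ n) (sq_series H B x)) = ip ((B ^^ n) v) (sq_series H B x)"
      using v S(1)[OF x] by (simp add: sa_pow_cip)
    also have "\<dots> = (\<Sum>\<^sub>\<infinity>m. of_real (sqc m) * ip ((B ^^ n) v) ((B ^^ m) x))"
      using S(2)[OF x] sa_pow_c[OF v] by simp
    also have "\<dots> = (\<Sum>\<^sub>\<infinity>m. of_real (sqc m) * ip v ((B ^^ (m + n)) x))"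
      using v x by (simp add: sa_pow_cip sa_pow_c add.commute[of _ n] funpow_add)
    finally show "of_real (sqc n) * ip v ((B ^^ n) (sq_series H B x)) =
       of_real (sqc n) * (\<Sum>\<^sub>\<infinity>m. of_real (sqc m) * ip v ((B ^^ (m + n)) x))" by simp
  qed
  also have "\<dots> = 2 * (\<Sum>\<^sub>\<infinity>n. of_real (sqc n) * ip v ((B ^^ n) x)) - ip v ((B ^^ 1) x)"
    by (rule sqc_double_sum[where K = "nrm v * nrm x"]) (rule sa_term_le[OF v x])
  also have "\<dots> = ip v (2 *\<^sub>C sq_series H B x - B x)"
    using v BC S[OF x] by (simp add: cip_diff_right cip_scale_right)
  finally show "ip v (sq_series H B (sq_series H B x)) = ip v (2 *\<^sub>C sq_series H B x - B x)" .
qed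

text \<open>With Y the series, (I - Y)^2 = I - 2 Y + Y^2 = I - B by \<open>sq_series_square\<close>.
  Positivity of I - Y holds because Y is a self-adjoint contraction.\<close>

lemma sq_root_positive: "positive_op H (\<lambda>x. x - sq_series H B x)"
  and sq_root_square: "x \<in> C \<Longrightarrow>
    (x - sq_series H B x) - sq_series H B (x - sq_series H B x) = x - B x"
proof -
  note Y = bounded_sq_series and YD = bounded_opD[OF bounded_sq_series(1)]
  show "(x - sq_series H B x) - sq_series H B (x - sq_series H B x) = x - B x" if x: "x \<in> C"
  proof -
    have "sq_series H B (x - sq_series H B x) = sq_series H B x - (2 *\<^sub>C sq_series H B x - B x)"
      using bounded_op_diff[OF Y(1) pre_hilbert_axioms x YD(1)[OF x]] sq_series_square[OF x] by simp
    moreover have "2 *\<^sub>C y = y + y" for y :: 'a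
      using scaleC_add_left[of 1 1 y] by (simp add: scaleC_one)
    ultimately show ?thesis by simp
  qed
  show "positive_op H (\<lambda>x. x - sq_series H B x)"
    unfolding positive_op_def
  proof (intro conjI ballI)
    show "bounded_op H H (\<lambda>x. x - sq_series H B x)"
      unfolding bounded_op_def
    proof (intro conjI ballI allI)
      show "\<exists>B'. \<forall>x\<in>C. nrm (x - sq_series H B x) \<le> B' * nrm x"
      proof (intro exI[of _ 2] ballI)
        fix x assume x: "x \<in> C"
        show "nrm (x - sq_series H B x) \<le> 2 * nrm x"
          using nrm_triangle_diff[OF x YD(1)[OF x]] Y(2)[OF x] by simp
      qed
    qed (auto simp: YD complex_vector.scale_right_diff_distrib)
    fix x assume x: "x \<in> C"
    have re: "ip (sq_series H B x) x = cnj (ip (sq_series H B x) x)"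
      using sq_series_sa[OF x x] cip_swap[OF x YD(1)[OF x]] by simp
    have d: "ip (x - sq_series H B x) x = of_real ((nrm x)\<^sup>2) - ip (sq_series H B x) x"
      using x YD(1)[OF x] by (simp add: cip_diff_left cip_self)
    show "Im (ip (x - sq_series H B x) x) = 0"
      using d arg_cong[OF re, of Im] by simp
    have "Re (ip (sq_series H B x) x) \<le> nrm (sq_series H B x) * nrm x"
      using x YD(1)[OF x] by (intro Re_cip_le) auto
    also have "\<dots> \<le> nrm x * nrm x" using x Y(2)[OF x] by (intro mult_right_mono) auto
    finally show "0 \<le> Re (ip (x - sq_series H B x) x)" unfolding d by (simp add: power2_eq_square)
  qed
qed

end

text \<open>Polarisation of a real quadratic form: x + y and x + i y give two identities, whose
  difference isolates one mixed term.\<close>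

lemma positive_op_sa:
  assumes A: "positive_op H A" and x: "x \<in> C" and y: "y \<in> C"
  shows "ip (A x) y = ip x (A y)"
proof -
  have Ab: "bounded_op H H A" and im: "\<And>x. x \<in> C \<Longrightarrow> Im (ip (A x) x) = 0"
    using A by (auto simp: positive_op_def)
  note A' = bounded_opD[OF Ab]
  have d: "ip (A x) x = ip x (A x)" if "x \<in> C" for x
    using cip_swap[OF that A'(1)[OF that]] im[OF that] by (simp add: complex_eq_iff)
  have 1: "ip (A x) y + ip (A y) x = ip x (A y) + ip y (A x)"
    using d[of "x + y"] d[OF x] d[OF y] x y by (simp add: A' cip_add_left cip_add_right algebra_simps)
  have 2: "- \<i> * ip (A x) y + \<i> * ip (A y) x = - \<i> * ip x (A y) + \<i> * ip y (A x)"
    using d[of "x + \<i> *\<^sub>C y"] d[OF x] d[of "\<i> *\<^sub>C y"] x y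
    by (simp add: A' cip_add_left cip_add_right cip_scale_left cip_scale_right algebra_simps)
  then have "\<i> * (ip (A y) x - ip (A x) y) = \<i> * (ip y (A x) - ip x (A y))" by (simp add: algebra_simps)
  then have 3: "ip (A y) x - ip (A x) y = ip y (A x) - ip x (A y)" by simp
  have "(ip (A x) y + ip (A y) x) - (ip (A y) x - ip (A x) y) =
      (ip x (A y) + ip y (A x)) - (ip y (A x) - ip x (A y))"
    by (simp only: 1 3)
  then show ?thesis by simp
qed

lemma positive_op_null:
  assumes A: "positive_op H A" and y: "y \<in> C" and 0: "Re (ip (A y) y) = 0"
  shows "A y = 0"
proof -
  have Ab: "bounded_op H H A" and pos: "\<And>x. x \<in> C \<Longrightarrow> 0 \<le> Re (ip (A x) x)"
    using A by (auto simp: positive_op_def)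
  note A' = bounded_opD[OF Ab]
  define z where "z = A y"
  have z: "z \<in> C" "A z \<in> C" using y A' by (auto simp: z_def)
  define q where "q = Re (ip (A z) z)"
  define a where "a = (nrm z)\<^sup>2"
  have q: "q \<ge> 0" using pos z by (simp add: q_def)
  \<comment> \<open>The perturbed quadratic form is 2 t a + t^2 q, minimal at t = - a / q. Taking q
    + 1 keeps the denominator positive when q = 0 and still gives a negative value unless a =
    0.\<close>
  define t where "t = - a / (q + 1)"
  have "0 \<le> Re (ip (A (y + of_real t *\<^sub>C z)) (y + of_real t *\<^sub>C z))" using y z by (intro pos) auto
  also have "\<dots> = 2 * t * a + t\<^sup>2 * q"
  proof -
    have "ip (A z) y = of_real a" using positive_op_sa[OF A z(1) y] z by (simp add: z_def[symmetric] cip_self a_def)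
    moreover have "ip (A y) z = of_real a" using z by (simp add: z_def[symmetric] cip_self a_def)
    ultimately show ?thesis
      using y z 0 by (simp add: A' cip_add_left cip_add_right cip_scale_left cip_scale_right q_def power2_eq_square z_def[symmetric] algebra_simps)
  qed
  finally have "0 \<le> (2 * t * a + t\<^sup>2 * q) * (q + 1)\<^sup>2" by simp
  also have "\<dots> = 2 * (t * (q + 1)) * a * (q + 1) + (t * (q + 1))\<^sup>2 * q"
    by (simp add: power2_eq_square algebra_simps)
  also have "\<dots> = - 2 * a * a * (q + 1) + a * a * q"
    using q by (simp add: t_def power2_eq_square)
  also have "\<dots> = - (a * a * (q + 2))" by (simp add: algebra_simps)
  finally have "a * a * (q + 2) \<le> 0" by simp
  then have "a = 0" using q by (auto simp: mult_le_0_iff)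
  then show ?thesis using z by (simp add: a_def z_def)
qed

end

text \<open>X passes each power of B, and its adjoint moves the weak series from K to H; no limit of
  operators is taken.\<close>

lemma sq_series_intertwine:
  assumes H: "hilbert_space H" and K: "hilbert_space K" and X: "bounded_op H K X"
    and B: "contraction_sa H B" and B': "contraction_sa K B'"
    and eq: "\<And>x. x \<in> carrier H \<Longrightarrow> X (B x) = B' (X x)" and x: "x \<in> carrier H"
  shows "X (sq_series H B x) = sq_series K B' (X x)"
proof -
  interpret H: hilbert_space H by fact
  interpret K: hilbert_space K by fact
  have Xx: "X x \<in> K.C" using bounded_opD(1)[OF X x] .
  have pow: "X ((B ^^ n) x) = (B' ^^ n) (X x)" for n
    by (induction n) (auto simp: eq H.sa_pow_c[OF B x])
  show ?thesis
  proof (rule K.eq_if_cip_eq')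
    show "X (sq_series H B x) \<in> K.C" "sq_series K B' (X x) \<in> K.C"
      using H.sq_series(1)[OF B x] K.sq_series(1)[OF B' Xx] bounded_opD(1)[OF X] by auto
    fix v assume v: "v \<in> K.C"
    note Xa = adj[OF H K.pre_hilbert_axioms X v] adj_left[OF H K.pre_hilbert_axioms X v]
    have "cip K v (X (sq_series H B x)) = cip H (adj H K X v) (sq_series H B x)"
      using Xa(3)[OF H.sq_series(1)[OF B x]] by simp
    also have "\<dots> = (\<Sum>\<^sub>\<infinity>n. of_real (sqc n) * cip H (adj H K X v) ((B ^^ n) x))"
      by (rule H.sq_series(2)[OF B x Xa(1)])
    also have "\<dots> = (\<Sum>\<^sub>\<infinity>n. of_real (sqc n) * cip K v ((B' ^^ n) (X x)))"
      using Xa(3)[OF H.sa_pow_c[OF B x]] pow by simp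
    also have "\<dots> = cip K v (sq_series K B' (X x))"
      by (rule K.sq_series(2)[OF B' Xx v, symmetric])
    finally show "cip K v (X (sq_series H B x)) = cip K v (sq_series K B' (X x))" .
  qed
qed

text \<open>Uniqueness of the positive root. Let S be the chosen root and R the one from the series.
  S commutes with B, hence with R, so y = S x - R x satisfies S y + R y = A x - A x = 0. Both
  quadratic forms vanish at y, so S y = R y = 0, and <y, y> = <x, S y - R y> = 0.\<close>

lemma op_sqrt_eq:
  assumes H: "hilbert_space H" and B: "contraction_sa H B"
    and A: "\<And>x. x \<in> carrier H \<Longrightarrow> A x = x - B x"
  shows "positive_op H (op_sqrt H A)"
    "\<And>x. x \<in> carrier H \<Longrightarrow> op_sqrt H A (op_sqrt H A x) = A x"
    "\<And>x. x \<in> carrier H \<Longrightarrow> op_sqrt H A x = x - sq_series H B x"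
proof -
  interpret H: hilbert_space H by fact
  let ?R = "\<lambda>x. x - sq_series H B x"
  define S where "S = op_sqrt H A"
  have R: "positive_op H ?R" "\<And>x. x \<in> H.C \<Longrightarrow> ?R (?R x) = A x"
    using H.sq_root_positive[OF B] H.sq_root_square[OF B] A by auto
  then have "\<exists>S. positive_op H S \<and> (\<forall>x\<in>H.C. S (S x) = A x)" by blast
  from someI_ex[OF this] have S: "positive_op H S" "\<And>x. x \<in> H.C \<Longrightarrow> S (S x) = A x"
    unfolding S_def op_sqrt_def by auto
  have Sb: "bounded_op H H S" and Rb: "bounded_op H H ?R" using S R by (auto simp: positive_op_def)
  note S' = bounded_opD[OF Sb] and R' = bounded_opD[OF Rb]
  have BC: "\<And>x. x \<in> H.C \<Longrightarrow> B x \<in> H.C" using bounded_opD(1)[OF H.sa_bounded[OF B]] .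
  have SB: "S (B x) = B (S x)" if x: "x \<in> H.C" for x
  proof -
    have "S (x - B x) = S x - B (S x)" using S(2)[of "S x"] S(2)[OF x] A[OF x] A[OF S'(1)[OF x]] S'(1)[OF x] by simp
    then show ?thesis using bounded_op_diff[OF Sb H.pre_hilbert_axioms x BC[OF x]] by simp
  qed
  have "S x = ?R x" if x: "x \<in> H.C" for x
  proof -
    have SY: "S (sq_series H B x) = sq_series H B (S x)"
      by (rule sq_series_intertwine[OF H H Sb B B SB x])
    have YC: "sq_series H B x \<in> H.C" by (rule H.sq_series(1)[OF B x])
    have SR: "S (?R x) = ?R (S x)"
      using bounded_op_diff[OF Sb H.pre_hilbert_axioms x YC] SY by simp
    define y where "y = S x - ?R x"
    have y: "y \<in> H.C" using S'(1)[OF x] R'(1)[OF x] by (simp add: y_def)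
    have Sy: "S y = A x - S (?R x)"
      unfolding y_def using bounded_op_diff[OF Sb H.pre_hilbert_axioms S'(1)[OF x] R'(1)[OF x]] S(2)[OF x] by simp
    have Ry: "?R y = S (?R x) - A x"
      unfolding y_def using bounded_op_diff[OF Rb H.pre_hilbert_axioms S'(1)[OF x] R'(1)[OF x]] R(2)[OF x] SR by simp
    have "cip H (S y) y + cip H (?R y) y = cip H (S y + ?R y) y"
      using y S'(1)[OF y] R'(1)[OF y] by (simp only: H.cip_add_left)
    also have "S y + ?R y = 0" unfolding Sy Ry by simp
    finally have "Re (cip H (S y) y) + Re (cip H (?R y) y) = 0" using y by (simp add: complex_eq_iff)
    moreover have "0 \<le> Re (cip H (S y) y)" "0 \<le> Re (cip H (?R y) y)"
      using S(1) R(1) y unfolding positive_op_def by blast+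
    ultimately have "Re (cip H (S y) y) = 0" "Re (cip H (?R y) y) = 0" by linarith+
    then have z: "S y = 0" "?R y = 0"
      using H.positive_op_null[OF S(1) y] H.positive_op_null[OF R(1) y] by auto
    have "cip H y y = cip H (S x) y - cip H (?R x) y"
      using y_def y S'(1)[OF x] R'(1)[OF x] H.cip_diff_left by metis
    also have "\<dots> = cip H x (S y) - cip H x (?R y)"
      using H.positive_op_sa[OF S(1) x y] H.positive_op_sa[OF R(1) x y] by simp
    also have "\<dots> = 0" unfolding z using x by simp
    finally have "y = 0" using H.cip_self_0D[OF y] by simp
    then show ?thesis by (simp add: y_def)
  qed
  with S show "positive_op H (op_sqrt H A)"
    "\<And>x. x \<in> H.C \<Longrightarrow> op_sqrt H A (op_sqrt H A x) = A x"
    "\<And>x. x \<in> H.C \<Longrightarrow> op_sqrt H A x = x - sq_series H B x"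
    unfolding S_def by auto
qed

text \<open>Gives the relations between the two defect operators, \<open>Tt_D\<close> and
  \<open>D_W\<close>.\<close>

lemma op_sqrt_intertwine:
  assumes H: "hilbert_space H" and K: "hilbert_space K" and X: "bounded_op H K X"
    and B: "contraction_sa H B" and B': "contraction_sa K B'"
    and A: "\<And>x. x \<in> carrier H \<Longrightarrow> A x = x - B x" and A': "\<And>x. x \<in> carrier K \<Longrightarrow> A' x = x - B' x"
    and eq: "\<And>x. x \<in> carrier H \<Longrightarrow> X (B x) = B' (X x)" and x: "x \<in> carrier H"
  shows "X (op_sqrt H A x) = op_sqrt K A' (X x)"
proof -
  have "X (op_sqrt H A x) = X x - X (sq_series H B x)"
    using op_sqrt_eq(3)[OF H B A x] bounded_op_diff[OF X pre_hilbert_of_hilbert[OF H] x]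
      hilbert_space.sq_series(1)[OF H B x] by simp
  also have "\<dots> = op_sqrt K A' (X x)"
    using op_sqrt_eq(3)[OF K B' A' bounded_opD(1)[OF X x]] sq_series_intertwine[OF H K X B B' eq x] by simp
  finally show ?thesis .
qed

section \<open>Multi-indices and kernel series\<close>

text \<open>The multinomial theorem divided by n!, so that coefficients split into one factor per
  coordinate and the induction step is the binomial theorem. Letting multi-indices vanish off I
  keeps the index set finite; finiteness is proved in the same induction because reindexing sums
  needs it.\<close>

lemma sum_pow_fact_aux:
  fixes x :: "'i \<Rightarrow> complex"
  assumes "finite I"
  shows "finite {\<alpha>. (\<forall>i. i \<notin> I \<longrightarrow> \<alpha> i = 0) \<and> (\<Sum>i\<in>I. \<alpha> i) = n} \<and>
    (\<Sum>i\<in>I. x i) ^ n / fact n =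
      (\<Sum>\<alpha> | (\<forall>i. i \<notin> I \<longrightarrow> \<alpha> i = 0) \<and> (\<Sum>i\<in>I. \<alpha> i) = n. \<Prod>i\<in>I. x i ^ \<alpha> i / fact (\<alpha> i))"
  using assms
proof (induction I arbitrary: n rule: finite_induct)
  case empty
  have "{\<alpha>. (\<forall>i. \<alpha> i = 0) \<and> 0 = n} = (if n = 0 then {\<lambda>_::'i. 0::nat} else {})" by auto
  then show ?case by (auto simp: power_0_left)
next
  case (insert j I)
  let ?S = "\<lambda>I n. {\<alpha>::'i \<Rightarrow> nat. (\<forall>i. i \<notin> I \<longrightarrow> \<alpha> i = 0) \<and> (\<Sum>i\<in>I. \<alpha> i) = n}"
  \<comment> \<open>Splits a multi-index into the exponent k of the new coordinate and a multi-index
    on I.\<close>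
  let ?g = "\<lambda>(k, \<alpha>). \<alpha>(j := k)"
  have bij: "bij_betw ?g (Sigma {..n} (\<lambda>k. ?S I (n - k))) (?S (insert j I) n)"
  proof (rule bij_betwI[where g = "\<lambda>\<alpha>. (\<alpha> j, \<alpha>(j := 0))"])
    show "?g \<in> Sigma {..n} (\<lambda>k. ?S I (n - k)) \<rightarrow> ?S (insert j I) n"
    proof (rule Pi_I)
      fix y assume "y \<in> Sigma {..n} (\<lambda>k. ?S I (n - k))"
      then obtain k \<alpha> where y: "y = (k, \<alpha>)" and k: "k \<le> n"
        and a: "\<forall>i. i \<notin> I \<longrightarrow> \<alpha> i = 0" "(\<Sum>i\<in>I. \<alpha> i) = n - k" by auto
      have "(\<Sum>i\<in>I. (\<alpha>(j := k)) i) = (\<Sum>i\<in>I. \<alpha> i)"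
        using insert.hyps(2) by (intro sum.cong) auto
      then have "(\<Sum>i\<in>insert j I. (\<alpha>(j := k)) i) = n"
        using insert.hyps k a by simp
      then show "?g y \<in> ?S (insert j I) n" using a by (simp add: y)
    qed
    show "(\<lambda>\<alpha>. (\<alpha> j, \<alpha>(j := 0))) \<in> ?S (insert j I) n \<rightarrow> Sigma {..n} (\<lambda>k. ?S I (n - k))"
    proof
      fix \<alpha> assume a: "\<alpha> \<in> ?S (insert j I) n"
      have "(\<Sum>i\<in>I. (\<alpha>(j := 0)) i) = (\<Sum>i\<in>I. \<alpha> i)"
        using insert.hyps(2) by (intro sum.cong) auto
      moreover have "\<alpha> j + (\<Sum>i\<in>I. \<alpha> i) = n" using a insert.hyps by simp
      ultimately show "(\<alpha> j, \<alpha>(j := 0)) \<in> Sigma {..n} (\<lambda>k. ?S I (n - k))" using a by auto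
    qed
    show "(\<lambda>\<alpha>. (\<alpha> j, \<alpha>(j := 0))) (?g y) = y" if "y \<in> Sigma {..n} (\<lambda>k. ?S I (n - k))" for y
      using that insert.hyps(2) by (auto simp: fun_eq_iff)
  qed auto
  have fin: "finite (?S (insert j I) n)"
    using bij_betw_finite[OF bij] conjunct1[OF insert.IH] by auto
  have "(\<Sum>\<alpha>\<in>?S (insert j I) n. \<Prod>i\<in>insert j I. x i ^ \<alpha> i / fact (\<alpha> i)) =
    (\<Sum>y\<in>Sigma {..n} (\<lambda>k. ?S I (n - k)). \<Prod>i\<in>insert j I. x i ^ (?g y) i / fact ((?g y) i))"
    by (rule sum.reindex_bij_betw[OF bij, symmetric])
  also have "\<dots> = (\<Sum>(k, \<alpha>)\<in>Sigma {..n} (\<lambda>k. ?S I (n - k)). x j ^ k / fact k * (\<Prod>i\<in>I. x i ^ \<alpha> i / fact (\<alpha> i)))"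
  proof (rule sum.cong[OF refl], clarify)
    fix k and \<alpha> :: "'i \<Rightarrow> nat"
    have "(\<Prod>i\<in>I. x i ^ (\<alpha>(j := k)) i / fact ((\<alpha>(j := k)) i)) = (\<Prod>i\<in>I. x i ^ \<alpha> i / fact (\<alpha> i))"
      using insert.hyps(2) by (intro prod.cong) auto
    then show "(\<Prod>i\<in>insert j I. x i ^ (\<alpha>(j := k)) i / fact ((\<alpha>(j := k)) i)) =
      x j ^ k / fact k * (\<Prod>i\<in>I. x i ^ \<alpha> i / fact (\<alpha> i))"
      using insert.hyps by simp
  qed
  also have "\<dots> = (\<Sum>k\<le>n. x j ^ k / fact k * (\<Sum>\<alpha>\<in>?S I (n - k). \<Prod>i\<in>I. x i ^ \<alpha> i / fact (\<alpha> i)))"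
    using conjunct1[OF insert.IH] by (subst sum.Sigma[symmetric]) (auto simp: sum_distrib_left)
  also have "\<dots> = (\<Sum>k\<le>n. x j ^ k / fact k * ((\<Sum>i\<in>I. x i) ^ (n - k) / fact (n - k)))"
    using conjunct2[OF insert.IH] by simp
  also have "\<dots> = (x j + (\<Sum>i\<in>I. x i)) ^ n / fact n"
    unfolding binomial_ring sum_divide_distrib
    by (intro sum.cong refl) (simp add: binomial_fact)
  finally have "(\<Sum>i\<in>insert j I. x i) ^ n / fact n = (\<Sum>\<alpha>\<in>?S (insert j I) n. \<Prod>i\<in>insert j I. x i ^ \<alpha> i / fact (\<alpha> i))"
    using insert.hyps by simp
  with fin show ?case by blast
qed

lemmas sum_pow_fact = conjunct1[OF sum_pow_fact_aux] conjunct2[OF sum_pow_fact_aux]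

lemma finite_msize: "finite {\<alpha>::'d::finite \<Rightarrow> nat. msize \<alpha> = n}"
  using sum_pow_fact(1)[of "UNIV :: 'd set" n] by (simp add: msize_def)

lemma multinomial:
  fixes x :: "'d::finite \<Rightarrow> complex"
  shows "(\<Sum>\<alpha> | msize \<alpha> = n. of_real (mweight c \<alpha>) * (\<Prod>i\<in>UNIV. x i ^ \<alpha> i)) = of_real (c n) * (\<Sum>i\<in>UNIV. x i) ^ n"
proof -
  have "(\<Sum>\<alpha> | msize \<alpha> = n. of_real (mweight c \<alpha>) * (\<Prod>i\<in>UNIV. x i ^ \<alpha> i)) =
    (\<Sum>\<alpha> | msize \<alpha> = n. of_real (c n) * fact n * (\<Prod>i\<in>UNIV. x i ^ \<alpha> i / fact (\<alpha> i)))"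
    by (rule sum.cong[OF refl]) (simp add: mweight_def prod_dividef)
  also have "\<dots> = of_real (c n) * fact n * ((\<Sum>i\<in>UNIV. x i) ^ n / fact n)"
    using sum_pow_fact(2)[of "UNIV :: 'd set" x n] by (simp add: msize_def sum_distrib_left)
  finally show ?thesis by simp
qed

text \<open>The sum of moduli is bounded, not merely \<open>cdot\<close>, because it is the argument
  of the majorant series in \<open>kernel_series\<close>.\<close>

lemma cdot_norm_le:
  fixes z w :: "complex ^ 'd::finite"
  shows "(\<Sum>i\<in>UNIV. cmod (z $ i) * cmod (w $ i)) \<le> norm z * norm w"
  using L2_set_mult_ineq[of "\<lambda>i. cmod (z $ i)" "\<lambda>i. cmod (w $ i)" UNIV]
  by (simp add: norm_vec_def)

lemma mweight_nonneg: "(\<And>n. 0 \<le> c n) \<Longrightarrow> 0 \<le> mweight c \<alpha>"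
  by (auto simp: mweight_def intro!: divide_nonneg_nonneg prod_nonneg)

lemma mpow_0 [simp]: "mpow z 0 = 1"
  by (simp add: mpow_def)

lemma msize_0 [simp]: "msize 0 = 0"
  by (simp add: msize_def)

lemma mweight_0 [simp]: "mweight c 0 = c 0"
  by (simp add: mweight_def)

text \<open>Grouping multi-indices by size turns the sum into the power series in
  \<open>cdot z w\<close>. The norms group to the same power series at \<rho> = sum |z_i| |w_i|,
  which is below 1 by Cauchy-Schwarz, so the sum converges absolutely.\<close>

lemma kernel_series:
  fixes z w :: "complex ^ 'd::finite"
  assumes c: "\<And>n. 0 \<le> c n" and r: "\<And>r. 0 \<le> r \<Longrightarrow> r < 1 \<Longrightarrow> summable (\<lambda>n. c n * r ^ n)"
    and z: "z \<in> Bd" and w: "w \<in> Bd" and s: "(\<lambda>n. of_real (c n) * cdot z w ^ n) sums s"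
  shows "((\<lambda>\<alpha>. of_real (mweight c \<alpha>) * (mpow z \<alpha> * cnj (mpow w \<alpha>))) has_sum s) UNIV"
proof -
  define f where "f = (\<lambda>\<alpha>::'d \<Rightarrow> nat. of_real (mweight c \<alpha>) * (mpow z \<alpha> * cnj (mpow w \<alpha>)))"
  define \<rho> where "\<rho> = (\<Sum>i\<in>UNIV. cmod (z $ i) * cmod (w $ i))"
  have rho: "0 \<le> \<rho>" "\<rho> < 1"
  proof -
    show "0 \<le> \<rho>" by (simp add: \<rho>_def sum_nonneg)
    have "\<rho> \<le> norm z * norm w" unfolding \<rho>_def by (rule cdot_norm_le)
    also have "\<dots> < 1 * 1" using z w by (intro mult_strict_mono') auto
    finally show "\<rho> < 1" by simp
  qed
  have fe: "f \<alpha> = of_real (mweight c \<alpha>) * (\<Prod>i\<in>UNIV. (z $ i * cnj (w $ i)) ^ \<alpha> i)" for \<alpha>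
    by (simp add: f_def mpow_def power_mult_distrib prod.distrib cnj_prod)
  have hom: "(\<Sum>\<alpha> | msize \<alpha> = n. f \<alpha>) = of_real (c n) * cdot z w ^ n" for n
    unfolding fe cdot_def by (rule multinomial)
  have nf: "of_real (norm (f \<alpha>)) = of_real (mweight c \<alpha>) * (\<Prod>i\<in>UNIV. complex_of_real (cmod (z $ i) * cmod (w $ i)) ^ \<alpha> i)" for \<alpha>
    unfolding fe by (simp add: norm_mult prod_norm[symmetric] norm_power mweight_nonneg[OF c] power_mult_distrib of_real_prod)
  have nhom: "(\<Sum>\<alpha> | msize \<alpha> = n. norm (f \<alpha>)) = c n * \<rho> ^ n" for n
  proof -
    have "complex_of_real (\<Sum>\<alpha> | msize \<alpha> = n. norm (f \<alpha>)) = of_real (c n * \<rho> ^ n)"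
      unfolding of_real_sum nf multinomial by (simp add: \<rho>_def)
    then show ?thesis by (simp only: of_real_eq_iff)
  qed
  have bij: "bij_betw snd (Sigma UNIV (\<lambda>n. {\<alpha>::'d \<Rightarrow> nat. msize \<alpha> = n})) UNIV"
    by (rule bij_betwI[where g = "\<lambda>\<alpha>. (msize \<alpha>, \<alpha>)"]) auto
  have abs: "(\<lambda>y. norm (f (snd y))) summable_on (Sigma UNIV (\<lambda>n. {\<alpha>::'d \<Rightarrow> nat. msize \<alpha> = n}))"
  proof (rule summable_on_SigmaI)
    show "((\<lambda>\<alpha>. norm (f (snd (n, \<alpha>)))) has_sum c n * \<rho> ^ n) {\<alpha>. msize \<alpha> = n}" for n
      using has_sum_finite[OF finite_msize, of "\<lambda>\<alpha>. norm (f \<alpha>)" n] nhom[of n] by simp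
    show "(\<lambda>n. c n * \<rho> ^ n) summable_on UNIV"
      by (rule norm_summable_imp_summable_on) (use r[OF rho] rho c in simp)
  qed auto
  then have "(\<lambda>y. norm (f y)) summable_on UNIV"
    using summable_on_reindex_bij_betw[OF bij, of "\<lambda>y. norm (f y)"] by simp
  then have fs: "f summable_on UNIV" by (rule Infinite_Sum.abs_summable_summable)
  have "((\<lambda>y. f (snd y)) has_sum infsum f UNIV) (Sigma UNIV (\<lambda>n. {\<alpha>::'d \<Rightarrow> nat. msize \<alpha> = n}))"
    using has_sum_infsum[OF fs] has_sum_reindex_bij_betw[OF bij, of f] by simp
  then have "((\<lambda>n. of_real (c n) * cdot z w ^ n) has_sum infsum f UNIV) UNIV"
  proof (rule has_sum_SigmaD)
    show "((\<lambda>\<alpha>. f (snd (n, \<alpha>))) has_sum of_real (c n) * cdot z w ^ n) {\<alpha>. msize \<alpha> = n}" for n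
      using has_sum_finite[OF finite_msize, of f n] hom[of n] by simp
  qed
  from has_sum_imp_sums[OF this] s have "infsum f UNIV = s" by (rule sums_unique2)
  then show ?thesis using has_sum_infsum[OF fs] by (simp add: f_def)
qed

section \<open>Numerical consequences of the kernel hypotheses\<close>

context
  fixes a b :: "nat \<Rightarrow> real" and k :: "complex ^ 'd::finite \<Rightarrow> complex ^ 'd \<Rightarrow> complex"
  assumes k: "regular_cnp_kernel a b k"
begin

lemma kernel_a: "a 0 = 1" "0 < a n" "(\<lambda>n. a n / a (Suc n)) \<longlonglongrightarrow> 1"
  "z \<in> Bd \<Longrightarrow> w \<in> Bd \<Longrightarrow> (\<lambda>n. of_real (a n) * cdot z w ^ n) sums k z w"
  using k by (auto simp: regular_cnp_kernel_def)

text \<open>The hypotheses on the kernel speak of values of \<open>cdot\<close>. Realising every r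
  in [0, 1) turns them into convergence of the scalar power series there.\<close>

lemma cdot_axis:
  assumes "0 \<le> r" "r < 1"
  shows "\<exists>z\<in>(Bd :: (complex ^ 'd) set). \<exists>w\<in>Bd. cdot z w = complex_of_real r"
proof -
  let ?i = "undefined :: 'd"
  let ?z = "axis ?i (complex_of_real (sqrt r)) :: complex ^ 'd"
  have "norm ?z = sqrt r" using assms by (simp add: norm_vec_def L2_set_def axis_def if_distrib[of norm] if_distrib[of "\<lambda>x. x\<^sup>2"] cong: if_cong)
  then have "?z \<in> Bd" using assms by simp
  moreover have "cdot ?z ?z = complex_of_real r"
  proof -
    have "cdot ?z ?z = (\<Sum>j\<in>UNIV. if j = ?i then complex_of_real (sqrt r) * of_real (sqrt r) else 0)"
      unfolding cdot_def by (rule sum.cong) (auto simp: axis_def)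
    also have "\<dots> = complex_of_real (sqrt r * sqrt r)" unfolding of_real_mult by (subst sum.delta) auto
    finally show ?thesis using assms by (simp only: real_sqrt_mult_self abs_of_nonneg)
  qed
  ultimately show ?thesis by blast
qed

lemma summable_of_complex:
  assumes "(\<lambda>n. complex_of_real (f n)) sums s"
  shows "summable f"
  using sums_Re[OF assms] by (auto simp: summable_def)

lemma a_summable: "0 \<le> r \<Longrightarrow> r < 1 \<Longrightarrow> summable (\<lambda>n. a n * r ^ n)"
proof -
  assume r: "0 \<le> r" "r < 1"
  obtain z w :: "complex ^ 'd" where zw: "z \<in> Bd" "w \<in> Bd" "cdot z w = complex_of_real r"
    using cdot_axis[OF r] by blast
  show ?thesis
    by (rule summable_of_complex[of _ "k z w"]) (use kernel_a(4)[OF zw(1,2)] zw(3) in simp)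
qed

lemma kernel_a_has_sum:
  assumes "z \<in> Bd" "w \<in> Bd"
  shows "((\<lambda>\<alpha>. of_real (mweight a \<alpha>) * (mpow z \<alpha> * cnj (mpow w \<alpha>))) has_sum k z w) UNIV"
  by (rule kernel_series[OF less_imp_le[OF kernel_a(2)] a_summable assms kernel_a(4)[OF assms]])

lemma kernel_nz: "z \<in> Bd \<Longrightarrow> w \<in> Bd \<Longrightarrow> k z w \<noteq> 0"
  using k by (auto simp: regular_cnp_kernel_def)

text \<open>\<open>kernel_series\<close> wants a nonnegative sequence indexed from 0, while
  \<open>b 0\<close> is unconstrained and the series of 1 - 1/k starts at 1.\<close>

definition b' :: "nat \<Rightarrow> real" where "b' n = (if n = 0 then 0 else b n)"

lemma b'_sums:
  assumes "z \<in> Bd" "w \<in> Bd"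
  shows "(\<lambda>n. of_real (b' n) * cdot z w ^ n) sums (1 - 1 / k z w)"
proof -
  have "(\<lambda>n. of_real (b' (Suc n)) * cdot z w ^ Suc n) sums (1 - 1 / k z w)"
    using k assms by (auto simp: regular_cnp_kernel_def b'_def)
  then show ?thesis by (subst (asm) sums_Suc_iff) (simp add: b'_def)
qed

lemma b'_nonneg: "0 \<le> b' n"
  using k by (auto simp: regular_cnp_kernel_def b'_def)

lemma b'_summable: "0 \<le> r \<Longrightarrow> r < 1 \<Longrightarrow> summable (\<lambda>n. b' n * r ^ n)"
proof -
  assume r: "0 \<le> r" "r < 1"
  obtain z w :: "complex ^ 'd" where zw: "z \<in> Bd" "w \<in> Bd" "cdot z w = complex_of_real r"
    using cdot_axis[OF r] by blast
  show ?thesis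
    by (rule summable_of_complex[of _ "1 - 1 / k z w"]) (use b'_sums[OF zw(1,2)] zw(3) in simp)
qed

lemma msize_eq_0: "msize \<alpha> = 0 \<longleftrightarrow> \<alpha> = 0"
  by (auto simp: msize_def fun_eq_iff)

lemma mweight_b_nonneg: "\<alpha> \<noteq> 0 \<Longrightarrow> 0 \<le> mweight b \<alpha>"
  using k msize_eq_0[of \<alpha>]
  by (auto simp: mweight_def regular_cnp_kernel_def intro!: divide_nonneg_nonneg mult_nonneg_nonneg prod_nonneg)

lemma kernel_b_has_sum:
  assumes "z \<in> Bd" "w \<in> Bd"
  shows "((\<lambda>\<alpha>. of_real (mweight b \<alpha>) * (mpow z \<alpha> * cnj (mpow w \<alpha>))) has_sum (1 - 1 / k z w)) (- {0})"
proof -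
  have "((\<lambda>\<alpha>. of_real (mweight b' \<alpha>) * (mpow z \<alpha> * cnj (mpow w \<alpha>))) has_sum (1 - 1 / k z w)) UNIV"
    by (rule kernel_series[OF b'_nonneg b'_summable assms b'_sums[OF assms]])
  then show ?thesis
    by (rule has_sum_cong_neutral[THEN iffD1, rotated 3])
      (auto simp: b'_def mweight_def msize_eq_0)
qed

lemma kernel_0: "z \<in> Bd \<Longrightarrow> k z 0 = 1" "z \<in> Bd \<Longrightarrow> k 0 z = 1"
proof -
  have *: "k z w = 1" if "z \<in> Bd" "w \<in> Bd" "cdot z w = 0" for z w
  proof -
    have "(\<lambda>n. complex_of_real (a n) * cdot z w ^ n) sums 1"
      using sums_single[of 0 "\<lambda>_. 1::complex"] kernel_a(1) that(3)
      by (simp add: power_0_left if_distrib cong: if_cong)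
    then show ?thesis using kernel_a(4)[OF that(1,2)] sums_unique2 by blast
  qed
  show "z \<in> Bd \<Longrightarrow> k z 0 = 1" "z \<in> Bd \<Longrightarrow> k 0 z = 1" by (rule *; simp add: cdot_def)+
qed

lemma kernel_cnj: "z \<in> Bd \<Longrightarrow> w \<in> Bd \<Longrightarrow> k w z = cnj (k z w)"
proof -
  assume zw: "z \<in> Bd" "w \<in> Bd"
  have "cnj (cdot z w) = cdot w z" by (simp add: cdot_def mult.commute)
  then have "(\<lambda>n. complex_of_real (a n) * cdot w z ^ n) sums cnj (k z w)"
    using kernel_a(4)[OF zw] sums_cnj[of "\<lambda>n. complex_of_real (a n) * cdot z w ^ n" "k z w"] by simp
  then show ?thesis using kernel_a(4)[OF zw(2,1)] sums_unique2 by blast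
qed

text \<open>The lower bound is the constant term of a nonnegative series. It puts 1 - 1/k(z,z), the
  squared norm of the weight column at z, into [0, 1), which makes the resolvent exist.\<close>

lemma kernel_diag: "z \<in> Bd \<Longrightarrow> k z z = of_real (Re (k z z))" "z \<in> Bd \<Longrightarrow> 1 \<le> Re (k z z)"
proof -
  assume z: "z \<in> Bd"
  show "k z z = of_real (Re (k z z))"
    using arg_cong[OF kernel_cnj[OF z z], of Im] by (simp add: complex_eq_iff)
  have "((\<lambda>\<alpha>. Re (of_real (mweight a \<alpha>) * (mpow z \<alpha> * cnj (mpow z \<alpha>)))) has_sum Re (k z z)) UNIV"
    using kernel_a_has_sum[OF z z] by (rule has_sum_Re)
  then have "(\<Sum>\<alpha>\<in>{0::'d \<Rightarrow> nat}. Re (of_real (mweight a \<alpha>) * (mpow z \<alpha> * cnj (mpow z \<alpha>)))) \<le> Re (k z z)"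
  proof (rule finite_sum_le_has_sum)
    fix \<alpha> :: "'d \<Rightarrow> nat"
    have "0 \<le> mweight a \<alpha>" by (rule mweight_nonneg[OF less_imp_le[OF kernel_a(2)]])
    then show "0 \<le> Re (of_real (mweight a \<alpha>) * (mpow z \<alpha> * cnj (mpow z \<alpha>)))"
      by (simp add: complex_mult_cnj)
  qed auto
  then show "1 \<le> Re (k z z)" by (simp add: kernel_a(1))
qed

lemma mweight_a_pos: "0 < mweight a \<alpha>"
  by (auto simp: mweight_def kernel_a(2) intro!: divide_pos_pos prod_pos)

text \<open>This is where the regularity limit enters: convergent ratios are bounded, so a n \<le> c
  a (n + 1). Raising \<alpha>_i by one multiplies the multinomial factor by (n + 1) / (\<alpha>_i +
  1), which is at least 1.\<close>

lemma mweight_a_ratio: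
  obtains c where "c \<ge> 0" "\<And>(\<alpha> :: 'd \<Rightarrow> nat) i. mweight a \<alpha> \<le> c * mweight a (\<alpha>(i := Suc (\<alpha> i)))"
proof -
  have "Bseq (\<lambda>n. a n / a (Suc n))" using kernel_a(3) by (intro convergent_imp_Bseq convergentI)
  then obtain c where c: "c > 0" "\<And>n. \<bar>a n / a (Suc n)\<bar> \<le> c" by (auto elim: BseqE)
  have "mweight a \<alpha> \<le> c * mweight a (\<alpha>(i := Suc (\<alpha> i)))" for \<alpha> :: "'d \<Rightarrow> nat" and i
  proof -
    let ?\<beta> = "\<alpha>(i := Suc (\<alpha> i))"
    have ms: "msize ?\<beta> = Suc (msize \<alpha>)"
    proof -
      have "msize ?\<beta> = (\<Sum>j\<in>UNIV. \<alpha> j + (if j = i then 1 else 0))"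
        unfolding msize_def by (rule sum.cong) auto
      then show ?thesis by (simp add: sum.distrib msize_def)
    qed
    have pf: "(\<Prod>j\<in>UNIV. fact (?\<beta> j)) = real (Suc (\<alpha> i)) * (\<Prod>j\<in>UNIV. fact (\<alpha> j))"
    proof -
      have "(\<Prod>j\<in>UNIV. fact (?\<beta> j) :: real) = (\<Prod>j\<in>UNIV. (if j = i then real (Suc (\<alpha> i)) else 1) * fact (\<alpha> j))"
        by (rule prod.cong) auto
      then show ?thesis by (simp add: prod.distrib)
    qed
    have le: "\<alpha> i \<le> msize \<alpha>" unfolding msize_def by (rule member_le_sum) auto
    let ?n = "msize \<alpha>" and ?P = "(\<Prod>j\<in>UNIV. fact (\<alpha> j)) :: real"
    have P: "?P > 0" by (auto intro: prod_pos)
    have an: "a ?n \<le> c * a (Suc ?n)"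
      using c(2)[of ?n] kernel_a(2)[of "Suc ?n"] kernel_a(2)[of ?n] by (simp add: pos_divide_le_eq)
    have q: "1 \<le> real (Suc ?n) / real (Suc (\<alpha> i))" using le by simp
    have "mweight a \<alpha> = a ?n * (fact ?n / ?P)" by (simp add: mweight_def)
    also have "\<dots> \<le> (c * a (Suc ?n)) * (fact ?n / ?P)" using an P by (intro mult_right_mono) auto
    also have "\<dots> \<le> (c * a (Suc ?n)) * (fact ?n / ?P) * (real (Suc ?n) / real (Suc (\<alpha> i)))"
    proof -
      have "0 \<le> (c * a (Suc ?n)) * (fact ?n / ?P)" using P c(1) kernel_a(2)[of "Suc ?n"] by simp
      then show ?thesis using mult_left_mono[OF q] by fastforce
    qed
    also have "\<dots> = c * mweight a ?\<beta>"
      unfolding mweight_def ms pf by (simp add: field_simps)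
    finally show ?thesis .
  qed
  then show thesis by (intro that[of c]) (use c(1) in auto)
qed

end

section \<open>Reproducing kernel spaces from feature maps\<close>

text \<open>Used to regard a Hilbert space of sequences as one of functions; completeness is carried
  along because \<Phi> preserves norms by construction.\<close>

lemma transport_hilbert:
  fixes L :: "('l::complex_vector) hilbert" and \<Phi> :: "'l \<Rightarrow> 'g::complex_vector"
  assumes L: "hilbert_space L"
    and add: "\<And>x y. x \<in> carrier L \<Longrightarrow> y \<in> carrier L \<Longrightarrow> \<Phi> (x + y) = \<Phi> x + \<Phi> y"
    and scale: "\<And>c x. x \<in> carrier L \<Longrightarrow> \<Phi> (c *\<^sub>C x) = c *\<^sub>C \<Phi> x"
    and inj: "inj_on \<Phi> (carrier L)"
  defines "G \<equiv> \<lparr>carrier = \<Phi> ` carrier L,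
    cip = \<lambda>F F'. cip L (inv_into (carrier L) \<Phi> F) (inv_into (carrier L) \<Phi> F')\<rparr>"
  shows "hilbert_space G"
    "\<And>x y. x \<in> carrier L \<Longrightarrow> y \<in> carrier L \<Longrightarrow> cip G (\<Phi> x) (\<Phi> y) = cip L x y"
proof -
  interpret L: hilbert_space L by fact
  have carG: "carrier G = \<Phi> ` L.C" by (simp add: G_def)
  show cipG: "cip G (\<Phi> x) (\<Phi> y) = cip L x y" if "x \<in> L.C" "y \<in> L.C" for x y
    using that inj by (simp add: G_def inv_into_f_f)
  have zero: "\<Phi> 0 = 0" using scale[of 0 0] by simp
  interpret G: pre_hilbert G
  proof
    show "csubspace (carrier G)"
    proof (rule complex_vector.subspaceI)
      show "0 \<in> carrier G" unfolding carG by (rule image_eqI[of _ _ 0]) (simp_all add: zero)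
      fix x y assume "x \<in> carrier G" "y \<in> carrier G"
      then obtain x' y' where "x' \<in> L.C" "y' \<in> L.C" "x = \<Phi> x'" "y = \<Phi> y'" unfolding carG by blast
      then show "x + y \<in> carrier G" unfolding carG by (intro image_eqI[of _ _ "x' + y'"]) (simp_all add: add)
    next
      fix c x assume "x \<in> carrier G"
      then obtain x' where "x' \<in> L.C" "x = \<Phi> x'" unfolding carG by blast
      then show "c *\<^sub>C x \<in> carrier G" unfolding carG by (intro image_eqI[of _ _ "c *\<^sub>C x'"]) (simp_all add: scale)
    qed
    fix x y u c assume x: "x \<in> carrier G"
    then obtain x' where x': "x' \<in> L.C" "x = \<Phi> x'" unfolding carG by blast
    show "0 \<le> Re (cip G x x)" using x' by (simp add: cipG L.cip_self_nonneg)
    show "x = 0" if "cip G x x = 0" using that x' zero L.cip_self_0D[of x'] by (simp add: cipG)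
    show "cip G (c *\<^sub>C x) u = c * cip G x u" if "u \<in> carrier G"
    proof -
      obtain u' where u': "u' \<in> L.C" "u = \<Phi> u'" using \<open>u \<in> carrier G\<close> unfolding carG by blast
      show ?thesis using x' u' cipG[of "c *\<^sub>C x'" u'] by (simp add: cipG scale L.cip_scale_left)
    qed
    assume y: "y \<in> carrier G"
    then obtain y' where y': "y' \<in> L.C" "y = \<Phi> y'" unfolding carG by blast
    show "cip G x y = cnj (cip G y x)"
      using L.cip_swap[OF x'(1) y'(1)] x' y' by (simp add: cipG)
    assume u: "u \<in> carrier G"
    then obtain u' where u': "u' \<in> L.C" "u = \<Phi> u'" unfolding carG by blast
    show "cip G (x + y) u = cip G x u + cip G y u"
      using x' y' u' cipG[of "x' + y'" u'] by (simp add: cipG add L.cip_add_left)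
  qed
  have nrmG: "hnorm G (\<Phi> x) = hnorm L x" if "x \<in> L.C" for x
    using cipG[OF that that] by (simp add: hnorm_def)
  have diff: "\<Phi> (x - y) = \<Phi> x - \<Phi> y" if "x \<in> L.C" "y \<in> L.C" for x y
    using add[of x "(-1) *\<^sub>C y"] scale[of y "-1"] that by simp
  show "hilbert_space G"
  proof (rule G.hilbert_spaceI)
    fix s :: "nat \<Rightarrow> 'g" assume s: "\<And>n. s n \<in> G.C"
      and c: "\<And>e. e > 0 \<Longrightarrow> \<exists>N. \<forall>m\<ge>N. \<forall>n\<ge>N. G.nrm (s m - s n) < e"
    have "\<forall>n. \<exists>t. t \<in> L.C \<and> s n = \<Phi> t" using s unfolding carG by blast
    then obtain t where t: "\<And>n. t n \<in> L.C" "\<And>n. s n = \<Phi> (t n)" by metis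
    have "G.nrm (s m - s n) = L.nrm (t m - t n)" for m n
      using t nrmG[OF L.diff_c[OF t(1)[of m] t(1)[of n]]] by (simp add: diff)
    with c have "\<And>e. e > 0 \<Longrightarrow> \<exists>N. \<forall>m\<ge>N. \<forall>n\<ge>N. L.nrm (t m - t n) < e" by simp
    from L.complete_seq[OF t(1) this] obtain l where l: "l \<in> L.C" "(\<lambda>n. L.nrm (t n - l)) \<longlonglongrightarrow> 0" by blast
    have "G.nrm (s n - \<Phi> l) = L.nrm (t n - l)" for n
      using t nrmG[OF L.diff_c[OF t(1)[of n] l(1)]] l(1) by (simp add: diff)
    then show "\<exists>l\<in>G.C. (\<lambda>n. G.nrm (s n - l)) \<longlonglongrightarrow> 0"
      using l by (intro bexI[of _ "\<Phi> l"]) (simp_all add: carG)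
  qed
qed

text \<open>A vector x of the feature space is read as the function sending z to the adjoint of
  \<Psi> z at x. The reproducing property is then the definition of the adjoint, and the kernel is
  the adjoint of \<Psi> z after \<Psi> w.\<close>

lemma feature_space_exists:
  fixes L :: "('l::complex_vector) hilbert" and E :: "('e::complex_vector) hilbert" and X :: "'x set"
  assumes L: "hilbert_space L" and E: "hilbert_space E"
    and Psi: "\<And>w. w \<in> X \<Longrightarrow> bounded_op E L (\<Psi> w)"
  obtains G :: "('x \<Rightarrow> 'e) hilbert" where "hilbert_space G"
    "\<And>F x. F \<in> carrier G \<Longrightarrow> F x \<in> carrier E"
    "\<And>F x. F \<in> carrier G \<Longrightarrow> x \<notin> X \<Longrightarrow> F x = 0"
    "\<And>w e. w \<in> X \<Longrightarrow> e \<in> carrier E \<Longrightarrow> (\<lambda>z. if z \<in> X then adj E L (\<Psi> z) (\<Psi> w e) else 0) \<in> carrier G"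
    "\<And>F w e. F \<in> carrier G \<Longrightarrow> w \<in> X \<Longrightarrow> e \<in> carrier E \<Longrightarrow>
      cip G F (\<lambda>z. if z \<in> X then adj E L (\<Psi> z) (\<Psi> w e) else 0) = cip E (F w) e"
    "\<And>x. \<exists>B. \<forall>F\<in>carrier G. hnorm E (F x) \<le> B * hnorm G F"
proof -
  interpret L: hilbert_space L by fact
  interpret E: hilbert_space E by fact
  define S where "S = (\<Union>w\<in>X. \<Psi> w ` E.C)"
  \<comment> \<open>The double complement is the closed span of the ranges of the \<Psi> w; there a
    vector is determined by its function, so the transport is injective.\<close>
  define L0 where "L0 = orth_compl L (orth_compl L S)"
  define \<Phi> where "\<Phi> = (\<lambda>x z. if z \<in> X then adj E L (\<Psi> z) x else 0)"
  have PsiC: "\<Psi> w e \<in> L.C" if "w \<in> X" "e \<in> E.C" for w e by (rule bounded_opD(1)[OF Psi[OF that(1)] that(2)])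
  have SC: "S \<subseteq> L.C" using PsiC by (auto simp: S_def)
  have L0: "closed_subspace L L0"
    unfolding L0_def by (rule L.orth_compl_closed) (auto simp: orth_compl_def)
  note L0D = L.closed_subspaceD[OF L0]
  have L0C: "x \<in> L.C" if "x \<in> L0" for x using L0D(2) that by blast
  note ad = adj[OF E L.pre_hilbert_axioms Psi] adj_left[OF E L.pre_hilbert_axioms Psi]
  note adb = bounded_op_adj[OF E L.pre_hilbert_axioms Psi]
  interpret L': hilbert_space "sub_hilbert L L0" by (rule L.sub_hilbert_space[OF L0])
  have PsiL0: "\<Psi> w e \<in> L0" if "w \<in> X" "e \<in> E.C" for w e
    using PsiC[OF that] that SC L.cip_swap[of "\<Psi> w e"]
    unfolding L0_def S_def by (auto simp: orth_compl_def)
  have Phi_cip: "cip L x (\<Psi> w e) = cip E (\<Phi> x w) e" if "x \<in> L.C" "w \<in> X" "e \<in> E.C" for x w e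
    using ad(3)[OF that(2,1,3)] that by (simp add: \<Phi>_def)
  have Phi_add: "\<Phi> (x + y) = \<Phi> x + \<Phi> y" if "x \<in> L.C" "y \<in> L.C" for x y
    using bounded_opD(2)[OF adb] that by (auto simp: \<Phi>_def fun_eq_iff)
  have Phi_scale: "\<Phi> (c *\<^sub>C x) = c *\<^sub>C \<Phi> x" if "x \<in> L.C" for c x
    using bounded_opD(3)[OF adb] that by (auto simp: \<Phi>_def fun_eq_iff scaleC_fun_def)
  have inj: "inj_on \<Phi> L0"
  proof (rule inj_onI)
    fix x y assume xy: "x \<in> L0" "y \<in> L0" and e: "\<Phi> x = \<Phi> y"
    have d: "x - y \<in> L0" using L'.diff_c xy by simp
    have "cip L (x - y) (\<Psi> w f) = 0" if "w \<in> X" "f \<in> E.C" for w f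
      using Phi_cip[OF L0C[OF xy(1)] that] Phi_cip[OF L0C[OF xy(2)] that] e PsiC[OF that] L0C xy
      by (simp add: L.cip_diff_left)
    then have "x - y \<in> orth_compl L S" using L0C[OF d] by (auto simp: orth_compl_def S_def)
    then have "cip L (x - y) (x - y) = 0" using d unfolding L0_def by (auto simp: orth_compl_def)
    then show "x = y" using L.cip_self_0D[OF L0C[OF d]] by simp
  qed
  define G where "G = \<lparr>carrier = \<Phi> ` carrier (sub_hilbert L L0),
    cip = \<lambda>F F'. cip (sub_hilbert L L0) (inv_into (carrier (sub_hilbert L L0)) \<Phi> F) (inv_into (carrier (sub_hilbert L L0)) \<Phi> F')\<rparr>"
  have GH: "hilbert_space G" and Gcip: "\<And>x y. x \<in> L0 \<Longrightarrow> y \<in> L0 \<Longrightarrow> cip G (\<Phi> x) (\<Phi> y) = cip L x y"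
    using transport_hilbert[OF L'.hilbert_space_axioms, of \<Phi>] Phi_add Phi_scale inj L0C
    unfolding G_def by auto
  have carG: "carrier G = \<Phi> ` L0" by (simp add: G_def)
  have kap: "(\<lambda>z. if z \<in> X then adj E L (\<Psi> z) (\<Psi> w e) else 0) = \<Phi> (\<Psi> w e)" for w e
    by (simp add: \<Phi>_def)
  show thesis
  proof (rule that[OF GH])
    show "F x \<in> E.C" if "F \<in> carrier G" for F x
      using that ad(1) L0C unfolding carG \<Phi>_def by auto
    show "F x = 0" if "F \<in> carrier G" "x \<notin> X" for F x
      using that unfolding carG \<Phi>_def by auto
    show "(\<lambda>z. if z \<in> X then adj E L (\<Psi> z) (\<Psi> w e) else 0) \<in> carrier G" if "w \<in> X" "e \<in> E.C" for w e
      unfolding kap carG using PsiL0[OF that] by blast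
    show "cip G F (\<lambda>z. if z \<in> X then adj E L (\<Psi> z) (\<Psi> w e) else 0) = cip E (F w) e"
      if F: "F \<in> carrier G" and w: "w \<in> X" "e \<in> E.C" for F w e
    proof -
      obtain x where x: "x \<in> L0" "F = \<Phi> x" using F unfolding carG by blast
      show ?thesis unfolding kap x(2) Gcip[OF x(1) PsiL0[OF w]] by (rule Phi_cip[OF L0C[OF x(1)] w])
    qed
    fix x :: 'x
    show "\<exists>B. \<forall>F\<in>carrier G. hnorm E (F x) \<le> B * hnorm G F"
    proof (cases "x \<in> X")
      case True
      obtain B where B: "\<And>y. y \<in> L.C \<Longrightarrow> hnorm E (adj E L (\<Psi> x) y) \<le> B * hnorm L y"
        using adb[OF True] unfolding bounded_op_def by blast
      have "hnorm E (F x) \<le> B * hnorm G F" if F: "F \<in> carrier G" for F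
      proof -
        obtain y where y: "y \<in> L0" "F = \<Phi> y" using F unfolding carG by blast
        have "hnorm G F = hnorm L y" using Gcip[OF y(1) y(1)] y(2) by (simp add: hnorm_def)
        then show ?thesis using B[OF L0C[OF y(1)]] True y(2) by (simp add: \<Phi>_def)
      qed
      then show ?thesis by blast
    next
      case False
      then have "hnorm E (F x) \<le> 0 * hnorm G F" if "F \<in> carrier G" for F
        using that unfolding carG \<Phi>_def by auto
      then show ?thesis by blast
    qed
  qed
qed

text \<open>The elementary tensor of the kernel function at w with e (\<open>kf_tensor\<close>),
  against which functions in the tensor product are evaluated at w.\<close>

definition kap :: "(complex ^ 'd::finite \<Rightarrow> complex ^ 'd \<Rightarrow> complex) \<Rightarrow> complex ^ 'd \<Rightarrow> 'e \<Rightarrow> complex ^ 'd \<Rightarrow> 'e::complex_vector"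
  where "kap k w e = (\<lambda>z. if z \<in> Bd then k z w *\<^sub>C e else 0)"

text \<open>Coordinates of the feature vector of w, conjugated because the kernel is antiholomorphic
  in its second argument. The products \<open>awt c w \<alpha> * cnj (awt c z \<alpha>)\<close> sum
  to k z w for c = a and, off \<alpha> = 0, to 1 - 1 / k z w for c = b.\<close>

definition awt :: "(nat \<Rightarrow> real) \<Rightarrow> complex ^ 'd::finite \<Rightarrow> ('d \<Rightarrow> nat) \<Rightarrow> complex"
  where "awt c w \<alpha> = of_real (sqrt (mweight c \<alpha>)) * cnj (mpow w \<alpha>)"

lemma awt_summable:
  assumes "((\<lambda>\<alpha>. awt c w \<alpha> * cnj (awt c w \<alpha>)) has_sum s) A"
  shows "(\<lambda>\<alpha>. (cmod (awt c w \<alpha>))\<^sup>2) summable_on A"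
proof -
  have "((\<lambda>\<alpha>. Re (awt c w \<alpha> * cnj (awt c w \<alpha>))) has_sum Re s) A" using assms by (rule has_sum_Re)
  then show ?thesis by (auto simp: summable_on_def complex_norm_square[symmetric] simp del: of_real_power)
qed

lemma bounded_ds_weights:
  assumes E: "hilbert_space E" and w: "(\<lambda>i. (cmod (w i))\<^sup>2) summable_on A"
  shows "bounded_op E (direct_sum A E) (\<lambda>p i. if i \<in> A then w i *\<^sub>C p else 0)"
proof -
  interpret E: hilbert_space E by fact
  interpret D: pre_hilbert "direct_sum A E" by (rule E.ds_pre_hilbert)
  let ?s = "\<Sum>\<^sub>\<infinity>i\<in>A. (cmod (w i))\<^sup>2"
  have s: "0 \<le> ?s" by (rule infsum_nonneg) simp
  have "hnorm (direct_sum A E) (\<lambda>i. if i \<in> A then w i *\<^sub>C p else 0) \<le> sqrt ?s * hnorm E p" if p: "p \<in> E.C" for p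
  proof (rule power2_le_imp_le)
    have "(hnorm (direct_sum A E) (\<lambda>i. if i \<in> A then w i *\<^sub>C p else 0))\<^sup>2 =
      (\<Sum>\<^sub>\<infinity>i\<in>A. (E.nrm (if i \<in> A then w i *\<^sub>C p else 0))\<^sup>2)"
      by (rule E.ds_nrm_sq[OF E.ds_weights[OF p w]])
    also have "\<dots> = (\<Sum>\<^sub>\<infinity>i\<in>A. (cmod (w i))\<^sup>2 * (E.nrm p)\<^sup>2)"
      by (rule infsum_cong) (simp add: E.nrm_scale[OF p] power_mult_distrib)
    also have "\<dots> = ?s * (E.nrm p)\<^sup>2" by (rule infsum_cmult_left) (use w in simp)
    finally show "(hnorm (direct_sum A E) (\<lambda>i. if i \<in> A then w i *\<^sub>C p else 0))\<^sup>2 \<le> (sqrt ?s * E.nrm p)\<^sup>2"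
      using s by (simp add: power_mult_distrib)
    show "0 \<le> sqrt ?s * E.nrm p" using s p by simp
  qed
  then show ?thesis
    unfolding bounded_op_def
    by (auto simp: E.ds_weights[OF _ w] fun_eq_iff scaleC_fun_def complex_vector.scale_right_distrib
      complex_vector.scale_left_commute)
qed

context
  fixes a b :: "nat \<Rightarrow> real" and k :: "complex ^ 'd::finite \<Rightarrow> complex ^ 'd \<Rightarrow> complex"
  assumes k: "regular_cnp_kernel a b k"
begin

lemma awt_a_has_sum:
  assumes "z \<in> Bd" "w \<in> Bd"
  shows "((\<lambda>\<alpha>. awt a w \<alpha> * cnj (awt a z \<alpha>)) has_sum k z w) UNIV"
proof -
  have "awt a w \<alpha> * cnj (awt a z \<alpha>) = of_real (mweight a \<alpha>) * (mpow z \<alpha> * cnj (mpow w \<alpha>))" for \<alpha>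
  proof -
    have "sqrt (mweight a \<alpha>) * sqrt (mweight a \<alpha>) = mweight a \<alpha>"
      using mweight_a_pos[OF k, of \<alpha>] by simp
    then have "complex_of_real (sqrt (mweight a \<alpha>)) * of_real (sqrt (mweight a \<alpha>)) = of_real (mweight a \<alpha>)"
      by (simp only: of_real_mult[symmetric])
    then show ?thesis by (simp add: awt_def mult_ac)
  qed
  then show ?thesis using kernel_a_has_sum[OF k assms] by simp
qed

lemma awt_b_has_sum:
  assumes "z \<in> Bd" "w \<in> Bd"
  shows "((\<lambda>\<alpha>. awt b w \<alpha> * cnj (awt b z \<alpha>)) has_sum (1 - 1 / k z w)) (- {0})"
proof -
  have "awt b w \<alpha> * cnj (awt b z \<alpha>) = of_real (mweight b \<alpha>) * (mpow z \<alpha> * cnj (mpow w \<alpha>))" if "\<alpha> \<in> - {0}" for \<alpha>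
  proof -
    have "sqrt (mweight b \<alpha>) * sqrt (mweight b \<alpha>) = mweight b \<alpha>"
      using mweight_b_nonneg[OF k, of \<alpha>] that by simp
    then have "complex_of_real (sqrt (mweight b \<alpha>)) * of_real (sqrt (mweight b \<alpha>)) = of_real (mweight b \<alpha>)"
      by (simp only: of_real_mult[symmetric])
    then show ?thesis by (simp add: awt_def mult_ac)
  qed
  then show ?thesis
    using kernel_b_has_sum[OF k assms] has_sum_cong by (metis (no_types, lifting))
qed

lemma vv_rkhs_exists:
  fixes E :: "('e::complex_vector) hilbert"
  assumes E: "hilbert_space E"
  obtains G :: "(complex ^ 'd \<Rightarrow> 'e) hilbert" where "hilbert_space G"
    "\<And>F x. F \<in> carrier G \<Longrightarrow> F x \<in> carrier E"
    "\<And>F x. F \<in> carrier G \<Longrightarrow> x \<notin> Bd \<Longrightarrow> F x = 0"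
    "\<And>w e. w \<in> Bd \<Longrightarrow> e \<in> carrier E \<Longrightarrow> kap k w e \<in> carrier G"
    "\<And>F w e. F \<in> carrier G \<Longrightarrow> w \<in> Bd \<Longrightarrow> e \<in> carrier E \<Longrightarrow> cip G F (kap k w e) = cip E (F w) e"
    "\<And>x. \<exists>B. \<forall>F\<in>carrier G. hnorm E (F x) \<le> B * hnorm G F"
proof -
  interpret E: hilbert_space E by fact
  let ?L = "direct_sum (UNIV :: ('d \<Rightarrow> nat) set) E"
  \<comment> \<open>The vacuous condition matches the general index set in
    \<open>bounded_ds_weights\<close>.\<close>
  let ?Psi = "\<lambda>w p \<alpha>. if \<alpha> \<in> UNIV then awt a w \<alpha> *\<^sub>C p else 0"
  have L: "hilbert_space ?L" by (rule E.ds_hilbert)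
  have w: "(\<lambda>i. (cmod (awt a w i))\<^sup>2) summable_on UNIV" if "w \<in> Bd" for w :: "complex ^ 'd"
    by (rule awt_summable[OF awt_a_has_sum[OF that that]])
  have Psi: "bounded_op E ?L (?Psi w)" if "w \<in> Bd" for w
    by (rule bounded_ds_weights[OF E w[OF that]])
  have ker: "adj E ?L (?Psi z) (?Psi w e) = k z w *\<^sub>C e" if z: "z \<in> Bd" and w: "w \<in> Bd" and e: "e \<in> E.C" for z w e
  proof (rule adj_eqI[OF E pre_hilbert_of_hilbert[OF L] Psi[OF z]])
    show "?Psi w e \<in> carrier ?L" by (rule bounded_opD(1)[OF Psi[OF w] e])
    fix h assume h: "h \<in> E.C"
    have "cip ?L (?Psi z h) (?Psi w e) = k w z * cip E h e"
      by (rule E.ds_weights_cip[OF h e awt_a_has_sum[OF w z]])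
    also have "\<dots> = cip E h (k z w *\<^sub>C e)"
      using h e kernel_cnj[OF k z w] by (simp add: E.cip_scale_right)
    finally show "cip ?L (?Psi z h) (?Psi w e) = cip E h (k z w *\<^sub>C e)" .
  qed (use e in simp)
  have kap: "(\<lambda>z. if z \<in> Bd then adj E ?L (?Psi z) (?Psi w e) else 0) = kap k w e"
    if "w \<in> Bd" "e \<in> E.C" for w e
    using ker[OF _ that] by (auto simp: kap_def fun_eq_iff)
  show thesis
  proof (rule feature_space_exists[OF L E Psi])
    fix G :: "(complex ^ 'd \<Rightarrow> 'e) hilbert"
    assume G: "hilbert_space G"
      "\<And>F x. F \<in> carrier G \<Longrightarrow> F x \<in> carrier E"
      "\<And>F x. F \<in> carrier G \<Longrightarrow> x \<notin> Bd \<Longrightarrow> F x = 0"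
      "\<And>w e. w \<in> Bd \<Longrightarrow> e \<in> carrier E \<Longrightarrow> (\<lambda>z. if z \<in> Bd then adj E ?L (?Psi z) (?Psi w e) else 0) \<in> carrier G"
      "\<And>F w e. F \<in> carrier G \<Longrightarrow> w \<in> Bd \<Longrightarrow> e \<in> carrier E \<Longrightarrow>
        cip G F (\<lambda>z. if z \<in> Bd then adj E ?L (?Psi z) (?Psi w e) else 0) = cip E (F w) e"
      "\<And>x. \<exists>B. \<forall>F\<in>carrier G. hnorm E (F x) \<le> B * hnorm G F"
    show thesis
    proof (rule that[OF G(1)])
      show "F x \<in> E.C" if "F \<in> carrier G" for F x by (rule G(2)[OF that])
      show "F x = 0" if "F \<in> carrier G" "x \<notin> Bd" for F x by (rule G(3)[OF that])
      show "\<exists>B. \<forall>F\<in>carrier G. hnorm E (F x) \<le> B * hnorm G F" for x by (rule G(6))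
      show "kap k w e \<in> carrier G" if "w \<in> Bd" "e \<in> E.C" for w e
        using G(4)[OF that] kap[OF that] by simp
      show "cip G F (kap k w e) = cip E (F w) e" if "F \<in> carrier G" "w \<in> Bd" "e \<in> E.C" for F w e
        using G(5)[OF that] kap[OF that(2,3)] by simp
    qed
  qed
qed

definition complex_hilbert :: "complex hilbert"
  where "complex_hilbert = \<lparr>carrier = UNIV, cip = \<lambda>x y. x * cnj y\<rparr>"

lemma complex_hilbert: "hilbert_space complex_hilbert"
proof -
  interpret pre_hilbert complex_hilbert
    by unfold_locales
      (auto simp: complex_hilbert_def complex_vector.subspace_def scaleC_complex_def algebra_simps
        complex_mult_cnj complex_eq_iff sum_power2_eq_zero_iff)
  have n: "nrm x = cmod x" for x :: complex
    by (simp add: hnorm_def complex_hilbert_def complex_mult_cnj cmod_def)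
  show ?thesis
  proof (rule hilbert_spaceI)
    fix s :: "nat \<Rightarrow> complex"
    assume "\<And>e. e > 0 \<Longrightarrow> \<exists>N. \<forall>m\<ge>N. \<forall>n\<ge>N. nrm (s m - s n) < e"
    then have "Cauchy s" by (simp add: Cauchy_def n dist_norm)
    then obtain l where "s \<longlonglongrightarrow> l" using Cauchy_convergent convergent_def by blast
    then have "(\<lambda>n. nrm (s n - l)) \<longlonglongrightarrow> 0" unfolding n by (simp add: tendsto_norm_zero LIM_zero)
    then show "\<exists>l\<in>C. (\<lambda>n. nrm (s n - l)) \<longlonglongrightarrow> 0" by (auto simp: complex_hilbert_def)
  qed
qed

abbreviation "kf w \<equiv> (\<lambda>z. if z \<in> Bd then k z w else 0)"

text \<open>The scalar case of the vector-valued construction, with complex numbers as coefficient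
  space.\<close>

lemma is_rkhs_Hk: "is_rkhs Bd k (Hk k)"
proof -
  have kap: "kap k w 1 = kf w" for w by (auto simp: kap_def scaleC_complex_def)
  show ?thesis
  proof (rule vv_rkhs_exists[OF complex_hilbert])
    fix G :: "(complex ^ 'd \<Rightarrow> complex) hilbert"
    assume G: "hilbert_space G"
      "\<And>F x. F \<in> carrier G \<Longrightarrow> x \<notin> Bd \<Longrightarrow> F x = 0"
      "\<And>w e. w \<in> Bd \<Longrightarrow> e \<in> carrier complex_hilbert \<Longrightarrow> kap k w e \<in> carrier G"
      "\<And>F w e. F \<in> carrier G \<Longrightarrow> w \<in> Bd \<Longrightarrow> e \<in> carrier complex_hilbert \<Longrightarrow>
        cip G F (kap k w e) = cip complex_hilbert (F w) e"
    have "is_rkhs Bd k G"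
      unfolding is_rkhs_def kap[symmetric]
      using G(1,2) G(3)[of _ 1] G(4)[of _ _ 1] by (simp add: complex_hilbert_def)
    then show ?thesis unfolding rkhs_def by (rule someI)
  qed
qed

lemma Hk_hilbert: "hilbert_space (Hk k)"
  and Hk_off: "f \<in> carrier (Hk k) \<Longrightarrow> x \<notin> Bd \<Longrightarrow> f x = 0"
  and Hk_kf: "w \<in> Bd \<Longrightarrow> kf w \<in> carrier (Hk k)"
  and Hk_rep: "w \<in> Bd \<Longrightarrow> f \<in> carrier (Hk k) \<Longrightarrow> cip (Hk k) f (kf w) = f w"
  using is_rkhs_Hk unfolding is_rkhs_def by blast+

lemma Hk_total:
  assumes "f \<in> carrier (Hk k)" "\<And>w. w \<in> Bd \<Longrightarrow> cip (Hk k) f (kf w) = 0"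
  shows "f = 0"
proof
  fix x show "f x = 0 x" using assms Hk_rep[of x f] Hk_off[of f x] by (cases "x \<in> Bd") auto
qed

lemma kf_tensor: "kf w \<otimes>\<^sub>e e = kap k w e"
  by (auto simp: elem_tensor_def kap_def)

end

section \<open>Tensor products with a Hilbert space\<close>

lemma bounded_op_scale:
  assumes H: "pre_hilbert H"
  shows "bounded_op H H (\<lambda>x. c *\<^sub>C x)"
proof -
  interpret pre_hilbert H by fact
  show ?thesis unfolding bounded_op_def
    by (auto simp: complex_vector.scale_right_distrib complex_vector.scale_left_commute nrm_scale intro: exI[of _ "cmod c"])
qed

context
  fixes a b :: "nat \<Rightarrow> real" and k :: "complex ^ 'd::finite \<Rightarrow> complex ^ 'd \<Rightarrow> complex"
    and E :: "('e::complex_vector) hilbert"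
  assumes k: "regular_cnp_kernel a b k" and E: "hilbert_space E"
begin

text \<open>A kernel space does not visibly contain the elementary tensors. For fixed e the map from
  k_w to \<open>kap k w e\<close> extends by its Gram matrix, which is the squared norm of e times
  that of the k_w. Its adjoint sends \<open>kap k z e'\<close> to a multiple of k_z, and evaluation
  shows that the extension is f -> f \<otimes> e.\<close>

lemma elem_tensor_rkhs:
  assumes G: "hilbert_space G"
    and vals: "\<And>F x. F \<in> carrier G \<Longrightarrow> F x \<in> carrier E"
    and off: "\<And>F x. F \<in> carrier G \<Longrightarrow> x \<notin> Bd \<Longrightarrow> F x = 0"
    and kap: "\<And>w e. w \<in> Bd \<Longrightarrow> e \<in> carrier E \<Longrightarrow> kap k w e \<in> carrier G"
    and rep: "\<And>F w e. F \<in> carrier G \<Longrightarrow> w \<in> Bd \<Longrightarrow> e \<in> carrier E \<Longrightarrow> cip G F (kap k w e) = cip E (F w) e"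
    and eval: "\<And>x. \<exists>B. \<forall>F\<in>carrier G. hnorm E (F x) \<le> B * hnorm G F"
  shows "is_tensor (Hk k) E G"
proof -
  interpret G: hilbert_space G by fact
  interpret E: hilbert_space E by fact
  interpret H: hilbert_space "Hk k" by (rule Hk_hilbert[OF k])
  let ?kf = "\<lambda>w z. if z \<in> Bd then k z w else 0"
  note kfC = Hk_kf[OF k] and Hrep = Hk_rep[OF k]
  have kap_cip: "cip G (kap k w e) (kap k z e') = k z w * cip E e e'"
    if "w \<in> Bd" "z \<in> Bd" "e \<in> E.C" "e' \<in> E.C" for w z e e'
    using rep[OF kap[OF that(1,3)] that(2,4)] that by (simp add: kap_def E.cip_scale_left)
  have ex: "\<forall>e\<in>E.C. \<exists>V. bounded_op (Hk k) G V \<and> (\<forall>w\<in>Bd. V (?kf w) = kap k w e)"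
  proof
    fix e assume e: "e \<in> E.C"
    have "\<exists>V. bounded_op (Hk k) G V \<and> (\<forall>w\<in>Bd. V (?kf w) = kap k w e) \<and>
      (\<forall>f\<in>H.C. \<forall>g\<in>H.C. cip G (V f) (V g) = cip (Hk k) (cip E e e *\<^sub>C f) g)"
    proof (rule gram_extension[OF H.hilbert_space_axioms G bounded_op_scale[OF H.pre_hilbert_axioms, of "cip E e e"]])
      show "?kf w \<in> H.C" if "w \<in> Bd" for w by (rule kfC[OF that])
      show "kap k w e \<in> G.C" if "w \<in> Bd" for w by (rule kap[OF that e])
      show "f = 0" if "f \<in> H.C" "\<And>w. w \<in> Bd \<Longrightarrow> cip (Hk k) f (?kf w) = 0" for f by (rule Hk_total[OF k that])
      fix w z :: "complex ^ 'd" assume w: "w \<in> Bd" and z: "z \<in> Bd"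
      show "cip G (kap k w e) (kap k z e) = cip (Hk k) (cip E e e *\<^sub>C ?kf w) (?kf z)"
        using kap_cip[OF w z e e] Hrep[OF z kfC[OF w]] kfC[OF w] kfC[OF z] z
        by (simp add: H.cip_scale_left mult.commute)
    qed
    then show "\<exists>V. bounded_op (Hk k) G V \<and> (\<forall>w\<in>Bd. V (?kf w) = kap k w e)" by blast
  qed
  from bchoice[OF ex] obtain V where
    "\<forall>e\<in>E.C. bounded_op (Hk k) G (V e) \<and> (\<forall>w\<in>Bd. V e (?kf w) = kap k w e)" ..
  then have V: "\<And>e. e \<in> E.C \<Longrightarrow> bounded_op (Hk k) G (V e)"
    and Vkf: "\<And>e w. e \<in> E.C \<Longrightarrow> w \<in> Bd \<Longrightarrow> V e (?kf w) = kap k w e" by blast+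
  have VC: "V e f \<in> G.C" if "e \<in> E.C" "f \<in> H.C" for e f by (rule bounded_opD(1)[OF V[OF that(1)] that(2)])
  note Va = adj[OF H.hilbert_space_axioms G.pre_hilbert_axioms V]
    and Val = adj_left[OF H.hilbert_space_axioms G.pre_hilbert_axioms V]
    and Vab = bounded_op_adj[OF H.hilbert_space_axioms G.pre_hilbert_axioms V]
  have adj_kap: "adj (Hk k) G (V e) (kap k z e') = cip E e' e *\<^sub>C ?kf z"
    if z: "z \<in> Bd" and e: "e \<in> E.C" "e' \<in> E.C" for z e e'
  proof -
    let ?d = "adj (Hk k) G (V e) (kap k z e') - cip E e' e *\<^sub>C ?kf z"
    have aC: "adj (Hk k) G (V e) (kap k z e') \<in> H.C" by (rule Va(1)[OF e(1) kap[OF z e(2)]])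
    have "?d = 0"
    proof (rule Hk_total[OF k])
      show "?d \<in> H.C" using aC kfC[OF z] by simp
      fix w :: "complex ^ 'd" assume w: "w \<in> Bd"
      have "cip (Hk k) (adj (Hk k) G (V e) (kap k z e')) (?kf w) = k w z * cip E e' e"
        using Val[OF e(1) kap[OF z e(2)] kfC[OF w]] Vkf[OF e(1) w] kap_cip[OF z w e(2,1)] by simp
      moreover have "cip (Hk k) (cip E e' e *\<^sub>C ?kf z) (?kf w) = k w z * cip E e' e"
        using Hrep[OF w kfC[OF z]] kfC[OF w] kfC[OF z] w by (simp add: H.cip_scale_left mult.commute)
      ultimately show "cip (Hk k) ?d (?kf w) = 0"
        using aC kfC[OF w] kfC[OF z] by (simp add: H.cip_diff_left)
    qed
    then show ?thesis by simp
  qed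
  have V_eq: "V e f = f \<otimes>\<^sub>e e" if e: "e \<in> E.C" and f: "f \<in> H.C" for e f
  proof
    fix z
    show "V e f z = (f \<otimes>\<^sub>e e) z"
    proof (cases "z \<in> Bd")
      case True
      have "V e f z = f z *\<^sub>C e"
      proof (rule E.eq_if_cip_eq)
        fix e' assume e': "e' \<in> E.C"
        have "cip E (V e f z) e' = cip G (V e f) (kap k z e')" by (rule rep[OF VC[OF e f] True e', symmetric])
        also have "\<dots> = cip (Hk k) f (cip E e' e *\<^sub>C ?kf z)"
          using Va(2)[OF e kap[OF True e'] f] adj_kap[OF True e e'] by simp
        also have "\<dots> = cip E e e' * f z"
          using f kfC[OF True] Hrep[OF True f] E.cip_swap[OF e e'] by (simp add: H.cip_scale_right)
        finally show "cip E (V e f z) e' = cip E (f z *\<^sub>C e) e'"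
          using e e' by (simp add: E.cip_scale_left)
      qed (use e vals[OF VC[OF e f]] in auto)
      then show ?thesis by (simp add: elem_tensor_def)
    next
      case False
      then show ?thesis using off[OF VC[OF e f]] Hk_off[OF k f] by (simp add: elem_tensor_def)
    qed
  qed
  have cip_elem: "cip G (f \<otimes>\<^sub>e e) (g \<otimes>\<^sub>e e') = cip (Hk k) f g * cip E e e'"
    if f: "f \<in> H.C" and g: "g \<in> H.C" and e: "e \<in> E.C" and e': "e' \<in> E.C" for f g e e'
  proof -
    \<comment> \<open>The product of an adjoint and an extension is a scalar on kernel functions,
      hence everywhere; this is the inner product formula for elementary tensors.\<close>
    have "adj (Hk k) G (V e) (V e' g) = cip E e' e *\<^sub>C g"
    proof (rule bounded_op_eq_on_total[OF H.hilbert_space_axioms H.pre_hilbert_axioms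
          bounded_op_comp[OF V[OF e'] Vab[OF e] G.pre_hilbert_axioms]
          bounded_op_scale[OF H.pre_hilbert_axioms], where I = Bd and u = ?kf])
      show "adj (Hk k) G (V e) (V e' (?kf z)) = cip E e' e *\<^sub>C ?kf z" if "z \<in> Bd" for z
        using adj_kap[OF that e e'] Vkf[OF e' that] by simp
      show "?kf w \<in> H.C" if "w \<in> Bd" for w by (rule kfC[OF that])
      show "f = 0" if "f \<in> H.C" "\<And>w. w \<in> Bd \<Longrightarrow> cip (Hk k) f (?kf w) = 0" for f by (rule Hk_total[OF k that])
    qed (rule g)
    then have "cip G (V e f) (V e' g) = cip (Hk k) f (cip E e' e *\<^sub>C g)"
      using Va(2)[OF e VC[OF e' g] f] by simp
    then show ?thesis using V_eq f g e e' E.cip_swap[OF e e'] by (simp add: H.cip_scale_right)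
  qed
  let ?X = "{f \<otimes>\<^sub>e e | f e. f \<in> H.C \<and> e \<in> E.C}"
  have XG: "?X \<subseteq> G.C"
  proof clarify
    fix f e assume "f \<in> H.C" "e \<in> E.C"
    then show "f \<otimes>\<^sub>e e \<in> G.C" using VC V_eq by metis
  qed
  have spG: "cspan ?X \<subseteq> G.C" by (rule complex_vector.span_minimal[OF XG G.csub])
  have "htop G closure_of (cspan ?X) = G.C"
  proof (rule G.closed_subspace_eq_if_total[OF G.closed_subspace_closure(1)[OF _ spG]])
    fix F assume F: "F \<in> G.C" and o: "\<And>s. s \<in> htop G closure_of (cspan ?X) \<Longrightarrow> cip G F s = 0"
    show "F = 0"
    proof
      fix w
      show "F w = 0 w"
      proof (cases "w \<in> Bd")
        case True
        have "F w = 0"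
        proof (rule E.eq_if_cip_eq)
          fix e assume e: "e \<in> E.C"
          have "?kf w \<otimes>\<^sub>e e \<in> ?X" using kfC[OF True] e by blast
          then have "kap k w e \<in> cspan ?X" unfolding kf_tensor[OF k] by (rule complex_vector.span_base)
          then have "kap k w e \<in> htop G closure_of (cspan ?X)"
            using G.closed_subspace_closure(2)[OF complex_vector.subspace_span spG] by blast
          then show "cip E (F w) e = cip E 0 e" using o rep[OF F True e] e by simp
        qed (use vals[OF F] in auto)
        then show ?thesis by simp
      qed (use off[OF F] in simp)
    qed
  qed (rule complex_vector.subspace_span)
  then show ?thesis
    unfolding is_tensor_def
  proof (intro conjI ballI allI G)
    show "F x \<in> E.C" if "F \<in> G.C" for F x by (rule vals[OF that])
    show "\<exists>B. \<forall>F\<in>G.C. hnorm E (F x) \<le> B * hnorm G F" for x by (rule eval)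
    show "f \<otimes>\<^sub>e e \<in> G.C" if "f \<in> H.C" "e \<in> E.C" for f e using XG that by blast
  qed (rule cip_elem)
qed

lemma is_tensor_tensor: "is_tensor (Hk k) E (Hk k \<otimes>\<^sub>H E)"
proof (rule vv_rkhs_exists[OF k E])
  fix G :: "(complex ^ 'd \<Rightarrow> 'e) hilbert"
  assume G: "hilbert_space G"
    "\<And>F x. F \<in> carrier G \<Longrightarrow> F x \<in> carrier E"
    "\<And>F x. F \<in> carrier G \<Longrightarrow> x \<notin> Bd \<Longrightarrow> F x = 0"
    "\<And>w e. w \<in> Bd \<Longrightarrow> e \<in> carrier E \<Longrightarrow> kap k w e \<in> carrier G"
    "\<And>F w e. F \<in> carrier G \<Longrightarrow> w \<in> Bd \<Longrightarrow> e \<in> carrier E \<Longrightarrow> cip G F (kap k w e) = cip E (F w) e"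
    "\<And>x. \<exists>B. \<forall>F\<in>carrier G. hnorm E (F x) \<le> B * hnorm G F"
  have "is_tensor (Hk k) E G"
    by (rule elem_tensor_rkhs[OF G(1)]) (fact G)+
  then show ?thesis unfolding tensor_def by (rule someI)
qed

lemma K_hilbert: "hilbert_space (Hk k \<otimes>\<^sub>H E)"
  and K_values: "F \<in> carrier (Hk k \<otimes>\<^sub>H E) \<Longrightarrow> F x \<in> carrier E"
  and K_elem: "f \<in> carrier (Hk k) \<Longrightarrow> e \<in> carrier E \<Longrightarrow> f \<otimes>\<^sub>e e \<in> carrier (Hk k \<otimes>\<^sub>H E)"
  and K_elem_cip: "f \<in> carrier (Hk k) \<Longrightarrow> g \<in> carrier (Hk k) \<Longrightarrow> e \<in> carrier E \<Longrightarrow> e' \<in> carrier E \<Longrightarrow>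
    cip (Hk k \<otimes>\<^sub>H E) (f \<otimes>\<^sub>e e) (g \<otimes>\<^sub>e e') = cip (Hk k) f g * cip E e e'"
  using is_tensor_tensor unfolding is_tensor_def by blast+

lemma K_elem_total:
  assumes d: "d \<in> carrier (Hk k \<otimes>\<^sub>H E)"
    and o: "\<And>f e. f \<in> carrier (Hk k) \<Longrightarrow> e \<in> carrier E \<Longrightarrow> cip (Hk k \<otimes>\<^sub>H E) (f \<otimes>\<^sub>e e) d = 0"
  shows "d = 0"
proof -
  let ?K = "Hk k \<otimes>\<^sub>H E"
  interpret K: hilbert_space ?K by (rule K_hilbert)
  let ?X = "{f \<otimes>\<^sub>e e | f e. f \<in> carrier (Hk k) \<and> e \<in> carrier E}"
  have c: "closed_subspace ?K (orth_compl ?K {d})" using d by (intro K.orth_compl_closed) simp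
  have "?X \<subseteq> orth_compl ?K {d}" using K_elem o by (auto simp: orth_compl_def)
  then have "cspan ?X \<subseteq> orth_compl ?K {d}"
    by (rule complex_vector.span_minimal[OF _ K.closed_subspaceD(1)[OF c]])
  then have "htop ?K closure_of (cspan ?X) \<subseteq> orth_compl ?K {d}"
    using c by (intro closure_of_minimal) (auto simp: closed_subspace_def)
  moreover have "htop ?K closure_of (cspan ?X) = K.C" using is_tensor_tensor unfolding is_tensor_def by blast
  ultimately have "cip ?K d d = 0" using d by (auto simp: orth_compl_def)
  then show ?thesis using K.cip_self_0D[OF d] by simp
qed

lemma K_total_pairs:
  assumes d: "d \<in> carrier (Hk k \<otimes>\<^sub>H E)"
    and o: "\<And>p. p \<in> carrier (Hk k) \<times> carrier E \<Longrightarrow> cip (Hk k \<otimes>\<^sub>H E) d (fst p \<otimes>\<^sub>e snd p) = 0"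
  shows "d = 0"
proof (rule K_elem_total[OF d])
  fix f e assume fe: "f \<in> carrier (Hk k)" "e \<in> carrier E"
  interpret K: hilbert_space "Hk k \<otimes>\<^sub>H E" by (rule K_hilbert)
  show "cip (Hk k \<otimes>\<^sub>H E) (f \<otimes>\<^sub>e e) d = 0"
    using o[of "(f, e)"] fe K.cip_swap[OF K_elem[OF fe] d] by simp
qed

lemma K_eval_bounded: "bounded_op (Hk k \<otimes>\<^sub>H E) E (\<lambda>F. F x)"
  using K_values is_tensor_tensor unfolding bounded_op_def is_tensor_def by (simp add: scaleC_fun_def)

lemma K_kap: "w \<in> Bd \<Longrightarrow> e \<in> carrier E \<Longrightarrow> kap k w e \<in> carrier (Hk k \<otimes>\<^sub>H E)"
  using K_elem[OF Hk_kf[OF k]] unfolding kf_tensor[OF k] by blast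

text \<open>\<open>is_tensor\<close> mentions no kernel. Its bounded evaluations have adjoints, and
  the adjoint at w applied to e is compared with \<open>kap k w e\<close> on elementary tensors,
  which are total.\<close>

lemma K_rep:
  assumes F: "F \<in> carrier (Hk k \<otimes>\<^sub>H E)" and w: "w \<in> Bd" and e: "e \<in> carrier E"
  shows "cip (Hk k \<otimes>\<^sub>H E) F (kap k w e) = cip E (F w) e"
proof -
  let ?K = "Hk k \<otimes>\<^sub>H E"
  interpret K: hilbert_space ?K by (rule K_hilbert)
  interpret E: hilbert_space E by (rule E)
  note ad = adj[OF K_hilbert E.pre_hilbert_axioms K_eval_bounded e]
  have dC: "adj ?K E (\<lambda>F. F w) e - kap k w e \<in> K.C" using ad(1) K_kap[OF w e] by simp
  have "adj ?K E (\<lambda>F. F w) e - kap k w e = 0"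
  proof (rule K_elem_total[OF dC])
    fix f e' assume f: "f \<in> carrier (Hk k)" and e': "e' \<in> carrier E"
    have "cip ?K (f \<otimes>\<^sub>e e') (kap k w e) = f w * cip E e' e"
      using K_elem_cip[OF f Hk_kf[OF k w] e' e] Hk_rep[OF k w f] unfolding kf_tensor[OF k] by simp
    moreover have "cip ?K (f \<otimes>\<^sub>e e') (adj ?K E (\<lambda>F. F w) e) = f w * cip E e' e"
      using ad(2)[OF K_elem[OF f e']] e e' by (simp add: elem_tensor_def E.cip_scale_left)
    ultimately show "cip ?K (f \<otimes>\<^sub>e e') (adj ?K E (\<lambda>F. F w) e - kap k w e) = 0"
      using ad(1) K_kap[OF w e] K_elem[OF f e'] by (simp add: K.cip_diff_right)
  qed
  then have "adj ?K E (\<lambda>F. F w) e = kap k w e" by simp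
  then show ?thesis using ad(2)[OF F] by simp
qed

text \<open>Vanishing off the ball is likewise derived: the adjoint of such an evaluation is
  orthogonal to all elementary tensors, since scalar functions vanish there.\<close>

lemma K_off:
  assumes F: "F \<in> carrier (Hk k \<otimes>\<^sub>H E)" and w: "w \<notin> Bd"
  shows "F w = 0"
proof -
  let ?K = "Hk k \<otimes>\<^sub>H E"
  interpret E: hilbert_space E by (rule E)
  show ?thesis
  proof (rule E.eq_if_cip_eq)
    fix e assume e: "e \<in> E.C"
    note ad = adj[OF K_hilbert E.pre_hilbert_axioms K_eval_bounded[of w] e]
    have "adj ?K E (\<lambda>F. F w) e = 0"
    proof (rule K_elem_total[OF ad(1)])
      fix f e' assume f: "f \<in> carrier (Hk k)" and e': "e' \<in> carrier E"
      show "cip ?K (f \<otimes>\<^sub>e e') (adj ?K E (\<lambda>F. F w) e) = 0"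
        using ad(2)[OF K_elem[OF f e']] Hk_off[OF k f w] e by (simp add: elem_tensor_def)
    qed
    then show "cip E (F w) e = cip E 0 e"
      using ad(2)[OF F] F e pre_hilbert.cip_zero_right[OF pre_hilbert_of_hilbert[OF K_hilbert] F] by simp
  qed (use K_values[OF F] in auto)
qed

lemma K_eqI:
  assumes F: "F \<in> carrier (Hk k \<otimes>\<^sub>H E)" and G: "G \<in> carrier (Hk k \<otimes>\<^sub>H E)"
    and "\<And>w e. w \<in> Bd \<Longrightarrow> e \<in> carrier E \<Longrightarrow> cip (Hk k \<otimes>\<^sub>H E) F (kap k w e) = cip (Hk k \<otimes>\<^sub>H E) G (kap k w e)"
  shows "F = G"
proof
  interpret E: hilbert_space E by (rule E)
  fix w show "F w = G w"
  proof (cases "w \<in> Bd")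
    case True
    show ?thesis
      by (rule E.eq_if_cip_eq) (use True assms K_rep[OF F True] K_rep[OF G True] K_values[OF F] K_values[OF G] in auto)
  qed (simp add: K_off[OF F] K_off[OF G])
qed

lemma K_total:
  assumes F: "F \<in> carrier (Hk k \<otimes>\<^sub>H E)"
    and o: "\<And>p. p \<in> Bd \<times> carrier E \<Longrightarrow> cip (Hk k \<otimes>\<^sub>H E) F (kap k (fst p) (snd p)) = 0"
  shows "F = 0"
proof -
  interpret K: hilbert_space "Hk k \<otimes>\<^sub>H E" by (rule K_hilbert)
  show ?thesis
  proof (rule K_eqI[OF F K.zero_c])
    fix w :: "complex ^ 'd" and e assume "w \<in> Bd" "e \<in> carrier E"
    then show "cip (Hk k \<otimes>\<^sub>H E) F (kap k w e) = cip (Hk k \<otimes>\<^sub>H E) 0 (kap k w e)"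
      using o[of "(w, e)"] K_kap[of w e] by simp
  qed
qed

lemma kap_cip:
  assumes "w \<in> Bd" "z \<in> Bd" "e \<in> carrier E" "e' \<in> carrier E"
  shows "cip (Hk k \<otimes>\<^sub>H E) (kap k w e) (kap k z e') = k z w * cip E e e'"
  using K_rep[OF K_kap[OF assms(1,3)] assms(2,4)] assms hilbert_space.cip_scale[OF E assms(3,4)]
  by (simp add: kap_def)

text \<open>\<open>tensor_op\<close> is specified only on elementary tensors. These are total, so
  any bounded U with the right values there agrees with the choice on the carrier.\<close>

lemma tensor_op_eq:
  assumes L: "pre_hilbert L" and U: "bounded_op (Hk k \<otimes>\<^sub>H E) L U"
    and eq: "\<And>f e. f \<in> carrier (Hk k) \<Longrightarrow> e \<in> carrier E \<Longrightarrow> U (f \<otimes>\<^sub>e e) = A f \<otimes>\<^sub>e B e"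
    and L_def: "L = H' \<otimes>\<^sub>H E'"
    and F: "F \<in> carrier (Hk k \<otimes>\<^sub>H E)"
  shows "tensor_op (Hk k) E H' E' A B F = U F"
proof -
  have ex: "bounded_op (Hk k \<otimes>\<^sub>H E) (H' \<otimes>\<^sub>H E') U \<and> (\<forall>f\<in>carrier (Hk k). \<forall>e\<in>carrier E. U (f \<otimes>\<^sub>e e) = A f \<otimes>\<^sub>e B e)"
    using U eq L_def by blast
  have R: "bounded_op (Hk k \<otimes>\<^sub>H E) (H' \<otimes>\<^sub>H E') (tensor_op (Hk k) E H' E' A B) \<and>
     (\<forall>f\<in>carrier (Hk k). \<forall>e\<in>carrier E. tensor_op (Hk k) E H' E' A B (f \<otimes>\<^sub>e e) = A f \<otimes>\<^sub>e B e)"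
    unfolding tensor_op_def by (rule someI[where P = "\<lambda>R. bounded_op (Hk k \<otimes>\<^sub>H E) (H' \<otimes>\<^sub>H E') R \<and>
     (\<forall>f\<in>carrier (Hk k). \<forall>e\<in>carrier E. R (f \<otimes>\<^sub>e e) = A f \<otimes>\<^sub>e B e)", OF ex])
  show ?thesis
  proof (rule bounded_op_eq_on_total[OF K_hilbert L _ U, where I = "carrier (Hk k) \<times> carrier E" and u = "\<lambda>p. fst p \<otimes>\<^sub>e snd p"])
    show "bounded_op (Hk k \<otimes>\<^sub>H E) L (tensor_op (Hk k) E H' E' A B)" using R L_def by blast
    show "fst p \<otimes>\<^sub>e snd p \<in> carrier (Hk k \<otimes>\<^sub>H E)" if "p \<in> carrier (Hk k) \<times> carrier E" for p
      using that K_elem by auto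
    show "tensor_op (Hk k) E H' E' A B (fst p \<otimes>\<^sub>e snd p) = U (fst p \<otimes>\<^sub>e snd p)"
      if "p \<in> carrier (Hk k) \<times> carrier E" for p
      using that R eq by auto
    show "d = 0" if "d \<in> carrier (Hk k \<otimes>\<^sub>H E)"
      "\<And>p. p \<in> carrier (Hk k) \<times> carrier E \<Longrightarrow> cip (Hk k \<otimes>\<^sub>H E) d (fst p \<otimes>\<^sub>e snd p) = 0" for d
      by (rule K_total_pairs[OF that])
  qed (rule F)
qed

end

text \<open>Pointwise application of V has no evident bound, so the operator is first obtained from
  the Gram matrix on kernel functions and then identified by evaluating at each point. It is used
  for \<tau>, for its inverse \<sigma> and for inclusions of closed subspaces of E.\<close>

lemma tensor_isometry:
  fixes E :: "('e::complex_vector) hilbert" and E' :: "('f::complex_vector) hilbert"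
  assumes k: "regular_cnp_kernel a b k" and E: "hilbert_space E" and E': "hilbert_space E'"
    and V: "bounded_op E E' V" and iso: "\<And>x y. x \<in> carrier E \<Longrightarrow> y \<in> carrier E \<Longrightarrow> cip E' (V x) (V y) = cip E x y"
  shows "bounded_op (Hk k \<otimes>\<^sub>H E) (Hk k \<otimes>\<^sub>H E') (\<lambda>F z. V (F z))"
    "\<And>F G. F \<in> carrier (Hk k \<otimes>\<^sub>H E) \<Longrightarrow> G \<in> carrier (Hk k \<otimes>\<^sub>H E) \<Longrightarrow>
      cip (Hk k \<otimes>\<^sub>H E') (\<lambda>z. V (F z)) (\<lambda>z. V (G z)) = cip (Hk k \<otimes>\<^sub>H E) F G"
    "\<And>F. F \<in> carrier (Hk k \<otimes>\<^sub>H E) \<Longrightarrow> tensor_op (Hk k) E (Hk k) E' (\<lambda>f. f) V F = (\<lambda>z. V (F z))"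
proof -
  let ?K = "Hk k \<otimes>\<^sub>H E" and ?K' = "Hk k \<otimes>\<^sub>H E'"
  interpret E: hilbert_space E by fact
  interpret E': hilbert_space E' by fact
  note KH = K_hilbert[OF k E] and KH' = K_hilbert[OF k E']
  interpret K: hilbert_space ?K by (rule KH)
  interpret K': hilbert_space ?K' by (rule KH')
  note V' = bounded_opD[OF V]
  have "\<exists>U. bounded_op ?K ?K' U \<and> (\<forall>p\<in>Bd \<times> E.C. U (kap k (fst p) (snd p)) = kap k (fst p) (V (snd p))) \<and>
    (\<forall>F\<in>K.C. \<forall>G\<in>K.C. cip ?K' (U F) (U G) = cip ?K F G)"
  proof (rule gram_extension[OF KH KH' bounded_op_id])
    show "kap k (fst p) (snd p) \<in> K.C" if "p \<in> Bd \<times> E.C" for p using that K_kap[OF k E] by auto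
    show "kap k (fst p) (V (snd p)) \<in> K'.C" if "p \<in> Bd \<times> E.C" for p using that K_kap[OF k E'] V' by auto
    show "F = 0" if "F \<in> K.C" "\<And>p. p \<in> Bd \<times> E.C \<Longrightarrow> cip ?K F (kap k (fst p) (snd p)) = 0" for F
      by (rule K_total[OF k E that])
    show "cip ?K' (kap k (fst p) (V (snd p))) (kap k (fst q) (V (snd q))) = cip ?K (kap k (fst p) (snd p)) (kap k (fst q) (snd q))"
      if "p \<in> Bd \<times> E.C" "q \<in> Bd \<times> E.C" for p q
    proof -
      have "fst p \<in> Bd" "fst q \<in> Bd" "snd p \<in> E.C" "snd q \<in> E.C" using that by auto
      then show ?thesis using kap_cip[OF k E] kap_cip[OF k E'] V' iso by simp
    qed
  qed
  then obtain U where U: "bounded_op ?K ?K' U" "\<And>p. p \<in> Bd \<times> E.C \<Longrightarrow> U (kap k (fst p) (snd p)) = kap k (fst p) (V (snd p))"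
    "\<And>F G. F \<in> K.C \<Longrightarrow> G \<in> K.C \<Longrightarrow> cip ?K' (U F) (U G) = cip ?K F G"
    by blast
  have U_eq: "U F = (\<lambda>z. V (F z))" if F: "F \<in> K.C" for F
  proof
    fix z
    show "U F z = V (F z)"
    proof (rule bounded_op_eq_on_total[OF KH E'.pre_hilbert_axioms
          bounded_op_comp[OF U(1) K_eval_bounded[OF k E'] K'.pre_hilbert_axioms]
          bounded_op_comp[OF K_eval_bounded[OF k E] V E.pre_hilbert_axioms],
          where I = "Bd \<times> E.C" and u = "\<lambda>p. kap k (fst p) (snd p)"])
      show "kap k (fst p) (snd p) \<in> K.C" if "p \<in> Bd \<times> E.C" for p using that K_kap[OF k E] by auto
      show "F = 0" if "F \<in> K.C" "\<And>p. p \<in> Bd \<times> E.C \<Longrightarrow> cip ?K F (kap k (fst p) (snd p)) = 0" for F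
        by (rule K_total[OF k E that])
      show "U (kap k (fst p) (snd p)) z = V (kap k (fst p) (snd p) z)" if p: "p \<in> Bd \<times> E.C" for p
      proof -
        have "V 0 = 0" by (rule bounded_op_0[OF V E.pre_hilbert_axioms])
        then show ?thesis using U(2)[OF p] V'(3) p by (auto simp: kap_def)
      qed
    qed (rule F)
  qed
  show bV: "bounded_op ?K ?K' (\<lambda>F z. V (F z))"
    using U(1) U_eq K.add_c K.scale_c unfolding bounded_op_def by (simp del: K.add_c K.scale_c)
  show "cip ?K' (\<lambda>z. V (F z)) (\<lambda>z. V (G z)) = cip ?K F G" if "F \<in> K.C" "G \<in> K.C" for F G
    using U(3)[OF that] U_eq that by simp
  show "tensor_op (Hk k) E (Hk k) E' (\<lambda>f. f) V F = (\<lambda>z. V (F z))" if F: "F \<in> K.C" for F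
    by (rule tensor_op_eq[OF k E K'.pre_hilbert_axioms bV _ refl F])
      (use V'(3) in \<open>auto simp: elem_tensor_def fun_eq_iff\<close>)
qed

section \<open>Multiplication operators on the tensor product\<close>

abbreviation Lm :: "('d \<Rightarrow> nat) \<Rightarrow> (complex ^ 'd::finite \<Rightarrow> 'e::complex_vector) \<Rightarrow> complex ^ 'd \<Rightarrow> 'e"
  where "Lm \<alpha> F \<equiv> (\<lambda>z. mpow z \<alpha> *\<^sub>C F z)"

locale kernel_tensor =
  fixes a b :: "nat \<Rightarrow> real" and k :: "complex ^ 'd::finite \<Rightarrow> complex ^ 'd \<Rightarrow> complex"
    and E :: "('e::complex_vector) hilbert"
  assumes ker: "regular_cnp_kernel a b k" and EH: "hilbert_space E"
begin

abbreviation K where "K \<equiv> Hk k \<otimes>\<^sub>H E"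
abbreviation \<kappa> where "\<kappa> \<equiv> kap k :: complex ^ 'd \<Rightarrow> 'e \<Rightarrow> complex ^ 'd \<Rightarrow> 'e"

sublocale E: hilbert_space E by (rule EH)
sublocale K: hilbert_space K by (rule K_hilbert[OF ker EH])

lemmas kap_c [simp] = K_kap[OF ker EH]
lemmas rep = K_rep[OF ker EH]
lemmas val_c [simp] = K_values[OF ker EH]
lemmas off = K_off[OF ker EH]
lemmas eval_bounded = K_eval_bounded[OF ker EH]
lemmas kernel_cip = kap_cip[OF ker EH]

abbreviation "I \<equiv> Bd \<times> E.C"

lemma pair_c: "p \<in> I \<Longrightarrow> \<kappa> (fst p) (snd p) \<in> K.C" by auto

lemma pair_total: "F \<in> K.C \<Longrightarrow> (\<And>p. p \<in> I \<Longrightarrow> cip K F (\<kappa> (fst p) (snd p)) = 0) \<Longrightarrow> F = 0"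
  by (rule K_total[OF ker EH])

lemma op_eqI:
  assumes "pre_hilbert L" "bounded_op K L S" "bounded_op K L S'"
    and "\<And>w e. w \<in> Bd \<Longrightarrow> e \<in> E.C \<Longrightarrow> S (\<kappa> w e) = S' (\<kappa> w e)" "F \<in> K.C"
  shows "S F = S' F"
proof (rule bounded_op_eq_on_total[OF K.hilbert_space_axioms assms(1-3) pair_c pair_total _ assms(5)])
  show "S (\<kappa> (fst p) (snd p)) = S' (\<kappa> (fst p) (snd p))" if "p \<in> I" for p
    using that assms(4) by auto
qed

lemma kap_scale: "c *\<^sub>C \<kappa> w e = \<kappa> w (c *\<^sub>C e)"
  by (auto simp: kap_def scaleC_fun_def complex_vector.scale_left_commute)

subsection \<open>Multiplication by coordinates\<close>

abbreviation "LE \<equiv> direct_sum (UNIV :: ('d \<Rightarrow> nat) set) E"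

lemma awt_a_vec: "w \<in> Bd \<Longrightarrow> e \<in> E.C \<Longrightarrow> (\<lambda>\<alpha>. awt a w \<alpha> *\<^sub>C e) \<in> carrier LE"
proof -
  assume w: "w \<in> Bd" and e: "e \<in> E.C"
  show ?thesis using E.ds_weights[OF e awt_summable[OF awt_a_has_sum[OF ker w w]]] by simp
qed

text \<open>J maps F to its weighted coefficients sqrt a_\<alpha> times the constant term of
  \<open>A \<alpha> F\<close> (\<open>J_coord\<close>). In these coordinates the adjoint of
  multiplication by z_i is a weighted backward shift.\<close>

lemma J_exists: "\<exists>J. bounded_op K LE J \<and> (\<forall>p\<in>I. J (\<kappa> (fst p) (snd p)) = (\<lambda>\<alpha>. awt a (fst p) \<alpha> *\<^sub>C snd p)) \<and>
    (\<forall>F\<in>K.C. \<forall>G\<in>K.C. cip LE (J F) (J G) = cip K F G)"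
proof (rule gram_extension[OF K.hilbert_space_axioms E.ds_hilbert bounded_op_id pair_c _ pair_total])
  show "(\<lambda>\<alpha>. awt a (fst p) \<alpha> *\<^sub>C snd p) \<in> carrier LE" if "p \<in> I" for p
    using that awt_a_vec by auto
  show "cip LE (\<lambda>\<alpha>. awt a (fst p) \<alpha> *\<^sub>C snd p) (\<lambda>\<alpha>. awt a (fst q) \<alpha> *\<^sub>C snd q) =
     cip K (\<kappa> (fst p) (snd p)) (\<kappa> (fst q) (snd q))" if "p \<in> I" "q \<in> I" for p q
  proof -
    have pq: "fst p \<in> Bd" "fst q \<in> Bd" "snd p \<in> E.C" "snd q \<in> E.C" using that by auto
    show ?thesis
      using E.ds_weights_cip[OF pq(3,4) awt_a_has_sum[OF ker pq(2,1)]] kernel_cip[OF pq] by simp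
  qed
qed

definition J where "J = (SOME J. bounded_op K LE J \<and>
  (\<forall>p\<in>I. J (\<kappa> (fst p) (snd p)) = (\<lambda>\<alpha>. awt a (fst p) \<alpha> *\<^sub>C snd p)) \<and>
  (\<forall>F\<in>K.C. \<forall>G\<in>K.C. cip LE (J F) (J G) = cip K F G))"

lemma J_bounded: "bounded_op K LE J"
  and J_kap: "w \<in> Bd \<Longrightarrow> e \<in> E.C \<Longrightarrow> J (\<kappa> w e) = (\<lambda>\<alpha>. awt a w \<alpha> *\<^sub>C e)"
  and J_iso: "F \<in> K.C \<Longrightarrow> G \<in> K.C \<Longrightarrow> cip LE (J F) (J G) = cip K F G"
  using someI_ex[OF J_exists] unfolding J_def[symmetric] by auto

lemma adj_J_J: "F \<in> K.C \<Longrightarrow> adj K LE J (J F) = F"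
  by (rule adj_eqI[OF K.hilbert_space_axioms E.ds_pre_hilbert J_bounded])
    (auto simp: J_iso bounded_opD(1)[OF J_bounded])

text \<open>The weight is the one for which the feature vector of w becomes an eigenvector with
  eigenvalue conj(w_i); \<open>mweight_a_ratio\<close> bounds it.\<close>

definition shift :: "'d \<Rightarrow> (('d \<Rightarrow> nat) \<Rightarrow> 'e) \<Rightarrow> ('d \<Rightarrow> nat) \<Rightarrow> 'e"
  where "shift i x \<alpha> = of_real (sqrt (mweight a \<alpha> / mweight a (\<alpha>(i := Suc (\<alpha> i))))) *\<^sub>C x (\<alpha>(i := Suc (\<alpha> i)))"

lemma shift_bounded: "bounded_op LE LE (shift i)"
proof -
  interpret L: pre_hilbert LE by (rule E.ds_pre_hilbert)
  obtain c where c: "c \<ge> 0" "\<And>(\<alpha> :: 'd \<Rightarrow> nat) i. mweight a \<alpha> \<le> c * mweight a (\<alpha>(i := Suc (\<alpha> i)))"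
    using mweight_a_ratio[OF ker] by blast
  let ?s = "\<lambda>\<alpha>::'d \<Rightarrow> nat. \<alpha>(i := Suc (\<alpha> i))"
  have inj: "inj ?s" by (rule injI) (auto simp: fun_eq_iff split: if_splits)
  have q: "0 \<le> mweight a \<alpha> / mweight a (?s \<alpha>)" "mweight a \<alpha> / mweight a (?s \<alpha>) \<le> c" for \<alpha> :: "'d \<Rightarrow> nat"
    using c(2)[of \<alpha> i] mweight_a_pos[OF ker, of \<alpha>] mweight_a_pos[OF ker, of "?s \<alpha>"]
    by (simp_all add: pos_divide_le_eq)
  have *: "shift i x \<in> L.C \<and> L.nrm (shift i x) \<le> sqrt c * L.nrm x" if x: "x \<in> L.C" for x
  proof -
    have xC: "x \<alpha> \<in> E.C" for \<alpha> using x by (simp add: direct_sum_simps)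
    have sC: "shift i x \<alpha> \<in> E.C" if "\<alpha> \<in> UNIV" for \<alpha> using xC by (simp add: shift_def)
    have nr: "0 \<le> sqrt c * L.nrm x" using c(1) x by simp
    have "(\<Sum>\<alpha>\<in>F. (E.nrm (shift i x \<alpha>))\<^sup>2) \<le> (sqrt c * L.nrm x)\<^sup>2" if F: "finite F" for F
    proof -
      have "(\<Sum>\<alpha>\<in>F. (E.nrm (shift i x \<alpha>))\<^sup>2) \<le> (\<Sum>\<alpha>\<in>F. c * (E.nrm (x (?s \<alpha>)))\<^sup>2)"
      proof (rule sum_mono)
        fix \<alpha>
        have "(E.nrm (shift i x \<alpha>))\<^sup>2 = mweight a \<alpha> / mweight a (?s \<alpha>) * (E.nrm (x (?s \<alpha>)))\<^sup>2"
          unfolding shift_def E.nrm_scale[OF xC] power_mult_distrib norm_of_real power2_abs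
          using q(1) by (simp only: real_sqrt_pow2)
        also have "\<dots> \<le> c * (E.nrm (x (?s \<alpha>)))\<^sup>2" using q(2) by (intro mult_right_mono) auto
        finally show "(E.nrm (shift i x \<alpha>))\<^sup>2 \<le> c * (E.nrm (x (?s \<alpha>)))\<^sup>2" .
      qed
      also have "\<dots> = c * (\<Sum>\<beta>\<in>?s ` F. (E.nrm (x \<beta>))\<^sup>2)"
        by (subst sum.reindex[OF inj_on_subset[OF inj]]) (auto simp: sum_distrib_left)
      also have "\<dots> \<le> c * (L.nrm x)\<^sup>2"
        using F by (intro mult_left_mono E.ds_finite_le[OF x] c(1)) auto
      finally show ?thesis using c(1) by (simp add: power_mult_distrib)
    qed
    then show ?thesis using E.ds_memI[of UNIV "shift i x" "sqrt c * L.nrm x"] sC nr by simp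
  qed
  show ?thesis
    unfolding bounded_op_def
  proof (intro conjI ballI allI)
    show "\<exists>B. \<forall>x\<in>L.C. L.nrm (shift i x) \<le> B * L.nrm x" using * by blast
    show "shift i x \<in> L.C" if "x \<in> L.C" for x using * that by blast
    show "shift i (x + y) = shift i x + shift i y" for x y
      by (simp add: shift_def fun_eq_iff complex_vector.scale_right_distrib)
    show "shift i (c *\<^sub>C x) = c *\<^sub>C shift i x" for x c
      by (simp add: shift_def fun_eq_iff scaleC_fun_def complex_vector.scale_left_commute)
  qed
qed

text \<open>The adjoint is built first: compressing the shift by J gives a bounded operator with
  every kernel function as eigenvector for conj(w_i). Its adjoint must be multiplication by
  z_i.\<close>

lemma coordinate_bounded: "bounded_op K K (\<lambda>F z. (z $ i) *\<^sub>C F z)"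
proof -
  interpret L: pre_hilbert LE by (rule E.ds_pre_hilbert)
  let ?A = "\<lambda>F. adj K LE J (shift i (J F))"
  have Ab: "bounded_op K K ?A"
    by (rule bounded_op_comp[OF bounded_op_comp[OF J_bounded shift_bounded L.pre_hilbert_axioms]
          bounded_op_adj[OF K.hilbert_space_axioms L.pre_hilbert_axioms J_bounded] L.pre_hilbert_axioms])
  have A_kap: "?A (\<kappa> w e) = cnj (w $ i) *\<^sub>C \<kappa> w e" if w: "w \<in> Bd" and e: "e \<in> E.C" for w e
  proof -
    have "shift i (J (\<kappa> w e)) = J (cnj (w $ i) *\<^sub>C \<kappa> w e)"
    proof
      fix \<alpha> :: "'d \<Rightarrow> nat"
      let ?\<beta> = "\<alpha>(i := Suc (\<alpha> i))"
      have mp: "mpow w ?\<beta> = w $ i * mpow w \<alpha>"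
      proof -
        have "mpow w ?\<beta> = (\<Prod>j\<in>UNIV. (if j = i then w $ i else 1) * (w $ j) ^ \<alpha> j)"
          unfolding mpow_def by (rule prod.cong) auto
        then show ?thesis by (simp add: prod.distrib mpow_def)
      qed
      have "sqrt (mweight a \<alpha> / mweight a ?\<beta>) * sqrt (mweight a ?\<beta>) = sqrt (mweight a \<alpha>)"
        using mweight_a_pos[OF ker, of ?\<beta>] by (simp add: real_sqrt_divide)
      then have X: "complex_of_real (sqrt (mweight a \<alpha> / mweight a ?\<beta>)) * of_real (sqrt (mweight a ?\<beta>)) = of_real (sqrt (mweight a \<alpha>))"
        by (simp only: of_real_mult[symmetric])
      have "complex_of_real (sqrt (mweight a \<alpha> / mweight a ?\<beta>)) * awt a w ?\<beta> =
        (complex_of_real (sqrt (mweight a \<alpha> / mweight a ?\<beta>)) * of_real (sqrt (mweight a ?\<beta>))) * (cnj (w $ i) * cnj (mpow w \<alpha>))"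
        unfolding awt_def mp complex_cnj_mult by (simp only: mult.assoc)
      also have "\<dots> = cnj (w $ i) * awt a w \<alpha>"
        unfolding X awt_def by (simp only: mult_ac)
      finally have Y: "complex_of_real (sqrt (mweight a \<alpha> / mweight a ?\<beta>)) * awt a w ?\<beta> = cnj (w $ i) * awt a w \<alpha>" .
      then show "shift i (J (\<kappa> w e)) \<alpha> = J (cnj (w $ i) *\<^sub>C \<kappa> w e) \<alpha>"
        using Y J_kap[OF w e] bounded_opD(3)[OF J_bounded kap_c[OF w e]]
        by (simp add: shift_def scaleC_fun_def scaleC_scaleC)
    qed
    then show ?thesis using adj_J_J w e by simp
  qed
  have eq: "adj K K ?A F = (\<lambda>z. (z $ i) *\<^sub>C F z)" if F: "F \<in> K.C" for F
  proof
    fix z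
    note ad = adj[OF K.hilbert_space_axioms K.pre_hilbert_axioms Ab F] adj_left[OF K.hilbert_space_axioms K.pre_hilbert_axioms Ab F]
    show "adj K K ?A F z = (z $ i) *\<^sub>C F z"
    proof (cases "z \<in> Bd")
      case True
      show ?thesis
      proof (rule E.eq_if_cip_eq)
        fix e assume e: "e \<in> E.C"
        have "cip E (adj K K ?A F z) e = cip K (adj K K ?A F) (\<kappa> z e)" using rep[OF ad(1) True e] by simp
        also have "\<dots> = cip K F (cnj (z $ i) *\<^sub>C \<kappa> z e)" using ad(3)[OF kap_c[OF True e]] A_kap[OF True e] by simp
        also have "\<dots> = z $ i * cip E (F z) e" using rep[OF F True e] F True e by (simp add: K.cip_scale_right)
        finally show "cip E (adj K K ?A F z) e = cip E ((z $ i) *\<^sub>C F z) e" using F e by (simp add: E.cip_scale_left)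
      qed (use F ad(1) in auto)
    next
      case False then show ?thesis using off[OF ad(1)] off[OF F] by simp
    qed
  qed
  have "bounded_op K K (adj K K ?A)" by (rule bounded_op_adj[OF K.hilbert_space_axioms K.pre_hilbert_axioms Ab])
  then show ?thesis
    using eq K.add_c K.scale_c unfolding bounded_op_def by (simp del: K.add_c K.scale_c)
qed

lemma Mz_eq: "F \<in> K.C \<Longrightarrow> Mz_tensor_I k E i F = (\<lambda>z. (z $ i) *\<^sub>C F z)"
  unfolding Mz_tensor_I_def
  by (rule tensor_op_eq[OF ker EH K.pre_hilbert_axioms coordinate_bounded _ refl])
    (auto simp: elem_tensor_def mult_coord_def scaleC_scaleC fun_eq_iff)

lemma pointwise_power_bounded:
  assumes "bounded_op K K (\<lambda>F z. m z *\<^sub>C F z)"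
  shows "bounded_op K K (\<lambda>F z. m z ^ n *\<^sub>C F z)"
proof (induction n)
  case 0 then show ?case using bounded_op_id[of K] by (simp add: scaleC_one)
next
  case (Suc n)
  from bounded_op_comp[OF Suc assms K.pre_hilbert_axioms] show ?case
    by (simp add: scaleC_scaleC)
qed

lemma Lm_bounded: "bounded_op K K (Lm \<alpha>)"
proof -
  have "bounded_op K K (\<lambda>F z. (\<Prod>i\<in>S. (z $ i) ^ \<alpha> i) *\<^sub>C F z)" if "finite S" for S
    using that
  proof (induction S)
    case empty then show ?case using bounded_op_id[of K] by (simp add: scaleC_one)
  next
    case (insert i S)
    from bounded_op_comp[OF insert.IH pointwise_power_bounded[OF coordinate_bounded[of i], of "\<alpha> i"] K.pre_hilbert_axioms] insert.hyps
    show ?case by (simp add: scaleC_scaleC)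
  qed
  from this[OF finite] show ?thesis by (simp add: mpow_def)
qed

lemma Lm_c [simp]: "F \<in> K.C \<Longrightarrow> Lm \<alpha> F \<in> K.C" by (rule bounded_opD(1)[OF Lm_bounded])

definition A where "A \<alpha> = adj K K (Lm \<alpha>)"

lemmas A_adj = adj[OF K.hilbert_space_axioms K.pre_hilbert_axioms Lm_bounded, folded A_def]
  and A_adj_left = adj_left[OF K.hilbert_space_axioms K.pre_hilbert_axioms Lm_bounded, folded A_def]
  and A_bounded = bounded_op_adj[OF K.hilbert_space_axioms K.pre_hilbert_axioms Lm_bounded, folded A_def]

lemma A_c [simp]: "F \<in> K.C \<Longrightarrow> A \<alpha> F \<in> K.C" by (rule A_adj(1))

lemma A_kap: "w \<in> Bd \<Longrightarrow> e \<in> E.C \<Longrightarrow> A \<alpha> (\<kappa> w e) = cnj (mpow w \<alpha>) *\<^sub>C \<kappa> w e"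
  unfolding A_def
  by (rule adj_eqI[OF K.hilbert_space_axioms K.pre_hilbert_axioms Lm_bounded])
    (simp_all add: rep K.cip_scale_right E.cip_scale_left)

lemma const_c [simp]: "e \<in> E.C \<Longrightarrow> \<kappa> 0 e \<in> K.C" by simp

lemma const_rep: "F \<in> K.C \<Longrightarrow> e \<in> E.C \<Longrightarrow> cip K F (\<kappa> 0 e) = cip E (F 0) e" by (simp add: rep)

lemma kap_at_0: "w \<in> Bd \<Longrightarrow> \<kappa> w e 0 = e" using kernel_0[OF ker] by (simp add: kap_def scaleC_one)

lemma const_bounded: "bounded_op E K (\<kappa> 0)"
proof -
  have "K.nrm (\<kappa> 0 e) = E.nrm e" if "e \<in> E.C" for e
    using kernel_cip[of 0 0 e e] that kernel_0[OF ker, of 0] by (simp add: hnorm_def)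
  then show ?thesis unfolding bounded_op_def
    by (intro conjI ballI allI exI[of _ 1])
      (auto simp: kap_scale, auto simp: kap_def fun_eq_iff complex_vector.scale_right_distrib)
qed

lemma J_coord: "F \<in> K.C \<Longrightarrow> J F \<alpha> = of_real (sqrt (mweight a \<alpha>)) *\<^sub>C (A \<alpha> F) 0"
proof (rule op_eqI[OF E.pre_hilbert_axioms, where S = "\<lambda>F. J F \<alpha>" and
    S' = "\<lambda>F. of_real (sqrt (mweight a \<alpha>)) *\<^sub>C (A \<alpha> F) 0"])
  show "bounded_op K E (\<lambda>F. J F \<alpha>)" by (rule bounded_op_coord[OF E.pre_hilbert_axioms J_bounded]) simp
  show "bounded_op K E (\<lambda>F. of_real (sqrt (mweight a \<alpha>)) *\<^sub>C (A \<alpha> F) 0)"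
    by (rule bounded_op_comp[OF bounded_op_comp[OF A_bounded eval_bounded K.pre_hilbert_axioms]
        bounded_op_scale[OF E.pre_hilbert_axioms] E.pre_hilbert_axioms])
  show "J (\<kappa> w e) \<alpha> = of_real (sqrt (mweight a \<alpha>)) *\<^sub>C (A \<alpha> (\<kappa> w e)) 0" if "w \<in> Bd" "e \<in> E.C" for w e
    using that by (simp add: J_kap A_kap awt_def scaleC_fun_def kap_at_0 scaleC_scaleC)
qed

lemma adj_J_coord:
  assumes e: "e \<in> E.C"
  shows "adj K E (\<lambda>F. J F \<alpha>) e = of_real (sqrt (mweight a \<alpha>)) *\<^sub>C Lm \<alpha> (\<kappa> 0 e)"
proof (rule adj_eqI[OF K.hilbert_space_axioms E.pre_hilbert_axioms bounded_op_coord[OF E.pre_hilbert_axioms J_bounded] e])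
  fix F assume F: "F \<in> K.C"
  have "cip E (J F \<alpha>) e = of_real (sqrt (mweight a \<alpha>)) * cip K (A \<alpha> F) (\<kappa> 0 e)"
    using F e by (simp add: J_coord E.cip_scale_left const_rep)
  also have "\<dots> = cip K F (of_real (sqrt (mweight a \<alpha>)) *\<^sub>C Lm \<alpha> (\<kappa> 0 e))"
    using A_adj_left[OF F const_c[OF e]] F e by (simp add: K.cip_scale_right)
  finally show "cip E (J F \<alpha>) e = cip K F (of_real (sqrt (mweight a \<alpha>)) *\<^sub>C Lm \<alpha> (\<kappa> 0 e))" .
qed (use e in simp_all)

text \<open>J is isometric, so its adjoint recovers F from J F; expanding that adjoint along
  coordinates gives the series. Compressed to the complement of M it becomes the purity sum.\<close>

lemma a_hsum:
  assumes F: "F \<in> K.C"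
  shows "has_hsum K (\<lambda>\<alpha>. of_real (mweight a \<alpha>) *\<^sub>C Lm \<alpha> (\<kappa> 0 ((A \<alpha> F) 0))) UNIV F"
proof -
  have "has_hsum K (\<lambda>\<alpha>. adj K E (\<lambda>F. J F \<alpha>) (J F \<alpha>)) UNIV (adj K LE J (J F))"
    by (rule adj_direct_sum_has_hsum[OF K.hilbert_space_axioms E.pre_hilbert_axioms J_bounded bounded_opD(1)[OF J_bounded F]])
  moreover have "adj K E (\<lambda>F. J F \<alpha>) (J F \<alpha>) = of_real (mweight a \<alpha>) *\<^sub>C Lm \<alpha> (\<kappa> 0 ((A \<alpha> F) 0))" for \<alpha>
  proof -
    have "J F \<alpha> \<in> E.C" using bounded_opD(1)[OF J_bounded F] by (simp add: direct_sum_simps)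
    then have "adj K E (\<lambda>F. J F \<alpha>) (J F \<alpha>) = of_real (sqrt (mweight a \<alpha>)) *\<^sub>C Lm \<alpha> (\<kappa> 0 (of_real (sqrt (mweight a \<alpha>)) *\<^sub>C (A \<alpha> F) 0))"
      by (subst adj_J_coord) (simp_all add: J_coord[OF F])
    also have "\<dots> = (of_real (sqrt (mweight a \<alpha>)) * of_real (sqrt (mweight a \<alpha>))) *\<^sub>C Lm \<alpha> (\<kappa> 0 ((A \<alpha> F) 0))"
      unfolding kap_scale[symmetric] by (simp add: fun_eq_iff scaleC_fun_def scaleC_scaleC mult_ac)
    also have "complex_of_real (sqrt (mweight a \<alpha>)) * of_real (sqrt (mweight a \<alpha>)) = of_real (mweight a \<alpha>)"
      unfolding of_real_mult[symmetric] using mweight_a_pos[OF ker, of \<alpha>] by simp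
    finally show ?thesis .
  qed
  ultimately show ?thesis using adj_J_J[OF F] by simp
qed

subsection \<open>The row operator\<close>

abbreviation "KT \<equiv> direct_sum (- {0::'d \<Rightarrow> nat}) K"
abbreviation "bwt w \<equiv> (\<lambda>\<alpha>. awt b w \<alpha>)"

text \<open>This is the adjoint of Z(w) at p. The type of p is left open so that the same column
  serves K and all its closed subspaces.\<close>

definition wv :: "complex ^ 'd \<Rightarrow> 'x::complex_vector \<Rightarrow> ('d \<Rightarrow> nat) \<Rightarrow> 'x"
  where "wv w p = (\<lambda>\<alpha>. if \<alpha> \<in> - {0} then awt b w \<alpha> *\<^sub>C p else 0)"

lemma bwt_summable: "(w :: complex ^ 'd) \<in> Bd \<Longrightarrow> (\<lambda>\<alpha>. (cmod (bwt w \<alpha>))\<^sup>2) summable_on - {0}"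
  by (rule awt_summable[OF awt_b_has_sum[OF ker]])

lemma wv_bounded: "hilbert_space L \<Longrightarrow> w \<in> Bd \<Longrightarrow> bounded_op L (direct_sum (- {0}) L) (wv w)"
  unfolding wv_def by (rule bounded_ds_weights[OF _ bwt_summable])

lemma wv_cip: "pre_hilbert L \<Longrightarrow> w \<in> Bd \<Longrightarrow> z \<in> Bd \<Longrightarrow> p \<in> carrier L \<Longrightarrow> q \<in> carrier L \<Longrightarrow>
    cip (direct_sum (- {0}) L) (wv w p) (wv z q) = (1 - 1 / k z w) * cip L p q"
  unfolding wv_def by (rule pre_hilbert.ds_weights_cip[OF _ _ _ awt_b_has_sum[OF ker]])

text \<open>Since k(z,0) = 1, \<open>\<kappa> 0 e\<close> is the constant function e on the ball.
  The operator is therefore the identity minus the projection onto constants, the one prescribed by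
  the Gram matrix of W.\<close>

lemma minus_const_bounded: "bounded_op K K (\<lambda>F. F - \<kappa> 0 (F 0))"
proof -
  have c: "bounded_op K K (\<lambda>F. \<kappa> 0 (F 0))"
    by (rule bounded_op_comp[OF eval_bounded const_bounded E.pre_hilbert_axioms])
  obtain B where B: "\<And>F. F \<in> K.C \<Longrightarrow> K.nrm (\<kappa> 0 (F 0)) \<le> B * K.nrm F" using c unfolding bounded_op_def by blast
  have "K.nrm (F - \<kappa> 0 (F 0)) \<le> (1 + B) * K.nrm F" if F: "F \<in> K.C" for F
    using K.nrm_triangle_diff[OF F const_c[OF val_c[OF F]], of 0] B[OF F] by (simp add: distrib_right)
  moreover have "F - \<kappa> 0 (F 0) \<in> K.C" if "F \<in> K.C" for F using that by simp
  ultimately show ?thesis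
    using bounded_opD(2,3)[OF c] unfolding bounded_op_def
    by (auto simp: complex_vector.scale_right_diff_distrib)
qed

lemma W_exists: "\<exists>W. bounded_op K KT W \<and> (\<forall>p\<in>I. W (\<kappa> (fst p) (snd p)) = wv (fst p) (\<kappa> (fst p) (snd p))) \<and>
    (\<forall>F\<in>K.C. \<forall>G\<in>K.C. cip KT (W F) (W G) = cip K (F - \<kappa> 0 (F 0)) G)"
proof (rule gram_extension[OF K.hilbert_space_axioms K.ds_hilbert minus_const_bounded pair_c _ pair_total])
  show "wv (fst p) (\<kappa> (fst p) (snd p)) \<in> carrier KT" if "p \<in> I" for p
    using bounded_opD(1)[OF wv_bounded[OF K.hilbert_space_axioms, of "fst p"] pair_c[OF that]] that by auto
  show "cip KT (wv (fst p) (\<kappa> (fst p) (snd p))) (wv (fst q) (\<kappa> (fst q) (snd q))) =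
     cip K (\<kappa> (fst p) (snd p) - \<kappa> 0 (\<kappa> (fst p) (snd p) 0)) (\<kappa> (fst q) (snd q))" if "p \<in> I" "q \<in> I" for p q
  proof -
    have pq: "fst p \<in> Bd" "fst q \<in> Bd" "snd p \<in> E.C" "snd q \<in> E.C" using that by auto
    have 0: "0 \<in> (Bd :: (complex ^ 'd) set)" by simp
    have "(1 - 1 / k (fst q) (fst p)) * (k (fst q) (fst p) * cip E (snd p) (snd q)) = k (fst q) (fst p) * cip E (snd p) (snd q) - cip E (snd p) (snd q)"
      using kernel_nz[OF ker pq(2,1)] by (simp add: field_simps)
    then show ?thesis
      using wv_cip[OF K.pre_hilbert_axioms pq(1,2) pair_c[OF that(1)] pair_c[OF that(2)]]
        kernel_cip[OF pq] kernel_cip[OF 0 pq(2,3,4)] kernel_0(1)[OF ker pq(2)] pq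
      by (simp add: kap_at_0 K.cip_diff_left)
  qed
qed

definition W where "W = (SOME W. bounded_op K KT W \<and>
  (\<forall>p\<in>I. W (\<kappa> (fst p) (snd p)) = wv (fst p) (\<kappa> (fst p) (snd p))) \<and>
  (\<forall>F\<in>K.C. \<forall>G\<in>K.C. cip KT (W F) (W G) = cip K (F - \<kappa> 0 (F 0)) G))"

lemma W_bounded: "bounded_op K KT W"
  and W_kap: "w \<in> Bd \<Longrightarrow> e \<in> E.C \<Longrightarrow> W (\<kappa> w e) = wv w (\<kappa> w e)"
  and W_cip: "F \<in> K.C \<Longrightarrow> G \<in> K.C \<Longrightarrow> cip KT (W F) (W G) = cip K (F - \<kappa> 0 (F 0)) G"
  using someI_ex[OF W_exists] unfolding W_def[symmetric] by auto

lemma W_cip': "F \<in> K.C \<Longrightarrow> G \<in> K.C \<Longrightarrow> cip KT (W F) (W G) = cip K F G - cip E (F 0) (G 0)"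
proof -
  assume F: "F \<in> K.C" and G: "G \<in> K.C"
  have "cip K (\<kappa> 0 (F 0)) G = cip E (F 0) (G 0)"
    using const_rep[OF G val_c[OF F, of 0]] K.cip_swap[OF const_c[OF val_c[OF F]] G, of 0] E.cip_swap[OF val_c[OF F] val_c[OF G], of 0 0]
    by simp
  then show ?thesis using W_cip[OF F G] F G by (simp add: K.cip_diff_left)
qed

text \<open>W is known only through its values on kernel functions; those are joint eigenvectors of
  the adjoint monomials, which identifies the coordinates.\<close>

lemma W_coord: "F \<in> K.C \<Longrightarrow> W F \<alpha> = (if \<alpha> = 0 then 0 else of_real (sqrt (mweight b \<alpha>)) *\<^sub>C A \<alpha> F)"
proof (cases "\<alpha> = 0")
  case True
  assume "F \<in> K.C"
  then show ?thesis using bounded_opD(1)[OF W_bounded] True by (simp add: direct_sum_simps)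
next
  case False
  assume F: "F \<in> K.C"
  have "W F \<alpha> = of_real (sqrt (mweight b \<alpha>)) *\<^sub>C A \<alpha> F"
  proof (rule op_eqI[OF K.pre_hilbert_axioms _ _ _ F, where S = "\<lambda>F. W F \<alpha>" and
      S' = "\<lambda>F. of_real (sqrt (mweight b \<alpha>)) *\<^sub>C A \<alpha> F"])
    show "bounded_op K K (\<lambda>F. W F \<alpha>)" by (rule bounded_op_coord[OF K.pre_hilbert_axioms W_bounded]) (use False in simp)
    show "bounded_op K K (\<lambda>F. of_real (sqrt (mweight b \<alpha>)) *\<^sub>C A \<alpha> F)"
      by (rule bounded_op_comp[OF A_bounded bounded_op_scale[OF K.pre_hilbert_axioms] K.pre_hilbert_axioms])
    show "W (\<kappa> w e) \<alpha> = of_real (sqrt (mweight b \<alpha>)) *\<^sub>C A \<alpha> (\<kappa> w e)" if "w \<in> Bd" "e \<in> E.C" for w e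
      using that False by (simp add: W_kap A_kap wv_def awt_def scaleC_scaleC)
  qed
  then show ?thesis using False by simp
qed

abbreviation "Wa \<equiv> adj K KT W"

lemmas KT_pre = K.ds_pre_hilbert[of "- {0::'d \<Rightarrow> nat}"]
lemmas Wa_adj = adj[OF K.hilbert_space_axioms KT_pre W_bounded]
  and Wa_adj_left = adj_left[OF K.hilbert_space_axioms KT_pre W_bounded]
  and Wa_bounded = bounded_op_adj[OF K.hilbert_space_axioms KT_pre W_bounded]

lemma W_c: "F \<in> K.C \<Longrightarrow> W F \<in> carrier KT" by (rule bounded_opD(1)[OF W_bounded])

lemma Wa_W: "F \<in> K.C \<Longrightarrow> Wa (W F) = F - \<kappa> 0 (F 0)"
proof -
  assume F: "F \<in> K.C"
  show ?thesis
  proof (rule K.eq_if_cip_eq)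
    show "Wa (W F) \<in> K.C" by (rule Wa_adj(1)[OF W_c[OF F]])
    show "F - \<kappa> 0 (F 0) \<in> K.C" using F by simp
    fix G assume G: "G \<in> K.C"
    show "cip K (Wa (W F)) G = cip K (F - \<kappa> 0 (F 0)) G"
      using Wa_adj_left[OF W_c[OF F] G] W_cip[OF F G] by simp
  qed
qed

text \<open>The row form of the adjoint of W. Compression gives both the b-sum
  (\<open>b_hsum\<close>) and the operator \<open>tilde_op\<close> (\<open>Tt_eq\<close>).\<close>

lemma Wa_hsum:
  assumes x: "x \<in> carrier KT"
  shows "has_hsum K (\<lambda>\<alpha>. of_real (sqrt (mweight b \<alpha>)) *\<^sub>C Lm \<alpha> (x \<alpha>)) (- {0}) (Wa x)"
proof -
  have "has_hsum K (\<lambda>\<alpha>. adj K K (\<lambda>F. W F \<alpha>) (x \<alpha>)) (- {0}) (Wa x)"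
    by (rule adj_direct_sum_has_hsum[OF K.hilbert_space_axioms K.pre_hilbert_axioms W_bounded x])
  moreover have "adj K K (\<lambda>F. W F \<alpha>) (x \<alpha>) = of_real (sqrt (mweight b \<alpha>)) *\<^sub>C Lm \<alpha> (x \<alpha>)" if "\<alpha> \<in> - {0}" for \<alpha>
  proof (rule adj_eqI[OF K.hilbert_space_axioms K.pre_hilbert_axioms bounded_op_coord[OF K.pre_hilbert_axioms W_bounded that]])
    show xa: "x \<alpha> \<in> K.C" using x that by (simp add: direct_sum_simps)
    then show "of_real (sqrt (mweight b \<alpha>)) *\<^sub>C Lm \<alpha> (x \<alpha>) \<in> K.C" by simp
    fix F assume F: "F \<in> K.C"
    show "cip K (W F \<alpha>) (x \<alpha>) = cip K F (of_real (sqrt (mweight b \<alpha>)) *\<^sub>C Lm \<alpha> (x \<alpha>))"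
      using that F xa A_adj_left[OF F xa] by (simp add: W_coord K.cip_scale_left K.cip_scale_right)
  qed
  ultimately show ?thesis by (subst (asm) has_hsum_cong) auto
qed

end

section \<open>Operators on subspaces, closures and ranges\<close>

lemma bounded_op_cong:
  assumes "pre_hilbert H" "bounded_op H K S" "\<And>x. x \<in> carrier H \<Longrightarrow> T x = S x"
  shows "bounded_op H K T"
proof -
  interpret pre_hilbert H by fact
  show ?thesis using assms(2,3) add_c scale_c unfolding bounded_op_def by (simp del: add_c scale_c)
qed

lemma bounded_op_restrict: "bounded_op H K T \<Longrightarrow> S \<subseteq> carrier H \<Longrightarrow> bounded_op (sub_hilbert H S) K T"
  unfolding bounded_op_def sub_hilbert_simps by (meson subsetD)

lemma (in hilbert_space) proj_compl_0:
  assumes S: "S \<subseteq> C" and m: "m \<in> S"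
  shows "orth_proj H (orth_compl H S) m = 0"
proof (rule proj_eqI[OF orth_compl_closed[OF S]])
  show "m \<in> C" using S m by blast
  show "0 \<in> orth_compl H S" using S by (auto simp: orth_compl_def)
  show "ip (m - 0) s = 0" if s: "s \<in> orth_compl H S" for s
  proof -
    have "s \<in> C" "m \<in> C" "ip s m = 0" using s m S by (auto simp: orth_compl_def)
    then show ?thesis using cip_swap[of m s] by simp
  qed
qed

lemma (in hilbert_space) bounded_proj': "closed_subspace H S \<Longrightarrow> bounded_op H H (orth_proj H S)"
  using bounded_proj(1)[of S] closed_subspaceD(2)[of S] unfolding bounded_op_def sub_hilbert_simps by (meson subsetD)

lemma (in hilbert_space) closure_orth_0:
  assumes S: "csubspace S" "S \<subseteq> C" and x: "x \<in> htop H closure_of S" and o: "\<And>s. s \<in> S \<Longrightarrow> ip x s = 0"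
  shows "x = 0"
proof -
  have xC: "x \<in> C" using closed_subspaceD(2)[OF closed_subspace_closure(1)[OF S]] x by blast
  have c: "closed_subspace H (orth_compl H {x})" by (rule orth_compl_closed) (use xC in simp)
  have "S \<subseteq> orth_compl H {x}"
  proof
    fix s assume s: "s \<in> S"
    then have "s \<in> C" using S(2) by blast
    then show "s \<in> orth_compl H {x}" using o[OF s] cip_swap[of s x] xC by (simp add: orth_compl_def)
  qed
  then have "htop H closure_of S \<subseteq> orth_compl H {x}"
    using c by (intro closure_of_minimal) (auto simp: closed_subspace_def)
  then have "ip x x = 0" using x by (auto simp: orth_compl_def)
  then show ?thesis using cip_self_0D[OF xC] by simp
qed

lemma bounded_op_closure:
  assumes H: "hilbert_space H" and K: "hilbert_space K" and T: "bounded_op H K T"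
    and S: "S \<subseteq> carrier H" and S': "csubspace S'" "S' \<subseteq> carrier K"
    and img: "\<And>s. s \<in> S \<Longrightarrow> T s \<in> S'" and x: "x \<in> htop H closure_of S"
  shows "T x \<in> htop K closure_of S'"
proof -
  interpret H: hilbert_space H by fact
  interpret K: hilbert_space K by fact
  obtain s where xC: "x \<in> H.C" and s: "\<And>n::nat. s n \<in> S" "(\<lambda>n. H.nrm (s n - x)) \<longlonglongrightarrow> 0"
    using x H.in_closure_htop[OF S] by auto
  have "(\<lambda>n. K.nrm (T (s n) - T x)) \<longlonglongrightarrow> 0"
    by (rule bounded_op_tendsto[OF T H.pre_hilbert_axioms K.pre_hilbert_axioms _ xC s(2)])
      (use s(1) S in \<open>simp add: subset_iff\<close>)
  then show ?thesis
    unfolding K.in_closure_htop[OF S'(2)] using bounded_opD(1)[OF T xC]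
    by (intro conjI exI[of _ "\<lambda>n. T (s n)"] allI img s(1))
qed

lemma csubspace_image:
  assumes H: "pre_hilbert H" and T: "bounded_op H K T"
  shows "csubspace (T ` carrier H)"
proof (rule complex_vector.subspaceI)
  interpret pre_hilbert H by fact
  show "0 \<in> T ` C" using bounded_op_0[OF T H] by (intro image_eqI[of _ _ 0]) simp_all
  fix x y assume "x \<in> T ` C" "y \<in> T ` C"
  then obtain x' y' where "x' \<in> C" "y' \<in> C" "x = T x'" "y = T y'" by blast
  then show "x + y \<in> T ` C" using bounded_opD(2)[OF T] by (intro image_eqI[of _ _ "x' + y'"]) simp_all
next
  interpret pre_hilbert H by fact
  fix c x assume "x \<in> T ` C"
  then obtain x' where "x' \<in> C" "x = T x'" by blast
  then show "c *\<^sub>C x \<in> T ` C" using bounded_opD(3)[OF T] by (intro image_eqI[of _ _ "c *\<^sub>C x'"]) simp_all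
qed

section \<open>Co-invariant subspaces and the resolvent of the row operator\<close>

context kernel_tensor
begin

lemma power_invariant:
  assumes S: "\<And>i f. f \<in> S \<Longrightarrow> (\<lambda>z. (z $ i) *\<^sub>C f z) \<in> S" and f: "f \<in> S"
  shows "(\<lambda>z. (z $ i) ^ n *\<^sub>C f z) \<in> S"
proof (induction n)
  case (Suc n)
  from S[OF Suc, of i] show ?case by (simp add: scaleC_scaleC)
qed (use f in \<open>simp add: scaleC_one\<close>)

lemma Lm_invariant:
  fixes S :: "(complex ^ 'd \<Rightarrow> 'e) set"
  assumes S: "\<And>i f. f \<in> S \<Longrightarrow> (\<lambda>z. (z $ i) *\<^sub>C f z) \<in> S" and f: "f \<in> S"
  shows "Lm \<alpha> f \<in> S"
proof -
  have "(\<lambda>z. (\<Prod>i\<in>A. (z $ i) ^ \<alpha> i) *\<^sub>C f z) \<in> S" if "finite A" for A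
    using that
  proof (induction A)
    case (insert i A)
    from power_invariant[OF S insert.IH, of i "\<alpha> i"] insert.hyps show ?case by (simp add: scaleC_scaleC)
  qed (use f in \<open>simp add: scaleC_one\<close>)
  from this[OF finite] show ?thesis by (simp add: mpow_def)
qed

lemma A_invariant:
  assumes SC: "S \<subseteq> K.C" and S: "\<And>i f. f \<in> S \<Longrightarrow> (\<lambda>z. (z $ i) *\<^sub>C f z) \<in> S"
    and h: "h \<in> orth_compl K S"
  shows "A \<alpha> h \<in> orth_compl K S"
proof -
  have hC: "h \<in> K.C" using h by (simp add: orth_compl_def)
  have "cip K (A \<alpha> h) s = 0" if s: "s \<in> S" for s
  proof -
    have "cip K (A \<alpha> h) s = cip K h (Lm \<alpha> s)" using A_adj_left[OF hC] SC s by blast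
    then show ?thesis using Lm_invariant[OF S s] h by (simp add: orth_compl_def)
  qed
  then show ?thesis using hC by (simp add: orth_compl_def)
qed

lemma const_cip: "e \<in> E.C \<Longrightarrow> G \<in> K.C \<Longrightarrow> cip K (\<kappa> 0 e) G = cip E e (G 0)"
  using const_rep[of G e] K.cip_swap[OF const_c[of e], of G] E.cip_swap[of e "G 0"] by simp

lemma const_nrm: "e \<in> E.C \<Longrightarrow> K.nrm (\<kappa> 0 e) = E.nrm e"
  using const_cip[of e "\<kappa> 0 e"] by (simp add: hnorm_def kap_at_0)

lemma W_nrm_sq: "F \<in> K.C \<Longrightarrow> (hnorm KT (W F))\<^sup>2 = (K.nrm F)\<^sup>2 - (E.nrm (F 0))\<^sup>2"
  using W_cip'[of F F] pre_hilbert.nrm_sq[OF KT_pre W_c[of F]] by (simp add: K.nrm_sq E.nrm_sq)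

lemma W_le: "F \<in> K.C \<Longrightarrow> hnorm KT (W F) \<le> K.nrm F"
  by (rule power2_le_imp_le) (simp_all add: W_nrm_sq)

lemma Wa_le:
  assumes x: "x \<in> carrier KT"
  shows "K.nrm (Wa x) \<le> hnorm KT x"
proof (rule K.nrm_le_if_cip_le)
  interpret KT: pre_hilbert KT by (rule KT_pre)
  have wC: "Wa x \<in> K.C" by (rule Wa_adj(1)[OF x])
  then show "Wa x \<in> K.C" .
  have "cmod (cip KT x (W (Wa x))) \<le> KT.nrm x * KT.nrm (W (Wa x))" by (rule KT.cauchy_schwarz[OF x W_c[OF wC]])
  moreover have "KT.nrm x * KT.nrm (W (Wa x)) \<le> KT.nrm x * K.nrm (Wa x)"
    by (rule mult_left_mono[OF W_le[OF wC] KT.nrm_nonneg[OF x]])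
  ultimately show "cmod (cip K (Wa x) (Wa x)) \<le> KT.nrm x * K.nrm (Wa x)"
    unfolding Wa_adj_left[OF x wC] by linarith
  show "0 \<le> KT.nrm x" by (rule KT.nrm_nonneg[OF x])
qed

lemma ds_sub:
  assumes S: "S \<subseteq> K.C"
  shows "carrier (direct_sum (- {0::'d \<Rightarrow> nat}) (sub_hilbert K S)) = {x \<in> carrier KT. \<forall>\<alpha>\<in>- {0}. x \<alpha> \<in> S}"
    "cip (direct_sum (- {0::'d \<Rightarrow> nat}) (sub_hilbert K S)) = cip KT"
    "hnorm (direct_sum (- {0::'d \<Rightarrow> nat}) (sub_hilbert K S)) = hnorm KT"
proof -
  show c: "cip (direct_sum (- {0::'d \<Rightarrow> nat}) (sub_hilbert K S)) = cip KT"
    by (simp add: direct_sum_def)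
  then show "hnorm (direct_sum (- {0::'d \<Rightarrow> nat}) (sub_hilbert K S)) = hnorm KT"
    by (simp add: hnorm_def fun_eq_iff)
  show "carrier (direct_sum (- {0::'d \<Rightarrow> nat}) (sub_hilbert K S)) = {x \<in> carrier KT. \<forall>\<alpha>\<in>- {0}. x \<alpha> \<in> S}"
    using S by (auto simp: direct_sum_simps)
qed

text \<open>\<open>wv\<close> acts on each coordinate by a scalar, so projecting its argument
  projects every coordinate, which is invisible against columns with entries in S.\<close>

lemma wv_proj_cip:
  assumes S: "closed_subspace K S" and x: "x \<in> carrier KT" "\<forall>\<alpha>\<in>- {0}. x \<alpha> \<in> S" and F: "F \<in> K.C"
  shows "cip KT x (wv z (orth_proj K S F)) = cip KT x (wv z F)"
    "z \<in> Bd \<Longrightarrow> cip KT (wv z (orth_proj K S F)) x = cip KT (wv z F) x"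
proof -
  note pC = K.proj_c[OF S F]
  have xC: "x \<alpha> \<in> K.C" if "\<alpha> \<noteq> 0" for \<alpha> using x that by (simp add: direct_sum_simps)
  show 1: "cip KT x (wv z (orth_proj K S F)) = cip KT x (wv z F)"
    unfolding direct_sum_simps(2)
  proof (rule infsum_cong)
    fix \<alpha> :: "'d \<Rightarrow> nat" assume a: "\<alpha> \<in> - {0}"
    then have "x \<alpha> \<in> S" "x \<alpha> \<in> K.C" using x xC by auto
    then show "cip K (x \<alpha>) (wv z (orth_proj K S F) \<alpha>) = cip K (x \<alpha>) (wv z F \<alpha>)"
      using a pC F K.cip_proj(2)[OF S F] by (simp add: wv_def K.cip_scale_right)
  qed
  assume z: "z \<in> Bd"
  interpret KT: pre_hilbert KT by (rule KT_pre)
  have "wv z G \<in> KT.C" if "G \<in> K.C" for G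
    by (rule bounded_opD(1)[OF wv_bounded[OF K.hilbert_space_axioms z] that])
  then show "cip KT (wv z (orth_proj K S F)) x = cip KT (wv z F) x"
    using KT.cip_swap[OF _ x(1)] 1 pC F by metis
qed

text \<open>The resolvent of the row operator realises point evaluations: \<open>g(0) = h(z)\<close> if
  \<open>h = (I - Z W) g\<close>.  This identifies the constant-term map with all point evaluations on
  co-invariant subspaces.\<close>

lemma resolvent:
  assumes S: "closed_subspace K S" and inv: "\<And>\<alpha> f. f \<in> S \<Longrightarrow> A \<alpha> f \<in> S" and z: "z \<in> Bd"
  defines "SH \<equiv> sub_hilbert K S"
  defines "Z \<equiv> adj SH (direct_sum (- {0}) SH) (wv z)"
  shows "bij_betw (\<lambda>h. h - Z (W h)) S S" "\<And>g. g \<in> S \<Longrightarrow> (g - Z (W g)) z = g 0"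
    "\<And>f. f \<in> S \<Longrightarrow> W f \<in> carrier (direct_sum (- {0}) SH)"
proof -
  let ?D = "direct_sum (- {0::'d \<Rightarrow> nat}) SH"
  note S' = K.closed_subspaceD[OF S]
  have SC: "\<And>f. f \<in> S \<Longrightarrow> f \<in> K.C" using S'(2) by blast
  interpret SH: hilbert_space SH unfolding SH_def by (rule K.sub_hilbert_space[OF S])
  interpret D: pre_hilbert ?D by (rule SH.ds_pre_hilbert)
  note ds = ds_sub[OF S'(2), folded SH_def]
  have SHC: "SH.C = S" "cip SH = cip K" "SH.nrm = K.nrm" by (simp_all add: SH_def)
  show WD: "W f \<in> D.C" if f: "f \<in> S" for f
    unfolding ds(1) using W_c[OF SC[OF f]] inv[OF f] complex_vector.subspace_scale[OF S'(1)] SC[OF f]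
    by (auto simp: W_coord)
  note wvb = wv_bounded[OF SH.hilbert_space_axioms z]
  note Zl = adj_left[OF SH.hilbert_space_axioms D.pre_hilbert_axioms wvb, folded Z_def, unfolded SHC]
  note Zc = adj(1)[OF SH.hilbert_space_axioms D.pre_hilbert_axioms wvb, folded Z_def, unfolded SHC]
  note Zb = bounded_op_adj[OF SH.hilbert_space_axioms D.pre_hilbert_axioms wvb, folded Z_def]
  have WSb: "bounded_op SH ?D W"
    using WD W_bounded SC unfolding bounded_op_def ds(3) SHC by blast
  have ZWb: "bounded_op SH SH (\<lambda>h. Z (W h))" by (rule bounded_op_comp[OF WSb Zb D.pre_hilbert_axioms])
  \<comment> \<open>This is the norm factor of the column \<open>wv z\<close>. As W is a
    contraction, Z W has norm at most c < 1 and I - Z W is invertible.\<close>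
  define c where "c = sqrt (1 - 1 / Re (k z z))"
  have kz: "1 \<le> Re (k z z)" "k z z = of_real (Re (k z z))" using kernel_diag[OF ker z] by auto
  have c: "0 \<le> c" "c < 1" "c\<^sup>2 = 1 - 1 / Re (k z z)" using kz(1) by (auto simp: c_def field_simps)
  have wvn: "D.nrm (wv z p) = c * K.nrm p" if p: "p \<in> S" for p
  proof -
    have "cip ?D (wv z p) (wv z p) = (1 - 1 / k z z) * cip K p p"
      using wv_cip[OF SH.pre_hilbert_axioms z z, of p p] p by (simp add: SHC)
    also have "\<dots> = of_real ((c * K.nrm p)\<^sup>2)"
      unfolding K.cip_self[OF SC[OF p]] using arg_cong[OF c(3), of complex_of_real] kz(2)
      by (simp add: power_mult_distrib)
    finally have "cip ?D (wv z p) (wv z p) = of_real ((c * K.nrm p)\<^sup>2)" .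
    then show ?thesis using c(1) SC[OF p] by (simp add: hnorm_def[of ?D] del: of_real_power)
  qed
  have ZWn: "SH.nrm (Z (W h)) \<le> c * SH.nrm h" if h: "h \<in> SH.C" for h
  proof (rule SH.nrm_le_if_cip_le)
    have hS: "h \<in> S" using h SHC by simp
    note wc = WD[OF hS]
    note zc = Zc[OF wc]
    show "Z (W h) \<in> SH.C" using zc SHC by simp
    have "cmod (cip ?D (W h) (wv z (Z (W h)))) \<le> D.nrm (W h) * D.nrm (wv z (Z (W h)))"
      by (rule D.cauchy_schwarz[OF wc]) (rule bounded_opD(1)[OF wvb, unfolded SHC, OF zc])
    also have "\<dots> \<le> K.nrm h * (c * K.nrm (Z (W h)))"
      using wvn[OF zc] W_le[OF SC[OF hS]] c(1) SC[OF zc] SC[OF hS] by (simp add: ds(3) mult_right_mono)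
    finally show "cmod (cip SH (Z (W h)) (Z (W h))) \<le> c * SH.nrm h * SH.nrm (Z (W h))"
      unfolding SHC Zl[OF wc zc] by (simp only: mult_ac)
    show "0 \<le> c * SH.nrm h" using c(1) h by simp
  qed
  show "bij_betw (\<lambda>h. h - Z (W h)) S S"
    using bounded_op_inverse_exists[OF SH.hilbert_space_axioms ZWb c(2) ZWn] by (simp add: SHC)
  show "(g - Z (W g)) z = g 0" if g: "g \<in> S" for g
  proof (rule E.eq_if_cip_eq)
    note gC = SC[OF g]
    note wc = WD[OF g]
    note zc = Zc[OF wc]
    have wc': "W g \<in> carrier KT" "\<forall>\<alpha>\<in>- {0}. W g \<alpha> \<in> S" using wc unfolding ds(1) by auto
    have dC: "g - Z (W g) \<in> K.C" using gC SC[OF zc] by simp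
    show "(g - Z (W g)) z \<in> E.C" "g 0 \<in> E.C" using val_c[OF dC] val_c[OF gC] by auto
    fix e assume e: "e \<in> E.C"
    note kc = kap_c[OF z e]
    have "cip E ((g - Z (W g)) z) e = cip K (g - Z (W g)) (\<kappa> z e)" by (rule rep[OF dC z e, symmetric])
    also have "\<dots> = cip K g (\<kappa> z e) - cip K (Z (W g)) (\<kappa> z e)" using gC SC[OF zc] kc by (simp add: K.cip_diff_left)
    \<comment> \<open>Z is an adjoint taken inside S, so the kernel function has to be projected to
      S before Z is moved; \<open>wv_proj_cip\<close> removes the projection again.\<close>
    also have "cip K (Z (W g)) (\<kappa> z e) = cip K (Z (W g)) (orth_proj K S (\<kappa> z e))"
      by (rule K.cip_proj(2)[OF S kc zc, symmetric])
    also have "\<dots> = cip KT (W g) (wv z (orth_proj K S (\<kappa> z e)))"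
      using Zl[OF wc K.proj(1)[OF S kc]] by (simp add: ds(2))
    also have "\<dots> = cip KT (W g) (W (\<kappa> z e))"
      using wv_proj_cip(1)[OF S wc' kc] by (simp add: W_kap[OF z e])
    also have "\<dots> = cip K g (\<kappa> z e) - cip E (g 0) e"
      using W_cip'[OF gC kc] by (simp add: kap_at_0[OF z])
    finally show "cip E ((g - Z (W g)) z) e = cip E (g 0) e" by simp
  qed
qed

end

section \<open>The compression to a co-invariant subspace\<close>

locale invariant_subspace = kernel_tensor a b k E
  for a b :: "nat \<Rightarrow> real" and k :: "complex ^ 'd::finite \<Rightarrow> complex ^ 'd \<Rightarrow> complex"
    and E :: "('e::complex_vector) hilbert" +
  fixes M :: "(complex ^ 'd \<Rightarrow> 'e) set"
  assumes M: "closed_subspace K M" and M_inv: "\<And>i f. f \<in> M \<Longrightarrow> Mz_tensor_I k E i f \<in> M"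
begin

abbreviation "N0 \<equiv> orth_compl K M"
abbreviation "N \<equiv> sub_hilbert K N0"
abbreviation "P \<equiv> orth_proj K N0"
abbreviation T where "T \<equiv> (\<lambda>i f. P (Mz_tensor_I k E i f))"

lemma M_c: "f \<in> M \<Longrightarrow> f \<in> K.C" using K.closed_subspaceD(2)[OF M] by blast
lemma M_sub: "M \<subseteq> K.C" by (rule K.closed_subspaceD(2)[OF M])

lemma M_coord: "f \<in> M \<Longrightarrow> (\<lambda>z. (z $ i) *\<^sub>C f z) \<in> M"
  using M_inv[of f i] Mz_eq[OF M_c] by simp

lemma N0_closed: "closed_subspace K N0" by (rule K.orth_compl_closed[OF M_sub])

lemma N0_c [simp]: "h \<in> N0 \<Longrightarrow> h \<in> K.C" by (simp add: orth_compl_def)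

lemma N0_sub: "N0 \<subseteq> K.C" by (rule K.closed_subspaceD(2)[OF N0_closed])

lemmas N0_csub = K.closed_subspaceD(1)[OF N0_closed]

lemmas N0_vec [simp] = complex_vector.subspace_0[OF N0_csub] complex_vector.subspace_add[OF N0_csub]
  complex_vector.subspace_diff[OF N0_csub] complex_vector.subspace_scale[OF N0_csub]
  complex_vector.subspace_neg[OF N0_csub]

lemma M_eq: "orth_compl K N0 = M" by (rule K.orth_compl_orth_compl[OF M])

lemma N_hilbert: "hilbert_space N" by (rule K.sub_hilbert_space[OF N0_closed])
lemmas N_pre = pre_hilbert_of_hilbert[OF N_hilbert]

lemma A_N0 [simp]: "h \<in> N0 \<Longrightarrow> A \<alpha> h \<in> N0"
  by (rule A_invariant[OF M_sub M_coord])

lemma P_c [simp]: "F \<in> K.C \<Longrightarrow> P F \<in> N0" by (rule K.proj(1)[OF N0_closed])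
lemma P_id [simp]: "h \<in> N0 \<Longrightarrow> P h = h" by (rule K.proj_ident[OF N0_closed])
lemma P_M: "m \<in> M \<Longrightarrow> P m = 0" by (rule K.proj_compl_0[OF M_sub])
lemma P_cip: "F \<in> K.C \<Longrightarrow> h \<in> N0 \<Longrightarrow> cip K (P F) h = cip K F h" "F \<in> K.C \<Longrightarrow> h \<in> N0 \<Longrightarrow> cip K h (P F) = cip K h F"
  by (rule K.cip_proj[OF N0_closed]; assumption)+
lemmas P_bounded' = K.bounded_proj'[OF N0_closed] and P_bounded = K.bounded_proj(1)[OF N0_closed]
lemmas P_lin = bounded_opD(2,3)[OF P_bounded'] bounded_op_diff[OF P_bounded' K.pre_hilbert_axioms]

lemma diff_P_M: "F \<in> K.C \<Longrightarrow> F - P F \<in> M"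
proof -
  assume F: "F \<in> K.C"
  have "F - P F \<in> orth_compl K N0"
    unfolding orth_compl_def[of K N0] using K.proj(2)[OF N0_closed F] K.diff_c[OF F K.proj_c[OF N0_closed F]] by blast
  then show ?thesis by (simp only: M_eq)
qed

text \<open>The part removed by the inner P lies in M, stays there under L and is killed by the
  outer P. Hence compressions of such operators multiply.\<close>

lemma P_absorb:
  assumes L: "bounded_op K K L" and inv: "\<And>f. f \<in> M \<Longrightarrow> L f \<in> M" and F: "F \<in> K.C"
  shows "P (L (P F)) = P (L F)"
proof -
  have PF: "P F \<in> K.C" using P_c[OF F] by simp
  have "P (L (F - P F)) = 0" by (rule P_M[OF inv[OF diff_P_M[OF F]]])
  then have "P (L F - L (P F)) = 0" using bounded_op_diff[OF L K.pre_hilbert_axioms F PF] by simp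
  then show ?thesis using P_lin(3)[OF bounded_opD(1)[OF L F] bounded_opD(1)[OF L PF]] by simp
qed

lemma P_Lm: "F \<in> K.C \<Longrightarrow> P (Lm \<alpha> (P F)) = P (Lm \<alpha> F)"
  by (rule P_absorb[OF Lm_bounded Lm_invariant[OF M_coord]])

lemma T_P: "F \<in> K.C \<Longrightarrow> T i (P F) = P (\<lambda>z. (z $ i) *\<^sub>C F z)"
  using P_absorb[OF coordinate_bounded M_coord, of F i] Mz_eq[of "P F" i] by simp

lemma T_pow_P: "F \<in> K.C \<Longrightarrow> (T i ^^ n) (P F) = P (\<lambda>z. (z $ i) ^ n *\<^sub>C F z)"
proof (induction n)
  case (Suc n)
  have c: "(\<lambda>z. (z $ i) ^ n *\<^sub>C F z) \<in> K.C"
    using power_invariant[of K.C, OF bounded_opD(1)[OF coordinate_bounded]] Suc by blast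
  then show ?case using Suc T_P[OF c] by (simp add: scaleC_scaleC)
qed (simp add: scaleC_one)

text \<open>\<open>tuple_pow\<close> composes along an unspecified enumeration of the indices. The
  induction is over arbitrary lists, and distinctness enters only when the list product is turned
  into the product over all indices.\<close>

lemma tuple_pow_eq:
  assumes h: "h \<in> N0"
  shows "tuple_pow T \<alpha> h = P (Lm \<alpha> h)"
proof -
  obtain xs :: "'d list" where "set xs = UNIV \<and> distinct xs" using finite_distinct_list[OF finite] by blast
  then have ex: "\<exists>xs::'d list. distinct xs \<and> set xs = UNIV" by blast
  define js where "js = (SOME is :: 'd list. distinct is \<and> set is = UNIV)"
  have js: "distinct js" "set js = UNIV" using someI_ex[OF ex] unfolding js_def by auto
  have c: "(\<lambda>z. (\<Prod>i\<leftarrow>xs. (z $ i) ^ \<alpha> i) *\<^sub>C h z) \<in> K.C" for xs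
  proof (induction xs)
    case (Cons i xs)
    have "(\<lambda>z. (z $ i) ^ \<alpha> i *\<^sub>C (\<Prod>i\<leftarrow>xs. (z $ i) ^ \<alpha> i) *\<^sub>C h z) \<in> K.C"
      using power_invariant[of K.C, OF bounded_opD(1)[OF coordinate_bounded] Cons] .
    then show ?case by (simp add: scaleC_scaleC)
  qed (use h in \<open>simp add: scaleC_one\<close>)
  have "foldr (\<lambda>i S. (T i ^^ \<alpha> i) \<circ> S) xs id h = P (\<lambda>z. (\<Prod>i\<leftarrow>xs. (z $ i) ^ \<alpha> i) *\<^sub>C h z)" for xs
  proof (induction xs)
    case (Cons i xs)
    then show ?case using T_pow_P[OF c[of xs], where i = i and n = "\<alpha> i"] by (simp add: scaleC_scaleC)
  qed (use h in \<open>simp add: scaleC_one\<close>)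
  then have "tuple_pow T \<alpha> h = P (\<lambda>z. (\<Prod>i\<leftarrow>js. (z $ i) ^ \<alpha> i) *\<^sub>C h z)"
    unfolding tuple_pow_def js_def .
  also have "(\<lambda>z. (\<Prod>i\<leftarrow>js. (z $ i) ^ \<alpha> i) *\<^sub>C h z) = Lm \<alpha> h"
    using js by (simp add: mpow_def prod.distinct_set_conv_list[symmetric])
  finally show ?thesis .
qed

lemma PLm_bounded: "bounded_op N N (\<lambda>h. P (Lm \<alpha> h))"
  by (rule bounded_op_comp[OF bounded_op_restrict[OF Lm_bounded N0_sub] P_bounded K.pre_hilbert_axioms])

lemma tuple_pow_bounded: "bounded_op N N (tuple_pow T \<alpha>)"
  by (rule bounded_op_cong[OF N_pre PLm_bounded]) (simp add: tuple_pow_eq)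

text \<open>The complement of an invariant subspace is invariant under the adjoints, so the adjoint
  of the compression is a plain restriction.\<close>

lemma adj_tuple_pow: "h \<in> N0 \<Longrightarrow> adj N N (tuple_pow T \<alpha>) h = A \<alpha> h"
  by (rule adj_eqI[OF N_hilbert N_pre tuple_pow_bounded]) (simp_all add: tuple_pow_eq P_cip A_adj(2))

lemma b_term_eq: "h \<in> N0 \<Longrightarrow> b_term b N T \<alpha> h = of_real (mweight b \<alpha>) *\<^sub>C P (Lm \<alpha> (A \<alpha> h))"
  by (simp add: b_term_def adj_tuple_pow tuple_pow_eq)

text \<open>\<open>Wa_W\<close> and the row expansion of the adjoint of W, compressed by P. The two
  square roots of the weight come from W and from its adjoint.\<close>

lemma b_hsum:
  assumes h: "h \<in> N0"
  shows "has_hsum N (\<lambda>\<alpha>. b_term b N T \<alpha> h) (- {0}) (h - P (\<kappa> 0 (h 0)))"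
proof -
  have hC: "h \<in> K.C" using h by simp
  have "has_hsum K (\<lambda>\<alpha>. of_real (sqrt (mweight b \<alpha>)) *\<^sub>C Lm \<alpha> (W h \<alpha>)) (- {0}) (h - \<kappa> 0 (h 0))"
    using Wa_hsum[OF W_c[OF hC]] Wa_W[OF hC] by simp
  then have "has_hsum N (\<lambda>\<alpha>. P (of_real (sqrt (mweight b \<alpha>)) *\<^sub>C Lm \<alpha> (W h \<alpha>))) (- {0}) (P (h - \<kappa> 0 (h 0)))"
    by (rule bounded_op_has_hsum[OF K.pre_hilbert_axioms N_pre P_bounded, rotated])
      (use hC in \<open>simp add: W_coord\<close>)
  moreover have "P (of_real (sqrt (mweight b \<alpha>)) *\<^sub>C Lm \<alpha> (W h \<alpha>)) = b_term b N T \<alpha> h" if "\<alpha> \<in> - {0}" for \<alpha>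
  proof -
    have s: "complex_of_real (sqrt (mweight b \<alpha>)) * of_real (sqrt (mweight b \<alpha>)) = of_real (mweight b \<alpha>)"
      unfolding of_real_mult[symmetric] using mweight_b_nonneg[OF ker, of \<alpha>] that by simp
    have wc: "W h \<alpha> = of_real (sqrt (mweight b \<alpha>)) *\<^sub>C A \<alpha> h" using that hC by (simp add: W_coord)
    have "of_real (sqrt (mweight b \<alpha>)) *\<^sub>C Lm \<alpha> (W h \<alpha>) =
      (complex_of_real (sqrt (mweight b \<alpha>)) * of_real (sqrt (mweight b \<alpha>))) *\<^sub>C Lm \<alpha> (A \<alpha> h)"
      unfolding wc by (simp add: fun_eq_iff scaleC_fun_def scaleC_scaleC mult_ac)
    then show ?thesis unfolding b_term_eq[OF h] s using hC by (simp add: P_lin)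
  qed
  ultimately show ?thesis using h hC by (subst (asm) has_hsum_cong) (auto simp: P_lin)
qed

lemma b_sum_eq: "h \<in> N0 \<Longrightarrow> b_sum b N T h = h - P (\<kappa> 0 (h 0))"
  unfolding b_sum_def by (rule pre_hilbert.hsum_eq[OF N_pre b_hsum])

lemma b_sum_c [simp]: "h \<in> N0 \<Longrightarrow> b_sum b N T h \<in> N0" by (simp add: b_sum_eq)

lemma b_sum_cip: "h \<in> N0 \<Longrightarrow> g \<in> N0 \<Longrightarrow> cip K (b_sum b N T h) g = cip K h g - cip E (h 0) (g 0)"
  by (simp add: b_sum_eq K.cip_diff_left P_cip const_cip)

text \<open>Removing the constant term of h lowers the squared norm by that of h(0), and P is a
  contraction.\<close>

lemma b_sum_contraction: "contraction_op N N (b_sum b N T)"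
  unfolding contraction_op_def
proof (intro conjI ballI)
  show "bounded_op N N (b_sum b N T)"
  proof (rule bounded_op_cong[OF N_pre])
    show "bounded_op N N (\<lambda>h. P (h - \<kappa> 0 (h 0)))"
      by (rule bounded_op_comp[OF bounded_op_restrict[OF minus_const_bounded N0_sub] P_bounded K.pre_hilbert_axioms])
    show "b_sum b N T h = P (h - \<kappa> 0 (h 0))" if "h \<in> carrier N" for h
      using that by (simp add: b_sum_eq P_lin)
  qed
  fix h assume "h \<in> carrier N"
  then have h: "h \<in> N0" "h \<in> K.C" by simp_all
  have "K.nrm (b_sum b N T h) = K.nrm (P (h - \<kappa> 0 (h 0)))" using h by (simp add: b_sum_eq P_lin)
  also have "\<dots> \<le> K.nrm (h - \<kappa> 0 (h 0))" using h by (intro K.bounded_proj(2)[OF N0_closed]) simp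
  also have "\<dots> \<le> K.nrm h"
  proof (rule power2_le_imp_le)
    have "Re (cip E (h 0) (h 0)) = (E.nrm (h 0))\<^sup>2" using h by (simp add: E.nrm_sq)
    then show "(K.nrm (h - \<kappa> 0 (h 0)))\<^sup>2 \<le> (K.nrm h)\<^sup>2"
      using h by (simp add: K.nrm_diff_sq const_rep const_nrm)
  qed (use h in simp)
  finally show "hnorm N (b_sum b N T h) \<le> hnorm N h" by simp
qed

lemma T_bounded: "bounded_op N N (T i)"
proof (rule bounded_op_cong[OF N_pre])
  show "bounded_op N N (\<lambda>h. P (\<lambda>z. (z $ i) *\<^sub>C h z))"
    by (rule bounded_op_comp[OF bounded_op_restrict[OF coordinate_bounded N0_sub] P_bounded K.pre_hilbert_axioms])
  show "T i h = P (\<lambda>z. (z $ i) *\<^sub>C h z)" if "h \<in> carrier N" for h using that by (simp add: Mz_eq)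
qed

lemma k_contraction_T: "k_contraction b N T"
  unfolding k_contraction_def commuting_tuple_def
proof (intro conjI allI ballI T_bounded b_sum_contraction)
  have cC: "(\<lambda>z. (z $ i) *\<^sub>C h z) \<in> K.C" if "h \<in> K.C" for i h by (rule bounded_opD(1)[OF coordinate_bounded that])
  fix i j h assume "h \<in> carrier N"
  then have h: "h \<in> N0" "h \<in> K.C" by simp_all
  have "T i (T j h) = P (\<lambda>z. (z $ i) *\<^sub>C (z $ j) *\<^sub>C h z)" for i j
    using T_P[OF cC[OF h(2), of j], of i] h by (simp add: Mz_eq)
  then show "T i (T j h) = T j (T i h)" by (simp add: scaleC_scaleC mult.commute)
next
  fix h assume "h \<in> carrier N"
  then show "has_hsum N (\<lambda>\<alpha>. b_term b N T \<alpha> h) (- {0}) (b_sum b N T h)"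
    using b_hsum[of h] b_sum_eq[of h] by simp
qed

subsection \<open>The defect operator\<close>

abbreviation "\<Delta> \<equiv> defect b N T"

lemma b_sum_sa: "contraction_sa N (b_sum b N T)"
  unfolding contraction_sa_def
proof (intro conjI ballI b_sum_contraction)
  fix h g assume "h \<in> carrier N" "g \<in> carrier N"
  then have h: "h \<in> N0" "h \<in> K.C" and g: "g \<in> N0" "g \<in> K.C" by simp_all
  have "cip K h (b_sum b N T g) = cnj (cip K (b_sum b N T g) h)"
    using h g by (intro K.cip_swap) simp_all
  also have "\<dots> = cip K (b_sum b N T h) g"
    using h g b_sum_cip[of g h] b_sum_cip[of h g] K.cip_swap[of h g] E.cip_swap[of "h 0" "g 0"] by simp
  finally show "cip N (b_sum b N T h) g = cip N h (b_sum b N T g)" by simp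
qed

lemma Delta_sqrt: "positive_op N \<Delta>"
  and Delta_sq: "h \<in> N0 \<Longrightarrow> \<Delta> (\<Delta> h) = P (\<kappa> 0 (h 0))"
  using op_sqrt_eq(1,2)[OF N_hilbert b_sum_sa refl] b_sum_eq[of h] unfolding defect_def by simp_all

lemma Delta_bounded: "bounded_op N N \<Delta>" using Delta_sqrt by (simp add: positive_op_def)

lemma Delta_c [simp]: "h \<in> N0 \<Longrightarrow> \<Delta> h \<in> N0" using bounded_opD(1)[OF Delta_bounded, of h] by simp

lemma Delta_sa: "h \<in> N0 \<Longrightarrow> g \<in> N0 \<Longrightarrow> cip K (\<Delta> h) g = cip K h (\<Delta> g)"
  using hilbert_space.positive_op_sa[OF N_hilbert Delta_sqrt, of h g] by simp

lemma Delta_cip: "h \<in> N0 \<Longrightarrow> g \<in> N0 \<Longrightarrow> cip K (\<Delta> h) (\<Delta> g) = cip E (h 0) (g 0)"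
  using Delta_sa[of "\<Delta> h" g] by (simp add: Delta_sq P_cip const_cip)

text \<open>The compression of \<open>a_hsum\<close>. The square of \<Delta> is the compressed
  projection onto constants, and \<open>P_Lm\<close> supplies the P that this requires in front of
  the constant.\<close>

lemma pure_T: "pure_k_contraction a b N T"
  unfolding pure_k_contraction_def
proof (intro conjI ballI k_contraction_T)
  fix h assume "h \<in> carrier N"
  then have h: "h \<in> N0" "h \<in> K.C" by simp_all
  have c: "Lm \<alpha> (\<kappa> 0 ((A \<alpha> h) 0)) \<in> K.C" for \<alpha> using h by simp
  have "has_hsum N (\<lambda>\<alpha>. P (of_real (mweight a \<alpha>) *\<^sub>C Lm \<alpha> (\<kappa> 0 ((A \<alpha> h) 0)))) UNIV (P h)"
    by (rule bounded_op_has_hsum[OF K.pre_hilbert_axioms N_pre P_bounded _ a_hsum[OF h(2)]])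
      (rule K.scale_c[OF c])
  moreover have "P (of_real (mweight a \<alpha>) *\<^sub>C Lm \<alpha> (\<kappa> 0 ((A \<alpha> h) 0))) = of_real (mweight a \<alpha>) *\<^sub>C
        tuple_pow T \<alpha> (\<Delta> (\<Delta> (adj N N (tuple_pow T \<alpha>) h)))" for \<alpha>
  proof -
    have "P (of_real (mweight a \<alpha>) *\<^sub>C Lm \<alpha> (\<kappa> 0 ((A \<alpha> h) 0))) = of_real (mweight a \<alpha>) *\<^sub>C P (Lm \<alpha> (\<kappa> 0 ((A \<alpha> h) 0)))"
      by (rule P_lin(2)[OF c])
    also have "P (Lm \<alpha> (\<kappa> 0 ((A \<alpha> h) 0))) = P (Lm \<alpha> (P (\<kappa> 0 ((A \<alpha> h) 0))))"
      using h by (intro P_Lm[symmetric]) simp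
    also have "\<dots> = tuple_pow T \<alpha> (\<Delta> (\<Delta> (adj N N (tuple_pow T \<alpha>) h)))"
      using h by (simp add: adj_tuple_pow Delta_sq tuple_pow_eq)
    finally show ?thesis .
  qed
  ultimately show "has_hsum N (\<lambda>\<alpha>. of_real (mweight a \<alpha>) *\<^sub>C
        tuple_pow T \<alpha> (\<Delta> (\<Delta> (adj N N (tuple_pow T \<alpha>) h)))) UNIV h"
    using h by simp
qed

subsection \<open>The row contraction and its defect\<close>

abbreviation "tN \<equiv> direct_sum (- {0::'d \<Rightarrow> nat}) N"
abbreviation "Tt \<equiv> tilde_op b N T"
abbreviation "D \<equiv> tilde_defect b N T"

lemmas tN_hilbert = hilbert_space.ds_hilbert[OF N_hilbert, of "- {0::'d \<Rightarrow> nat}"]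
lemmas tN_pre = pre_hilbert_of_hilbert[OF tN_hilbert]
lemmas tN_ds = ds_sub[OF N0_sub]

lemma tN_KT: "x \<in> carrier tN \<Longrightarrow> x \<in> carrier KT" "x \<in> carrier tN \<Longrightarrow> \<forall>\<alpha>\<in>- {0}. x \<alpha> \<in> N0"
  unfolding tN_ds by auto

lemma W_tN: "h \<in> N0 \<Longrightarrow> W h \<in> carrier tN"
  unfolding tN_ds using W_c[of h] by (auto simp: W_coord)

text \<open>The row operator of the compression is the compressed adjoint of W. Its own adjoint is
  therefore W restricted to the complement (\<open>tilde_adj_eq\<close>).\<close>

lemma Tt_eq:
  assumes x: "x \<in> carrier tN"
  shows "Tt x = P (Wa x)"
  unfolding tilde_op_def
proof (rule pre_hilbert.hsum_eq[OF N_pre])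
  have xa: "x \<alpha> \<in> N0" if "\<alpha> \<in> - {0}" for \<alpha> using tN_KT(2)[OF x] that by blast
  have "has_hsum N (\<lambda>\<alpha>. P (of_real (sqrt (mweight b \<alpha>)) *\<^sub>C Lm \<alpha> (x \<alpha>))) (- {0}) (P (Wa x))"
    by (rule bounded_op_has_hsum[OF K.pre_hilbert_axioms N_pre P_bounded _ Wa_hsum[OF tN_KT(1)[OF x]]])
      (simp add: xa)
  moreover have "P (of_real (sqrt (mweight b \<alpha>)) *\<^sub>C Lm \<alpha> (x \<alpha>)) = of_real (sqrt (mweight b \<alpha>)) *\<^sub>C tuple_pow T \<alpha> (x \<alpha>)"
    if "\<alpha> \<in> - {0}" for \<alpha> using xa[OF that] by (simp add: tuple_pow_eq P_lin)
  ultimately show "has_hsum N (\<lambda>\<alpha>. of_real (sqrt (mweight b \<alpha>)) *\<^sub>C tuple_pow T \<alpha> (x \<alpha>)) (- {0}) (P (Wa x))"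
    by (subst (asm) has_hsum_cong) auto
qed

lemma Tt_bounded: "bounded_op tN N Tt"
proof (rule bounded_op_cong[OF tN_pre])
  have "bounded_op tN K Wa" using Wa_bounded tN_KT(1) unfolding bounded_op_def tN_ds(3) by blast
  then show "bounded_op tN N (\<lambda>x. P (Wa x))" by (rule bounded_op_comp[OF _ P_bounded K.pre_hilbert_axioms])
qed (rule Tt_eq)

lemma Tt_c [simp]: "x \<in> carrier tN \<Longrightarrow> Tt x \<in> N0" using bounded_opD(1)[OF Tt_bounded, of x] by simp

lemma Tt_cip: "x \<in> carrier tN \<Longrightarrow> h \<in> N0 \<Longrightarrow> cip K (Tt x) h = cip KT x (W h)"
  using Wa_adj_left[OF tN_KT(1)[of x] N0_c[of h]] Wa_adj(1)[OF tN_KT(1)[of x]] by (simp add: Tt_eq P_cip)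

lemma Tt_cip': "x \<in> carrier tN \<Longrightarrow> h \<in> N0 \<Longrightarrow> cip K h (Tt x) = cip KT (W h) x"
  using Tt_cip[of x h] K.cip_swap[of h "Tt x"] pre_hilbert.cip_swap[OF KT_pre W_c[of h] tN_KT(1)[of x]] by simp

lemma tilde_adj_eq: "h \<in> N0 \<Longrightarrow> tilde_adj b N T h = W h"
  unfolding tilde_adj_def tilde_space_def
  by (rule adj_eqI[OF tN_hilbert N_pre Tt_bounded]) (simp_all add: W_tN Tt_cip tN_ds(2))

lemma Tt_le: "x \<in> carrier tN \<Longrightarrow> K.nrm (Tt x) \<le> hnorm KT x"
  using order_trans[OF K.bounded_proj(2)[OF N0_closed Wa_adj(1)] Wa_le] tN_KT(1)[of x] by (simp add: Tt_eq)

lemma Tt_W: "h \<in> N0 \<Longrightarrow> Tt (W h) = b_sum b N T h"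
  by (simp add: Tt_eq W_tN Wa_W b_sum_eq P_lin)

lemma W_N_bounded: "bounded_op N tN W"
  using W_bounded W_tN unfolding bounded_op_def tN_ds(3) sub_hilbert_simps by (meson N0_c)

lemma WTt_sa: "contraction_sa tN (\<lambda>x. W (Tt x))"
  unfolding contraction_sa_def contraction_op_def
proof (intro conjI ballI)
  show "bounded_op tN tN (\<lambda>x. W (Tt x))" by (rule bounded_op_comp[OF Tt_bounded W_N_bounded N_pre])
  fix x assume x: "x \<in> carrier tN"
  show "hnorm tN (W (Tt x)) \<le> hnorm tN x"
    using order_trans[OF W_le Tt_le] x by (simp add: tN_ds(3))
  fix y assume y: "y \<in> carrier tN"
  show "cip tN (W (Tt x)) y = cip tN x (W (Tt y))"
    using Tt_cip[OF x Tt_c[OF y]] Tt_cip'[OF y Tt_c[OF x]] by (simp add: tN_ds(2))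
qed

lemma D_aux: "x \<in> carrier tN \<Longrightarrow> x - tilde_adj b N T (Tt x) = x - W (Tt x)"
  by (simp add: tilde_adj_eq)

lemma D_sqrt: "positive_op tN D"
  and D_sq: "x \<in> carrier tN \<Longrightarrow> D (D x) = x - W (Tt x)"
  using op_sqrt_eq(1,2)[OF tN_hilbert WTt_sa D_aux] D_aux[of x]
  unfolding tilde_defect_def tilde_space_def by simp_all

lemma D_bounded: "bounded_op tN tN D" using D_sqrt by (simp add: positive_op_def)

lemma D_c [simp]: "x \<in> carrier tN \<Longrightarrow> D x \<in> carrier tN" by (rule bounded_opD(1)[OF D_bounded])

lemma D_sa: "x \<in> carrier tN \<Longrightarrow> y \<in> carrier tN \<Longrightarrow> cip KT (D x) y = cip KT x (D y)"
  using hilbert_space.positive_op_sa[OF tN_hilbert D_sqrt, of x y] by (simp add: tN_ds(2))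

text \<open>The roots are those of I - Tt W and I - W Tt, and Tt (W Tt) = (Tt W) Tt;
  \<open>D_W\<close> uses the mirror identity for W.\<close>

lemma Tt_D: "x \<in> carrier tN \<Longrightarrow> Tt (D x) = \<Delta> (Tt x)"
  unfolding tilde_defect_def tilde_space_def defect_def
  by (rule op_sqrt_intertwine[OF tN_hilbert N_hilbert Tt_bounded WTt_sa b_sum_sa D_aux refl]) (simp_all add: Tt_W)

lemma D_W: "h \<in> N0 \<Longrightarrow> D (W h) = W (\<Delta> h)"
  unfolding tilde_defect_def tilde_space_def defect_def
  by (rule op_sqrt_intertwine[OF N_hilbert tN_hilbert W_N_bounded b_sum_sa WTt_sa refl D_aux, symmetric]) (simp_all add: Tt_W)

end

section \<open>Tensor products with closed subspaces of E, and the reducing subspaces they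
  give\<close>

context kernel_tensor
begin

text \<open>The two tensor products are separate choices, so their inclusion is not automatic; it
  comes from tensoring the isometric inclusion of coefficient spaces.\<close>

lemma sub_tensor_embedding:
  assumes E': "closed_subspace E E'"
  defines "K' \<equiv> Hk k \<otimes>\<^sub>H sub_hilbert E E'"
  shows "bounded_op K' K (\<lambda>F. F)" "\<And>F G. F \<in> carrier K' \<Longrightarrow> G \<in> carrier K' \<Longrightarrow> cip K F G = cip K' F G"
proof -
  have b: "bounded_op (sub_hilbert E E') E (\<lambda>x. x)"
    using bounded_op_restrict[OF bounded_op_id E.closed_subspaceD(2)[OF E']] .
  note ti = tensor_isometry(1,2)[OF ker E.sub_hilbert_space[OF E'] EH b, folded K'_def]
  show "bounded_op K' K (\<lambda>F. F)" using ti(1) by simp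
  show "cip K F G = cip K' F G" if "F \<in> carrier K'" "G \<in> carrier K'" for F G
    using ti(2)[OF _ that] by simp
qed

text \<open>The adjoint of the inclusion is the projection of values onto E', described here by
  pairing with vectors of E'.\<close>

lemma sub_tensor_adj_value:
  assumes E': "closed_subspace E E'" and F: "F \<in> K.C" and w: "w \<in> Bd" and e: "e \<in> E'"
  defines "K' \<equiv> Hk k \<otimes>\<^sub>H sub_hilbert E E'"
  shows "cip E (adj K' K (\<lambda>F. F) F w) e = cip E (F w) e"
proof -
  have EH': "hilbert_space (sub_hilbert E E')" by (rule E.sub_hilbert_space[OF E'])
  have eC: "e \<in> E.C" using e E.closed_subspaceD(2)[OF E'] by blast
  have H': "hilbert_space K'" unfolding K'_def by (rule K_hilbert[OF ker EH'])
  note ad = adj(1)[OF H' K.pre_hilbert_axioms sub_tensor_embedding(1)[OF E', folded K'_def] F]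
    and adl = adj_left[OF H' K.pre_hilbert_axioms sub_tensor_embedding(1)[OF E', folded K'_def] F]
  have kc: "\<kappa> w e \<in> carrier K'" unfolding K'_def by (rule K_kap[OF ker EH' w]) (use e in simp)
  have "cip K' (adj K' K (\<lambda>F. F) F) (\<kappa> w e) = cip E (adj K' K (\<lambda>F. F) F w) e"
    using K_rep[OF ker EH' ad[unfolded K'_def] w] e unfolding K'_def by simp
  moreover have "cip K' (adj K' K (\<lambda>F. F) F) (\<kappa> w e) = cip K F (\<kappa> w e)" by (rule adl[OF kc])
  ultimately show ?thesis using rep[OF F w eC] by simp
qed

text \<open>A function with values in E' agrees pointwise with its image under the adjoint of the
  inclusion, and that image lies in the smaller space.\<close>

lemma sub_tensor_carrier:
  assumes E': "closed_subspace E E'"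
  shows "carrier (Hk k \<otimes>\<^sub>H sub_hilbert E E') = {F \<in> K.C. \<forall>z. F z \<in> E'}"
proof -
  let ?K' = "Hk k \<otimes>\<^sub>H sub_hilbert E E'"
  have EH': "hilbert_space (sub_hilbert E E')" by (rule E.sub_hilbert_space[OF E'])
  note emb = sub_tensor_embedding(1)[OF E']
  note E'D = E.closed_subspaceD[OF E']
  have E'C: "\<And>e. e \<in> E' \<Longrightarrow> e \<in> E.C" using E'D(2) by blast
  have "F \<in> K.C" "F z \<in> E'" if "F \<in> carrier ?K'" for F z
    using bounded_opD(1)[OF emb that] K_values[OF ker EH' that, of z] by simp_all
  moreover have "F \<in> carrier ?K'" if F: "F \<in> K.C" and v: "\<And>z. F z \<in> E'" for F
  proof -
    let ?F1 = "adj ?K' K (\<lambda>F. F) F"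
    have F1: "?F1 \<in> carrier ?K'" by (rule adj(1)[OF K_hilbert[OF ker EH'] K.pre_hilbert_axioms emb F])
    have F1v: "?F1 z \<in> E'" for z using K_values[OF ker EH' F1, of z] by simp
    have "?F1 z = F z" for z
    proof (cases "z \<in> Bd")
      case True
      show ?thesis
      proof (rule pre_hilbert.eq_if_cip_eq[OF pre_hilbert_of_hilbert[OF EH']])
        fix u assume "u \<in> carrier (sub_hilbert E E')"
        then show "cip (sub_hilbert E E') (?F1 z) u = cip (sub_hilbert E E') (F z) u"
          using sub_tensor_adj_value[OF E' F True, of u] by simp
      qed (use F1v v in simp_all)
    next
      case False
      then show ?thesis using K_off[OF ker EH' F1 False] off[OF F False] by simp
    qed
    then have "?F1 = F" by (rule ext)
    then show ?thesis using F1 by simp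
  qed
  ultimately show ?thesis by blast
qed

text \<open>The adjoint of the inclusion sends F to a function orthogonal to E' at every point,
  hence to 0; pairing F with G only sees this image.\<close>

lemma orth_values:
  assumes E': "closed_subspace E E'" and F: "F \<in> K.C" "\<And>z. F z \<in> orth_compl E E'"
    and G: "G \<in> K.C" "\<And>z. G z \<in> E'"
  shows "cip K F G = 0"
proof -
  let ?K' = "Hk k \<otimes>\<^sub>H sub_hilbert E E'"
  have EH': "hilbert_space (sub_hilbert E E')" by (rule E.sub_hilbert_space[OF E'])
  have H': "hilbert_space ?K'" by (rule K_hilbert[OF ker EH'])
  interpret K': hilbert_space ?K' by (rule H')
  note emb = sub_tensor_embedding(1)[OF E']
  let ?F1 = "adj ?K' K (\<lambda>F. F) F"
  have F1: "?F1 \<in> K'.C" by (rule adj(1)[OF H' K.pre_hilbert_axioms emb F(1)])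
  have G': "G \<in> K'.C" using G sub_tensor_carrier[OF E'] by simp
  have "?F1 = 0"
  proof (rule K_eqI[OF ker EH' F1 K'.zero_c])
    fix w :: "complex ^ 'd" and e assume w: "w \<in> Bd" and e: "e \<in> carrier (sub_hilbert E E')"
    have "cip E (?F1 w) e = 0" using sub_tensor_adj_value[OF E' F(1) w, of e] F(2)[of w] e by (simp add: orth_compl_def)
    then show "cip ?K' ?F1 (\<kappa> w e) = cip ?K' 0 (\<kappa> w e)"
      using K_rep[OF ker EH' F1 w e] K'.cip_zero_left[OF K_kap[OF ker EH' w e]] by simp
  qed
  then show ?thesis using adj_left[OF H' K.pre_hilbert_axioms emb F(1) G'] K'.cip_zero_left[OF G'] by simp
qed

lemma values_orth_compl:
  assumes E': "closed_subspace E E'"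
  shows "{F \<in> K.C. \<forall>z. F z \<in> orth_compl E E'} = orth_compl K {\<kappa> w e | w e. w \<in> Bd \<and> e \<in> E'}"
proof -
  have E'C: "\<And>e. e \<in> E' \<Longrightarrow> e \<in> E.C" using E.closed_subspaceD(2)[OF E'] by blast
  have 0: "0 \<in> orth_compl E E'" using E'C by (simp add: orth_compl_def)
  have "F z \<in> orth_compl E E'" if F: "F \<in> K.C" and o: "\<And>w e. w \<in> Bd \<Longrightarrow> e \<in> E' \<Longrightarrow> cip K F (\<kappa> w e) = 0" for F z
  proof (cases "z \<in> Bd")
    case True
    have "cip E (F z) e = 0" if "e \<in> E'" for e using o[OF True that] rep[OF F True E'C[OF that]] by simp
    then show ?thesis using val_c[OF F] by (simp add: orth_compl_def)
  qed (simp add: off[OF F] 0)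
  note 1 = this
  have 2: "cip K F (\<kappa> w e) = 0" if "F \<in> K.C" "F w \<in> orth_compl E E'" "w \<in> Bd" "e \<in> E'" for F w e
    using rep[OF that(1,3) E'C[OF that(4)]] that(2,4) by (simp add: orth_compl_def)
  show ?thesis
  proof (rule set_eqI, rule iffI)
    fix F assume "F \<in> {F \<in> K.C. \<forall>z. F z \<in> orth_compl E E'}"
    then have F: "F \<in> K.C" "\<And>z. F z \<in> orth_compl E E'" by simp_all
    have "cip K F s = 0" if s: "s \<in> {\<kappa> w e | w e. w \<in> Bd \<and> e \<in> E'}" for s
    proof -
      obtain w e where "s = \<kappa> w e" "w \<in> Bd" "e \<in> E'" using s by blast
      then show ?thesis using 2[OF F(1) F(2)] by simp
    qed
    then show "F \<in> orth_compl K {\<kappa> w e | w e. w \<in> Bd \<and> e \<in> E'}" using F(1) by (simp add: orth_compl_def[of K])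
  next
    fix F assume "F \<in> orth_compl K {\<kappa> w e | w e. w \<in> Bd \<and> e \<in> E'}"
    then have F: "F \<in> K.C" and o: "\<forall>s\<in>{\<kappa> w e | w e. w \<in> Bd \<and> e \<in> E'}. cip K F s = 0"
      by (simp_all add: orth_compl_def[of K])
    have "cip K F (\<kappa> w e) = 0" if "w \<in> Bd" "e \<in> E'" for w e
      by (rule o[rule_format]) (use that in blast)
    then show "F \<in> {F \<in> K.C. \<forall>z. F z \<in> orth_compl E E'}" using F 1[OF F] by simp
  qed
qed

lemma Mz_bounded: "bounded_op K K (Mz_tensor_I k E i)"
  by (rule bounded_op_cong[OF K.pre_hilbert_axioms coordinate_bounded Mz_eq])

text \<open>The subspace is the complement of the kernel functions with coefficients in E2.
  Invariance under the adjoints follows since multiplying such a kernel function by z_i keeps its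
  values in E2.\<close>

lemma reducing_values:
  assumes E1: "closed_subspace E E1"
  shows "reducing K (Mz_tensor_I k E) {F \<in> K.C. \<forall>z. F z \<in> E1}"
proof -
  define E2 where "E2 = orth_compl E E1"
  have E2: "closed_subspace E E2" unfolding E2_def by (rule E.orth_compl_closed[OF E.closed_subspaceD(2)[OF E1]])
  have E21: "orth_compl E E2 = E1" unfolding E2_def by (rule E.orth_compl_orth_compl[OF E1])
  have E2C: "\<And>e. e \<in> E2 \<Longrightarrow> e \<in> E.C" using E.closed_subspaceD(2)[OF E2] by blast
  let ?S = "{F \<in> K.C. \<forall>z. F z \<in> E1}"
  have eq: "?S = orth_compl K {\<kappa> w e | w e. w \<in> Bd \<and> e \<in> E2}" using values_orth_compl[OF E2] E21 by simp
  show ?thesis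
    unfolding reducing_def
  proof (intro conjI allI ballI)
    show "closed_subspace K ?S" unfolding eq by (rule K.orth_compl_closed) (use E2C in auto)
    fix i F assume "F \<in> ?S"
    then have F: "F \<in> K.C" "\<And>z. F z \<in> E1" by auto
    have cC: "(\<lambda>z. (z $ i) *\<^sub>C G z) \<in> K.C" if "G \<in> K.C" for G by (rule bounded_opD(1)[OF coordinate_bounded that])
    show "Mz_tensor_I k E i F \<in> ?S"
      using F cC[OF F(1)] complex_vector.subspace_scale[OF E.closed_subspaceD(1)[OF E1]] by (simp add: Mz_eq)
    note ad = adj[OF K.hilbert_space_axioms K.pre_hilbert_axioms Mz_bounded[of i] F(1)]
      and adl = adj_left[OF K.hilbert_space_axioms K.pre_hilbert_axioms Mz_bounded[of i] F(1)]
    have "cip K (adj K K (Mz_tensor_I k E i) F) (\<kappa> w e) = 0" if w: "w \<in> Bd" and e: "e \<in> E2" for w e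
    proof -
      note kc = kap_c[OF w E2C[OF e]]
      have "cip K (adj K K (Mz_tensor_I k E i) F) (\<kappa> w e) = cip K F (\<lambda>z. (z $ i) *\<^sub>C \<kappa> w e z)"
        using adl[OF kc] Mz_eq[OF kc] by simp
      also have "\<dots> = 0"
      proof (rule orth_values[OF E2 F(1) _ cC[OF kc]])
        show "F z \<in> orth_compl E E2" for z using F(2) E21 by simp
        note sub = E.closed_subspaceD(1)[OF E2]
        show "(z $ i) *\<^sub>C \<kappa> w e z \<in> E2" for z
          using complex_vector.subspace_scale[OF sub] complex_vector.subspace_0[OF sub] e by (simp add: kap_def)
      qed
      finally show ?thesis .
    qed
    then show "adj K K (Mz_tensor_I k E i) F \<in> ?S" unfolding eq orth_compl_def[of K] using ad(1) by blast
  qed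
qed

end

context invariant_subspace
begin

section \<open>The unitary identification of the defect space\<close>

abbreviation "E1 \<equiv> orth_compl E ((\<lambda>h. h 0) ` N0)"
abbreviation "E2 \<equiv> orth_compl E E1"
abbreviation "EH2 \<equiv> sub_hilbert E E2"
abbreviation "DS \<equiv> defect_space b N T"
abbreviation "DT \<equiv> tilde_defect_space b N T"
definition dsC where "dsC = htop N closure_of (\<Delta> ` N0)"
definition dtC where "dtC = htop tN closure_of (D ` carrier tN)"

lemma DS_simps [simp]: "carrier DS = dsC" "cip DS = cip K" "hnorm DS = K.nrm"
  by (simp_all add: defect_space_def closed_range_def dsC_def)

lemma DT_simps [simp]: "carrier DT = dtC" "cip DT = cip KT" "hnorm DT = hnorm KT"
  by (simp_all add: tilde_defect_space_def closed_range_def tilde_space_def dtC_def tN_ds)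

lemma Delta_img: "csubspace (\<Delta> ` N0)" "\<Delta> ` N0 \<subseteq> N0"
  by (rule csubspace_image[OF N_pre Delta_bounded, unfolded sub_hilbert_simps]) (rule image_subsetI, rule Delta_c)

lemma D_img: "csubspace (D ` carrier tN)" "D ` carrier tN \<subseteq> carrier tN"
  by (rule csubspace_image[OF tN_pre D_bounded]) (rule image_subsetI, rule D_c)

lemma dsC_closed: "closed_subspace N dsC" "\<Delta> ` N0 \<subseteq> dsC"
  using hilbert_space.closed_subspace_closure[OF N_hilbert Delta_img(1)] Delta_img(2) unfolding dsC_def by simp_all

lemma dtC_closed: "closed_subspace tN dtC" "D ` carrier tN \<subseteq> dtC"
  using hilbert_space.closed_subspace_closure[OF tN_hilbert D_img] unfolding dtC_def by simp_all

lemma dsC_N0 [simp]: "x \<in> dsC \<Longrightarrow> x \<in> N0"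
  using hilbert_space.closed_subspaceD(2)[OF N_hilbert dsC_closed(1)] unfolding sub_hilbert_simps by blast

lemma dtC_tN [simp]: "x \<in> dtC \<Longrightarrow> x \<in> carrier tN"
  using hilbert_space.closed_subspaceD(2)[OF tN_hilbert dtC_closed(1)] by blast

lemma Delta_ds [simp]: "h \<in> N0 \<Longrightarrow> \<Delta> h \<in> dsC" using dsC_closed(2) by blast
lemma D_dt [simp]: "x \<in> carrier tN \<Longrightarrow> D x \<in> dtC" using dtC_closed(2) by blast

lemma DS_hilbert: "hilbert_space DS"
  using hilbert_space.sub_hilbert_space[OF N_hilbert dsC_closed(1)]
  unfolding defect_space_def closed_range_def sub_hilbert_simps dsC_def .

lemma DT_hilbert: "hilbert_space DT"
  using hilbert_space.sub_hilbert_space[OF tN_hilbert dtC_closed(1)]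
  unfolding tilde_defect_space_def closed_range_def tilde_space_def dtC_def .

lemmas DS_pre = pre_hilbert_of_hilbert[OF DS_hilbert] and DT_pre = pre_hilbert_of_hilbert[OF DT_hilbert]
lemmas dsC_csub = pre_hilbert.csub[OF DS_pre, unfolded DS_simps]
lemmas dtC_csub = pre_hilbert.csub[OF DT_pre, unfolded DT_simps]

lemma V_c: "(\<lambda>h. h 0) ` N0 \<subseteq> E.C" by auto
lemma E1_closed: "closed_subspace E E1" by (rule E.orth_compl_closed[OF V_c])
lemma E1_sub: "E1 \<subseteq> E.C" by (rule E.closed_subspaceD(2)[OF E1_closed])
lemma E2_closed: "closed_subspace E E2" by (rule E.orth_compl_closed[OF E1_sub])
lemma E12: "orth_compl E E2 = E1" by (rule E.orth_compl_orth_compl[OF E1_closed])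
lemma E2_c [simp]: "e \<in> E2 \<Longrightarrow> e \<in> E.C" using E.closed_subspaceD(2)[OF E2_closed] by blast
lemma EH2_hilbert: "hilbert_space EH2" by (rule E.sub_hilbert_space[OF E2_closed])
lemmas EH2_pre = pre_hilbert_of_hilbert[OF EH2_hilbert]

lemma V_E2: "h \<in> N0 \<Longrightarrow> h 0 \<in> E2"
proof -
  assume h: "h \<in> N0"
  have "cip E (h 0) x = 0" if x: "x \<in> E1" for x
  proof -
    have "x \<in> E.C" using x E1_sub by blast
    moreover have "cip E x (h 0) = 0"
      using x imageI[OF h, of "\<lambda>h. h 0"] unfolding orth_compl_def[of E "(\<lambda>h. h 0) ` N0"] by blast
    ultimately have "cip E x (h 0) = 0" "x \<in> E.C" by blast+
    then show ?thesis using E.cip_swap[of "h 0" x] h by simp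
  qed
  then show ?thesis unfolding orth_compl_def[of E E1] using val_c[OF N0_c[OF h]] by blast
qed

lemma E1I: "e \<in> E.C \<Longrightarrow> (\<And>h. h \<in> N0 \<Longrightarrow> cip E e (h 0) = 0) \<Longrightarrow> e \<in> E1"
  unfolding orth_compl_def[of E "(\<lambda>h. h 0) ` N0"] by blast

text \<open>The constant terms of functions in N0 separate E2, because a vector orthogonal to all of
  them lies in E1.\<close>

lemma E2_eqI:
  assumes e: "e \<in> E2" "f \<in> E2" and eq: "\<And>h. h \<in> N0 \<Longrightarrow> cip E e (h 0) = cip E f (h 0)"
  shows "e = f"
proof -
  have d2: "e - f \<in> E2" using e complex_vector.subspace_diff[OF E.closed_subspaceD(1)[OF E2_closed]] by blast
  have "e - f \<in> E1" by (rule E1I) (use e eq in \<open>simp_all add: E.cip_diff_left\<close>)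
  then have "cip E (e - f) (e - f) = 0" using d2 unfolding orth_compl_def[of E E1] by blast
  then show ?thesis using E.cip_self_0D[of "e - f"] e by simp
qed

lemma tau_exists: "\<exists>\<tau>. bounded_op DS EH2 \<tau> \<and> (\<forall>h\<in>N0. \<tau> (\<Delta> h) = h 0) \<and>
    (\<forall>x\<in>carrier DS. \<forall>y\<in>carrier DS. cip EH2 (\<tau> x) (\<tau> y) = cip DS x y)"
proof (rule gram_extension[OF DS_hilbert EH2_hilbert bounded_op_id])
  show "\<Delta> h \<in> carrier DS" if "h \<in> N0" for h using that by simp
  show "h 0 \<in> carrier EH2" if "h \<in> N0" for h using V_E2[OF that] by simp
  show "x = 0" if x: "x \<in> carrier DS" and o: "\<And>h. h \<in> N0 \<Longrightarrow> cip DS x (\<Delta> h) = 0" for x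
  proof (rule hilbert_space.closure_orth_0[OF N_hilbert Delta_img(1)])
    show "\<Delta> ` N0 \<subseteq> carrier N" using Delta_img(2) by simp
    show "x \<in> htop N closure_of \<Delta> ` N0" using x by (simp add: dsC_def[symmetric])
    show "cip N x s = 0" if "s \<in> \<Delta> ` N0" for s using that o by auto
  qed
  show "cip EH2 (h 0) (g 0) = cip DS (\<Delta> h) (\<Delta> g)" if "h \<in> N0" "g \<in> N0" for h g
    using Delta_cip[OF that] by simp
qed

definition \<tau> where "\<tau> = (SOME \<tau>. bounded_op DS EH2 \<tau> \<and> (\<forall>h\<in>N0. \<tau> (\<Delta> h) = h 0) \<and>
    (\<forall>x\<in>carrier DS. \<forall>y\<in>carrier DS. cip EH2 (\<tau> x) (\<tau> y) = cip DS x y))"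

lemma tau_bounded: "bounded_op DS EH2 \<tau>"
  and tau_Delta: "h \<in> N0 \<Longrightarrow> \<tau> (\<Delta> h) = h 0"
  and tau_iso: "x \<in> dsC \<Longrightarrow> y \<in> dsC \<Longrightarrow> cip E (\<tau> x) (\<tau> y) = cip K x y"
  using someI_ex[OF tau_exists] unfolding \<tau>_def[symmetric] by auto

lemma tau_c: "x \<in> dsC \<Longrightarrow> \<tau> x \<in> E2" using bounded_opD(1)[OF tau_bounded, of x] by simp

definition \<sigma> where "\<sigma> = adj DS EH2 \<tau>"

lemma sigma_bounded: "bounded_op EH2 DS \<sigma>"
  unfolding \<sigma>_def by (rule bounded_op_adj[OF DS_hilbert EH2_pre tau_bounded])

lemma sigma_c [simp]: "e \<in> E2 \<Longrightarrow> \<sigma> e \<in> dsC" using bounded_opD(1)[OF sigma_bounded, of e] by simp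

lemma sigma_cip: "x \<in> dsC \<Longrightarrow> e \<in> E2 \<Longrightarrow> cip K x (\<sigma> e) = cip E (\<tau> x) e"
  using adj(2)[OF DS_hilbert EH2_pre tau_bounded, of e x] by (simp add: \<sigma>_def)

lemma sigma_cip': "x \<in> dsC \<Longrightarrow> e \<in> E2 \<Longrightarrow> cip K (\<sigma> e) x = cip E e (\<tau> x)"
  using adj_left[OF DS_hilbert EH2_pre tau_bounded, of e x] by (simp add: \<sigma>_def)

lemma sigma_tau: "x \<in> dsC \<Longrightarrow> \<sigma> (\<tau> x) = x"
  unfolding \<sigma>_def by (rule adj_eqI[OF DS_hilbert EH2_pre tau_bounded]) (simp_all add: tau_c tau_iso)

text \<open>This is surjectivity of \<tau>: both sides pair equally with every h(0) = \<tau>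
  (\<Delta> h), and these vectors separate E2.\<close>

lemma tau_sigma: "e \<in> E2 \<Longrightarrow> \<tau> (\<sigma> e) = e"
proof (rule E2_eqI)
  assume e: "e \<in> E2"
  then show "\<tau> (\<sigma> e) \<in> E2" "e \<in> E2" by (simp_all add: tau_c)
  fix h assume h: "h \<in> N0"
  have "cip E (\<tau> (\<sigma> e)) (\<tau> (\<Delta> h)) = cip K (\<sigma> e) (\<Delta> h)" using e h by (simp add: tau_iso)
  also have "\<dots> = cip E e (\<tau> (\<Delta> h))" using e h by (simp add: sigma_cip')
  finally show "cip E (\<tau> (\<sigma> e)) (h 0) = cip E e (h 0)" using h by (simp add: tau_Delta)
qed

lemma sigma_iso: "e \<in> E2 \<Longrightarrow> f \<in> E2 \<Longrightarrow> cip K (\<sigma> e) (\<sigma> f) = cip E e f"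
  by (simp add: sigma_cip tau_sigma)

text \<open>The adjoint form of \<tau> (\<Delta> h) = h(0); it rewrites compressed constants in
  terms of \<Delta>.\<close>

lemma Delta_sigma: "e \<in> E2 \<Longrightarrow> \<Delta> (\<sigma> e) = P (\<kappa> 0 e)"
proof (rule pre_hilbert.eq_if_cip_eq[OF N_pre])
  assume e: "e \<in> E2"
  then show "\<Delta> (\<sigma> e) \<in> carrier N" "P (\<kappa> 0 e) \<in> carrier N" by simp_all
  fix h assume "h \<in> carrier N"
  then have h: "h \<in> N0" by simp
  have "cip K (\<Delta> (\<sigma> e)) h = cip K (\<sigma> e) (\<Delta> h)" using e h by (simp add: Delta_sa)
  also have "\<dots> = cip E e (h 0)" using e h by (simp add: sigma_cip' tau_Delta)
  also have "\<dots> = cip K (P (\<kappa> 0 e)) h" using e h by (simp add: P_cip const_cip)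
  finally show "cip N (\<Delta> (\<sigma> e)) h = cip N (P (\<kappa> 0 e)) h" by simp
qed

lemma tau_unitary: "unitary_op DS EH2 \<tau>"
  unfolding unitary_op_def
proof (intro conjI tau_bounded ballI)
  show "\<tau> ` carrier DS = carrier EH2"
  proof
    show "\<tau> ` carrier DS \<subseteq> carrier EH2" using tau_c by auto
    show "carrier EH2 \<subseteq> \<tau> ` carrier DS"
    proof
      fix e assume "e \<in> carrier EH2"
      then have "e = \<tau> (\<sigma> e)" "\<sigma> e \<in> carrier DS" by (simp_all add: tau_sigma)
      then show "e \<in> \<tau> ` carrier DS" by blast
    qed
  qed
qed (simp add: tau_iso)

subsection \<open>Values of functions in the co-invariant subspace\<close>

text \<open>Z(z) as an adjoint, the form in which \<open>resolvent\<close> speaks of it;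
  \<open>Z_op_eq\<close> links it to the series.\<close>

definition Zf :: "complex ^ 'd \<Rightarrow> (('d \<Rightarrow> nat) \<Rightarrow> complex ^ 'd \<Rightarrow> 'e) \<Rightarrow> complex ^ 'd \<Rightarrow> 'e"
  where "Zf z = adj N tN (wv z)"

lemmas wv_N = wv_bounded[OF N_hilbert]

lemma wv_c [simp]: "z \<in> Bd \<Longrightarrow> h \<in> N0 \<Longrightarrow> wv z h \<in> carrier tN"
  using bounded_opD(1)[OF wv_N, of z h] by simp

lemma Zf_c [simp]: "z \<in> Bd \<Longrightarrow> x \<in> carrier tN \<Longrightarrow> Zf z x \<in> N0"
  using adj(1)[OF N_hilbert tN_pre wv_N, of z x] by (simp add: Zf_def)

lemma Zf_cip: "z \<in> Bd \<Longrightarrow> x \<in> carrier tN \<Longrightarrow> h \<in> N0 \<Longrightarrow> cip K (Zf z x) h = cip KT x (wv z h)"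
  using adj_left[OF N_hilbert tN_pre wv_N, of z x h] by (simp add: Zf_def tN_ds)

lemma resolvent_N0:
  assumes z: "z \<in> Bd"
  shows "bij_betw (\<lambda>h. h - Zf z (W h)) N0 N0" "\<And>g. g \<in> N0 \<Longrightarrow> (g - Zf z (W g)) z = g 0"
  unfolding Zf_def by (rule resolvent(1,2)[OF N0_closed A_N0 z]; assumption)+

lemma N0_values: "h \<in> N0 \<Longrightarrow> h z \<in> E2"
proof (cases "z \<in> Bd")
  case True
  assume "h \<in> N0"
  then obtain g where g: "g \<in> N0" "h = g - Zf z (W g)"
    using bij_betw_imp_surj_on[OF resolvent_N0(1)[OF True]] by blast
  then show ?thesis using resolvent_N0(2)[OF True g(1)] V_E2[OF g(1)] by simp
next
  case False
  assume h: "h \<in> N0"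
  show ?thesis using off[OF N0_c[OF h] False] complex_vector.subspace_0[OF E.closed_subspaceD(1)[OF E2_closed]] by simp
qed

lemma Z_op_eq:
  assumes z: "z \<in> Bd" and x: "x \<in> carrier tN"
  shows "Z_op b N z x = Zf z x"
  unfolding Z_op_def
proof (rule pre_hilbert.hsum_eq[OF N_pre])
  have "has_hsum N (\<lambda>\<alpha>. adj N N (\<lambda>f. wv z f \<alpha>) (x \<alpha>)) (- {0}) (Zf z x)"
    unfolding Zf_def by (rule adj_direct_sum_has_hsum[OF N_hilbert N_pre wv_N[OF z] x])
  moreover have "adj N N (\<lambda>f. wv z f \<alpha>) (x \<alpha>) = (of_real (sqrt (mweight b \<alpha>)) * mpow z \<alpha>) *\<^sub>C x \<alpha>"
    if a: "\<alpha> \<in> - {0}" for \<alpha>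
  proof (rule adj_eqI[OF N_hilbert N_pre bounded_op_coord[OF N_pre wv_N[OF z] a]])
    have xa: "x \<alpha> \<in> N0" using tN_KT(2)[OF x] a by blast
    then show "x \<alpha> \<in> carrier N" "(of_real (sqrt (mweight b \<alpha>)) * mpow z \<alpha>) *\<^sub>C x \<alpha> \<in> carrier N" by simp_all
    fix f assume "f \<in> carrier N"
    then show "cip N (wv z f \<alpha>) (x \<alpha>) = cip N f ((of_real (sqrt (mweight b \<alpha>)) * mpow z \<alpha>) *\<^sub>C x \<alpha>)"
      using xa a by (simp add: wv_def awt_def K.cip_scale_left K.cip_scale_right)
  qed
  ultimately show "has_hsum N (\<lambda>\<alpha>. (of_real (sqrt (mweight b \<alpha>)) * mpow z \<alpha>) *\<^sub>C x \<alpha>) (- {0}) (Zf z x)"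
    by (subst (asm) has_hsum_cong) auto
qed

section \<open>The characteristic function\<close>

abbreviation "\<theta> \<equiv> char_fun b N T"

lemma W_ds_dt: "x \<in> dsC \<Longrightarrow> W x \<in> dtC"
  unfolding dsC_def dtC_def
  by (rule bounded_op_closure[OF N_hilbert tN_hilbert W_N_bounded _ D_img])
    (auto simp: D_W[symmetric] W_tN)

lemma Tt_dt_ds: "x \<in> dtC \<Longrightarrow> Tt x \<in> dsC"
  unfolding dsC_def dtC_def
  by (rule bounded_op_closure[OF tN_hilbert N_hilbert Tt_bounded D_img(2) Delta_img(1)])
    (auto simp: Tt_D)

text \<open>The inverse inside \<open>char_fun\<close> is kept only through the equation for g. That
  suffices, because \<open>resolvent_N0\<close> recovers g(0) from it.\<close>

lemma theta:
  assumes z: "z \<in> Bd" and x: "x \<in> dtC"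
  shows "\<exists>g\<in>N0. g - Zf z (W g) = Zf z (D x) \<and> \<theta> z x = \<Delta> g - Tt x"
proof -
  let ?f = "\<lambda>h. h - Z_op b N z (tilde_adj b N T h)"
  have f: "?f h = h - Zf z (W h)" if "h \<in> N0" for h
    using that z by (simp add: tilde_adj_eq Z_op_eq W_tN)
  have y: "Z_op b N z (D x) = Zf z (D x)" "Zf z (D x) \<in> N0" using z x by (simp_all add: Z_op_eq)
  then obtain g' where g': "g' \<in> N0" "Zf z (D x) = g' - Zf z (W g')"
    using bij_betw_imp_surj_on[OF resolvent_N0(1)[OF z]] by blast
  have img: "Zf z (D x) \<in> ?f ` carrier N"
    by (rule image_eqI[of _ _ g']) (simp_all only: f[OF g'(1)] sub_hilbert_simps g')
  let ?g = "inv_into (carrier N) ?f (Zf z (D x))"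
  have g: "?g \<in> N0" using inv_into_into[OF img] by simp
  moreover have "?g - Zf z (W ?g) = Zf z (D x)" using f_inv_into_f[OF img] f[OF g] by simp
  moreover have "\<theta> z x = \<Delta> ?g - Tt x" unfolding char_fun_def y(1) by simp
  ultimately show ?thesis by blast
qed

lemma theta_c: "z \<in> Bd \<Longrightarrow> x \<in> dtC \<Longrightarrow> \<theta> z x \<in> dsC"
proof -
  assume z: "z \<in> Bd" and x: "x \<in> dtC"
  obtain g where g: "g \<in> N0" "\<theta> z x = \<Delta> g - Tt x" using theta[OF z x] by blast
  show ?thesis unfolding g(2) by (rule complex_vector.subspace_diff[OF dsC_csub Delta_ds[OF g(1)] Tt_dt_ds[OF x]])
qed

definition vv :: "complex ^ 'd \<Rightarrow> 'e \<Rightarrow> ('d \<Rightarrow> nat) \<Rightarrow> complex ^ 'd \<Rightarrow> 'e"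
  where "vv w e = D (wv w (P (\<kappa> w e))) - W (\<sigma> e)"

lemma vv_c: "w \<in> Bd \<Longrightarrow> e \<in> E2 \<Longrightarrow> vv w e \<in> dtC"
  unfolding vv_def by (rule complex_vector.subspace_diff[OF dtC_csub]) (simp_all add: W_ds_dt)

text \<open>\<open>vv w\<close> is the adjoint of \<open>\<theta> w\<close>, up to the identification \<open>\<tau>\<close>.\<close>

lemma theta_cip:
  assumes z: "z \<in> Bd" and x: "x \<in> dtC" and e: "e \<in> E2"
  shows "cip K (\<theta> z x) (\<sigma> e) = cip KT x (vv z e)"
proof -
  obtain g where g: "g \<in> N0" "g - Zf z (W g) = Zf z (D x)" "\<theta> z x = \<Delta> g - Tt x" using theta[OF z x] by blast
  have xt: "x \<in> carrier tN" using x by simp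
  note kc = kap_c[OF z E2_c[OF e]]
  have "cip K (\<Delta> g) (\<sigma> e) = cip E (g 0) e" using g(1) e by (simp add: sigma_cip tau_Delta)
  \<comment> \<open>The value of g - Z W g at z is g(0), and the equation for g identifies that
    function with Z D x. Evaluation at z then brings in the kernel function.\<close>
  also have "g 0 = Zf z (D x) z" using resolvent_N0(2)[OF z g(1)] g(2) by simp
  also have "cip E (Zf z (D x) z) e = cip K (Zf z (D x)) (\<kappa> z e)"
    using rep[OF N0_c[OF Zf_c[OF z D_c[OF xt]]] z E2_c[OF e]] by simp
  also have "\<dots> = cip K (Zf z (D x)) (P (\<kappa> z e))" using P_cip(2)[OF kc Zf_c[OF z D_c[OF xt]]] by simp
  also have "\<dots> = cip KT (D x) (wv z (P (\<kappa> z e)))" by (rule Zf_cip[OF z D_c[OF xt] P_c[OF kc]])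
  also have "\<dots> = cip KT x (D (wv z (P (\<kappa> z e))))" by (rule D_sa[OF xt wv_c[OF z P_c[OF kc]]])
  finally have 1: "cip K (\<Delta> g) (\<sigma> e) = cip KT x (D (wv z (P (\<kappa> z e))))" .
  have 2: "cip K (Tt x) (\<sigma> e) = cip KT x (W (\<sigma> e))" using Tt_cip[OF xt] e by simp
  have "cip K (\<theta> z x) (\<sigma> e) = cip K (\<Delta> g) (\<sigma> e) - cip K (Tt x) (\<sigma> e)"
    unfolding g(3) by (rule K.cip_diff_left) (use g(1) xt e in simp_all)
  also have "\<dots> = cip KT x (vv z e)"
    unfolding 1 2 vv_def
    by (rule pre_hilbert.cip_diff_right[OF KT_pre, symmetric])
      (use kc z xt e in \<open>simp_all add: tN_KT(1) W_c\<close>)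
  finally show ?thesis .
qed

text \<open>On kernel functions W is the weight column, so against W h the projected column acts
  like \<open>W (\<kappa> w e)\<close>; \<open>W_cip'\<close> subtracts the constant term, and that
  is \<Delta> (\<sigma> e) after projection.\<close>

lemma Tt_wv:
  assumes w: "w \<in> Bd" and e: "e \<in> E2"
  shows "Tt (wv w (P (\<kappa> w e))) = P (\<kappa> w e) - \<Delta> (\<sigma> e)"
proof (rule pre_hilbert.eq_if_cip_eq[OF N_pre])
  note kc = kap_c[OF w E2_c[OF e]]
  have wc: "wv w (P (\<kappa> w e)) \<in> carrier tN" by (rule wv_c[OF w P_c[OF kc]])
  show "Tt (wv w (P (\<kappa> w e))) \<in> carrier N" "P (\<kappa> w e) - \<Delta> (\<sigma> e) \<in> carrier N"
    using wc kc e by simp_all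
  fix h assume "h \<in> carrier N"
  then have h: "h \<in> N0" "h \<in> K.C" by simp_all
  have "cip K (Tt (wv w (P (\<kappa> w e)))) h = cip KT (wv w (P (\<kappa> w e))) (W h)" by (rule Tt_cip[OF wc h(1)])
  also have "\<dots> = cip KT (W (\<kappa> w e)) (W h)"
    using wv_proj_cip(2)[OF N0_closed tN_KT[OF W_tN[OF h(1)]] kc w] W_kap[OF w E2_c[OF e]] by simp
  also have "\<dots> = cip K (\<kappa> w e) h - cip E e (h 0)"
    using W_cip'[OF kc h(2)] kap_at_0[OF w, of e] by simp
  also have "\<dots> = cip K (P (\<kappa> w e) - \<Delta> (\<sigma> e)) h"
    using h kc e by (simp add: K.cip_diff_left P_cip Delta_sigma const_cip)
  finally show "cip N (Tt (wv w (P (\<kappa> w e)))) h = cip N (P (\<kappa> w e) - \<Delta> (\<sigma> e)) h" by simp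
qed

text \<open>With p, q the projected kernel functions and d, d' the images of \<sigma> e, \<sigma> f
  under \<Delta>, the four products are (1 - 1/k) <p,q> - <p-d, q-d'>, <p-d, d'>, <d, q-d'> and
  <e,f> - <d,d'>. The two mixed ones use D W = W \<Delta>. All terms with d or d' cancel.\<close>

lemma vv_cip:
  assumes w: "w \<in> Bd" and z: "z \<in> Bd" and e: "e \<in> E2" and f: "f \<in> E2"
  shows "cip KT (vv w e) (vv z f) = cip E e f - 1 / k z w * cip K (P (\<kappa> w e)) (P (\<kappa> z f))"
proof -
  interpret KT: pre_hilbert KT by (rule KT_pre)
  let ?p = "P (\<kappa> w e)" and ?q = "P (\<kappa> z f)"
  have pq: "?p \<in> N0" "?q \<in> N0" using w z e f by simp_all
  have wp: "wv w ?p \<in> carrier tN" "wv z ?q \<in> carrier tN" using pq w z by simp_all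
  have s: "\<sigma> e \<in> N0" "\<sigma> f \<in> N0" using e f by simp_all
  have c: "D (wv w ?p) \<in> KT.C" "D (wv z ?q) \<in> KT.C" "W (\<sigma> e) \<in> KT.C" "W (\<sigma> f) \<in> KT.C"
    "wv w ?p \<in> KT.C" "wv z ?q \<in> KT.C" "W (Tt (wv w ?p)) \<in> KT.C"
    using wp s by (simp_all add: tN_KT(1) W_c)
  note Tp = Tt_wv[OF w e] and Tq = Tt_wv[OF z f]
  have 1: "cip KT (W (\<sigma> e)) (W (\<sigma> f)) = cip E e f - cip K (\<Delta> (\<sigma> e)) (\<Delta> (\<sigma> f))"
    using W_cip'[of "\<sigma> e" "\<sigma> f"] s Delta_cip[OF s] sigma_iso[OF e f] by simp
  have 2: "cip KT (W (\<sigma> e)) (D (wv z ?q)) = cip K (\<Delta> (\<sigma> e)) (?q - \<Delta> (\<sigma> f))"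
    using D_sa[OF W_tN[OF s(1)] wp(2)] D_W[OF s(1)] Tt_cip'[OF wp(2) Delta_c[OF s(1)]] Tq by simp
  have 3: "cip KT (D (wv w ?p)) (W (\<sigma> f)) = cip K (?p - \<Delta> (\<sigma> e)) (\<Delta> (\<sigma> f))"
    using D_sa[OF wp(1) W_tN[OF s(2)]] D_W[OF s(2)] Tt_cip[OF wp(1) Delta_c[OF s(2)]] Tp by simp
  have "cip KT (D (wv w ?p)) (D (wv z ?q)) = cip KT (D (D (wv w ?p))) (wv z ?q)"
    using D_sa[OF D_c[OF wp(1)] wp(2)] by simp
  also have "\<dots> = cip KT (wv w ?p) (wv z ?q) - cip KT (W (Tt (wv w ?p))) (wv z ?q)"
    unfolding D_sq[OF wp(1)] by (rule KT.cip_diff_left[OF c(5,7,6)])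
  also have "cip KT (W (Tt (wv w ?p))) (wv z ?q) = cip K (?p - \<Delta> (\<sigma> e)) (?q - \<Delta> (\<sigma> f))"
    using Tt_cip'[OF wp(2) Tt_c[OF wp(1)]] Tp Tq by simp
  also have "cip KT (wv w ?p) (wv z ?q) = (1 - 1 / k z w) * cip K ?p ?q"
    using wv_cip[OF K.pre_hilbert_axioms w z] pq by simp
  finally have 4: "cip KT (D (wv w ?p)) (D (wv z ?q)) =
    (1 - 1 / k z w) * cip K ?p ?q - cip K (?p - \<Delta> (\<sigma> e)) (?q - \<Delta> (\<sigma> f))" .
  have "cip KT (vv w e) (vv z f) = cip KT (D (wv w ?p)) (D (wv z ?q)) - cip KT (D (wv w ?p)) (W (\<sigma> f))
      - cip KT (W (\<sigma> e)) (D (wv z ?q)) + cip KT (W (\<sigma> e)) (W (\<sigma> f))"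
    unfolding vv_def using c by (simp add: KT.cip_diff_left KT.cip_diff_right)
  also have "\<dots> = cip E e f - 1 / k z w * cip K ?p ?q"
    unfolding 1 2 3 4 using pq s by (simp add: K.cip_diff_left K.cip_diff_right algebra_simps)
  finally show ?thesis .
qed

end

context invariant_subspace
begin

section \<open>The multiplication operator of the characteristic function\<close>

abbreviation "K2 \<equiv> Hk k \<otimes>\<^sub>H EH2"
abbreviation "Kd \<equiv> Hk k \<otimes>\<^sub>H DT"

lemmas K2_hilbert = K_hilbert[OF ker EH2_hilbert] and Kd_hilbert = K_hilbert[OF ker DT_hilbert]
lemmas K2_pre = pre_hilbert_of_hilbert[OF K2_hilbert] and Kd_pre = pre_hilbert_of_hilbert[OF Kd_hilbert]
lemmas K2_carrier = sub_tensor_carrier[OF E2_closed]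
lemmas K2_cip = sub_tensor_embedding(2)[OF E2_closed]

lemma K2_c: "F \<in> carrier K2 \<Longrightarrow> F \<in> K.C" "F \<in> carrier K2 \<Longrightarrow> F z \<in> E2"
  unfolding K2_carrier by simp_all

lemma K2_nrm: "F \<in> carrier K2 \<Longrightarrow> hnorm K2 F = K.nrm F"
  using K2_cip[of F F] by (simp add: hnorm_def)

lemma N0_K2: "h \<in> N0 \<Longrightarrow> h \<in> carrier K2"
  unfolding K2_carrier using N0_values[of h] N0_c[of h] by blast

lemma P_K2: "F \<in> carrier K2 \<Longrightarrow> P F \<in> carrier K2"
  by (rule N0_K2[OF P_c[OF K2_c(1)]])

lemma minus_P_bounded: "bounded_op K2 K2 (\<lambda>F. F - P F)"
  unfolding bounded_op_def
proof (intro conjI ballI allI)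
  interpret K2: pre_hilbert K2 by (rule K2_pre)
  show "F - P F \<in> carrier K2" if "F \<in> carrier K2" for F by (rule K2.diff_c[OF that P_K2[OF that]])
  show "F + G - P (F + G) = F - P F + (G - P G)" if "F \<in> carrier K2" "G \<in> carrier K2" for F G
    using P_lin(1)[OF K2_c(1)[OF that(1)] K2_c(1)[OF that(2)]] by simp
  show "c *\<^sub>C F - P (c *\<^sub>C F) = c *\<^sub>C (F - P F)" if "F \<in> carrier K2" for c F
    using P_lin(2)[OF K2_c(1)[OF that]] by (simp add: complex_vector.scale_right_diff_distrib)
  show "\<exists>B. \<forall>F\<in>carrier K2. hnorm K2 (F - P F) \<le> B * hnorm K2 F"
  proof (intro exI[of _ 2] ballI)
    fix F assume F: "F \<in> carrier K2"
    note FK = K2_c(1)[OF F]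
    have "K.nrm (F - P F) \<le> K.nrm F + K.nrm (P F)" by (rule K.nrm_triangle_diff[OF FK N0_c[OF P_c[OF FK]]])
    also have "\<dots> \<le> 2 * K.nrm F" using K.bounded_proj(2)[OF N0_closed FK] by simp
    finally show "hnorm K2 (F - P F) \<le> 2 * hnorm K2 F"
      using K2_nrm[OF F] K2_nrm[OF K2.diff_c[OF F P_K2[OF F]]] by simp
  qed
qed

lemma R_exists: "\<exists>R. bounded_op K2 Kd R \<and>
    (\<forall>p\<in>Bd \<times> E2. R (kap k (fst p) (snd p)) = kap k (fst p) (vv (fst p) (snd p))) \<and>
    (\<forall>F\<in>carrier K2. \<forall>G\<in>carrier K2. cip Kd (R F) (R G) = cip K2 (F - P F) G)"
proof (rule gram_extension[OF K2_hilbert Kd_hilbert minus_P_bounded])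
  fix p :: "(complex ^ 'd) \<times> 'e" assume p: "p \<in> Bd \<times> E2"
  then have p': "fst p \<in> Bd" "snd p \<in> E2" by auto
  show pK: "\<kappa> (fst p) (snd p) \<in> carrier K2" by (rule K_kap[OF ker EH2_hilbert]) (use p' in simp_all)
  show "kap k (fst p) (vv (fst p) (snd p)) \<in> carrier Kd"
    by (rule K_kap[OF ker DT_hilbert p'(1)]) (use vv_c[OF p'] in simp)
  fix q :: "(complex ^ 'd) \<times> 'e" assume q: "q \<in> Bd \<times> E2"
  then have q': "fst q \<in> Bd" "snd q \<in> E2" by auto
  interpret K2: pre_hilbert K2 by (rule K2_pre)
  have qK: "\<kappa> (fst q) (snd q) \<in> carrier K2" by (rule K_kap[OF ker EH2_hilbert]) (use q' in simp_all)
  let ?p = "\<kappa> (fst p) (snd p)" and ?q = "\<kappa> (fst q) (snd q)"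
  have kz: "k (fst q) (fst p) \<noteq> 0" by (rule kernel_nz[OF ker q'(1) p'(1)])
  have "cip Kd (kap k (fst p) (vv (fst p) (snd p))) (kap k (fst q) (vv (fst q) (snd q))) =
     k (fst q) (fst p) * cip KT (vv (fst p) (snd p)) (vv (fst q) (snd q))"
    using kap_cip[OF ker DT_hilbert p'(1) q'(1), of "vv (fst p) (snd p)" "vv (fst q) (snd q)"] vv_c[OF p'] vv_c[OF q'] by simp
  also have "\<dots> = k (fst q) (fst p) * cip E (snd p) (snd q) - cip K (P ?p) (P ?q)"
    unfolding vv_cip[OF p'(1) q'(1) p'(2) q'(2)] using kz by (simp add: field_simps)
  also have "k (fst q) (fst p) * cip E (snd p) (snd q) = cip K ?p ?q"
    by (rule kernel_cip[OF p'(1) q'(1) E2_c[OF p'(2)] E2_c[OF q'(2)], symmetric])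
  also have "cip K (P ?p) (P ?q) = cip K (P ?p) ?q" by (rule K.cip_proj_proj[OF N0_closed K2_c(1)[OF pK] K2_c(1)[OF qK]])
  also have "cip K ?p ?q - cip K (P ?p) ?q = cip K (?p - P ?p) ?q"
    by (rule K.cip_diff_left[symmetric]) (use K2_c(1)[OF pK] K2_c(1)[OF qK] in simp_all)
  also have "\<dots> = cip K2 (?p - P ?p) ?q" by (rule K2_cip[OF K2.diff_c[OF pK P_K2[OF pK]] qK])
  finally show "cip Kd (kap k (fst p) (vv (fst p) (snd p))) (kap k (fst q) (vv (fst q) (snd q))) = cip K2 (?p - P ?p) ?q" .
next
  fix F assume F: "F \<in> carrier K2" and o: "\<And>p. p \<in> Bd \<times> E2 \<Longrightarrow> cip K2 F (\<kappa> (fst p) (snd p)) = 0"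
  show "F = 0" by (rule K_total[OF ker EH2_hilbert F]) (rule o, simp)
qed

definition R where "R = (SOME R. bounded_op K2 Kd R \<and>
    (\<forall>p\<in>Bd \<times> E2. R (kap k (fst p) (snd p)) = kap k (fst p) (vv (fst p) (snd p))) \<and>
    (\<forall>F\<in>carrier K2. \<forall>G\<in>carrier K2. cip Kd (R F) (R G) = cip K2 (F - P F) G))"

lemma R_bounded: "bounded_op K2 Kd R"
  and R_kap: "w \<in> Bd \<Longrightarrow> e \<in> E2 \<Longrightarrow> R (\<kappa> w e) = kap k w (vv w e)"
  and R_cip: "F \<in> carrier K2 \<Longrightarrow> G \<in> carrier K2 \<Longrightarrow> cip Kd (R F) (R G) = cip K2 (F - P F) G"
  using someI_ex[OF R_exists] unfolding R_def[symmetric] by force+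

lemma R_c: "F \<in> carrier K2 \<Longrightarrow> R F \<in> carrier Kd" by (rule bounded_opD(1)[OF R_bounded])

text \<open>By \<open>S_eq\<close> this is (I \<otimes> \<tau>) after multiplication by \<theta>.
  Starting from the adjoint of R makes it bounded before boundedness of that multiplication is
  known.\<close>

definition S where "S = adj K2 Kd R"

lemmas S_c = adj(1)[OF K2_hilbert Kd_pre R_bounded, folded S_def]
  and S_cip = adj_left[OF K2_hilbert Kd_pre R_bounded, folded S_def]
  and S_bounded = bounded_op_adj[OF K2_hilbert Kd_pre R_bounded, folded S_def]

text \<open>The squared norm of R F is that of F minus that of P F. Passed to the adjoint S, this is
  the contractivity of the multiplier \<theta>.\<close>

lemma R_le: "F \<in> carrier K2 \<Longrightarrow> hnorm Kd (R F) \<le> hnorm K2 F"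
proof (rule power2_le_imp_le)
  interpret K2: pre_hilbert K2 by (rule K2_pre)
  assume F: "F \<in> carrier K2"
  note FK = K2_c(1)[OF F]
  have "(hnorm Kd (R F))\<^sup>2 = Re (cip K2 (F - P F) F)"
    unfolding pre_hilbert.nrm_sq[OF Kd_pre R_c[OF F]] R_cip[OF F F] ..
  also have "\<dots> = Re (cip K (F - P F) F)" unfolding K2_cip[OF K2.diff_c[OF F P_K2[OF F]] F] ..
  also have "\<dots> = (K.nrm F)\<^sup>2 - (K.nrm (P F))\<^sup>2"
    using FK K.cip_proj_proj[OF N0_closed FK FK] by (simp add: K.cip_diff_left K.nrm_sq)
  finally show "(hnorm Kd (R F))\<^sup>2 \<le> (hnorm K2 F)\<^sup>2" using K2_nrm[OF F] by simp
  show "0 \<le> hnorm K2 F" by (rule K2.nrm_nonneg[OF F])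
qed

lemma S_le:
  assumes g: "g \<in> carrier Kd"
  shows "hnorm K2 (S g) \<le> hnorm Kd g"
proof (rule pre_hilbert.nrm_le_if_cip_le[OF K2_pre S_c[OF g]])
  note sc = S_c[OF g]
  have "cmod (cip Kd g (R (S g))) \<le> hnorm Kd g * hnorm Kd (R (S g))"
    by (rule pre_hilbert.cauchy_schwarz[OF Kd_pre g R_c[OF sc]])
  moreover have "hnorm Kd g * hnorm Kd (R (S g)) \<le> hnorm Kd g * hnorm K2 (S g)"
    by (rule mult_left_mono[OF R_le[OF sc] pre_hilbert.nrm_nonneg[OF Kd_pre g]])
  ultimately show "cmod (cip K2 (S g) (S g)) \<le> hnorm Kd g * hnorm K2 (S g)"
    unfolding S_cip[OF g sc] by linarith
  show "0 \<le> hnorm Kd g" by (rule pre_hilbert.nrm_nonneg[OF Kd_pre g])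
qed

lemma tau_0: "\<tau> 0 = 0" by (rule bounded_op_0[OF tau_bounded DS_pre])
lemma sigma_0: "\<sigma> 0 = 0" by (rule bounded_op_0[OF sigma_bounded EH2_pre])

lemma Kd_value: "g \<in> carrier Kd \<Longrightarrow> g z \<in> dtC"
  using K_values[OF ker DT_hilbert, of g z] by simp

lemma S_eq:
  assumes g: "g \<in> carrier Kd"
  shows "S g = (\<lambda>z. \<tau> (mult_op Bd \<theta> g z))"
proof
  fix z
  show "S g z = \<tau> (mult_op Bd \<theta> g z)"
  proof (cases "z \<in> Bd")
    case True
    note gz = Kd_value[OF g, of z]
    have "S g z = \<tau> (\<theta> z (g z))"
    proof (rule pre_hilbert.eq_if_cip_eq[OF EH2_pre])
      show "S g z \<in> carrier EH2" using K2_c(2)[OF S_c[OF g]] by simp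
      show "\<tau> (\<theta> z (g z)) \<in> carrier EH2" using tau_c[OF theta_c[OF True gz]] by simp
      fix e assume "e \<in> carrier EH2"
      then have e: "e \<in> E2" "e \<in> carrier EH2" by simp_all
      have "cip EH2 (S g z) e = cip K2 (S g) (\<kappa> z e)" by (rule K_rep[OF ker EH2_hilbert S_c[OF g] True e(2), symmetric])
      also have "\<dots> = cip Kd g (kap k z (vv z e))"
        using S_cip[OF g K_kap[OF ker EH2_hilbert True e(2)]] R_kap[OF True e(1)] by simp
      also have "\<dots> = cip KT (g z) (vv z e)"
        using K_rep[OF ker DT_hilbert g True, of "vv z e"] vv_c[OF True e(1)] by simp
      also have "\<dots> = cip E (\<tau> (\<theta> z (g z))) e"
        using theta_cip[OF True gz e(1)] sigma_cip[OF theta_c[OF True gz] e(1)] by simp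
      finally show "cip EH2 (S g z) e = cip EH2 (\<tau> (\<theta> z (g z))) e" by simp
    qed
    then show ?thesis using True by (simp add: mult_op_def)
  next
    case False
    then show ?thesis using K_off[OF ker EH2_hilbert S_c[OF g] False] tau_0 by (simp add: mult_op_def)
  qed
qed

lemma sigma_isometry: "e \<in> carrier EH2 \<Longrightarrow> f \<in> carrier EH2 \<Longrightarrow> cip DS (\<sigma> e) (\<sigma> f) = cip EH2 e f"
  by (simp add: sigma_iso)

text \<open>Undoing \<tau> by \<sigma> expresses multiplication by \<theta> through S, from which it
  inherits linearity and its norm bound.\<close>

lemma mult_op_eq:
  assumes g: "g \<in> carrier Kd"
  shows "mult_op Bd \<theta> g = (\<lambda>z. \<sigma> (S g z))"
proof
  fix z
  show "mult_op Bd \<theta> g z = \<sigma> (S g z)"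
    using sigma_tau[OF theta_c[OF _ Kd_value[OF g]], of z z] sigma_0 tau_0
    by (cases "z \<in> Bd") (simp_all add: S_eq[OF g] mult_op_def)
qed

lemmas sigma_tensor = tensor_isometry(1,2)[OF ker EH2_hilbert DS_hilbert sigma_bounded sigma_isometry]

lemma mult_op_contraction: "contraction_op Kd (Hk k \<otimes>\<^sub>H DS) (mult_op Bd \<theta>)"
  unfolding contraction_op_def
proof (intro conjI ballI)
  show "bounded_op Kd (Hk k \<otimes>\<^sub>H DS) (mult_op Bd \<theta>)"
    by (rule bounded_op_cong[OF Kd_pre bounded_op_comp[OF S_bounded sigma_tensor(1) K2_pre] mult_op_eq])
  fix g assume g: "g \<in> carrier Kd"
  have "hnorm (Hk k \<otimes>\<^sub>H DS) (\<lambda>z. \<sigma> (S g z)) = hnorm K2 (S g)"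
    using sigma_tensor(2)[OF _ _ S_c[OF g] S_c[OF g]] by (simp add: hnorm_def)
  then show "hnorm (Hk k \<otimes>\<^sub>H DS) (mult_op Bd \<theta> g) \<le> hnorm Kd g"
    using S_le[OF g] mult_op_eq[OF g] by simp
qed

lemma kap_bounded:
  assumes w: "w \<in> Bd"
  shows "bounded_op EH2 K (\<kappa> w)"
  unfolding bounded_op_def
proof (intro conjI ballI allI)
  show "\<kappa> w e \<in> K.C" if "e \<in> carrier EH2" for e using that w by simp
  show "\<kappa> w (e + f) = \<kappa> w e + \<kappa> w f" for e f
    by (simp add: kap_def fun_eq_iff complex_vector.scale_right_distrib)
  show "\<kappa> w (c *\<^sub>C e) = c *\<^sub>C \<kappa> w e" for c e by (rule kap_scale[symmetric])
  have "K.nrm (\<kappa> w e) \<le> sqrt (Re (k w w)) * E.nrm e" if "e \<in> carrier EH2" for e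
  proof (rule power2_le_imp_le)
    have e: "e \<in> E.C" using that by simp
    have kd: "k w w = of_real (Re (k w w))" "1 \<le> Re (k w w)" using kernel_diag[OF ker w] by auto
    have "(K.nrm (\<kappa> w e))\<^sup>2 = Re (k w w * cip E e e)"
      unfolding K.nrm_sq[OF kap_c[OF w e]] kernel_cip[OF w w e e] ..
    also have "\<dots> = Re (k w w) * (E.nrm e)\<^sup>2" unfolding E.cip_self[OF e] by simp
    finally show "(K.nrm (\<kappa> w e))\<^sup>2 \<le> (sqrt (Re (k w w)) * E.nrm e)\<^sup>2"
      using kd(2) by (simp add: power_mult_distrib)
    show "0 \<le> sqrt (Re (k w w)) * E.nrm e" using kd(2) e by simp
  qed
  then show "\<exists>B. \<forall>e\<in>carrier EH2. K.nrm (\<kappa> w e) \<le> B * hnorm EH2 e" by (intro exI[of _ "sqrt (Re (k w w))"]) simp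
qed

lemma vv_bounded:
  assumes w: "w \<in> Bd"
  shows "bounded_op EH2 DT (vv w)"
proof -
  interpret tN: pre_hilbert tN by (rule tN_pre)
  have 1: "bounded_op EH2 tN (\<lambda>e. D (wv w (P (\<kappa> w e))))"
    by (rule bounded_op_comp[OF bounded_op_comp[OF bounded_op_comp[OF kap_bounded[OF w] P_bounded K.pre_hilbert_axioms]
          wv_N[OF w] N_pre] D_bounded tN_pre])
  have "bounded_op DS N (\<lambda>x. x)"
    unfolding bounded_op_def by (auto intro: exI[of _ 1])
  then have 2: "bounded_op EH2 tN (\<lambda>e. W (\<sigma> e))"
    by (rule bounded_op_comp[OF bounded_op_comp[OF sigma_bounded _ DS_pre] W_N_bounded N_pre])
  obtain B where B: "\<And>e. e \<in> carrier EH2 \<Longrightarrow> hnorm tN (D (wv w (P (\<kappa> w e)))) \<le> B * hnorm EH2 e"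
    using 1 unfolding bounded_op_def by blast
  obtain B' where B': "\<And>e. e \<in> carrier EH2 \<Longrightarrow> hnorm tN (W (\<sigma> e)) \<le> B' * hnorm EH2 e"
    using 2 unfolding bounded_op_def by blast
  show ?thesis
    unfolding bounded_op_def
  proof (intro conjI ballI allI)
    show "vv w e \<in> carrier DT" if "e \<in> carrier EH2" for e using vv_c[OF w, of e] that by simp
    show "vv w (e + f) = vv w e + vv w f" if "e \<in> carrier EH2" "f \<in> carrier EH2" for e f
      unfolding vv_def using bounded_opD(2)[OF 1 that] bounded_opD(2)[OF 2 that] by simp
    show "vv w (c *\<^sub>C e) = c *\<^sub>C vv w e" if "e \<in> carrier EH2" for c e
      unfolding vv_def using bounded_opD(3)[OF 1 that, of c] bounded_opD(3)[OF 2 that, of c]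
      by (simp add: complex_vector.scale_right_diff_distrib)
    have "hnorm tN (vv w e) \<le> (B + B') * hnorm EH2 e" if e: "e \<in> carrier EH2" for e
      using tN.nrm_triangle_diff[OF bounded_opD(1)[OF 1 e] bounded_opD(1)[OF 2 e]] B[OF e] B'[OF e]
      unfolding vv_def distrib_right by linarith
    then show "\<exists>B. \<forall>e\<in>carrier EH2. hnorm DT (vv w e) \<le> B * hnorm EH2 e"
      unfolding DT_simps tN_ds(3) by blast
  qed
qed

text \<open>By \<open>theta_cip\<close>, \<theta> w is \<sigma> after the adjoint of
  \<open>vv w\<close>. Linearity and boundedness are visible in this form, but not through the
  inverse image in \<open>char_fun\<close>.\<close>

lemma theta_bounded:
  assumes w: "w \<in> Bd"
  shows "bounded_op DT DS (\<theta> w)"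
proof (rule bounded_op_cong[OF DT_pre])
  note vb = vv_bounded[OF w]
  show "bounded_op DT DS (\<lambda>x. \<sigma> (adj EH2 DT (vv w) x))"
    by (rule bounded_op_comp[OF bounded_op_adj[OF EH2_hilbert DT_pre vb] sigma_bounded EH2_pre])
  fix x assume x: "x \<in> carrier DT"
  then have x': "x \<in> dtC" by simp
  have ac: "adj EH2 DT (vv w) x \<in> E2" using adj(1)[OF EH2_hilbert DT_pre vb x] by simp
  have "\<tau> (\<theta> w x) = adj EH2 DT (vv w) x"
  proof (rule pre_hilbert.eq_if_cip_eq[OF EH2_pre])
    show "\<tau> (\<theta> w x) \<in> carrier EH2" "adj EH2 DT (vv w) x \<in> carrier EH2"
      using tau_c[OF theta_c[OF w x']] ac by simp_all
    fix e assume e: "e \<in> carrier EH2"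
    then have e': "e \<in> E2" by simp
    show "cip EH2 (\<tau> (\<theta> w x)) e = cip EH2 (adj EH2 DT (vv w) x) e"
      using adj_left[OF EH2_hilbert DT_pre vb x e] theta_cip[OF w x' e'] sigma_cip[OF theta_c[OF w x'] e'] by simp
  qed
  then show "\<theta> w x = \<sigma> (adj EH2 DT (vv w) x)" using sigma_tau[OF theta_c[OF w x']] by simp
qed

lemma theta_multiplier: "contractive_multiplier Bd (Hk k) DT DS \<theta>"
  unfolding contractive_multiplier_def using theta_bounded mult_op_contraction by blast

text \<open>S R = I - P on K2. Hence R kills N0, which makes the range of S orthogonal to N0, and
  every f in M with values in E2 is S (R f).\<close>

lemma S_range: "S ` carrier Kd = {f \<in> M. f \<in> carrier K2}"
proof (rule set_eqI, rule iffI)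
  interpret K2: pre_hilbert K2 by (rule K2_pre)
  interpret Kd: pre_hilbert Kd by (rule Kd_pre)
  fix f assume "f \<in> S ` carrier Kd"
  then obtain g where g: "g \<in> carrier Kd" "f = S g" by blast
  note fc = S_c[OF g(1)]
  have "cip K (S g) h = 0" if h: "h \<in> N0" for h
  proof -
    note h2 = N0_K2[OF h]
    have "cip Kd (R h) (R h) = 0" using R_cip[OF h2 h2] h K2.cip_zero_left[OF h2] by simp
    then have "R h = 0" by (rule Kd.cip_self_0D[OF R_c[OF h2]])
    then show ?thesis using S_cip[OF g(1) h2] K2_cip[OF fc h2] Kd.cip_zero_right[OF g(1)] by simp
  qed
  then have "S g \<in> orth_compl K N0" unfolding orth_compl_def[of K N0] using K2_c(1)[OF fc] by blast
  then show "f \<in> {f \<in> M. f \<in> carrier K2}" using fc g(2) by (simp only: M_eq) simp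
next
  interpret K2: pre_hilbert K2 by (rule K2_pre)
  fix f assume "f \<in> {f \<in> M. f \<in> carrier K2}"
  then have f: "f \<in> M" "f \<in> carrier K2" by auto
  have "S (R f) = f"
  proof (rule K2.eq_if_cip_eq[OF S_c[OF R_c[OF f(2)]] f(2)])
    fix G assume G: "G \<in> carrier K2"
    show "cip K2 (S (R f)) G = cip K2 f G"
      using S_cip[OF R_c[OF f(2)] G] R_cip[OF f(2) G] P_M[OF f(1)] by simp
  qed
  then show "f \<in> S ` carrier Kd" using R_c[OF f(2)] by (metis image_eqI)
qed

section \<open>The decomposition\<close>

abbreviation "KE1 \<equiv> {F \<in> K.C. \<forall>z. F z \<in> E1}"

lemma KE1_orth: "F \<in> KE1 \<Longrightarrow> G \<in> carrier K2 \<Longrightarrow> cip K F G = 0"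
  by (rule orth_values[OF E2_closed]) (simp_all only: E12 mem_Collect_eq K2_c)

lemma KE1_M: "KE1 \<subseteq> M"
proof
  fix F assume F: "F \<in> KE1"
  have "cip K F h = 0" if "h \<in> N0" for h by (rule KE1_orth[OF F N0_K2[OF that]])
  then have "F \<in> orth_compl K N0" using F unfolding orth_compl_def[of K N0] by blast
  then show "F \<in> M" by (simp only: M_eq)
qed

text \<open>S' is invariant under all \<open>A \<alpha>\<close>, so the resolvent writes f(z) as
  g(0) with g in S'. For h in N0 the entries of W g lie in M and those of W h in N0, so both <W g, W
  h> and <g, h> vanish, and \<open>W_cip'\<close> leaves <g(0), h(0)> = 0.\<close>

lemma reducing_sub:
  assumes red: "reducing K (Mz_tensor_I k E) S'" and SM: "S' \<subseteq> M"
  shows "S' \<subseteq> KE1"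
proof
  fix f assume f: "f \<in> S'"
  have cl: "closed_subspace K S'" using red by (simp add: reducing_def)
  have SC: "S' \<subseteq> K.C" by (rule K.closed_subspaceD(2)[OF cl])
  have fC: "f \<in> K.C" using f SC by blast
  \<comment> \<open>The adjoint half of \<open>reducing\<close> makes the complement of S'
    invariant. As the complement of that complement, S' is then invariant under every
    \<open>A \<alpha>\<close>.\<close>
  have inv: "(\<lambda>z. (z $ i) *\<^sub>C x z) \<in> orth_compl K S'" if x: "x \<in> orth_compl K S'" for i x
  proof -
    have xC: "x \<in> K.C" and xo: "\<And>s. s \<in> S' \<Longrightarrow> cip K x s = 0" using x by (auto simp: orth_compl_def[of K S'])
    have "cip K (\<lambda>z. (z $ i) *\<^sub>C x z) s = 0" if s: "s \<in> S'" for s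
    proof -
      have sC: "s \<in> K.C" using s SC by blast
      have "adj K K (Mz_tensor_I k E i) s \<in> S'" using red s by (simp add: reducing_def)
      then show ?thesis
        using adj(2)[OF K.hilbert_space_axioms K.pre_hilbert_axioms Mz_bounded[of i] sC xC] xo Mz_eq[OF xC, of i] by simp
    qed
    then show ?thesis
      using bounded_opD(1)[OF coordinate_bounded[of i] xC] by (simp add: orth_compl_def[of K S'])
  qed
  have OC: "orth_compl K S' \<subseteq> K.C" by (auto simp: orth_compl_def[of K S'])
  have A_inv: "A \<alpha> x \<in> S'" if "x \<in> S'" for \<alpha> x
    using A_invariant[OF OC inv, of x \<alpha>] that unfolding K.orth_compl_orth_compl[OF cl] by blast
  have "f z \<in> E1" for z
  proof (cases "z \<in> Bd")
    case True
    let ?SH = "sub_hilbert K S'"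
    let ?Z = "adj ?SH (direct_sum (- {0}) ?SH) (wv z)"
    note res = resolvent(1,2)[OF cl A_inv True]
    obtain g where g: "g \<in> S'" "f = g - ?Z (W g)"
      using bij_betw_imp_surj_on[OF res(1)] f by blast
    have gC: "g \<in> K.C" using g(1) SC by blast
    have "f z = g 0" using res(2)[OF _ g(1)] g(2) by simp
    moreover have "g 0 \<in> E1"
    proof (rule E1I)
      fix h assume h: "h \<in> N0"
      have 0: "cip K m h' = 0" if "m \<in> M" "h' \<in> N0" for m h'
      proof -
        have "m \<in> orth_compl K N0" using that(1) by (simp only: M_eq)
        then show ?thesis using that(2) unfolding orth_compl_def[of K N0] by blast
      qed
      have "cip KT (W g) (W h) = (\<Sum>\<^sub>\<infinity>\<alpha>\<in>- {0::'d \<Rightarrow> nat}. 0)"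
        unfolding direct_sum_simps(2)
      proof (rule infsum_cong)
        fix \<alpha> :: "'d \<Rightarrow> nat"
        have "A \<alpha> g \<in> M" using A_inv[OF g(1)] SM by blast
        then have "cip K (A \<alpha> g) (A \<alpha> h) = 0" using A_N0[OF h] by (rule 0)
        then show "cip K (W g \<alpha>) (W h \<alpha>) = 0"
          using gC h by (simp add: W_coord K.cip_scale_left K.cip_scale_right)
      qed
      then have "cip KT (W g) (W h) = 0" by simp
      moreover have "g \<in> M" using g(1) SM by blast
      ultimately show "cip E (g 0) (h 0) = 0" using W_cip'[OF gC N0_c[OF h]] 0[OF _ h] by simp
    qed (use gC in simp)
    ultimately show ?thesis by simp
  next
    case False
    then show ?thesis using off[OF fC False] complex_vector.subspace_0[OF E.closed_subspaceD(1)[OF E1_closed]] by simp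
  qed
  then show "f \<in> KE1" using fC by simp
qed

lemma decomposition: "orth_sum K M KE1 (S ` carrier Kd)"
  unfolding orth_sum_def
proof (intro conjI ballI)
  fix x y assume x: "x \<in> KE1" and y: "y \<in> S ` carrier Kd"
  have "y \<in> carrier K2" using y unfolding S_range by blast
  then show "cip K x y = 0" by (rule KE1_orth[OF x])
next
  note Mcs = K.closed_subspaceD(1)[OF M]
  have red: "reducing K (Mz_tensor_I k E) KE1" by (rule reducing_values[OF E1_closed])
  then have cl: "closed_subspace K KE1" by (simp add: reducing_def)
  show "M = {x + y |x y. x \<in> KE1 \<and> y \<in> S ` carrier Kd}"
  proof (rule set_eqI, rule iffI)
    fix f assume f: "f \<in> M"
    have fC: "f \<in> K.C" by (rule M_c[OF f])
    define x where "x = orth_proj K KE1 f"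
    have x: "x \<in> KE1" "\<And>s. s \<in> KE1 \<Longrightarrow> cip K (f - x) s = 0"
      unfolding x_def using K.proj[OF cl fC] by blast+
    have xM: "x \<in> M" using x(1) KE1_M by blast
    have yM: "f - x \<in> M" by (rule complex_vector.subspace_diff[OF Mcs f xM])
    have yC: "f - x \<in> K.C" by (rule M_c[OF yM])
    \<comment> \<open>Orthogonality to \<open>KE1\<close>, tested on kernel functions with
      coefficients in E1, becomes orthogonality of the values to E1.\<close>
    have "(f - x) w \<in> E2" for w
    proof (cases "w \<in> Bd")
      case True
      have "cip E ((f - x) w) e = 0" if e: "e \<in> E1" for e
      proof -
        have eC: "e \<in> E.C" using e E1_sub by blast
        have "\<kappa> w e z \<in> E1" for z
          using e complex_vector.subspace_scale[OF E.closed_subspaceD(1)[OF E1_closed]]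
            complex_vector.subspace_0[OF E.closed_subspaceD(1)[OF E1_closed]] by (simp add: kap_def)
        then have "\<kappa> w e \<in> KE1" using kap_c[OF True eC] by simp
        then have "cip K (f - x) (\<kappa> w e) = 0" by (rule x(2))
        then show ?thesis using rep[OF yC True eC] by simp
      qed
      then show ?thesis using val_c[OF yC, of w] unfolding orth_compl_def[of E E1] by blast
    next
      case False
      then show ?thesis using off[OF yC False] complex_vector.subspace_0[OF E.closed_subspaceD(1)[OF E2_closed]] by simp
    qed
    then have "f - x \<in> carrier K2" unfolding K2_carrier using yC by blast
    then have "f - x \<in> S ` carrier Kd" unfolding S_range using yM by blast
    moreover have "f = x + (f - x)" by simp
    ultimately show "f \<in> {x + y |x y. x \<in> KE1 \<and> y \<in> S ` carrier Kd}" using x(1) by blast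
  next
    fix f assume "f \<in> {x + y |x y. x \<in> KE1 \<and> y \<in> S ` carrier Kd}"
    then obtain x y where xy: "f = x + y" "x \<in> KE1" "y \<in> S ` carrier Kd" by blast
    have "x \<in> M" using xy(2) KE1_M by blast
    moreover have "y \<in> M" using xy(3) unfolding S_range by blast
    ultimately show "f \<in> M" unfolding xy(1) by (rule complex_vector.subspace_add[OF Mcs])
  qed
qed

lemma tau_isometry: "x \<in> carrier DS \<Longrightarrow> y \<in> carrier DS \<Longrightarrow> cip EH2 (\<tau> x) (\<tau> y) = cip DS x y"
  by (simp add: tau_iso)

lemma image_eq:
  "tensor_op (Hk k) DS (Hk k) EH2 (\<lambda>f. f) \<tau> ` (mult_op Bd \<theta> ` carrier Kd) = S ` carrier Kd"
proof -
  have "tensor_op (Hk k) DS (Hk k) EH2 (\<lambda>f. f) \<tau> (mult_op Bd \<theta> g) = S g" if g: "g \<in> carrier Kd" for g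
  proof -
    have "mult_op Bd \<theta> g \<in> carrier (Hk k \<otimes>\<^sub>H DS)"
      using mult_op_contraction g unfolding contraction_op_def by (blast dest: bounded_opD(1))
    then show ?thesis
      using tensor_isometry(3)[OF ker DS_hilbert EH2_hilbert tau_bounded tau_isometry] S_eq[OF g] by simp
  qed
  then show ?thesis by (simp add: image_image)
qed

lemma invariant_subspace_decomposition: "pure_k_contraction a b N T \<and> contractive_multiplier Bd (Hk k) DT DS \<theta> \<and>
    (\<exists>E1 \<tau>. closed_subspace E E1 \<and>
      reducing K (Mz_tensor_I k E) (carrier (Hk k \<otimes>\<^sub>H sub_hilbert E E1)) \<and>
      carrier (Hk k \<otimes>\<^sub>H sub_hilbert E E1) \<subseteq> M \<and>
      (\<forall>S. reducing K (Mz_tensor_I k E) S \<and> S \<subseteq> M \<longrightarrow> S \<subseteq> carrier (Hk k \<otimes>\<^sub>H sub_hilbert E E1)) \<and>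
      unitary_op DS (sub_hilbert E (orth_compl E E1)) \<tau> \<and>
      orth_sum K M (carrier (Hk k \<otimes>\<^sub>H sub_hilbert E E1))
        (tensor_op (Hk k) DS (Hk k) (sub_hilbert E (orth_compl E E1)) (\<lambda>f. f) \<tau> ` (mult_op Bd \<theta> ` carrier Kd)))"
proof (intro conjI pure_T theta_multiplier exI[of _ E1] exI[of _ \<tau>] E1_closed tau_unitary allI impI)
  note car = sub_tensor_carrier[OF E1_closed]
  show "reducing K (Mz_tensor_I k E) (carrier (Hk k \<otimes>\<^sub>H sub_hilbert E E1))"
    unfolding car by (rule reducing_values[OF E1_closed])
  show "carrier (Hk k \<otimes>\<^sub>H sub_hilbert E E1) \<subseteq> M" unfolding car by (rule KE1_M)
  show "S' \<subseteq> carrier (Hk k \<otimes>\<^sub>H sub_hilbert E E1)" if "reducing K (Mz_tensor_I k E) S' \<and> S' \<subseteq> M" for S'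
    unfolding car using that by (intro reducing_sub) simp_all
  show "orth_sum K M (carrier (Hk k \<otimes>\<^sub>H sub_hilbert E E1))
        (tensor_op (Hk k) DS (Hk k) EH2 (\<lambda>f. f) \<tau> ` (mult_op Bd \<theta> ` carrier Kd))"
    unfolding car image_eq by (rule decomposition)
qed

end

theorem theorem4p2:
  fixes a b :: "nat \<Rightarrow> real"
    and k :: "complex ^ 'd::finite \<Rightarrow> complex ^ 'd \<Rightarrow> complex"
    and E :: "('e::complex_vector) hilbert"
    and M :: "(complex ^ 'd \<Rightarrow> 'e) set"
    and N :: "(complex ^ 'd \<Rightarrow> 'e) hilbert"
    and T :: "'d \<Rightarrow> (complex ^ 'd \<Rightarrow> 'e) \<Rightarrow> complex ^ 'd \<Rightarrow> 'e"
  assumes kernel: "regular_cnp_kernel a b k"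
    and E: "hilbert_space E"
    and M: "closed_subspace (Hk k \<otimes>\<^sub>H E) M"
    and invariant: "\<And>i f. f \<in> M \<Longrightarrow> Mz_tensor_I k E i f \<in> M"
    and N_eq: "N = sub_hilbert (Hk k \<otimes>\<^sub>H E) (orth_compl (Hk k \<otimes>\<^sub>H E) M)"
    and T_eq: "T = (\<lambda>i f. orth_proj (Hk k \<otimes>\<^sub>H E) (orth_compl (Hk k \<otimes>\<^sub>H E) M)
                            (Mz_tensor_I k E i f))"
  shows "pure_k_contraction a b N T \<and>
    contractive_multiplier Bd (Hk k) (tilde_defect_space b N T) (defect_space b N T)
      (char_fun b N T) \<and>
    (\<exists>E1 \<tau>.
      closed_subspace E E1 \<and>
      reducing (Hk k \<otimes>\<^sub>H E) (Mz_tensor_I k E) (carrier (Hk k \<otimes>\<^sub>H sub_hilbert E E1)) \<and>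
      carrier (Hk k \<otimes>\<^sub>H sub_hilbert E E1) \<subseteq> M \<and>
      (\<forall>S. reducing (Hk k \<otimes>\<^sub>H E) (Mz_tensor_I k E) S \<and> S \<subseteq> M \<longrightarrow>
           S \<subseteq> carrier (Hk k \<otimes>\<^sub>H sub_hilbert E E1)) \<and>
      unitary_op (defect_space b N T) (sub_hilbert E (orth_compl E E1)) \<tau> \<and>
      orth_sum (Hk k \<otimes>\<^sub>H E) M
        (carrier (Hk k \<otimes>\<^sub>H sub_hilbert E E1))
        (tensor_op (Hk k) (defect_space b N T) (Hk k) (sub_hilbert E (orth_compl E E1))
             (\<lambda>f. f) \<tau> `
           (mult_op Bd (char_fun b N T) ` carrier (Hk k \<otimes>\<^sub>H tilde_defect_space b N T))))"
proof -
  interpret kernel_tensor a b k E by (rule kernel_tensor.intro[OF kernel E])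
  interpret invariant_subspace a b k E M
    by (rule invariant_subspace.intro[OF kernel_tensor_axioms invariant_subspace_axioms.intro[OF M invariant]])
  show ?thesis unfolding N_eq T_eq by (rule invariant_subspace_decomposition)
qed

end
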